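(* Consider the three-state, two-action discounted MDP, the update distribution $q=(0.02,0.18,0.80)$, the scalar-stepsize asynchronous Monte Carlo recursion $$J_{t+1}=J_t+\gamma_t e_{I_t}\bigl(R_t-J_t(I_t)\bigr),\qquad t=0,1,2,\dots,$$ with the bounded unbiased geometric-horizon estimator $R_t$, and the certified cycle $C$, all as specified in the context. There exist $N<\infty$ and an initial condition $J_0\in\mathbb R^3$ in the local basin of $C$ such that, with stepsizes $$\gamma_t=\frac1{t+N},$$ the sequence $(J_t)_{t\ge 0}$ fails to converge with positive probability, i.e. $\mathbb P\bigl(\lim_{t\to\infty}J_t\text{ does not exist in }\mathbb R^3\bigr)>0$.
   Context: **MDP data** (all decimals are exact rational numbers). States $S=\{1,2,3\}$, actions $A=\{0,1\}$, discount $\alpha=0.95$. One-stage costs $g(i,a)$ (row $i=1,2,3$; columns $a=0,1$): $$g=\begin{pmatrix}2.8645365128&6.2604856687\\8.8765458733&-6.6644477357\\-4.4428868652&-7.5034828348\end{pmatrix}.$$ Transition rows $P(i,a)=(P(i,a,1),P(i,a,2),P(i,a,3))$: $$\begin{aligned} P(1,0)&=(0.0083421983,\,0.5161392971,\,0.4755185046),\\ P(1,1)&=(0.4115295055,\,0.3414919270,\,0.2469785675),\\ P(2,0)&=(0.0176113658,\,0.9549690854,\,0.0274195488),\\ P(2,1)&=(0.3574261643,\,0.1754143753,\,0.4671594604),\\ P(3,0)&=(0.6791060489,\,0.0358694514,\,0.2850244997),\\ P(3,1)&=(0.3221209528,\,0.3803472570,\,0.2975317902). \end{aligned}$$ **Policies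 and greediness.** A deterministic policy is $\mu=(\mu(1),\mu(2),\mu(3))\in A^3$; $P_\mu(i,j)=P(i,\mu(i),j)$, $g_\mu(i)=g(i,\mu(i))$, and its discounted cost-to-go is $J^\mu=(I-\alpha P_\mu)^{-1}g_\mu$. For $J\in\mathbb R^3$ let $Q_i(a;J)=g(i,a)+\alpha\sum_jP(i,a,j)J(j)$ and $d_i(J)=Q_i(1;J)-Q_i(0;J)$. Costs are minimized: $\mu$ is greedy at $J$ if $\mu(i)$ minimizes $a\mapsto Q_i(a;J)$ for every $i$; $G(J)$ is the set of greedy policies at $J$. Thus $d_i(J)>0$ means action $0$ is uniquely greedy at $i$ and $d_i(J)<0$ means action $1$ is. When $G(J)$ is a singleton, its element is $\mu(J)$. **Recursion.** Fix a measurable tie-breaking rule $\tau$ with $\tau(J)\in G(J)$ for all $J$ (e.g. lexicographic), and let $\mu_t=\tau(J_t)$. Let $\mathcal F_t$ be the natural filtration generated by the initial condition and all samples before the $t$-th update. Conditional on $\mathcal F_t$, the index $I_t\in\{1,2,3\}$ has law $\mathbb P(I_t=i)=q_i$, with $q=(0.02,0.18,0.80)$, and is independent of the geometric horizon and Markov-chain randomness used to generate the return. Conditional on $\mathcal F_t$ and $I_t=i$, the return $R_t$ is generated as follows with $\mu=\mu_t$: sample $T$ with $\mathbb P(T=m)=(1-\alpha)\alpha^m$, $m=0,1,2,\dots$; run the Markov chain with transition matrix $P_\mu$ for $T$ transitions from $S_0=i$; set $R_t=g(S_T,\mu(S_T))/(1-\alpha)$. Here $e_i$ is the $i$-th standard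 basis vector. **Mean field.** Let $D=\operatorname{diag}(q_1,q_2,q_3)$. Away from ties the mean ODE (hybrid ODE) is $\dot J=D(J^{\mu(J)}-J)$; in general one has the differential inclusion $\dot J\in H(J)=D\,\mathrm{co}\{J^\mu-J:\mu\in G(J)\}$, where $\mathrm{co}$ is the convex hull. For a fixed policy $\mu$, with $z=e^{-0.02t}$, the flow of $\dot J=D(J^\mu-J)$ from $x$ is $\Phi_\mu(x,z)=J^\mu+(x-J^\mu)\odot(z,z^9,z^{40})$, $\odot$ being the entrywise product. **The certified cycle $C$.** Let $\mu_0=(0,1,1)$, $\mu_1=(0,0,1)$, $\mu_2=(1,0,1)$, $\mu_3=(1,0,0)$, $\mu_4=(1,1,0)$, $\mu_5=(1,1,1)$ (these six fixed policies are not to be confused with the random policies $\tau(J_t)$), and $(s_0,\dots,s_5)=(2,1,3,2,3,1)$. For $y=(x_0,z_0,\dots,z_5)\in\mathbb R^3\times\mathbb R^6$ put $x_{k+1}=\Phi_{\mu_k}(x_k,z_k)$, $k=0,\dots,5$, and consider the event equations $$d_{s_k}(x_{k+1})=0\ (k=0,\dots,5),\qquad x_6=x_0 .$$ Let $\bar y=(\bar x_0,\bar z_0,\dots,\bar z_5)$ with $$\bar x_0=\begin{pmatrix}-8.59365549110427684060547352373810356279806687\\-0.0178290152994757047995861123714012318312941336\\0.494199384159623810384986644320237043033461336\end{pmatrix},$$ $$\begin{aligned} \bar z_0&=0.747518894957396298068037965192410779744158632,\\ \bar z_1&=0.983925376878883085999540632135004996246384770,\\ \bar z_2&=0.978860491445977974417005488978870175248391989,\\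 \bar z_3&=0.957246782943564021435154886545707794901486695,\\ \bar z_4&=0.748005437128185097605270137358697189429422619,\\ \bar z_5&=0.999089891635080634085860840337534558610691943. \end{aligned}$$ The event equations have a unique solution $y^*=(x_0^*,z_0^*,\dots,z_5^* )$ in the box $\bar y+[-10^{-30},10^{-30}]^9$. With $x_{k+1}^*=\Phi_{\mu_k}(x_k^*,z_k^* )$, the cycle is $$C=\bigcup_{k=0}^5\{\Phi_{\mu_k}(x_k^*,r):r\in[z_k^*,1]\},$$ a nonconstant locally attracting periodic orbit of the hybrid ODE following the policy sequence $\mu_0\to\mu_1\to\mu_2\to\mu_3\to\mu_4\to\mu_5\to\mu_0$, and a strict local attractor of the differential inclusion. The local basin of $C$ means a neighborhood of $C$ all of whose points have the property that every solution of the differential inclusion starting there converges to $C$. *)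

theory Defs
  imports "HOL-Probability.Probability"
begin

section \<open>The Markov decision process\<close>

text \<open>States are the elements 1, 2, 3 of the numeral type \<open>3\<close>, so that cost vectors live in
  \<open>real^3\<close>; actions are the elements 0 and 1 of the numeral type \<open>2\<close>. In that type \<open>2 = 0\<close>, hence
  tables indexed by actions are given by case distinction and not by vectors.\<close>

type_synonym state = 3
type_synonym action = 2
type_synonym policy = "state \<Rightarrow> action"

definition discount :: real where
  "discount = 0.95"

definition cost :: "state \<Rightarrow> action \<Rightarrow> real" where
  "cost i a =
    (if a = 0 then vector [2.8645365128, 8.8765458733, -4.4428868652]
     else vector [6.2604856687, -6.6644477357, -7.5034828348] :: real^3) $ i"

definition trans_prob :: "state \<Rightarrow> action \<Rightarrow> state \<Rightarrow> real" where
  "trans_prob i a j =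
    (if i = 1 then
       if a = 0 then vector [0.0083421983, 0.5161392971, 0.4755185046]
       else vector [0.4115295055, 0.3414919270, 0.2469785675]
     else if i = 2 then
       if a = 0 then vector [0.0176113658, 0.9549690854, 0.0274195488]
       else vector [0.3574261643, 0.1754143753, 0.4671594604]
     else
       if a = 0 then vector [0.6791060489, 0.0358694514, 0.2850244997]
       else vector [0.3221209528, 0.3803472570, 0.2975317902] :: real^3) $ j"

definition update_prob :: "real^3" where
  "update_prob = vector [0.02, 0.18, 0.80]"

definition policy_matrix :: "policy \<Rightarrow> real^3^3" where
  "policy_matrix \<mu> = (\<chi> i j. trans_prob i (\<mu> i) j)"

definition policy_cost :: "policy \<Rightarrow> real^3" where
  "policy_cost \<mu> = (\<chi> i. cost i (\<mu> i))"

definition cost_to_go :: "policy \<Rightarrow> real^3" where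
  "cost_to_go \<mu> = matrix_inv (mat 1 - discount *\<^sub>R policy_matrix \<mu>) *v policy_cost \<mu>"

definition Q_value :: "state \<Rightarrow> action \<Rightarrow> real^3 \<Rightarrow> real" where
  "Q_value i a J = cost i a + discount * (\<Sum>j\<in>UNIV. trans_prob i a j * J $ j)"

definition Q_diff :: "state \<Rightarrow> real^3 \<Rightarrow> real" where
  "Q_diff i J = Q_value i 1 J - Q_value i 0 J"

definition greedy_policies :: "real^3 \<Rightarrow> policy set" where
  "greedy_policies J = {\<mu>. \<forall>i a. Q_value i (\<mu> i) J \<le> Q_value i a J}"


section \<open>The Monte Carlo recursion\<close>

text \<open>A sample consists of the updated state \<open>I\<close> and of the simulated trajectory
  \<open>[S\<^sub>0, \<dots>, S\<^sub>T]\<close>, \<open>S\<^sub>0 = I\<close>; the horizon is recovered as \<open>T = length - 1\<close>.\<close>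

type_synonym sample = "state \<times> state list"

definition update_pmf :: "state pmf" where
  "update_pmf = embed_pmf (\<lambda>i. update_prob $ i)"

definition step_pmf :: "policy \<Rightarrow> state \<Rightarrow> state pmf" where
  "step_pmf \<mu> i = embed_pmf (trans_prob i (\<mu> i))"

primrec trajectory_pmf :: "policy \<Rightarrow> nat \<Rightarrow> state \<Rightarrow> state list pmf" where
  "trajectory_pmf \<mu> 0 i = return_pmf [i]"
| "trajectory_pmf \<mu> (Suc m) i =
     bind_pmf (step_pmf \<mu> i) (\<lambda>j. map_pmf ((#) i) (trajectory_pmf \<mu> m j))"

text \<open>Here \<open>geometric_pmf p\<close> gives \<open>m\<close> the probability \<open>(1 - p)\<^sup>m p\<close>.\<close>

definition sample_pmf :: "policy \<Rightarrow> sample pmf" where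
  "sample_pmf \<mu> =
     bind_pmf update_pmf (\<lambda>i.
     bind_pmf (geometric_pmf (1 - discount)) (\<lambda>m.
     map_pmf (\<lambda>path. (i, path)) (trajectory_pmf \<mu> m i)))"

definition mc_return :: "policy \<Rightarrow> sample \<Rightarrow> real" where
  "mc_return \<mu> s = (let S = last (snd s) in cost S (\<mu> S) / (1 - discount))"

definition mc_update :: "(real^3 \<Rightarrow> policy) \<Rightarrow> real \<Rightarrow> real^3 \<Rightarrow> sample \<Rightarrow> real^3" where
  "mc_update \<tau> \<gamma> J s = J + (\<gamma> * (mc_return (\<tau> J) s - J $ fst s)) *\<^sub>R axis (fst s) 1"

text \<open>The \<open>\<sigma>\<close>-algebra generated by the samples before the \<open>t\<close>-th update. The initial condition is
  deterministic below and contributes nothing.\<close>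

definition history :: "'w measure \<Rightarrow> (nat \<Rightarrow> 'w \<Rightarrow> sample) \<Rightarrow> nat \<Rightarrow> 'w measure" where
  "history M X t = sigma (space M) {X s -` A \<inter> space M | s A. s < t}"

text \<open>\<open>J\<close> is a realization of the recursion on the probability space \<open>M\<close>, driven by the samples
  \<open>X\<close>, with tie-breaking rule \<open>\<tau>\<close>, stepsizes \<open>\<gamma>\<close> and initial condition \<open>J0\<close>. As samples
  form a countable set, the last clause determines the whole conditional law of \<open>X t\<close>
  given \<open>history M X t\<close>.\<close>

definition mc_recursion ::
    "(real^3 \<Rightarrow> policy) \<Rightarrow> (nat \<Rightarrow> real) \<Rightarrow> real^3 \<Rightarrow> 'w measure \<Rightarrow>
     (nat \<Rightarrow> 'w \<Rightarrow> sample) \<Rightarrow> (nat \<Rightarrow> 'w \<Rightarrow> real^3) \<Rightarrow> bool" where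
  "mc_recursion \<tau> \<gamma> J0 M X J \<longleftrightarrow>
     prob_space M \<and>
     (\<forall>t. X t \<in> M \<rightarrow>\<^sub>M count_space UNIV) \<and>
     (\<forall>\<omega>\<in>space M. J 0 \<omega> = J0) \<and>
     (\<forall>t. \<forall>\<omega>\<in>space M. J (Suc t) \<omega> = mc_update \<tau> (\<gamma> t) (J t \<omega>) (X t \<omega>)) \<and>
     (\<forall>t x. AE \<omega> in M. real_cond_exp M (history M X t) (\<lambda>\<omega>. indicator {x} (X t \<omega>)) \<omega>
                     = pmf (sample_pmf (\<tau> (J t \<omega>))) x)"


section \<open>The mean field and its differential inclusion\<close>

text \<open>Multiplication on \<open>real^3\<close> is entrywise, so \<open>(*) update_prob\<close> is multiplication by \<open>D\<close>.\<close>

definition mean_field :: "real^3 \<Rightarrow> (real^3) set" where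
  "mean_field J = (*) update_prob ` (convex hull {cost_to_go \<mu> - J | \<mu>. \<mu> \<in> greedy_policies J})"

text \<open>Solutions on \<open>[0, \<infinity>)\<close> are absolutely continuous functions with derivative in the mean field
  almost everywhere, that is, indefinite Lebesgue integrals of such a derivative \<open>v\<close>.\<close>

definition inclusion_solution :: "(real \<Rightarrow> real^3) \<Rightarrow> bool" where
  "inclusion_solution x \<longleftrightarrow>
     (\<exists>v. (\<forall>t\<ge>0. v absolutely_integrable_on {0..t} \<and> x t = x 0 + integral {0..t} v) \<and>
          (AE t in lebesgue. 0 \<le> t \<longrightarrow> v t \<in> mean_field (x t)))"

text \<open>The flow of \<open>J' = D (J\<^sup>\<mu> - J)\<close> from \<open>x\<close> at time \<open>t\<close>, where \<open>z = exp (- 0.02 * t)\<close>.\<close>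

definition flow :: "policy \<Rightarrow> real^3 \<Rightarrow> real \<Rightarrow> real^3" where
  "flow \<mu> x z = cost_to_go \<mu> + (x - cost_to_go \<mu>) * vector [z, z ^ 9, z ^ 40]"


section \<open>The certified cycle\<close>

definition mk_policy :: "action \<Rightarrow> action \<Rightarrow> action \<Rightarrow> policy" where
  "mk_policy a b c = (\<lambda>i. if i = 1 then a else if i = 2 then b else c)"

definition cycle_policies :: "policy list" where
  "cycle_policies =
     [mk_policy 0 1 1, mk_policy 0 0 1, mk_policy 1 0 1,
      mk_policy 1 0 0, mk_policy 1 1 0, mk_policy 1 1 1]"

definition switch_states :: "state list" where
  "switch_states = [2, 1, 3, 2, 3, 1]"

primrec cycle_point :: "real^3 \<Rightarrow> real list \<Rightarrow> nat \<Rightarrow> real^3" where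
  "cycle_point x zs 0 = x"
| "cycle_point x zs (Suc k) = flow (cycle_policies ! k) (cycle_point x zs k) (zs ! k)"

definition x_bar :: "real^3" where
  "x_bar = vector
     [-8.59365549110427684060547352373810356279806687,
      -0.0178290152994757047995861123714012318312941336,
      0.494199384159623810384986644320237043033461336]"

definition z_bar :: "real list" where
  "z_bar =
     [0.747518894957396298068037965192410779744158632,
      0.983925376878883085999540632135004996246384770,
      0.978860491445977974417005488978870175248391989,
      0.957246782943564021435154886545707794901486695,
      0.748005437128185097605270137358697189429422619,
      0.999089891635080634085860840337534558610691943]"

definition event_box :: "((real^3) \<times> real list) set" where
  "event_box = {(x, zs). (\<forall>i. \<bar>x $ i - x_bar $ i\<bar> \<le> 1 / 10 ^ 30) \<and>
     length zs = 6 \<and> (\<forall>k<6. \<bar>zs ! k - z_bar ! k\<bar> \<le> 1 / 10 ^ 30)}"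

definition event_equations :: "real^3 \<Rightarrow> real list \<Rightarrow> bool" where
  "event_equations x zs \<longleftrightarrow>
     (\<forall>k<6. Q_diff (switch_states ! k) (cycle_point x zs (Suc k)) = 0) \<and> cycle_point x zs 6 = x"

definition y_star :: "(real^3) \<times> real list" where
  "y_star = (THE y. y \<in> event_box \<and> event_equations (fst y) (snd y))"

definition certified_cycle :: "(real^3) set" where
  "certified_cycle =
     (let (x, zs) = y_star in
      \<Union>k<6. flow (cycle_policies ! k) (cycle_point x zs k) ` {zs ! k .. 1})"

definition is_local_basin :: "(real^3) set \<Rightarrow> bool" where
  "is_local_basin U \<longleftrightarrow>
     certified_cycle \<subseteq> interior U \<and>
     (\<forall>x. inclusion_solution x \<and> x 0 \<in> U \<longrightarrow>
        ((\<lambda>t. infdist (x t) certified_cycle) \<longlongrightarrow> 0) at_top)"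


section \<open>Well-definedness\<close>

text \<open>The prescribed probabilities are those of the distributions built with \<^const>\<open>embed_pmf\<close>.\<close>

lemma pmf_update_pmf: "pmf update_pmf i = update_prob $ i"
proof -
  have nn: "0 \<le> update_prob $ i" for i :: 3
    using exhaust_3[of i] by (auto simp: update_prob_def)
  have "(\<Sum>i\<in>UNIV. update_prob $ i) = 1"
    by (simp add: sum_3 update_prob_def)
  then show ?thesis
    unfolding update_pmf_def
    by (subst pmf_embed_pmf)
       (simp_all add: nn nn_integral_count_space_finite sum_ennreal flip: ennreal_1)
qed

lemma pmf_step_pmf: "pmf (step_pmf \<mu> i) j = trans_prob i (\<mu> i) j"
proof -
  have nn: "0 \<le> trans_prob i a j" for i a j
    using exhaust_3[of j] by (auto simp: trans_prob_def)
  have "(\<Sum>j\<in>UNIV. trans_prob i a j) = 1" for i a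
    using exhaust_3[of i] by (auto simp: sum_3 trans_prob_def)
  then show ?thesis
    unfolding step_pmf_def
    by (subst pmf_embed_pmf)
       (simp_all add: nn nn_integral_count_space_finite sum_ennreal flip: ennreal_1)
qed

lemma mc_update_measurable:
  assumes \<tau>: "\<tau> \<in> borel \<rightarrow>\<^sub>M count_space UNIV"
    and f: "f \<in> borel_measurable N" and s: "s \<in> N \<rightarrow>\<^sub>M count_space UNIV"
  shows "(\<lambda>\<omega>. mc_update \<tau> c (f \<omega>) (s \<omega>)) \<in> borel_measurable N"
proof -
  have \<tau>f: "(\<lambda>\<omega>. \<tau> (f \<omega>)) \<in> N \<rightarrow>\<^sub>M count_space UNIV"
    using measurable_compose[OF f \<tau>] .
  have nth: "(\<lambda>\<omega>. f \<omega> $ i) \<in> borel_measurable N" for i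
    using f by (rule borel_measurable_nth[THEN measurable_compose_rev, rotated]) 
  have "(\<lambda>\<omega>. f \<omega> + (c * (mc_return (\<tau> (f \<omega>)) x - f \<omega> $ fst x)) *\<^sub>R axis (fst x) 1) \<in> borel_measurable N" for x
    using measurable_compose[OF \<tau>f, of "\<lambda>\<mu>. mc_return \<mu> x" borel] nth f by measurable
  then show ?thesis
    unfolding mc_update_def by (rule measurable_compose_countable[OF _ s])
qed

text \<open>The recursion has a realization for every initial condition and all stepsizes.\<close>

lemma mc_recursion_exists:
  assumes \<tau>: "\<tau> \<in> borel \<rightarrow>\<^sub>M count_space UNIV"
  shows "\<exists>(M :: (nat \<Rightarrow> sample) measure) X J. mc_recursion \<tau> \<gamma> J0 M X J"
proof -
  define it :: "(nat \<Rightarrow> sample) \<Rightarrow> nat \<Rightarrow> real^3"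
    where "it h = rec_nat J0 (\<lambda>t J. mc_update \<tau> (\<gamma> t) J (h t))" for h
  have it_0: "it h 0 = J0" and it_Suc: "it h (Suc t) = mc_update \<tau> (\<gamma> t) (it h t) (h t)" for h t
    by (simp_all add: it_def)
  define K :: "nat \<Rightarrow> (nat \<Rightarrow> sample) \<Rightarrow> sample measure"
    where "K t h = measure_pmf (sample_pmf (\<tau> (it h t)))" for t h
  define S :: "nat \<Rightarrow> sample measure" where "S = (\<lambda>_. count_space UNIV)"
  have it_cong: "it g t = it h t" if "\<And>s. s < t \<Longrightarrow> g s = h s" for g h t
    using that by (induction t) (simp_all add: it_0 it_Suc)
  have comp: "(\<lambda>h. h s) \<in> PiM I S \<rightarrow>\<^sub>M count_space UNIV" if "s \<in> I" for s I
    using measurable_component_singleton[OF that, of S] by (simp add: S_def)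
  have it_meas: "(\<lambda>h. it h t) \<in> borel_measurable (PiM I S)" if "{0..<t} \<subseteq> I" for t I
    using that
  proof (induction t)
    case 0
    then show ?case by (simp add: it_0)
  next
    case (Suc t)
    then have "{0..<t} \<subseteq> I" "t \<in> I" by auto
    with Suc.IH show ?case
      unfolding it_Suc by (intro mc_update_measurable[OF \<tau>] comp)
  qed
  have pol_meas: "(\<lambda>h. \<tau> (it h t)) \<in> PiM I S \<rightarrow>\<^sub>M count_space UNIV" if "{0..<t} \<subseteq> I" for t I
    using measurable_compose[OF it_meas[OF that] \<tau>] .
  interpret IT: Ionescu_Tulcea K S
  proof (rule Ionescu_Tulcea.intro)
    show "K i \<in> PiM {0..<i} S \<rightarrow>\<^sub>M subprob_algebra (S i)" for i
      unfolding K_def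
      by (rule measurable_compose[OF pol_meas]) (simp_all add: S_def measure_pmf_in_subprob_algebra)
    show "prob_space (K i h)" if "h \<in> space (PiM {0..<i} S)" for i h
      by (simp add: K_def measure_pmf.prob_space_axioms)
  qed
  define L where "L = IT.PF.lim"
  have sets_L: "sets L = sets (PiM UNIV S)"
    unfolding L_def by (rule IT.PF.sets_lim)
  have space_L: "space L = UNIV"
    unfolding L_def IT.PF.space_lim by (simp add: space_PiM S_def)
  let ?r = "\<lambda>t h. restrict h {0..<t}"
  have r_meas: "?r t \<in> L \<rightarrow>\<^sub>M PiM {0..<t} S" for t
    unfolding measurable_cong_sets[OF sets_L refl] by (rule measurable_restrict_subset) simp
  have X_meas: "(\<lambda>h. h t) \<in> L \<rightarrow>\<^sub>M count_space UNIV" for t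
    unfolding measurable_cong_sets[OF sets_L refl] by (rule comp) simp
  have distr: "distr L (PiM {0..<t} S) (?r t) = IT.C 0 t (\<lambda>_. undefined)" for t
  proof -
    have "distr L (PiM {0..<t} S) (?r t) = IT.CI {0..<t}"
      unfolding L_def by (rule IT.distr_lim) simp
    also have "\<dots> = IT.C 0 t (\<lambda>_. undefined)"
    proof -
      have "IT.up_to {0..<t} = t"
        unfolding IT.up_to_def by (rule Least_equality) (auto simp: not_le[symmetric])
      then show ?thesis
        unfolding IT.CI_def using IT.distr_C[of t t "\<lambda>_. undefined" 0]
        by (simp add: space_PiM)
    qed
    finally show ?thesis .
  qed
  have "prob_space (distr L (PiM {0..<0} S) (?r 0))"
    unfolding distr by (rule IT.prob_space_C) (simp add: space_PiM)
  then interpret L: prob_space L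
    by (rule prob_space_distrD[OF r_meas])
  have C_space: "space (IT.C 0 t (\<lambda>_. undefined)) = space (PiM {0..<t} S)"
    and C_sets: "sets (IT.C 0 t (\<lambda>_. undefined)) = sets (PiM {0..<t} S)" for t
    using IT.space_C[of "\<lambda>_. undefined" 0 t] IT.sets_C[of "\<lambda>_. undefined" 0 t]
    by (simp_all add: space_PiM)
  have L_int: "(\<integral>\<^sup>+h. f (?r t h) \<partial>L) = (\<integral>\<^sup>+h. f h \<partial>IT.C 0 t (\<lambda>_. undefined))"
    if "f \<in> borel_measurable (PiM {0..<t} S)" for f t
    unfolding distr[symmetric] using that by (subst nn_integral_distr[OF r_meas]) simp_all
  have kernel: "(\<integral>\<^sup>+h. indicator B (?r t h) * indicator {x} (h t) \<partial>L) =
      (\<integral>\<^sup>+h. indicator B (?r t h) * ennreal (pmf (sample_pmf (\<tau> (it h t))) x) \<partial>L)"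
    if B: "B \<in> sets (PiM {0..<t} S)" for B t x
  proof -
    define f :: "(nat \<Rightarrow> sample) \<Rightarrow> ennreal"
      where "f h = indicator B (?r t h) * indicator {x} (h t)" for h
    define g :: "(nat \<Rightarrow> sample) \<Rightarrow> ennreal"
      where "g h = indicator B h * ennreal (pmf (sample_pmf (\<tau> (it h t))) x)" for h
    have r_meas': "?r t \<in> PiM {0..<Suc t} S \<rightarrow>\<^sub>M PiM {0..<t} S"
      by (rule measurable_restrict_subset) simp
    have f_meas: "f \<in> borel_measurable (PiM {0..<Suc t} S)"
      unfolding f_def
      by (intro borel_measurable_times_ennreal measurable_compose[OF r_meas']
            borel_measurable_indicator B measurable_compose[OF comp]) simp_all
    have g_meas: "g \<in> borel_measurable (PiM {0..<t} S)"
      unfolding g_def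
      by (intro borel_measurable_times_ennreal borel_measurable_indicator B
            measurable_compose[OF pol_meas]) simp_all
    have "(\<integral>\<^sup>+h. indicator B (?r t h) * indicator {x} (h t) \<partial>L) = (\<integral>\<^sup>+h. f (?r (Suc t) h) \<partial>L)"
      by (simp add: f_def)
    also have "\<dots> = (\<integral>\<^sup>+h. f h \<partial>IT.C 0 (Suc t) (\<lambda>_. undefined))"
      by (rule L_int[OF f_meas])
    also have "\<dots> = (\<integral>\<^sup>+h. (\<integral>\<^sup>+h'. f h' \<partial>IT.eP t h) \<partial>IT.C 0 t (\<lambda>_. undefined))"
      using IT.measurable_eP[of t]
      by (simp add: nn_integral_bind[OF f_meas] measurable_cong_sets[OF C_sets refl])
    also have "\<dots> = (\<integral>\<^sup>+h. g h \<partial>IT.C 0 t (\<lambda>_. undefined))"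
    proof (rule nn_integral_cong)
      fix h assume "h \<in> space (IT.C 0 t (\<lambda>_. undefined))"
      then have h: "h \<in> space (PiM {0..<t} S)" by (simp add: C_space)
      have res: "?r t (h(t := y)) = h" for y
        using h by (auto simp: space_PiM PiE_iff extensional_def restrict_def fun_eq_iff)
      have "(\<integral>\<^sup>+h'. f h' \<partial>IT.eP t h) = (\<integral>\<^sup>+y. f (h(t := y)) \<partial>K t h)"
        by (rule IT.nn_integral_eP[OF h f_meas])
      also have "\<dots> = (\<integral>\<^sup>+y. indicator B h * indicator {x} y \<partial>K t h)"
        by (simp add: f_def res del: restrict_apply)
      also have "\<dots> = g h"
        by (simp add: g_def K_def nn_integral_cmult emeasure_pmf_single)
      finally show "(\<integral>\<^sup>+h'. f h' \<partial>IT.eP t h) = g h" .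
    qed
    also have "\<dots> = (\<integral>\<^sup>+h. g (?r t h) \<partial>L)"
      by (rule L_int[OF g_meas, symmetric])
    also have "\<dots> = (\<integral>\<^sup>+h. indicator B (?r t h) * ennreal (pmf (sample_pmf (\<tau> (it h t))) x) \<partial>L)"
      unfolding g_def by (intro nn_integral_cong) (simp add: it_cong[of t "?r t h" h for h])
    finally show ?thesis .
  qed
  let ?X = "\<lambda>t h. h t" and ?J = "\<lambda>t h. it h t"
  have hist_gen: "{?X s -` A \<inter> space L | s A. s < t} \<subseteq> Pow (space L)" for t
    by auto
  have hist_sets: "sets (history L ?X t) = sigma_sets (space L) {?X s -` A \<inter> space L | s A. s < t}" for t
    unfolding history_def by (rule sets_measure_of[OF hist_gen])
  have hist_space: "space (history L ?X t) = space L" for t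
    unfolding history_def by (rule space_measure_of[OF hist_gen])
  have X_hist: "?X s \<in> history L ?X t \<rightarrow>\<^sub>M count_space UNIV" if "s < t" for s t
    using that by (intro measurableI) (auto simp: hist_space hist_sets intro!: sigma_sets.Basic)
  have J_hist: "?J s \<in> borel_measurable (history L ?X t)" if "s \<le> t" for s t
    using that
  proof (induction s)
    case 0
    then show ?case by (simp add: it_0)
  next
    case (Suc s)
    then show ?case
      unfolding it_Suc by (intro mc_update_measurable[OF \<tau>] X_hist) auto
  qed
  have subalg: "subalgebra L (history L ?X t)" for t
    unfolding subalgebra_def hist_space hist_sets
    by (auto intro!: sets.sigma_sets_subset measurable_sets[OF X_meas])
  have hist_r: "\<exists>B\<in>sets (PiM {0..<t} S). A = ?r t -` B \<inter> space L"
    if "A \<in> sets (history L ?X t)" for A t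
  proof -
    let ?V = "vimage_algebra (space L) (?r t) (PiM {0..<t} S)"
    have r_sp: "?r t \<in> space L \<rightarrow> space (PiM {0..<t} S)"
      by (auto simp: space_PiM S_def)
    have "?X s -` A \<inter> space L \<in> sets ?V" if "s < t" for s A
    proof -
      have "(\<lambda>h. ?r t h s) \<in> ?V \<rightarrow>\<^sub>M count_space UNIV"
        using that by (intro measurable_compose[OF measurable_vimage_algebra1[OF r_sp]] comp) simp
      then have "(\<lambda>h. ?r t h s) -` A \<inter> space ?V \<in> sets ?V"
        by (rule measurable_sets) simp
      then show ?thesis using that by simp
    qed
    then have "sigma_sets (space ?V) {?X s -` A \<inter> space L | s A. s < t} \<subseteq> sets ?V"
      by (intro sets.sigma_sets_subset) auto
    then have "A \<in> sets ?V"
      using that by (auto simp: hist_sets)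
    then show ?thesis
      unfolding sets_vimage_algebra2[OF r_sp] by auto
  qed
  have "AE h in L. real_cond_exp L (history L ?X t) (\<lambda>h. indicator {x} (?X t h)) h
                 = pmf (sample_pmf (\<tau> (?J t h))) x" for t x
  proof -
    interpret F: finite_measure_subalgebra L "history L ?X t"
      by unfold_locales (rule subalg)
    let ?f = "\<lambda>h. indicator {x} (?X t h) :: real"
    let ?g = "\<lambda>h. pmf (sample_pmf (\<tau> (?J t h))) x"
    have f_meas: "?f \<in> borel_measurable L"
      by (rule measurable_compose[OF X_meas]) simp
    have g_hist: "?g \<in> borel_measurable (history L ?X t)"
      by (rule measurable_compose[OF measurable_compose[OF J_hist[OF order_refl] \<tau>]]) simp
    have g_meas: "?g \<in> borel_measurable L"
      by (rule measurable_from_subalg[OF subalg g_hist])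
    show ?thesis
    proof (rule F.real_cond_exp_charact)
      show "integrable L ?f"
        by (rule L.integrable_const_bound[of _ 1]) (auto intro: f_meas split: split_indicator)
      show "integrable L ?g"
        by (rule L.integrable_const_bound[of _ 1]) (auto intro: g_meas simp: pmf_le_1)
      show "?g \<in> borel_measurable (history L ?X t)" by fact
      fix A assume A: "A \<in> sets (history L ?X t)"
      then obtain B where B: "B \<in> sets (PiM {0..<t} S)" "A = ?r t -` B \<inter> space L"
        using hist_r by blast
      have "A \<in> sets L"
        using A subalg by (auto simp: subalgebra_def)
      then have iA: "(indicator A :: _ \<Rightarrow> real) \<in> borel_measurable L"
        by simp
      have ind: "indicator A h = (indicator B (?r t h) :: real)" for h
        by (auto simp: B(2) space_L split: split_indicator)
      have "(\<integral>h\<in>A. ?f h \<partial>L) = enn2real (\<integral>\<^sup>+h. ennreal (indicator A h * ?f h) \<partial>L)"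
        unfolding set_lebesgue_integral_def real_scaleR_def
        by (rule integral_eq_nn_integral) (auto intro!: borel_measurable_times iA f_meas)
      also have "(\<integral>\<^sup>+h. ennreal (indicator A h * ?f h) \<partial>L) = (\<integral>\<^sup>+h. ennreal (indicator A h * ?g h) \<partial>L)"
        using kernel[OF B(1), of x] by (simp add: ind ennreal_mult ennreal_indicator)
      also have "enn2real \<dots> = (\<integral>h\<in>A. ?g h \<partial>L)"
        unfolding set_lebesgue_integral_def real_scaleR_def
        by (rule integral_eq_nn_integral[symmetric]) (auto intro!: borel_measurable_times iA g_meas)
      finally show "(\<integral>h\<in>A. ?f h \<partial>L) = (\<integral>h\<in>A. ?g h \<partial>L)" .
    qed
  qed
  then have "mc_recursion \<tau> \<gamma> J0 L ?X ?J"
    unfolding mc_recursion_def using X_meas by (simp add: L.prob_space_axioms it_0 it_Suc)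
  then show ?thesis by blast
qed

end

theory Submission imports Defs begin

text \<open>The cycle is a hyperbolic attracting periodic orbit of a piecewise linear flow: the return map contracts
  a polyhedral norm on each switching plane, which is verified in exact arithmetic around an approximate
  solution of the event equations. Transported along the flow, these norms measure the distance to
  the cycle and, after a correction near the switching planes, yield a Lyapunov function for every Euler
  scheme whose velocities lie in the closed convex hull of the velocities at distance at most \<open>\<delta>\<close>.
  Both the solutions of the inclusion, sampled at equidistant times, and the recursion, after subtraction
  of its accumulated noise, are such schemes. With stepsizes \<open>1 / (t + N)\<close> the second moment of
  the noise is \<open>O(1 / N)\<close>, so for large \<open>N\<close> it stays below \<open>\<delta>\<close> with positive
  probability; the iterates then remain near the cycle, where no point is an approximate equilibrium, while the
  stepsizes are not summable, and they cannot converge.\<close>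


text \<open>The distance function of a segment is constant along the flow of its own policy, so
  contraction happens only at the switches, and there only in norms adapted to the cycle. A weight
  increasing in the flow coordinate spreads this discrete gain over the segments. The obstacle is
  the vicinity of the switching planes: with an error \<delta> the velocity may be that of the wrong
  segment, and the distance may then grow at a rate of order 1. Both adjacent fields cross the plane
  in the same direction with a definite speed, so a band of width O(\<delta>) is passed in time
  O(\<delta>), and terms measuring the depth in the band pay for the growth. The noise is treated
  without a maximal inequality: its accumulated sum is frozen once it exceeds \<delta>, so
  exceedance is monotone in time and a second moment bound at each fixed time suffices. The
  numerical tolerances are nested: residuals of the approximate cycle are at most 10^-41, the event
  box has radius 10^-30, and the contraction estimates hold within 10^-20, wide enough for all
  points that solutions in the box pass through.\<close>

section \<open>Exact costs-to-go of the six policies\<close>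

lemma trans_prob_nonneg: "0 \<le> trans_prob i a j"
  using exhaust_3[of j] by (auto simp: trans_prob_def)

lemma trans_prob_sum: "(\<Sum>j\<in>UNIV. trans_prob i a j) = 1"
  using exhaust_3[of i] by (auto simp: sum_3 trans_prob_def)

lemma bellman_matrix_component:
  "((mat 1 - discount *\<^sub>R policy_matrix \<mu>) *v v) $ i
     = v $ i - discount * (\<Sum>j\<in>UNIV. trans_prob i (\<mu> i) j * v $ j)"
proof -
  have "((mat 1 - discount *\<^sub>R policy_matrix \<mu>) *v v) $ i
      = (mat 1 *v v) $ i - (discount *\<^sub>R (policy_matrix \<mu> *v v)) $ i"
    by (simp only: matrix_vector_mult_diff_rdistrib scaleR_matrix_vector_assoc vector_minus_component)
  then show ?thesis
    by (simp add: matrix_vector_mul_lid) (simp add: policy_matrix_def matrix_vector_mult_def)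
qed

text \<open>Rows are probability vectors and \<open>discount\<close> is less than 1: at an index
  where a kernel vector has its largest modulus m, the equation gives m \<le> 0.95 m.\<close>

lemma invertible_bellman: "invertible (mat 1 - discount *\<^sub>R policy_matrix \<mu>)"
proof -
  have "v = 0" if v: "(mat 1 - discount *\<^sub>R policy_matrix \<mu>) *v v = 0" for v
  proof -
    define m where "m = Max (range (\<lambda>i. \<bar>v $ i\<bar>))"
    have m: "\<bar>v $ i\<bar> \<le> m" for i
      unfolding m_def by (rule Max_ge) auto
    have "m \<in> range (\<lambda>i. \<bar>v $ i\<bar>)"
      unfolding m_def by (rule Max_in) auto
    then obtain i where i: "m = \<bar>v $ i\<bar>" by auto
    have "v $ i = discount * (\<Sum>j\<in>UNIV. trans_prob i (\<mu> i) j * v $ j)"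
      using bellman_matrix_component[of \<mu> v i] v by simp
    then have "m = discount * \<bar>\<Sum>j\<in>UNIV. trans_prob i (\<mu> i) j * v $ j\<bar>"
      by (simp add: i abs_mult discount_def)
    also have "\<dots> \<le> discount * (\<Sum>j\<in>UNIV. trans_prob i (\<mu> i) j * m)"
      by (intro mult_left_mono order.trans[OF sum_abs] sum_mono)
         (auto simp: abs_mult trans_prob_nonneg discount_def intro!: mult_left_mono m)
    also have "\<dots> = discount * m"
      by (simp add: trans_prob_sum flip: sum_distrib_right)
    finally have "m \<le> 0" by (simp add: discount_def)
    then have "v $ i = 0" for i using m[of i] by simp
    then show "v = 0" by (simp add: vec_eq_iff)
  qed
  then show ?thesis
    unfolding invertible_left_inverse matrix_left_invertible_ker by blast
qed

text \<open>Replaces the matrix inverse by the policy evaluation equation. It serves for the exact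
  rational vectors below and again for identifying the expected Monte Carlo return with
  \<open>cost_to_go\<close>.\<close>

lemma cost_to_go_eqI:
  assumes "\<forall>i. J $ i = cost i (\<mu> i) + discount * (\<Sum>j\<in>UNIV. trans_prob i (\<mu> i) j * J $ j)"
  shows "cost_to_go \<mu> = J"
proof -
  let ?A = "mat 1 - discount *\<^sub>R policy_matrix \<mu>"
  have "?A *v J = policy_cost \<mu>"
    unfolding vec_eq_iff bellman_matrix_component policy_cost_def vec_lambda_beta
    by (metis add_diff_cancel_right' assms)
  then have "cost_to_go \<mu> = (matrix_inv ?A ** ?A) *v J"
    by (simp add: cost_to_go_def matrix_vector_mul_assoc[symmetric])
  then show ?thesis
    using someI_ex[OF invertible_bellman[of \<mu>, unfolded invertible_def]]
    by (simp add: matrix_inv_def)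
qed

lemma cost_to_go_011:
  "cost_to_go (mk_policy 0 1 1) =
     vector [-1327299527342387038049868968812593/15464833038463578125037500000000,
       -1437878345554071871412428968812593/15464833038463578125037500000000,
       -1452247203335736546251753968812593/15464833038463578125037500000000]"
  by (rule cost_to_go_eqI)
     (simp add: forall_3 sum_3 mk_policy_def cost_def trans_prob_def discount_def)

lemma cost_to_go_001:
  "cost_to_go (mk_policy 0 0 1) =
     vector [864894971601091368474289432212653/6267929652184485240872500000000,
       979316651351807743558449432212653/6267929652184485240872500000000,
       796682198957824065666074432212653/6267929652184485240872500000000]"
  by (rule cost_to_go_eqI)
     (simp add: forall_3 sum_3 mk_policy_def cost_def trans_prob_def discount_def)

lemma cost_to_go_101:
  "cost_to_go (mk_policy 1 0 1) =
     vector [2295154717140532013023716939899/15753301776313649791000000000,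
       2503766611744815878528716939899/15753301776313649791000000000,
       2075477022839547068423716939899/15753301776313649791000000000]"
  by (rule cost_to_go_eqI)
     (simp add: forall_3 sum_3 mk_policy_def cost_def trans_prob_def discount_def)

lemma cost_to_go_100:
  "cost_to_go (mk_policy 1 0 0) =
     vector [163645112203563106566770354402467/1138526616214164220003000000000,
       538475608107598043880506063207401/3415579848642492660009000000000,
       438685715099467628739311063207401/3415579848642492660009000000000]"
  by (rule cost_to_go_eqI)
     (simp add: forall_3 sum_3 mk_policy_def cost_def trans_prob_def discount_def)

lemma cost_to_go_110:
  "cost_to_go (mk_policy 1 1 0) =
     vector [15241257988584017046063842008001/1568878348702848843095000000000,
       -13062720181784004624802473975997/4706635046108546529285000000000,
       11166012737040012522229526024003/4706635046108546529285000000000]"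
  by (rule cost_to_go_eqI)
     (simp add: forall_3 sum_3 mk_policy_def cost_def trans_prob_def discount_def)

lemma cost_to_go_111:
  "cost_to_go (mk_policy 1 1 1) =
     vector [-192481355362500635279531306613557/5472249370596643844587625000000,
       -268397560115821456252063806613557/5472249370596643844587625000000,
       -274544619411118232361043806613557/5472249370596643844587625000000]"
  by (rule cost_to_go_eqI)
     (simp add: forall_3 sum_3 mk_policy_def cost_def trans_prob_def discount_def)

section \<open>Flow coordinates and gradients of the action gaps\<close>

text \<open>The exponents 1, 9, 40 are 50 times the update probabilities, so the single scalar z =
  exp(-t/50) encodes all three decay rates.\<close>

definition flow_exp :: "state \<Rightarrow> nat" where
  "flow_exp i = (if i = 1 then 1 else if i = 2 then 9 else 40)"

lemma flow_component:
  "flow \<mu> x z $ i = cost_to_go \<mu> $ i + (x $ i - cost_to_go \<mu> $ i) * z ^ flow_exp i"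
  using exhaust_3[of i] by (auto simp: flow_def flow_exp_def)

definition Q_grad :: "state \<Rightarrow> real^3" where
  "Q_grad i = (\<chi> j. discount * (trans_prob i 1 j - trans_prob i 0 j))"

lemma Q_diff_affine: "Q_diff i x = cost i 1 - cost i 0 + Q_grad i \<bullet> x"
  by (simp add: Q_diff_def Q_value_def Q_grad_def inner_vec_def sum_3 algebra_simps)

lemma Q_diff_diff: "Q_diff i x - Q_diff i y = Q_grad i \<bullet> (x - y)"
  by (simp add: Q_diff_affine inner_diff_right)

lemma abs_Q_grad_le: "\<bar>Q_grad i $ j\<bar> \<le> 1"
proof -
  have "\<bar>trans_prob i 1 j - trans_prob i 0 j\<bar> \<le> 1"
    using exhaust_3[of i] exhaust_3[of j] by (auto simp: trans_prob_def)
  then show ?thesis by (simp add: Q_grad_def discount_def abs_mult)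
qed

text \<open>A secant slope instead of a derivative: differences of two flow images become exactly
  linear in the change of z, with coefficients close to those at the reference value c, so no Taylor
  remainder has to be carried along. The induction rests on z^(p+1) - w^(p+1) = z (z^p - w^p) + (z -
  w) w^p.\<close>

lemma power_slope:
  fixes z w c \<epsilon> :: real
  assumes "0 \<le> z" "z \<le> 1" "0 \<le> w" "w \<le> 1" "0 \<le> c" "c \<le> 1" "\<bar>z - c\<bar> \<le> \<epsilon>" "\<bar>w - c\<bar> \<le> \<epsilon>"
  shows "\<exists>m. z ^ p - w ^ p = (z - w) * m \<and> \<bar>m - real p * c ^ (p - 1)\<bar> \<le> (real p)\<^sup>2 * \<epsilon>"
proof (induction p)
  case 0
  then show ?case by (intro exI[of _ 0]) simp
next
  case (Suc p)
  then obtain m where m: "z ^ p - w ^ p = (z - w) * m" "\<bar>m - real p * c ^ (p - 1)\<bar> \<le> (real p)\<^sup>2 * \<epsilon>"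
    by blast
  have eps: "0 \<le> \<epsilon>" using assms(7) by linarith
  have "\<bar>z * m - real p * c ^ p\<bar> = \<bar>z * (m - real p * c ^ (p - 1)) + (z - c) * (real p * c ^ (p - 1))\<bar>"
    by (cases p) (simp_all add: algebra_simps)
  also have "\<dots> \<le> 1 * ((real p)\<^sup>2 * \<epsilon>) + \<epsilon> * (real p * 1)"
    using assms m(2) eps
    by (intro order.trans[OF abs_triangle_ineq] add_mono; unfold abs_mult; intro mult_mono)
       (auto simp: power_le_one)
  finally have 1: "\<bar>z * m - real p * c ^ p\<bar> \<le> (real p)\<^sup>2 * \<epsilon> + real p * \<epsilon>"
    by (simp add: mult.commute)
  have "\<bar>w ^ p - c ^ p\<bar> \<le> real p * \<bar>w - c\<bar>"
    using norm_power_diff[of w c p] assms by simp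
  also have "\<dots> \<le> real p * \<epsilon>"
    using assms by (simp add: mult_left_mono)
  finally have 2: "\<bar>w ^ p - c ^ p\<bar> \<le> real p * \<epsilon>" .
  have "\<bar>(z * m + w ^ p) - real (Suc p) * c ^ p\<bar> \<le> (real p)\<^sup>2 * \<epsilon> + 2 * (real p * \<epsilon>)"
    using 1 2 by (simp add: algebra_simps abs_le_iff)
  also have "\<dots> \<le> (real (Suc p))\<^sup>2 * \<epsilon>"
    using eps by (simp add: power2_eq_square algebra_simps)
  finally have "\<bar>(z * m + w ^ p) - real (Suc p) * c ^ (Suc p - 1)\<bar> \<le> (real (Suc p))\<^sup>2 * \<epsilon>"
    by simp
  moreover have "z ^ Suc p - w ^ Suc p = (z - w) * (z * m + w ^ p)"
  proof -
    have "z ^ Suc p - w ^ Suc p = z * (z ^ p - w ^ p) + (z - w) * w ^ p"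
      by (simp add: algebra_simps)
    then show ?thesis unfolding m(1) by (simp add: algebra_simps)
  qed
  ultimately show ?case by blast
qed

lemma abs_add_bound:
  fixes x y :: real
  assumes "\<bar>x\<bar> \<le> a" "\<bar>y\<bar> \<le> b"
  shows "\<bar>x + y\<bar> \<le> a + b"
  using assms by linarith

lemma abs_inner_le_bound:
  fixes w e :: "real^3"
  assumes "\<And>j. \<bar>w $ j\<bar> \<le> c" "\<And>j. \<bar>e $ j\<bar> \<le> E"
  shows "\<bar>w \<bullet> e\<bar> \<le> 3 * c * E"
proof -
  have c: "0 \<le> c" using assms(1)[of 1] by linarith
  have "\<bar>w $ j * e $ j\<bar> \<le> c * E" for j
    unfolding abs_mult using assms c by (intro mult_mono) auto
  from this[of 1] this[of 2] this[of 3] show ?thesis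
    by (simp add: inner_vec_def sum_3)
qed

lemma abs_inner_le_sum:
  fixes w e :: "real^3"
  assumes "\<And>j. \<bar>e $ j\<bar> \<le> E"
  shows "\<bar>w \<bullet> e\<bar> \<le> (\<Sum>j\<in>UNIV. \<bar>w $ j\<bar>) * E"
  unfolding inner_vec_def sum_distrib_right using assms
  by (intro order.trans[OF sum_abs] sum_mono) (auto simp: abs_mult intro!: mult_left_mono)

section \<open>Certified contraction along one segment\<close>

lemma inner_diff_divide:
  fixes u q A e :: "real^3"
  shows "(\<chi> j. u $ j - c * (q $ j * A $ j) / \<gamma>) \<bullet> e = u \<bullet> e - c * (q \<bullet> (A * e)) / \<gamma>"
  by (simp add: inner_vec_def sum_3 algebra_simps add_divide_distrib)

text \<open>A numerical certificate for one segment of the cycle: from the neighborhood of \<open>X\<close> the flow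
  of \<open>\<mu>\<close> reaches the switching plane of state \<open>s\<close> near \<open>X'\<close>, after the time coded by \<open>z \<approx> zb\<close>.
  The vectors \<open>A\<close> and \<open>B\<close> approximate the diagonal of the derivative in \<open>x\<close> and the derivative in
  \<open>z\<close> of the flow. Vectors in the switching plane with normal \<open>gp\<close> are measured by
  the functionals \<open>c1\<close>, \<open>c2\<close> at the start, those in the plane of \<open>s\<close> by \<open>d1\<close>, \<open>d2\<close> at the end; the
  entries of \<open>m1\<close>, \<open>m2\<close>, \<open>n\<close> are coefficients with respect to \<open>(c1, c2, gp)\<close>.\<close>

locale segment_certificate =
  fixes \<mu> :: policy and s :: state and gp X X' A B c1 c2 d1 d2 m1 m2 :: "real^3"
    and n :: "state \<Rightarrow> real^3" and zb G :: real
  assumes zb: "0 < zb - 1 / 10 ^ 20" "zb + 1 / 10 ^ 20 < 1"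
    and A: "\<And>i. \<bar>zb ^ flow_exp i - A $ i\<bar> \<le> 1 / 10000000000000" "\<And>i. 0 \<le> A $ i" "\<And>i. A $ i \<le> 1"
    and B: "\<And>i. \<bar>(X $ i - cost_to_go \<mu> $ i) * (flow_exp i * zb ^ (flow_exp i - 1)) - B $ i\<bar> \<le> 1 / 10000000000000"
    and X: "\<And>i. \<bar>X $ i - cost_to_go \<mu> $ i\<bar> \<le> 300"
    and \<gamma>: "20 \<le> \<bar>Q_grad s \<bullet> B\<bar>" "\<And>i. \<bar>B $ i\<bar> \<le> 10 * \<bar>Q_grad s \<bullet> B\<bar>"
    and residual: "\<And>i. \<bar>flow \<mu> X zb $ i - X' $ i\<bar> \<le> 1 / 10 ^ 41" "\<bar>Q_diff s X'\<bar> \<le> 1 / 10 ^ 41"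
    and growth: "\<And>i. (\<Sum>j\<in>UNIV. \<bar>(if i = j then A $ j else 0) - B $ i * (Q_grad s $ j * A $ j) / (Q_grad s \<bullet> B)\<bar>) \<le> G"
    and contr1: "\<And>j. \<bar>d1 $ j * A $ j - d1 \<bullet> B * (Q_grad s $ j * A $ j) / (Q_grad s \<bullet> B)
        - (m1 $ 1 * c1 $ j + m1 $ 2 * c2 $ j + m1 $ 3 * gp $ j)\<bar> \<le> 1 / 1000" "\<bar>m1 $ 1\<bar> + \<bar>m1 $ 2\<bar> \<le> 0.94"
    and contr2: "\<And>j. \<bar>d2 $ j * A $ j - d2 \<bullet> B * (Q_grad s $ j * A $ j) / (Q_grad s \<bullet> B)
        - (m2 $ 1 * c1 $ j + m2 $ 2 * c2 $ j + m2 $ 3 * gp $ j)\<bar> \<le> 1 / 1000" "\<bar>m2 $ 1\<bar> + \<bar>m2 $ 2\<bar> \<le> 0.94"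
    and norms: "\<And>j. \<bar>d1 $ j\<bar> \<le> 1000" "\<And>j. \<bar>d2 $ j\<bar> \<le> 1000"
    and inj: "\<And>i j. \<bar>(if i = j then 1 else 0) - (n i $ 1 * c1 $ j + n i $ 2 * c2 $ j + n i $ 3 * gp $ j)\<bar> \<le> 1 / 1000"
      "\<And>i. \<bar>n i $ 1\<bar> + \<bar>n i $ 2\<bar> \<le> 0.2"
begin

text \<open>On the plane \<open>gp \<bullet> e = 0\<close> a combination of \<open>c1\<close>,
  \<open>c2\<close>, \<open>gp\<close> acts like its first two terms; a defect of 1/1000 per entry
  costs three such entries times the size of e. Both the contraction and the injectivity of the
  plane norm are read off from decompositions of this kind.\<close>

lemma functional_bound:
  assumes "gp \<bullet> e = 0" "\<bar>c1 \<bullet> e\<bar> \<le> t" "\<bar>c2 \<bullet> e\<bar> \<le> t"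
    and "\<And>j. \<bar>w $ j - (m $ 1 * c1 $ j + m $ 2 * c2 $ j + m $ 3 * gp $ j)\<bar> \<le> 1 / 1000"
    and "\<bar>m $ 1\<bar> + \<bar>m $ 2\<bar> \<le> c" "\<And>j. \<bar>e $ j\<bar> \<le> E"
  shows "\<bar>w \<bullet> e\<bar> \<le> c * t + 3 / 1000 * E"
proof -
  let ?r = "w - ((m $ 1) *\<^sub>R c1 + (m $ 2) *\<^sub>R c2 + (m $ 3) *\<^sub>R gp)"
  have "\<bar>?r \<bullet> e\<bar> \<le> 3 * (1 / 1000) * E"
    using assms(4,6) by (intro abs_inner_le_bound) auto
  moreover have "w \<bullet> e = ?r \<bullet> e + m $ 1 * (c1 \<bullet> e) + m $ 2 * (c2 \<bullet> e)"
    using assms(1) by (simp add: inner_add_left inner_diff_left)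
  moreover have t: "0 \<le> t" using assms(2) by linarith
  have "\<bar>m $ 1 * (c1 \<bullet> e)\<bar> + \<bar>m $ 2 * (c2 \<bullet> e)\<bar> \<le> \<bar>m $ 1\<bar> * t + \<bar>m $ 2\<bar> * t"
    unfolding abs_mult using assms(2,3) by (intro add_mono mult_left_mono) auto
  moreover have "\<bar>m $ 1\<bar> * t + \<bar>m $ 2\<bar> * t \<le> c * t"
    unfolding distrib_right[symmetric] using assms(5) t by (rule mult_right_mono)
  ultimately show ?thesis by linarith
qed

text \<open>Makes the two functionals a norm on the plane. The unit covectors decompose with weights
  at most 0.2, and the resulting bound E \<le> 0.2 t + 0.003 E for the largest entry absorbs
  itself.\<close>

lemma component_bound:
  assumes "gp \<bullet> e = 0" "\<bar>c1 \<bullet> e\<bar> \<le> t" "\<bar>c2 \<bullet> e\<bar> \<le> t"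
  shows "\<bar>e $ i\<bar> \<le> 0.3 * t"
proof -
  define E where "E = Max (range (\<lambda>i. \<bar>e $ i\<bar>))"
  have E: "\<bar>e $ i\<bar> \<le> E" for i
    unfolding E_def by (rule Max_ge) auto
  have "E \<in> range (\<lambda>i. \<bar>e $ i\<bar>)"
    unfolding E_def by (rule Max_in) auto
  then obtain k where k: "E = \<bar>e $ k\<bar>" by auto
  have "\<bar>axis k 1 \<bullet> e\<bar> \<le> 0.2 * t + 3 / 1000 * E"
  proof (rule functional_bound[OF assms _ inj(2)[of k] E])
    show "\<bar>axis k 1 $ j - (n k $ 1 * c1 $ j + n k $ 2 * c2 $ j + n k $ 3 * gp $ j)\<bar> \<le> 1 / 1000" for j
      using inj(1)[of k j] by (cases "j = k") (auto simp: axis_def)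
  qed
  then have "E \<le> 0.3 * t"
    unfolding k by (auto simp: inner_axis')
  then show ?thesis using E[of i] by linarith
qed

text \<open>Model of the difference of two flow images: e is the initial displacement, e' the final
  one, d the unknown shift of the passage parameter, and a, b are the actual coefficients near the
  certified \<open>A\<close>, \<open>B\<close>. The shift is restricted only through \<kappa>, which
  measures how far e' is from being parallel to the switching plane.\<close>

context
  fixes a b e e' :: "real^3" and d E \<kappa> :: real
  assumes a: "\<And>i. \<bar>a $ i - A $ i\<bar> \<le> 1 / 1000000000000" and b: "\<And>i. \<bar>b $ i - B $ i\<bar> \<le> 1 / 1000000000000"
    and e: "\<And>i. \<bar>e $ i\<bar> \<le> E" and e': "\<And>i. e' $ i = a $ i * e $ i + d * b $ i"
    and \<kappa>: "\<bar>Q_grad s \<bullet> e'\<bar> \<le> \<kappa>"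
begin

text \<open>Near-tangency of e' determines d up to a small error, so e' is close to the derivative
  of the passage map, that is, to \<open>A * e\<close> projected onto the plane along
  \<open>B\<close>. Divisions are by the transversality coefficient, whose modulus is at least 20.
  The factor 11 is the certified ratio 10 with room for the error in b.\<close>

lemma linear_image_approx:
  "\<bar>e' $ i - (A $ i * e $ i - (Q_grad s \<bullet> (A * e)) / (Q_grad s \<bullet> B) * B $ i)\<bar>
     \<le> 11 * \<kappa> + 50 / 1000000000000 * E"
proof -
  define \<gamma>0 \<gamma>1 d0 where "\<gamma>0 = Q_grad s \<bullet> B" and "\<gamma>1 = Q_grad s \<bullet> b"
    and "d0 = - (Q_grad s \<bullet> (A * e)) / \<gamma>0"
  have E0: "0 \<le> E" using e[of 1] by linarith
  have "\<bar>Q_grad s \<bullet> (b - B)\<bar> \<le> 3 * 1 * (1 / 1000000000000)"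
    using abs_Q_grad_le b by (intro abs_inner_le_bound) auto
  then have \<gamma>d: "\<bar>\<gamma>1 - \<gamma>0\<bar> \<le> 3 / 1000000000000"
    by (simp add: \<gamma>0_def \<gamma>1_def inner_diff_right)
  have \<gamma>0: "20 \<le> \<bar>\<gamma>0\<bar>" using \<gamma>(1) by (simp add: \<gamma>0_def)
  have Ae: "\<bar>(A * e) $ j\<bar> \<le> E" for j
    using mult_mono[of "\<bar>A $ j\<bar>" 1 "\<bar>e $ j\<bar>" E] A e[of j] E0 by (simp add: abs_mult)
  have "\<bar>Q_grad s \<bullet> (A * e)\<bar> \<le> 3 * 1 * E"
    by (rule abs_inner_le_bound[OF abs_Q_grad_le Ae])
  then have Q: "\<bar>Q_grad s \<bullet> (A * e)\<bar> \<le> 3 * E" by simp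
  have d0: "\<bar>d0\<bar> \<le> 3 / 20 * E"
  proof -
    have "20 * E \<le> \<bar>\<gamma>0\<bar> * E" using \<gamma>0 E0 by (rule mult_right_mono)
    with Q have "\<bar>Q_grad s \<bullet> (A * e)\<bar> \<le> 3 / 20 * (\<bar>\<gamma>0\<bar> * E)"
      by linarith
    then show ?thesis using \<gamma>0 by (simp add: d0_def divide_le_eq mult_ac)
  qed
  have d0e: "d0 * \<gamma>0 = - (Q_grad s \<bullet> (A * e))"
    using \<gamma>0 by (auto simp: d0_def)
  have "e' = a * e + d *\<^sub>R b"
    by (simp add: vec_eq_iff e')
  then have de: "d * \<gamma>1 = Q_grad s \<bullet> e' - Q_grad s \<bullet> (a * e)"
    by (simp add: \<gamma>1_def inner_add_right)
  have "\<bar>((a - A) * e) $ j\<bar> \<le> 1 / 1000000000000 * E" for j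
    using mult_mono[of "\<bar>a $ j - A $ j\<bar>" "1 / 1000000000000" "\<bar>e $ j\<bar>" E] a[of j] e[of j] by (simp add: abs_mult)
  then have "\<bar>Q_grad s \<bullet> ((a - A) * e)\<bar> \<le> 3 * 1 * (1 / 1000000000000 * E)"
    by (intro abs_inner_le_bound abs_Q_grad_le)
  moreover have "\<bar>d0 * (\<gamma>1 - \<gamma>0)\<bar> \<le> 3 / 20 * E * (3 / 1000000000000)"
    unfolding abs_mult using \<gamma>d d0 E0 by (intro mult_mono) auto
  moreover have "(d - d0) * \<gamma>1 = Q_grad s \<bullet> e' - Q_grad s \<bullet> ((a - A) * e) - d0 * (\<gamma>1 - \<gamma>0)"
    using de d0e by (simp add: algebra_simps inner_diff_right)
  ultimately have 1: "\<bar>(d - d0) * \<gamma>1\<bar> \<le> \<kappa> + 4 / 1000000000000 * E"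
    using \<kappa> E0 by linarith
  have "\<bar>b $ i\<bar> \<le> 11 * \<bar>\<gamma>1\<bar>"
    using b[of i] \<gamma>(2)[of i] \<gamma>d \<gamma>0 unfolding \<gamma>0_def[symmetric] by linarith
  then have "\<bar>(d - d0) * b $ i\<bar> \<le> 11 * \<bar>(d - d0) * \<gamma>1\<bar>"
    using mult_left_mono[of "\<bar>b $ i\<bar>" "11 * \<bar>\<gamma>1\<bar>" "\<bar>d - d0\<bar>"] by (simp add: abs_mult)
  then have 2: "\<bar>(d - d0) * b $ i\<bar> \<le> 11 * \<kappa> + 44 / 1000000000000 * E"
    using 1 by simp
  have 3: "\<bar>(a $ i - A $ i) * e $ i\<bar> \<le> 1 / 1000000000000 * E"
    unfolding abs_mult using a e by (intro mult_mono) auto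
  have 4: "\<bar>d0 * (b $ i - B $ i)\<bar> \<le> 3 / 20 * E * (1 / 1000000000000)"
    unfolding abs_mult using b d0 E0 by (intro mult_mono) auto
  have "e' $ i - (A $ i * e $ i + d0 * B $ i)
      = (a $ i - A $ i) * e $ i + (d - d0) * b $ i + d0 * (b $ i - B $ i)"
    by (simp add: e' algebra_simps)
  then have "\<bar>e' $ i - (A $ i * e $ i + d0 * B $ i)\<bar> \<le> 11 * \<kappa> + 50 / 1000000000000 * E"
    using 2 3 4 E0 by linarith
  then show ?thesis by (simp add: d0_def \<gamma>0_def)
qed

text \<open>Counterpart in the maximum norm, where \<open>growth\<close> bounds the absolute row
  sums of the projected derivative. It serves for propagating radii, not for contraction.\<close>

lemma linear_image_growth: "\<bar>e' $ i\<bar> \<le> G * E + 11 * \<kappa> + 50 / 1000000000000 * E"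
proof -
  let ?w = "\<chi> j. (if i = j then A $ j else 0) - B $ i * (Q_grad s $ j * A $ j) / (Q_grad s \<bullet> B)"
  have "(\<chi> j. if i = j then A $ j else 0) \<bullet> e = A $ i * e $ i"
    using exhaust_3[of i] by (auto simp: inner_vec_def sum_3)
  then have "?w \<bullet> e = A $ i * e $ i - (Q_grad s \<bullet> (A * e)) / (Q_grad s \<bullet> B) * B $ i"
    using inner_diff_divide[of "\<chi> j. if i = j then A $ j else 0" "B $ i" "Q_grad s" A "Q_grad s \<bullet> B" e]
    by simp
  moreover have "\<bar>?w \<bullet> e\<bar> \<le> G * E"
  proof -
    have "\<bar>?w \<bullet> e\<bar> \<le> (\<Sum>j\<in>UNIV. \<bar>?w $ j\<bar>) * E"
      by (rule abs_inner_le_sum[OF e])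
    also have "\<dots> \<le> G * E"
      using growth[of i] e[of 1] by (intro mult_right_mono) auto
    finally show ?thesis .
  qed
  ultimately have "\<bar>A $ i * e $ i - (Q_grad s \<bullet> (A * e)) / (Q_grad s \<bullet> B) * B $ i\<bar> \<le> G * E"
    by simp
  from abs_add_bound[OF linear_image_approx[of i] this] show ?thesis by simp
qed

text \<open>With E = 0.3 t the certified factor 0.94 increases by 0.0009 through the decomposition
  defect and by a negligible amount through the inexact coefficients; 0.95 covers both.\<close>

lemma linear_image_functional:
  fixes f :: "real^3"
  assumes t: "gp \<bullet> e = 0" "\<bar>c1 \<bullet> e\<bar> \<le> t" "\<bar>c2 \<bullet> e\<bar> \<le> t" and \<kappa>0: "\<kappa> = 0" and E: "E = 0.3 * t"
    and m: "\<And>j. \<bar>f $ j * A $ j - f \<bullet> B * (Q_grad s $ j * A $ j) / (Q_grad s \<bullet> B)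
        - (m $ 1 * c1 $ j + m $ 2 * c2 $ j + m $ 3 * gp $ j)\<bar> \<le> 1 / 1000" "\<bar>m $ 1\<bar> + \<bar>m $ 2\<bar> \<le> 0.94"
    and f: "\<And>j. \<bar>f $ j\<bar> \<le> 1000"
  shows "\<bar>f \<bullet> e'\<bar> \<le> 0.95 * t"
proof -
  let ?w = "\<chi> j. f $ j * A $ j - f \<bullet> B * (Q_grad s $ j * A $ j) / (Q_grad s \<bullet> B)"
  let ?r = "e' - (A * e - ((Q_grad s \<bullet> (A * e)) / (Q_grad s \<bullet> B)) *\<^sub>R B)"
  have t0: "0 \<le> t" using t(2) by linarith
  have 1: "\<bar>f \<bullet> ?r\<bar> \<le> 3 * 1000 * (50 / 1000000000000 * E)"
    using linear_image_approx by (intro abs_inner_le_bound f) (simp add: \<kappa>0)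
  have 2: "\<bar>?w \<bullet> e\<bar> \<le> 0.94 * t + 3 / 1000 * E"
    using m by (intro functional_bound t e) auto
  have "?w \<bullet> e = f \<bullet> (A * e) - f \<bullet> B * (Q_grad s \<bullet> (A * e)) / (Q_grad s \<bullet> B)"
  proof -
    have "(f * A) \<bullet> e = f \<bullet> (A * e)"
      by (simp add: inner_vec_def mult.assoc)
    then show ?thesis
      using inner_diff_divide[of "f * A" "f \<bullet> B" "Q_grad s" A "Q_grad s \<bullet> B" e] by simp
  qed
  then have "f \<bullet> e' = f \<bullet> ?r + ?w \<bullet> e"
    by (simp add: inner_diff_right)
  then have "\<bar>f \<bullet> e'\<bar> \<le> 3 * 1000 * (50 / 1000000000000 * E) + (0.94 * t + 3 / 1000 * E)"
    using abs_add_bound[OF 1 2] by simp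
  then show ?thesis using E t0 by simp
qed

end

lemma abs_power_le_one:
  assumes "\<bar>z - zb\<bar> \<le> 1 / 10 ^ 20"
  shows "\<bar>z ^ k\<bar> \<le> 1"
proof -
  have "0 \<le> z" "z \<le> 1" using assms zb by linarith+
  then show ?thesis by (simp add: power_le_one)
qed

text \<open>Within 10^-20 of the reference point the entries of the z-derivative move by at most 300
  * 1600 * 10^-20 and a smaller term, so the certified precision 10^-13 degrades to 10^-12 at
  worst.\<close>

lemma derivative_approx:
  fixes z m :: real
  assumes x: "\<And>i. \<bar>x $ i - X $ i\<bar> \<le> 1 / 10 ^ 20"
    and z: "\<bar>z - zb\<bar> \<le> 1 / 10 ^ 20" and m: "\<bar>m - flow_exp i * zb ^ (flow_exp i - 1)\<bar> \<le> (real (flow_exp i))\<^sup>2 * (1 / 10 ^ 20)"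
  shows "\<bar>z ^ flow_exp i - A $ i\<bar> \<le> 1 / 1000000000000"
    and "\<bar>(x $ i - cost_to_go \<mu> $ i) * m - B $ i\<bar> \<le> 1 / 1000000000000"
proof -
  define p where "p = flow_exp i"
  have p: "real p \<le> 40" by (simp add: p_def flow_exp_def)
  have z01: "0 \<le> z" "z \<le> 1" "0 \<le> zb" "zb \<le> 1" using zb z by linarith+
  have "\<bar>z ^ p - zb ^ p\<bar> \<le> real p * \<bar>z - zb\<bar>"
    using norm_power_diff[of z zb p] z01 by simp
  also have "\<dots> \<le> 40 * (1 / 10 ^ 20)"
    using p z by (intro mult_mono) auto
  finally have "\<bar>z ^ p - zb ^ p\<bar> \<le> 40 * (1 / 10 ^ 20)" .
  from abs_add_bound[OF this A(1)[of i, folded p_def]]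
  show "\<bar>z ^ flow_exp i - A $ i\<bar> \<le> 1 / 1000000000000"
    by (simp add: p_def)
  define M where "M = real p * zb ^ (p - 1)"
  have M: "\<bar>M\<bar> \<le> 40"
    using mult_mono[of "real p" 40 "zb ^ (p - 1)" 1] p z01 by (simp add: M_def power_le_one)
  have "(real p)\<^sup>2 \<le> 40\<^sup>2" using p by (intro power_mono) auto
  then have "(real p)\<^sup>2 * (1 / 10 ^ 20) \<le> 1600 * (1 / 10 ^ 20)" by (intro mult_right_mono) auto
  then have mM: "\<bar>m - M\<bar> \<le> 1600 / 10 ^ 20"
    using m by (simp add: M_def p_def)
  have 1: "\<bar>(X $ i - cost_to_go \<mu> $ i) * (m - M)\<bar> \<le> 300 * (1600 / 10 ^ 20)"
    unfolding abs_mult using X[of i] mM by (intro mult_mono) auto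
  have 2: "\<bar>(x $ i - X $ i) * m\<bar> \<le> (1 / 10 ^ 20) * 41"
    unfolding abs_mult using x[of i] abs_add_bound[OF mM M] by (intro mult_mono) auto
  have "(x $ i - cost_to_go \<mu> $ i) * m - B $ i
     = ((X $ i - cost_to_go \<mu> $ i) * M - B $ i) + ((X $ i - cost_to_go \<mu> $ i) * (m - M) + (x $ i - X $ i) * m)"
    by (simp add: algebra_simps)
  also have "\<bar>\<dots>\<bar> \<le> 1 / 10000000000000 + (300 * (1600 / 10 ^ 20) + (1 / 10 ^ 20) * 41)"
    using B[of i] by (intro abs_add_bound 1 2) (simp add: M_def p_def)
  finally show "\<bar>(x $ i - cost_to_go \<mu> $ i) * m - B $ i\<bar> \<le> 1 / 1000000000000"
    by simp
qed

text \<open>The displacement in x is transported with the first parameter z, and the slope in z is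
  taken at the second point x. In this arrangement b depends on x, z and w only, and one b works for
  all y.\<close>

lemma flow_difference:
  assumes x: "\<And>i. \<bar>x $ i - X $ i\<bar> \<le> 1 / 10 ^ 20"
    and z: "\<bar>z - zb\<bar> \<le> 1 / 10 ^ 20" "\<bar>w - zb\<bar> \<le> 1 / 10 ^ 20"
  obtains b where "\<And>i. \<bar>b $ i - B $ i\<bar> \<le> 1 / 1000000000000"
    and "\<And>y i. (flow \<mu> y z - flow \<mu> x w) $ i
        = (\<chi> i. z ^ flow_exp i) $ i * (y - x) $ i + (z - w) * b $ i"
proof -
  have "\<exists>m. z ^ p - w ^ p = (z - w) * m \<and> \<bar>m - real p * zb ^ (p - 1)\<bar> \<le> (real p)\<^sup>2 * (1 / 10 ^ 20)" for p
    using z zb by (intro power_slope) linarith+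
  then obtain m where m: "\<And>p. z ^ p - w ^ p = (z - w) * m p"
    "\<And>p. \<bar>m p - real p * zb ^ (p - 1)\<bar> \<le> (real p)\<^sup>2 * (1 / 10 ^ 20)"
    by metis
  show thesis
  proof
    show "\<bar>(\<chi> i. (x $ i - cost_to_go \<mu> $ i) * m (flow_exp i)) $ i - B $ i\<bar> \<le> 1 / 1000000000000" for i
      using derivative_approx(2)[OF x z(1) m(2)] by simp
    fix y i
    have "w ^ flow_exp i = z ^ flow_exp i - (z - w) * m (flow_exp i)"
      using m(1)[of "flow_exp i"] by simp
    then show "(flow \<mu> y z - flow \<mu> x w) $ i = (\<chi> i. z ^ flow_exp i) $ i * (y - x) $ i
        + (z - w) * (\<chi> i. (x $ i - cost_to_go \<mu> $ i) * m (flow_exp i)) $ i"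
      unfolding vector_minus_component flow_component vec_lambda_beta
      by (simp only: \<open>w ^ flow_exp i = z ^ flow_exp i - (z - w) * m (flow_exp i)\<close>) (simp add: algebra_simps)
  qed
qed

text \<open>The tolerance 10^-30 is that of \<open>event_box\<close>, so the parameters of a
  solution in the box qualify directly.\<close>

definition crosses :: "real^3 \<Rightarrow> real \<Rightarrow> real^3 \<Rightarrow> bool" where
  "crosses x z x' \<longleftrightarrow> \<bar>z - zb\<bar> \<le> 1 / 10 ^ 30 \<and> x' = flow \<mu> x z \<and> Q_diff s x' = 0"

lemma crossesD:
  assumes "crosses x z x'"
  shows "\<bar>z - zb\<bar> \<le> 1 / 10 ^ 30" "\<bar>z - zb\<bar> \<le> 1 / 10 ^ 20" "x' = flow \<mu> x z" "Q_diff s x' = 0"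
proof -
  show 1: "\<bar>z - zb\<bar> \<le> 1 / 10 ^ 30" and "x' = flow \<mu> x z" "Q_diff s x' = 0"
    using assms unfolding crosses_def by blast+
  have "1 / 10 ^ 30 \<le> 1 / (10 ^ 20 :: real)" by simp
  with 1 show "\<bar>z - zb\<bar> \<le> 1 / 10 ^ 20" by (rule order_trans)
qed

lemma power_approx:
  assumes "\<bar>z - zb\<bar> \<le> 1 / 10 ^ 20"
  shows "\<bar>(\<chi> i. z ^ flow_exp i) $ i - A $ i\<bar> \<le> 1 / 1000000000000"
  using derivative_approx(1)[of X z _ i, OF _ assms, of "flow_exp i * zb ^ (flow_exp i - 1)"] by simp

text \<open>The bound on the parameters comes from transversality: the slope along b is at least 1
  in modulus, while the transported displacement contributes at most 0.9 t. It later identifies the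
  z-components of two solutions of the event equations.\<close>

lemma crosses_contraction:
  assumes y: "\<And>i. \<bar>y $ i - X $ i\<bar> \<le> 1 / 10 ^ 20"
    and c: "crosses x z x'" "crosses y w y'"
    and t: "gp \<bullet> (x - y) = 0" "\<bar>c1 \<bullet> (x - y)\<bar> \<le> t" "\<bar>c2 \<bullet> (x - y)\<bar> \<le> t"
  shows "\<bar>d1 \<bullet> (x' - y')\<bar> \<le> 0.95 * t" "\<bar>d2 \<bullet> (x' - y')\<bar> \<le> 0.95 * t" "Q_grad s \<bullet> (x' - y') = 0"
    "\<bar>z - w\<bar> \<le> t"
proof -
  have z: "\<bar>z - zb\<bar> \<le> 1 / 10 ^ 20" "\<bar>w - zb\<bar> \<le> 1 / 10 ^ 20"
    by (rule crossesD(2)[OF c(1)], rule crossesD(2)[OF c(2)])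
  obtain b where b: "\<And>i. \<bar>b $ i - B $ i\<bar> \<le> 1 / 1000000000000"
    and fd: "\<And>x i. (flow \<mu> x z - flow \<mu> y w) $ i = (\<chi> i. z ^ flow_exp i) $ i * (x - y) $ i + (z - w) * b $ i"
    by (rule flow_difference[OF y z]) (rule that)
  have e': "(x' - y') $ i = (\<chi> i. z ^ flow_exp i) $ i * (x - y) $ i + (z - w) * b $ i" for i
    unfolding crossesD(3)[OF c(1)] crossesD(3)[OF c(2)] by (rule fd)
  show g: "Q_grad s \<bullet> (x' - y') = 0"
    using Q_diff_diff[of s x' y'] c[THEN crossesD(4)] by simp
  have g0: "\<bar>Q_grad s \<bullet> (x' - y')\<bar> \<le> 0" using g by simp
  note lin = linear_image_functional[OF power_approx[OF z(1)] b component_bound[OF t] e' g0 t refl refl]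
  show "\<bar>d1 \<bullet> (x' - y')\<bar> \<le> 0.95 * t" by (rule lin[OF contr1 norms(1)])
  show "\<bar>d2 \<bullet> (x' - y')\<bar> \<le> 0.95 * t" by (rule lin[OF contr2 norms(2)])
  have t0: "0 \<le> t" using t(2) by linarith
  let ?a = "\<chi> i. z ^ flow_exp i"
  have "x' - y' = ?a * (x - y) + (z - w) *\<^sub>R b"
    by (simp add: vec_eq_iff e'[simplified])
  then have 1: "(z - w) * (Q_grad s \<bullet> b) = - (Q_grad s \<bullet> (?a * (x - y)))"
    using g by (simp add: inner_add_right)
  have "\<bar>(?a * (x - y)) $ j\<bar> \<le> 1 * (0.3 * t)" for j
    unfolding vector_mult_component abs_mult using abs_power_le_one[OF z(1)] component_bound[OF t, of j]
    by (intro mult_mono) auto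
  then have 2: "\<bar>Q_grad s \<bullet> (?a * (x - y))\<bar> \<le> 3 * 1 * (1 * (0.3 * t))"
    by (intro abs_inner_le_bound abs_Q_grad_le)
  have "\<bar>Q_grad s \<bullet> (b - B)\<bar> \<le> 3 * 1 * (1 / 1000000000000)"
    using b by (intro abs_inner_le_bound abs_Q_grad_le) auto
  then have "1 \<le> \<bar>Q_grad s \<bullet> b\<bar>"
    using \<gamma>(1) unfolding inner_diff_right by linarith
  then have "\<bar>z - w\<bar> * 1 \<le> \<bar>(z - w) * (Q_grad s \<bullet> b)\<bar>"
    unfolding abs_mult by (intro mult_left_mono) auto
  from this[unfolded 1 abs_minus_cancel] 2 have "\<bar>z - w\<bar> * 1 \<le> 3 * 1 * (1 * (0.3 * t))"
    by (rule order_trans)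
  then show "\<bar>z - w\<bar> \<le> t" using t0 by simp
qed

text \<open>Infinitesimal version of \<open>crosses_contraction\<close>, with the derivative in z in
  place of the secant slope. It is applied at the exact cycle, where d also absorbs the component of
  a displacement along the flow.\<close>

lemma derivative_contraction:
  fixes z :: real
  assumes x: "\<And>i. \<bar>x $ i - X $ i\<bar> \<le> 1 / 10 ^ 20" and z: "\<bar>z - zb\<bar> \<le> 1 / 10 ^ 20"
    and t: "gp \<bullet> e = 0" "\<bar>c1 \<bullet> e\<bar> \<le> t" "\<bar>c2 \<bullet> e\<bar> \<le> t" and g: "Q_grad s \<bullet> e' = 0"
    and e': "\<And>i. e' $ i = z ^ flow_exp i * e $ i
        + d * ((x $ i - cost_to_go \<mu> $ i) * (flow_exp i * z ^ (flow_exp i - 1)))"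
  shows "\<bar>d1 \<bullet> e'\<bar> \<le> 0.95 * t" "\<bar>d2 \<bullet> e'\<bar> \<le> 0.95 * t"
proof -
  have zw: "\<exists>m. z ^ p - z ^ p = (z - z) * m \<and> \<bar>m - real p * zb ^ (p - 1)\<bar> \<le> (real p)\<^sup>2 * (1 / 10 ^ 20)" for p
    using z zb by (intro power_slope) linarith+
  have m: "\<bar>real p * z ^ (p - 1) - real p * zb ^ (p - 1)\<bar> \<le> (real p)\<^sup>2 * (1 / 10 ^ 20)" for p
  proof -
    have "norm z \<le> 1" "norm zb \<le> 1" using z zb unfolding real_norm_def by linarith+
    then have "\<bar>z ^ (p - 1) - zb ^ (p - 1)\<bar> \<le> real (p - 1) * \<bar>z - zb\<bar>"
      using norm_power_diff[of z zb "p - 1"] by simp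
    also have "\<dots> \<le> real p * (1 / 10 ^ 20)"
      using z by (intro mult_mono) auto
    finally have "real p * \<bar>z ^ (p - 1) - zb ^ (p - 1)\<bar> \<le> real p * (real p * (1 / 10 ^ 20))"
      by (rule mult_left_mono) simp
    then show ?thesis
      by (simp add: power2_eq_square abs_mult flip: right_diff_distrib)
  qed
  have e'': "e' $ i = (\<chi> i. z ^ flow_exp i) $ i * e $ i
        + d * (\<chi> i. (x $ i - cost_to_go \<mu> $ i) * (flow_exp i * z ^ (flow_exp i - 1))) $ i" for i
    using e'[of i] by simp
  have b: "\<bar>(\<chi> i. (x $ i - cost_to_go \<mu> $ i) * (flow_exp i * z ^ (flow_exp i - 1))) $ i - B $ i\<bar>
      \<le> 1 / 1000000000000" for i
    using derivative_approx(2)[OF x z m] by simp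
  have g0: "\<bar>Q_grad s \<bullet> e'\<bar> \<le> 0" using g by simp
  note lin = linear_image_functional[OF power_approx[OF z] b component_bound[OF t] e'' g0 t refl refl]
  show "\<bar>d1 \<bullet> e'\<bar> \<le> 0.95 * t" by (rule lin[OF contr1 norms(1)])
  show "\<bar>d2 \<bullet> e'\<bar> \<le> 0.95 * t" by (rule lin[OF contr2 norms(2)])
qed

text \<open>At \<open>zb\<close> the event function has modulus at most 4 r, and its secant slopes
  in z have modulus at least 19, so it vanishes somewhere on [zb - r, zb + r]. The lower limit on r
  makes the residuals 10^-41 of the approximate cycle negligible against r.\<close>

lemma crosses_exists:
  assumes r: "1 / 10 ^ 38 \<le> r" "r \<le> 1 / 10 ^ 30" and x: "\<And>i. \<bar>x $ i - X $ i\<bar> \<le> r"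
  shows "\<exists>z x'. crosses x z x'" "crosses x z x' \<Longrightarrow> \<bar>x' $ i - X' $ i\<bar> \<le> (G + 0.1) * r"
proof -
  have x20: "\<bar>x $ i - X $ i\<bar> \<le> 1 / 10 ^ 20" for i
    using x[of i] r by (simp add: power_one_over)
  have X20: "\<bar>X $ i - X $ i\<bar> \<le> 1 / 10 ^ 20" for i by simp
  have zb20: "\<bar>zb - zb\<bar> \<le> 1 / 10 ^ 20" by simp
  have r0: "0 \<le> r" using r by (simp add: order.trans[rotated])
  have rs: "1 / 10 ^ 41 \<le> r / 1000" using r(1) by simp
  have res: "\<bar>Q_diff s (flow \<mu> X zb)\<bar> \<le> 4 * (1 / 10 ^ 41)"
  proof -
    have "\<bar>Q_grad s \<bullet> (flow \<mu> X zb - X')\<bar> \<le> 3 * 1 * (1 / 10 ^ 41)"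
      using residual(1) by (intro abs_inner_le_bound abs_Q_grad_le) simp
    then show ?thesis
      using residual(2) unfolding Q_diff_diff[symmetric] by linarith
  qed
  have 0: "\<bar>Q_diff s (flow \<mu> x zb)\<bar> \<le> 4 * r"
  proof -
    have "\<bar>(flow \<mu> x zb - flow \<mu> X zb) $ j\<bar> \<le> 1 * r" for j
    proof -
      have "(flow \<mu> x zb - flow \<mu> X zb) $ j = zb ^ flow_exp j * (x $ j - X $ j)"
        by (simp add: flow_component algebra_simps)
      then show ?thesis
        using mult_mono[OF abs_power_le_one[OF zb20] x[of j], of "flow_exp j"] by (simp add: abs_mult)
    qed
    then have "\<bar>Q_grad s \<bullet> (flow \<mu> x zb - flow \<mu> X zb)\<bar> \<le> 3 * 1 * (1 * r)"
      by (intro abs_inner_le_bound abs_Q_grad_le)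
    then show ?thesis
      using res rs r0 unfolding Q_diff_diff[symmetric] by linarith
  qed
  have slope: "\<exists>\<gamma>1. Q_diff s (flow \<mu> x z) - Q_diff s (flow \<mu> x zb) = (z - zb) * \<gamma>1
      \<and> \<bar>\<gamma>1 - Q_grad s \<bullet> B\<bar> \<le> 1" if z: "\<bar>z - zb\<bar> \<le> 1 / 10 ^ 20" for z
  proof -
    obtain b where b: "\<And>i. \<bar>b $ i - B $ i\<bar> \<le> 1 / 1000000000000"
      and e': "\<And>y i. (flow \<mu> y z - flow \<mu> x zb) $ i = (\<chi> i. z ^ flow_exp i) $ i * (y - x) $ i + (z - zb) * b $ i"
      by (rule flow_difference[OF x20 z zb20]) (rule that)
    have "flow \<mu> x z - flow \<mu> x zb = (z - zb) *\<^sub>R b"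
      using e'[of x] by (simp add: vec_eq_iff)
    moreover have "\<bar>Q_grad s \<bullet> (b - B)\<bar> \<le> 3 * 1 * (1 / 1000000000000)"
      using b by (intro abs_inner_le_bound abs_Q_grad_le) auto
    ultimately show ?thesis
      by (intro exI[of _ "Q_grad s \<bullet> b"]) (simp add: Q_diff_diff inner_diff_right)
  qed
  have zr: "\<bar>(zb + r) - zb\<bar> \<le> 1 / 10 ^ 20" "\<bar>(zb - r) - zb\<bar> \<le> 1 / 10 ^ 20"
    using r r0 by (auto simp: power_one_over)
  obtain \<gamma>1 \<gamma>2 where g12: "Q_diff s (flow \<mu> x (zb + r)) - Q_diff s (flow \<mu> x zb) = r * \<gamma>1"
    "\<bar>\<gamma>1 - Q_grad s \<bullet> B\<bar> \<le> 1"
    "Q_diff s (flow \<mu> x (zb - r)) - Q_diff s (flow \<mu> x zb) = - r * \<gamma>2" "\<bar>\<gamma>2 - Q_grad s \<bullet> B\<bar> \<le> 1"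
    using slope[OF zr(1)] slope[OF zr(2)] by auto
  have cont: "continuous_on {zb - r..zb + r} (\<lambda>z. Q_diff s (flow \<mu> x z))"
    unfolding Q_diff_affine inner_vec_def flow_component sum_3 inner_real_def by (intro continuous_intros)
  have "\<exists>z. zb - r \<le> z \<and> z \<le> zb + r \<and> Q_diff s (flow \<mu> x z) = 0"
  proof (cases "0 \<le> Q_grad s \<bullet> B")
    case True
    then have "4 * r \<le> r * \<gamma>1" "4 * r \<le> r * \<gamma>2"
      using mult_left_mono[of 4 \<gamma>1 r] mult_left_mono[of 4 \<gamma>2 r] g12 \<gamma>(1) r0 by (auto simp: mult.commute)
    then show ?thesis using g12 0 r0
      by (intro IVT'[OF _ _ _ cont]) auto
  next
    case False
    then have "r * \<gamma>1 \<le> - 4 * r" "r * \<gamma>2 \<le> - 4 * r"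
      using mult_left_mono[of \<gamma>1 "-4" r] mult_left_mono[of \<gamma>2 "-4" r] g12 \<gamma>(1) r0 by (auto simp: mult.commute)
    then show ?thesis using g12 0 r0
      by (intro IVT2'[OF _ _ _ cont]) auto
  qed
  then obtain z0 where z0: "zb - r \<le> z0" "z0 \<le> zb + r" "Q_diff s (flow \<mu> x z0) = 0"
    by blast
  then have "\<bar>z0 - zb\<bar> \<le> r" by linarith
  with z0(3) show "\<exists>z x'. crosses x z x'"
    unfolding crosses_def using r by (intro exI[of _ z0] exI[of _ "flow \<mu> x z0"]) auto
  assume c: "crosses x z x'"
  then have z: "\<bar>z - zb\<bar> \<le> 1 / 10 ^ 20" by (rule crossesD)
  obtain b where b: "\<And>i. \<bar>b $ i - B $ i\<bar> \<le> 1 / 1000000000000"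
    and e': "\<And>y i. (flow \<mu> y z - flow \<mu> X zb) $ i = (\<chi> i. z ^ flow_exp i) $ i * (y - X) $ i + (z - zb) * b $ i"
    by (rule flow_difference[OF X20 z zb20]) (rule that)
  have \<kappa>: "\<bar>Q_grad s \<bullet> (flow \<mu> x z - flow \<mu> X zb)\<bar> \<le> 4 * (1 / 10 ^ 41)"
    using res crossesD(3,4)[OF c] unfolding Q_diff_diff[symmetric] by simp
  have e: "\<bar>(x - X) $ i\<bar> \<le> r" for i using x by simp
  have "\<bar>(flow \<mu> x z - flow \<mu> X zb) $ i\<bar> \<le> G * r + 11 * (4 * (1 / 10 ^ 41)) + 50 / 1000000000000 * r"
    by (rule linear_image_growth[OF power_approx[OF z] b e e' \<kappa>])
  from abs_add_bound[OF this residual(1)[of i]]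
  have "\<bar>x' $ i - X' $ i\<bar> \<le> G * r + 11 * (4 * (1 / 10 ^ 41)) + 50 / 1000000000000 * r + 1 / 10 ^ 41"
    using crossesD(3)[OF c] by simp
  also have "\<dots> \<le> (G + 0.1) * r"
    using rs r0 by (simp add: distrib_right)
  finally show "\<bar>x' $ i - X' $ i\<bar> \<le> (G + 0.1) * r" .
qed

text \<open>A cruder estimate for radii beyond the range of \<open>crosses_exists\<close>. By
  definition of \<open>crosses\<close> the parameter is within 10^-30 of \<open>zb\<close> and so
  contributes at most 20000 * 10^-30, and the flow is nonexpansive in x. A solution in the event box
  may leave the radius 10^-30 after one segment, so this version is the one that follows it around
  the cycle.\<close>

lemma crosses_near:
  assumes x: "\<And>i. \<bar>x $ i - X $ i\<bar> \<le> r" "r \<le> 1 / 10 ^ 22" and c: "crosses x z x'"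
  shows "\<bar>x' $ i - X' $ i\<bar> \<le> r + 1 / 10 ^ 25"
proof -
  have z: "\<bar>z - zb\<bar> \<le> 1 / 10 ^ 20" "\<bar>z - zb\<bar> \<le> 1 / 10 ^ 30"
    by (rule crossesD[OF c])+
  have zb20: "\<bar>zb - zb\<bar> \<le> 1 / 10 ^ 20" by simp
  have X20: "\<bar>X $ i - X $ i\<bar> \<le> 1 / 10 ^ 20" for i by simp
  obtain b where b: "\<And>i. \<bar>b $ i - B $ i\<bar> \<le> 1 / 1000000000000"
    and e': "\<And>y i. (flow \<mu> y z - flow \<mu> X zb) $ i = (\<chi> i. z ^ flow_exp i) $ i * (y - X) $ i + (z - zb) * b $ i"
    by (rule flow_difference[OF X20 z(1) zb20]) (rule that)
  have "flow_exp i * zb ^ (flow_exp i - 1) \<le> 40 * 1"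
    using zb by (intro mult_mono) (auto simp: flow_exp_def power_le_one)
  then have "\<bar>(X $ i - cost_to_go \<mu> $ i) * (flow_exp i * zb ^ (flow_exp i - 1))\<bar> \<le> 300 * 40"
    unfolding abs_mult using X[of i] zb by (intro mult_mono) auto
  then have bb: "\<bar>b $ i\<bar> \<le> 20000" using B[of i] b[of i] by linarith
  have 1: "\<bar>(z - zb) * b $ i\<bar> \<le> 1 / 10 ^ 30 * 20000"
    unfolding abs_mult using z(2) bb by (intro mult_mono) auto
  have 2: "\<bar>(\<chi> i. z ^ flow_exp i) $ i * (x - X) $ i\<bar> \<le> 1 * r"
    unfolding abs_mult using x(1)[of i] abs_power_le_one[OF z(1)] by (intro mult_mono) auto
  have 3: "x' $ i - X' $ i = (\<chi> i. z ^ flow_exp i) $ i * (x - X) $ i + (z - zb) * b $ i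
      + (flow \<mu> X zb $ i - X' $ i)"
    using e'[of x i] crossesD(3)[OF c] by simp
  have "\<bar>x' $ i - X' $ i\<bar> \<le> 1 * r + 1 / 10 ^ 30 * 20000 + 1 / 10 ^ 41"
    unfolding 3 by (rule abs_add_bound[OF abs_add_bound[OF 2 1] residual(1)])
  then show ?thesis by simp
qed

end

section \<open>Numerical data of the six segments\<close>

lemma Q_grad_1: "Q_grad 1 = vector [0.383027941840, -0.165915001595, -0.217112940245]"
  by (simp add: vec_eq_iff forall_3 Q_grad_def trans_prob_def discount_def)

lemma Q_grad_2: "Q_grad 2 = vector [0.322824058575, -0.740576974595, 0.417752916020]"
  by (simp add: vec_eq_iff forall_3 Q_grad_def trans_prob_def discount_def)

lemma Q_grad_3: "Q_grad 3 = vector [-0.339135841295, 0.327253915320, 0.011881925975]"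
  by (simp add: vec_eq_iff forall_3 Q_grad_def trans_prob_def discount_def)

lemmas Q_grad_simps = Q_grad_1 Q_grad_2 Q_grad_3

lemma flow_exp_simps: "flow_exp 1 = 1" "flow_exp 2 = 9" "flow_exp 3 = 40"
  by (simp_all add: flow_exp_def)

lemmas cost_to_go_simps = cost_to_go_011 cost_to_go_001 cost_to_go_101 cost_to_go_100 cost_to_go_110 cost_to_go_111

text \<open>Index 6 repeats \<open>x_bar\<close>, so that the last segment also certifies the
  closing of the approximate cycle.\<close>

definition approx_point :: "nat \<Rightarrow> real^3" where
  "approx_point k =
    (if k = 0 then x_bar
     else if k = 1 then vector [-28.093604265648992056843302475518500077532053646175, -86.202546378743232548833450045618150016889235158891, -93.905594759845995215029438882638795813816778474975]
     else if k = 2 then vector [-25.423915597966787957766213296403962378725466965017, -53.300321263932469433189313875939514996060403539290, 11.520280530464041764978697273555541404071884603690]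
     else if k = 3 then vector [-21.806576125173319100168852896579123570403856081644, -16.172373210007546458709039204573905156510347907429, 80.599465493398799316798259108471698350878921472679]
     else if k = 4 then vector [-14.729179152822204031515482112079257275607068122073, 40.344713194039381327929800630610581935615768580717, 120.105188298278460169955513286062224680036731518265]
     else if k = 5 then vector [-8.569442384834639378399883693614201629037203796516, 0.385601528652859076376960031922782681971015427421, 2.373462605673919550896756192769740832542362140273]
     else x_bar)"

text \<open>The vectors \<open>m1\<close> in the segment lemmas show the meaning: modulo the plane
  normal and up to small errors, each functional pulls back to about 0.89 or -0.89 times its
  predecessor. It is an approximate eigenfunctional of the linearized return map, scaled so that
  every segment contracts by nearly the same factor.\<close>

definition functional1 :: "nat \<Rightarrow> real^3" where
  "functional1 k =
    (if k = 0 then vector [-3.366543, -2.234035, -4.231992]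
     else if k = 1 then vector [-6.663052, -2.059689, 1.497621]
     else if k = 2 then vector [-2.215208, -1.483309, -2.774517]
     else if k = 3 then vector [-2.781161, -2.877443, -0.129343]
     else if k = 4 then vector [4.851085, 1.686849, -0.758355]
     else vector [-5.220186, -5.401690, -0.221164])"

text \<open>The second functional completes the norm on each plane. Its pullback also involves
  \<open>functional1\<close>, but the weights in \<open>m2\<close> sum to less than 0.7 in modulus,
  so the rate is governed by \<open>functional1\<close>.\<close>

definition functional2 :: "nat \<Rightarrow> real^3" where
  "functional2 k =
    (if k = 0 then vector [34.234285, -152.498985, 176.933522]
     else if k = 1 then vector [27.035678, -63.996529, -134.342864]
     else if k = 2 then vector [-2.611282, -215.241764, 159.878281]
     else if k = 3 then vector [-36.910194, -41.359887, 85.643977]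
     else if k = 4 then vector [22.608736, -32.784257, -75.589920]
     else vector [4.966878, 0.850889, 118.330112])"

text \<open>Maximum-norm expansion factors of the segments. Several exceed 1, which is why
  contraction is sought in adapted norms; with 0.1 added to each, their product stays below
  20.\<close>

definition growth_bound :: "nat \<Rightarrow> real" where
  "growth_bound k = (if k = 0 then 1.4 else if k = 1 then 2.03 else if k = 2 then 2.96 else if k = 3 then 1.2 else if k = 4 then 0.5 else 2.34)"

text \<open>Fixed-point multiplication with S = 10^50: an approximation of z^k carries an error of
  at most k - 1 units in the last place, because the errors m - 1 and n - 1 of the factors and one
  unit of rounding add up to m + n - 1. The integer r is the remainder of the rounded
  product.\<close>

lemma power_step:
  fixes z S :: real
  assumes "\<bar>z ^ m - a / S\<bar> \<le> (real m - 1) / S" "\<bar>z ^ n - b / S\<bar> \<le> (real n - 1) / S"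
    and ab: "a * b = c * S + r" "\<bar>r\<bar> \<le> S" "\<bar>a\<bar> \<le> S" and S: "0 < S" and z: "\<bar>z\<bar> \<le> 1" and k: "k = m + n"
  shows "\<bar>z ^ k - c / S\<bar> \<le> (real k - 1) / S"
proof -
  have "\<bar>z ^ n\<bar> \<le> 1" using z by (simp add: power_abs power_le_one)
  then have 1: "\<bar>(z ^ m - a / S) * z ^ n\<bar> \<le> (real m - 1) / S * 1"
    unfolding abs_mult by (intro mult_mono assms) (auto intro: order.trans[OF _ assms(1)])
  have "\<bar>a / S\<bar> \<le> 1" using ab S by (simp add: abs_divide)
  then have 2: "\<bar>a / S * (z ^ n - b / S)\<bar> \<le> 1 * ((real n - 1) / S)"
    unfolding abs_mult by (intro mult_mono assms) auto
  have 3: "\<bar>r / (S * S)\<bar> \<le> 1 / S"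
    using ab S by (simp add: abs_divide abs_mult divide_simps)
  have "a / S * (b / S) - c / S = r / (S * S)"
    using S ab(1) by (simp add: field_simps)
  then have "z ^ k - c / S = ((z ^ m - a / S) * z ^ n + a / S * (z ^ n - b / S)) + r / (S * S)"
    by (simp add: k power_add algebra_simps)
  then have "\<bar>z ^ k - c / S\<bar> \<le> ((real m - 1) / S * 1 + 1 * ((real n - 1) / S)) + 1 / S"
    using abs_add_bound[OF abs_add_bound[OF 1 2] 3] by simp
  then show ?thesis by (simp add: k diff_divide_distrib add_divide_distrib)
qed

text \<open>The multiplications with fifty digits are stated for integers scaled by \<open>10\<^sup>5\<^sup>0\<close>, since the
  simplifier is much slower on fractions.\<close>

lemma segment_certificateI:
  fixes Pa Pa' Xa Xa' Ja ca ra Ua Pl h :: "real^3"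
  assumes J: "cost_to_go \<mu> = J" "\<forall>i. \<bar>J $ i * 10 ^ 50 - Ja $ i\<bar> \<le> 1" and zb: "1 / 10 ^ 20 < zb" "zb < 1 - 1 / 10 ^ 20"
    and P: "\<forall>i. \<bar>zb ^ flow_exp i - Pa $ i / 10 ^ 50\<bar> \<le> 40 / 10 ^ 50"
    and P': "\<forall>i. \<bar>zb ^ (flow_exp i - 1) - Pa' $ i / 10 ^ 50\<bar> \<le> 40 / 10 ^ 50"
    and Xa: "\<forall>i. X $ i * 10 ^ 50 = Xa $ i" "\<forall>i. X' $ i * 10 ^ 50 = Xa' $ i" "\<forall>i. \<bar>Xa $ i - Ja $ i\<bar> \<le> 299 * 10 ^ 50"
    and res: "\<forall>i. (Xa $ i - Ja $ i) * Pa $ i = ca $ i * 10 ^ 50 + ra $ i" "\<forall>i. \<bar>ra $ i\<bar> \<le> 10 ^ 50"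
      "\<forall>i. \<bar>Ja $ i + ca $ i - Xa' $ i\<bar> \<le> 10 ^ 8" "\<bar>Q_diff s X'\<bar> \<le> 1 / 10 ^ 41"
    and U: "\<forall>i. \<bar>Xa $ i - Ja $ i - Ua $ i * 10 ^ 30\<bar> \<le> 10 ^ 30" "\<forall>i. \<bar>Pa' $ i - Pl $ i * 10 ^ 30\<bar> \<le> 10 ^ 30"
      "\<forall>i. \<bar>Pl $ i\<bar> \<le> 10 ^ 20"
    and A: "\<forall>i. \<bar>Pa $ i / 10 ^ 50 - A $ i\<bar> \<le> 1 / 10 ^ 14 \<and> 0 \<le> A $ i \<and> A $ i \<le> 1"
    and B: "\<forall>i. \<bar>Ua $ i * (flow_exp i * Pl $ i) / 10 ^ 40 - B $ i\<bar> \<le> 1 / 10 ^ 14"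
    and g: "Q_grad s \<bullet> B = \<gamma>" "20 \<le> \<bar>\<gamma>\<bar>" "\<forall>i. \<bar>B $ i\<bar> \<le> 10 * \<bar>\<gamma>\<bar>"
    and h: "\<forall>j. \<bar>Q_grad s $ j * A $ j / \<gamma> - h $ j\<bar> \<le> 1 / 10 ^ 14" "\<forall>i. \<bar>B $ i\<bar> \<le> 5000"
    and growth: "\<forall>i. (\<Sum>j\<in>UNIV. \<bar>(if i = j then A $ j else 0) - B $ i * h $ j\<bar>) \<le> G - 1 / 1000000"
    and contr1: "\<forall>j. \<bar>d1 $ j * A $ j - d1 \<bullet> B * h $ j
        - (m1 $ 1 * c1 $ j + m1 $ 2 * c2 $ j + m1 $ 3 * gp $ j)\<bar> \<le> 9 / 10000" "\<bar>m1 $ 1\<bar> + \<bar>m1 $ 2\<bar> \<le> 0.94"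
    and contr2: "\<forall>j. \<bar>d2 $ j * A $ j - d2 \<bullet> B * h $ j
        - (m2 $ 1 * c1 $ j + m2 $ 2 * c2 $ j + m2 $ 3 * gp $ j)\<bar> \<le> 9 / 10000" "\<bar>m2 $ 1\<bar> + \<bar>m2 $ 2\<bar> \<le> 0.94"
    and norms: "\<forall>j. \<bar>d1 $ j\<bar> \<le> 1000 \<and> \<bar>d2 $ j\<bar> \<le> 1000"
    and inj: "\<forall>i j. \<bar>(if i = j then 1 else 0) - (n i $ 1 * c1 $ j + n i $ 2 * c2 $ j + n i $ 3 * gp $ j)\<bar> \<le> 1 / 1000"
      "\<forall>i. \<bar>n i $ 1\<bar> + \<bar>n i $ 2\<bar> \<le> 0.2"
  shows "segment_certificate \<mu> s gp X X' A B c1 c2 d1 d2 m1 m2 n zb G"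
proof -
  define S :: real where "S = 10 ^ 50"
  have S: "0 < S" "S \<noteq> 0" by (simp_all add: S_def)
  note rules = J(2)[rule_format, folded S_def] P[rule_format, folded S_def] P'[rule_format, folded S_def]
    Xa[rule_format, folded S_def] res(1,2)[rule_format, folded S_def]
  have XJ: "\<bar>X $ i - J $ i\<bar> \<le> 300" for i
  proof -
    have "\<bar>(Xa $ i - Ja $ i) - (J $ i * S - Ja $ i)\<bar> \<le> 299 * S + 1"
      using abs_add_bound[OF rules(6)[of i], of "- (J $ i * S - Ja $ i)" 1] rules(1)[of i] by simp
    then have "\<bar>X $ i - J $ i\<bar> * S \<le> 299 * S + 1"
      using S by (simp add: rules(4)[symmetric] abs_mult left_diff_distrib[symmetric])
    also have "\<dots> \<le> 300 * S" by (simp add: S_def)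
    finally show ?thesis using S by simp
  qed
  have zb01: "0 \<le> zb" "zb \<le> 1" using zb by (auto intro: order.trans[rotated])
  have zp: "0 \<le> zb ^ p" "zb ^ p \<le> 1" for p
    using zb01 by (auto simp: power_le_one)
  have P1: "\<bar>zb ^ flow_exp i - A $ i\<bar> \<le> 1 / 10000000000000" for i
    using abs_add_bound[OF P[rule_format, of i] A[rule_format, of i, THEN conjunct1]] by simp
  have B1: "\<bar>(X $ i - J $ i) * (flow_exp i * zb ^ (flow_exp i - 1)) - B $ i\<bar> \<le> 1 / 10000000000000" for i
  proof -
    have p: "real (flow_exp i) \<le> 40" by (simp add: flow_exp_def)
    have "\<bar>Pa' $ i / 10 ^ 50 - Pl $ i / 10 ^ 20\<bar> \<le> 1 / 10 ^ 20"
      using U(2)[rule_format, of i] by (simp add: abs_le_iff divide_simps)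
    from abs_add_bound[OF P'[rule_format, of i] this]
    have "\<bar>zb ^ (flow_exp i - 1) - Pl $ i / 10 ^ 20\<bar> \<le> 2 / 10 ^ 20"
      by simp
    then have 1: "\<bar>(X $ i - J $ i) * (flow_exp i * (zb ^ (flow_exp i - 1) - Pl $ i / 10 ^ 20))\<bar> \<le> 300 * (40 * (2 / 10 ^ 20))"
      unfolding abs_mult using XJ[of i] p by (intro mult_mono) auto
    have "\<bar>(X $ i - J $ i) * 10 ^ 50 - Ua $ i * 10 ^ 30\<bar> \<le> 2 * 10 ^ 30"
    proof -
      have "\<bar>(Xa $ i - Ja $ i - Ua $ i * 10 ^ 30) + (Ja $ i - J $ i * S)\<bar> \<le> 10 ^ 30 + 1"
        using U(1)[rule_format, of i] rules(1)[of i] by (intro abs_add_bound) (simp_all add: abs_minus_commute)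
      then show ?thesis by (simp add: rules(4)[symmetric] S_def algebra_simps)
    qed
    then have "\<bar>X $ i - J $ i - Ua $ i / 10 ^ 20\<bar> \<le> 2 / 10 ^ 20"
      by (simp add: abs_le_iff divide_simps)
    moreover have "\<bar>Pl $ i / 10 ^ 20\<bar> \<le> 1"
      using U(3)[rule_format, of i] by simp
    ultimately have "\<bar>(X $ i - J $ i - Ua $ i / 10 ^ 20) * (flow_exp i * (Pl $ i / 10 ^ 20))\<bar> \<le> 2 / 10 ^ 20 * (40 * 1)"
      unfolding abs_mult using p by (intro mult_mono) auto
    note 2 = this
    define L W where "L = Pl $ i / 10 ^ 20" and "W = Ua $ i / 10 ^ 20"
    have "\<bar>W * (flow_exp i * L) - B $ i\<bar> \<le> 1 / 10 ^ 14"
      using B[rule_format, of i] by (simp add: L_def W_def)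
    from abs_add_bound[OF abs_add_bound[OF 1 2] this, folded L_def W_def]
    have "\<bar>(X $ i - J $ i) * (flow_exp i * zb ^ (flow_exp i - 1)) - B $ i\<bar>
        \<le> 300 * (40 * (2 / 10 ^ 20)) + 2 / 10 ^ 20 * (40 * 1) + 1 / 10 ^ 14"
      by (simp only: algebra_simps)
    then show ?thesis by simp
  qed
  have R1: "\<bar>flow \<mu> X zb $ i - X' $ i\<bar> \<le> 1 / 10 ^ 41" for i
  proof -
    have "\<bar>1 - zb ^ flow_exp i\<bar> \<le> 1" using zp[of "flow_exp i"] by simp
    then have 1: "\<bar>(J $ i * S - Ja $ i) * (1 - zb ^ flow_exp i)\<bar> \<le> 1 * 1"
      unfolding abs_mult using rules(1)[of i] by (intro mult_mono) auto
    have 2: "\<bar>(Xa $ i - Ja $ i) * (zb ^ flow_exp i - Pa $ i / S)\<bar> \<le> 299 * S * (40 / S)"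
      unfolding abs_mult using rules(2,6)[of i] S by (intro mult_mono) auto
    have 3: "\<bar>ra $ i / S\<bar> \<le> 1"
      using rules(8)[of i] S by simp
    have "(Xa $ i - Ja $ i) * (Pa $ i / S) = ca $ i + ra $ i / S"
      using rules(7)[of i] S by (simp add: field_simps)
    then have "(flow \<mu> X zb $ i - X' $ i) * S = (J $ i * S - Ja $ i) * (1 - zb ^ flow_exp i)
        + (Xa $ i - Ja $ i) * (zb ^ flow_exp i - Pa $ i / S) + ra $ i / S + (Ja $ i + ca $ i - Xa' $ i)"
      by (simp add: flow_component J(1) rules(4,5)[symmetric] algebra_simps)
    \<comment> \<open>Of the budget of 10^9 units of 10^-50, the powers take 299 * 40 and the
      mismatch of the rounded endpoints up to 10^8.\<close>
    then have "\<bar>(flow \<mu> X zb $ i - X' $ i) * S\<bar> \<le> 1 * 1 + 299 * S * (40 / S) + 1 + 10 ^ 8"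
      using abs_add_bound[OF abs_add_bound[OF abs_add_bound[OF 1 2] 3] res(3)[rule_format, of i]] by simp
    then have "\<bar>flow \<mu> X zb $ i - X' $ i\<bar> * S \<le> 10 ^ 9"
      using S by (simp add: abs_mult)
    then show ?thesis by (simp add: S_def)
  qed
  have hj: "\<bar>b * h $ j - b * (Q_grad s $ j * A $ j) / \<gamma>\<bar> \<le> b0 * (1 / 10 ^ 14)" if "\<bar>b\<bar> \<le> b0" for b b0 j
  proof -
    have "\<bar>b * (h $ j - Q_grad s $ j * A $ j / \<gamma>)\<bar> \<le> b0 * (1 / 10 ^ 14)"
      unfolding abs_mult using that h(1)[rule_format, of j] by (intro mult_mono) (auto simp: abs_minus_commute)
    then show ?thesis by (simp add: right_diff_distrib)
  qed
  have growth': "(\<Sum>j\<in>UNIV. \<bar>(if i = j then A $ j else 0) - B $ i * (Q_grad s $ j * A $ j) / \<gamma>\<bar>) \<le> G" for i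
  proof -
    have "\<bar>(if i = j then A $ j else 0) - B $ i * (Q_grad s $ j * A $ j) / \<gamma>\<bar>
        \<le> \<bar>(if i = j then A $ j else 0) - B $ i * h $ j\<bar> + 1 / 10 ^ 9" for j
      using abs_add_bound[OF order_refl hj[OF h(2)[rule_format, of i], of j],
          of "(if i = j then A $ j else 0) - B $ i * h $ j"] by simp
    then have "(\<Sum>j\<in>UNIV. \<bar>(if i = j then A $ j else 0) - B $ i * (Q_grad s $ j * A $ j) / \<gamma>\<bar>)
        \<le> (\<Sum>j\<in>UNIV. \<bar>(if i = j then A $ j else 0) - B $ i * h $ j\<bar> + 1 / 10 ^ 9)"
      by (rule sum_mono)
    then show ?thesis
      using growth[rule_format, of i] by (simp add: sum.distrib)
  qed
  have contr: "\<bar>f $ j * A $ j - f \<bullet> B * (Q_grad s $ j * A $ j) / \<gamma> - c\<bar> \<le> 1 / 1000"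
    if "\<bar>f $ j * A $ j - f \<bullet> B * h $ j - c\<bar> \<le> 9 / 10000" "\<And>j. \<bar>f $ j\<bar> \<le> 1000" for f :: "real^3" and c j
  proof -
    \<comment> \<open>Replacing the exact quotient by the rounded covector h costs 3 * 1000 * 5000 *
      10^-14, far below the gap between 9/10000 and 1/1000.\<close>
    have "\<bar>f \<bullet> B\<bar> \<le> 3 * 1000 * 5000"
      using that(2) h(2) by (intro abs_inner_le_bound) auto
    from abs_add_bound[OF that(1) hj[OF this, of j]] show ?thesis
      by (simp add: algebra_simps)
  qed
  show ?thesis
    by (rule segment_certificate.intro,
        use zb in simp, use zb in simp,
        rule P1, use A in blast, use A in blast, unfold J(1), rule B1, rule XJ,
        unfold g(1), rule g(2), rule g(3)[rule_format], rule R1[unfolded J(1)], rule res(4), rule growth',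
        (rule contr, rule contr1(1)[rule_format], use norms in blast), rule contr1(2),
        (rule contr, rule contr2(1)[rule_format], use norms in blast), rule contr2(2),
        use norms in blast, use norms in blast, rule inj(1)[rule_format], rule inj(2)[rule_format])
qed

text \<open>The addition chain 1, 2, 4, 5, 8, 9, 10, 20, 30, 39, 40 reaches the exponents 9 and 40
  of the flow and the exponents 8 and 39 of its derivative. The other five segments use the same
  chain.\<close>

lemma z_bar_powers_0:
  "\<forall>i. \<bar>z_bar ! 0 ^ flow_exp i - (vector [74751889495739629806803796519241077974415863200000, 7287852474257626201694472375233010725532874542466, 880819640713420253113272159465630365306764083] :: real^3) $ i / 10 ^ 50\<bar> \<le> 40 / 10 ^ 50"
  "\<forall>i. \<bar>z_bar ! 0 ^ (flow_exp i - 1) - (vector [100000000000000000000000000000000000000000000000000, 9749388976546186519699950202758689784114248879535, 1178324249266797768648025607216775224560402933] :: real^3) $ i / 10 ^ 50\<bar> \<le> 40 / 10 ^ 50"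
proof -
  define z where "z = z_bar ! 0"
  have z: "z = 0.747518894957396298068037965192410779744158632" by (simp add: z_def z_bar_def)
  have S: "0 < (10 ^ 50 :: real)" and z1: "\<bar>z\<bar> \<le> 1" by (simp_all add: z)
  have p1: "\<bar>z ^ 1 - 74751889495739629806803796519241077974415863200000 / 10 ^ 50\<bar> \<le> (real 1 - 1) / 10 ^ 50" by (simp add: z)
  have p2: "\<bar>z ^ 2 - 55878449831832688061963582453566620253802516825861 / 10 ^ 50\<bar> \<le> (real 2 - 1) / 10 ^ 50"
    by (rule power_step[where r = "14396358221280786828857191607255801114240000000000", OF p1 p1 _ _ _ S z1]) simp_all
  have p4: "\<bar>z ^ 4 - 31224011556086425647523026923698452206683413611226 / 10 ^ 50\<bar> \<le> (real 4 - 1) / 10 ^ 50"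
    by (rule power_step[where r = "-39737138247776515664938982477733218543985401608679", OF p2 p2 _ _ _ S z1]) simp_all
  have p5: "\<bar>z ^ 5 - 23340538614542696943080428419946528404983554479640 / 10 ^ 50\<bar> \<le> (real 5 - 1) / 10 ^ 50"
    by (rule power_step[where r = "44032968432515692995138904810813507412000283200000", OF p4 p1 _ _ _ S z1]) simp_all
  have p8: "\<bar>z ^ 8 - 9749388976546186519699950202758689784114248879535 / 10 ^ 50\<bar> \<le> (real 8 - 1) / 10 ^ 50"
    by (rule power_step[where r = "32480692885834223896636000405506293120962273223076", OF p4 p4 _ _ _ S z1]) simp_all
  have p9: "\<bar>z ^ 9 - 7287852474257626201694472375233010725532874542466 / 10 ^ 50\<bar> \<le> (real 9 - 1) / 10 ^ 50"
    by (rule power_step[where r = "43866967564322643088521404504128566729839612000000", OF p8 p1 _ _ _ S z1]) simp_all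
  have p10: "\<bar>z ^ 10 - 5447807428169587189076315192588787498678100378424 / 10 ^ 50\<bar> \<le> (real 10 - 1) / 10 ^ 50"
    by (rule power_step[where r = "49770728867921518076337499008778803539911174529600", OF p5 p5 _ _ _ S z1]) simp_all
  have p20: "\<bar>z ^ 20 - 296786057744197318807159405448077000486082670633 / 10 ^ 50\<bar> \<le> (real 20 - 1) / 10 ^ 50"
    by (rule power_step[where r = "-26059488618166507978985510313939590477227995276224", OF p10 p10 _ _ _ S z1]) simp_all
  have p30: "\<bar>z ^ 30 - 16168332899560061905852064980923559740612852301 / 10 ^ 50\<bar> \<le> (real 30 - 1) / 10 ^ 50"
    by (rule power_step[where r = "-8019853524655395883392582688134362864414148377608", OF p20 p10 _ _ _ S z1]) simp_all
  have p39: "\<bar>z ^ 39 - 1178324249266797768648025607216775224560402933 / 10 ^ 50\<bar> \<le> (real 39 - 1) / 10 ^ 50"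
    by (rule power_step[where r = "-46615094024681805086668359551126980466665389685734", OF p30 p9 _ _ _ S z1]) simp_all
  have p40: "\<bar>z ^ 40 - 880819640713420253113272159465630365306764083 / 10 ^ 50\<bar> \<le> (real 40 - 1) / 10 ^ 50"
    by (rule power_step[where r = "-36648113798165516266567681554722294500993234400000", OF p39 p1 _ _ _ S z1]) simp_all
  have le: "(real n - 1) / 10 ^ 50 \<le> 40 / 10 ^ 50" if "n \<le> 40" for n
    using that by (intro divide_right_mono) auto
  note p = p1 p8 p9 p39 p40
  show "\<forall>i. \<bar>z_bar ! 0 ^ flow_exp i - (vector [74751889495739629806803796519241077974415863200000, 7287852474257626201694472375233010725532874542466, 880819640713420253113272159465630365306764083] :: real^3) $ i / 10 ^ 50\<bar> \<le> 40 / 10 ^ 50"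
    unfolding z_def[symmetric] forall_3 flow_exp_simps vector_3
    by (intro conjI; rule order_trans[OF _ le]; (rule p)?) simp_all
  show "\<forall>i. \<bar>z_bar ! 0 ^ (flow_exp i - 1) - (vector [100000000000000000000000000000000000000000000000000, 9749388976546186519699950202758689784114248879535, 1178324249266797768648025607216775224560402933] :: real^3) $ i / 10 ^ 50\<bar> \<le> 40 / 10 ^ 50"
    unfolding z_def[symmetric] forall_3 flow_exp_simps vector_3
    using order_trans[OF p8 le] order_trans[OF p39 le] by simp
qed

text \<open>All explicit vectors and integers are data that are merely checked against the
  inequalities of the certificate. The plane normal at the start is that of the preceding switch,
  for this segment the switch ending segment 5.\<close>

lemma segment_0:
  "segment_certificate (cycle_policies ! 0) (switch_states ! 0) (Q_grad (switch_states ! 5))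
    (approx_point 0) (approx_point 1)
    (vector [0.747518894957396298, 0.072878524742576262, 0.000008808196407134])
    (vector [77.2332993839451501, 81.5668194784231695, 0.0444938185365628])
    (functional1 0) (functional2 0) (functional1 1) (functional2 1)
    (vector [0.88862026, -0.00000115, -17.32176736]) (vector [0.10523905, -0.00003018, -2.06897657])
    (\<lambda>i. if i = 1 then vector [-0.10385669, -0.00036098, 1.73021272] else if i = 2 then vector [-0.12503483, -0.00391032, -0.74947069]
       else vector [-0.08767262, 0.00235138, -0.98074188])
    (z_bar ! 0) (growth_bound 0)"
proof -
  note vectors = forall_3 sum_3 inner_vec_def flow_exp_simps Q_grad_simps cycle_policies_def switch_states_def
    approx_point_def x_bar_def functional1_def functional2_def growth_bound_def z_bar_def
  show ?thesis
    by (rule segment_certificateI[where J = "vector [-1327299527342387038049868968812593/15464833038463578125037500000000, -1437878345554071871412428968812593/15464833038463578125037500000000, -1452247203335736546251753968812593/15464833038463578125037500000000]"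
        and Ja = "vector [-8582695487504942691455751333623958515921403197570071, -9297729513004326760743818326368192817821076687309609, -9390642625909761737432792064091849516950451985264201]"
        and Xa = "vector [-859365549110427684060547352373810356279806687000000, -1782901529947570479958611237140123183129413360000, 49419938415962381038498664432023704303346133600000]"
        and Xa' = "vector [-2809360426564899205684330247551850007753205364617500, -8620254637874323254883345004561815001688923515889100, -9390559475984599521502943888263879581381677847497500]"
        and ca = "vector [5773335060940043485771421086072108508168197832952543, 677474875130003505860473321806377816132153171420456, 83149925162215929848175827969935568774137766743]"
        and ra = "vector [4928441448023756647042419216479710657550287200000, -45500081799093523569898749720428316145143385404206, -44866015850119388675100636870812212736133378707317]"
        and Ua = "vector [7723329938394515007395, 9295946611474379190264, 9440062564325724118471]"
        and Pl = "vector [100000000000000000000, 9749388976546186520, 1178324249266798]"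
        and \<gamma> = "-35.4551538099654123603034556890"
        and h = "vector [-0.0068062624921914, 0.0015222654978762, -0.0000001037832117]", OF _ _ _ _ z_bar_powers_0])
       (simp_all add: vectors Q_diff_affine cost_def cost_to_go_011)
qed

lemma z_bar_powers_1:
  "\<forall>i. \<bar>z_bar ! 1 ^ flow_exp i - (vector [98392537687888308599954063213500499624638477000000, 86428993651774573722404325814006501417741642308909, 52298167570043437262560706500020411024056246864038] :: real^3) $ i / 10 ^ 50\<bar> \<le> 40 / 10 ^ 50"
  "\<forall>i. \<bar>z_bar ! 1 ^ (flow_exp i - 1) - (vector [100000000000000000000000000000000000000000000000000, 87841004696856807601159655002309502239357671674164, 53152575184043772396805948870877848711660598381121] :: real^3) $ i / 10 ^ 50\<bar> \<le> 40 / 10 ^ 50"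
proof -
  define z where "z = z_bar ! 1"
  have z: "z = 0.983925376878883085999540632135004996246384770" by (simp add: z_def z_bar_def)
  have S: "0 < (10 ^ 50 :: real)" and z1: "\<bar>z\<bar> \<le> 1" by (simp_all add: z)
  have p1: "\<bar>z ^ 1 - 98392537687888308599954063213500499624638477000000 / 10 ^ 50\<bar> \<le> (real 1 - 1) / 10 ^ 50" by (simp add: z)
  have p2: "\<bar>z ^ 2 - 96810914726625211847671218345750088209361357739756 / 10 ^ 50\<bar> \<le> (real 2 - 1) / 10 ^ 50"
    by (rule power_step[where r = "45560699953704534356458373272948879529000000000000", OF p1 p1 _ _ _ S z1]) simp_all
  have p4: "\<bar>z ^ 4 - 93723532102058983168175573317643456070197448066934 / 10 ^ 50\<bar> \<le> (real 4 - 1) / 10 ^ 50"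
    by (rule power_step[where r = "43391378058908598550854088414311690089565022939536", OF p2 p2 _ _ _ S z1]) simp_all
  have p5: "\<bar>z ^ 5 - 92216961645938482512559434712604596283694642440352 / 10 ^ 50\<bar> \<le> (real 5 - 1) / 10 ^ 50"
    by (rule power_step[where r = "32536181860548466929072363533449882247819518000000", OF p4 p1 _ _ _ S z1]) simp_all
  have p8: "\<bar>z ^ 8 - 87841004696856807601159655002309502239357671674164 / 10 ^ 50\<bar> \<le> (real 8 - 1) / 10 ^ 50"
    by (rule power_step[where r = "-20330901866775947808375985448117082104026655839644", OF p4 p4 _ _ _ S z1]) simp_all
  have p9: "\<bar>z ^ 9 - 86428993651774573722404325814006501417741642308909 / 10 ^ 50\<bar> \<le> (real 9 - 1) / 10 ^ 50"
    by (rule power_step[where r = "15649569750120679223231664644900651841208228000000", OF p8 p1 _ _ _ S z1]) simp_all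
  have p10: "\<bar>z ^ 10 - 85039680152084891177562739927766591766214400479917 / 10 ^ 50\<bar> \<le> (real 10 - 1) / 10 ^ 50"
    by (rule power_step[where r = "-38618805137787906172030838367735056829818122116096", OF p5 p5 _ _ _ S z1]) simp_all
  have p20: "\<bar>z ^ 20 - 72317472003689009802793312912520890836590014314761 / 10 ^ 50\<bar> \<le> (real 20 - 1) / 10 ^ 50"
    by (rule power_step[where r = "-18393484348713494519770866774391307367360079673111", OF p10 p10 _ _ _ S z1]) simp_all
  have p30: "\<bar>z ^ 30 - 61498546886010670730638895636009702506811903226926 / 10 ^ 50\<bar> \<le> (real 30 - 1) / 10 ^ 50"
    by (rule power_step[where r = "-46530424606059617967851312381818449219341702845163", OF p20 p10 _ _ _ S z1]) simp_all
  have p39: "\<bar>z ^ 39 - 53152575184043772396805948870877848711660598381121 / 10 ^ 50\<bar> \<le> (real 39 - 1) / 10 ^ 50"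
    by (rule power_step[where r = "-22712829193598384057068998115923236075933581516266", OF p30 p9 _ _ _ S z1]) simp_all
  have p40: "\<bar>z ^ 40 - 52298167570043437262560706500020411024056246864038 / 10 ^ 50\<bar> \<le> (real 40 - 1) / 10 ^ 50"
    by (rule power_step[where r = "-2522729629855736179610080986006928913007283000000", OF p39 p1 _ _ _ S z1]) simp_all
  have le: "(real n - 1) / 10 ^ 50 \<le> 40 / 10 ^ 50" if "n \<le> 40" for n
    using that by (intro divide_right_mono) auto
  note p = p1 p8 p9 p39 p40
  show "\<forall>i. \<bar>z_bar ! 1 ^ flow_exp i - (vector [98392537687888308599954063213500499624638477000000, 86428993651774573722404325814006501417741642308909, 52298167570043437262560706500020411024056246864038] :: real^3) $ i / 10 ^ 50\<bar> \<le> 40 / 10 ^ 50"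
    unfolding z_def[symmetric] forall_3 flow_exp_simps vector_3
    by (intro conjI; rule order_trans[OF _ le]; (rule p)?) simp_all
  show "\<forall>i. \<bar>z_bar ! 1 ^ (flow_exp i - 1) - (vector [100000000000000000000000000000000000000000000000000, 87841004696856807601159655002309502239357671674164, 53152575184043772396805948870877848711660598381121] :: real^3) $ i / 10 ^ 50\<bar> \<le> 40 / 10 ^ 50"
    unfolding z_def[symmetric] forall_3 flow_exp_simps vector_3
    using order_trans[OF p8 le] order_trans[OF p39 le] by simp
qed

lemma segment_1:
  "segment_certificate (cycle_policies ! 1) (switch_states ! 1) (Q_grad (switch_states ! 0))
    (approx_point 1) (approx_point 2)
    (vector [0.983925376878883086, 0.864289936517745737, 0.522981675700434373])
    (vector [-166.0809493054357819, -1916.6950431075074241, -4698.9027274287705994])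
    (functional1 1) (functional2 1) (functional1 2) (functional2 2)
    (vector [0.89220701, -0.00002850, -3.21620641]) (vector [-0.01795199, 0.42783301, 265.66498940])
    (\<lambda>i. if i = 1 then vector [-0.13222992, -0.00026049, 0.39026731] else if i = 2 then vector [-0.05726341, -0.00342237, -0.89529555]
       else vector [0.00066795, -0.00586576, 0.50502831])
    (z_bar ! 1) (growth_bound 1)"
proof -
  note vectors = forall_3 sum_3 inner_vec_def flow_exp_simps Q_grad_simps cycle_policies_def switch_states_def
    approx_point_def x_bar_def functional1_def functional2_def growth_bound_def z_bar_def
  show ?thesis
    by (rule segment_certificateI[where J = "vector [864894971601091368474289432212653/6267929652184485240872500000000, 979316651351807743558449432212653/6267929652184485240872500000000, 796682198957824065666074432212653/6267929652184485240872500000000]"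
        and Ja = "vector [13798734503978678985455652305880276663351273220641867, 15624244458622767557099107434092384540321371019060205, 12710452145552816064205684789646331980912648403542617]"
        and Xa = "vector [-2809360426564899205684330247551850007753205364617500, -8620254637874323254883345004561815001688923515889100, -9390559475984599521502943888263879581381677847497500]"
        and Xa' = "vector [-2542391559796678795776621329640396237872546696501700, -5330032126393246943318931387593951499606040353929000, 1152028053046404176497869727355554140407188460369000]"
        and ca = "vector [-16341126063775357781232273635520672901223819917143563, -20954276585016014500418038821686336039927411372988581, -11558424092506411887707815062290777840505459943172401]"
        and ra = "vector [4106677865601685073744408689700341347135941000000, 33709757289710394064635110478311987868044535141755, -41472170349947891389714550494389030875716982612446]"
        and Ua = "vector [-16608094930543578191140, -24244499096497090811982, -22101011621537415585709]"
        and Pl = "vector [100000000000000000000, 87841004696856807601, 53152575184043772397]"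
        and \<gamma> = "1274.5874040203264366019227495965"
        and h = "vector [0.0002956807127085, -0.0001125059495673, -0.0000890845845074]", OF _ _ _ _ z_bar_powers_1])
       (simp_all add: vectors Q_diff_affine cost_def cost_to_go_001)
qed

lemma z_bar_powers_2:
  "\<forall>i. \<bar>z_bar ! 2 ^ flow_exp i - (vector [97886049144597797441700548897887017524839198900000, 82506316730970545717711207346236697536164187994558, 42543380742015044943448939614760246202567791773065] :: real^3) $ i / 10 ^ 50\<bar> \<le> 40 / 10 ^ 50"
  "\<forall>i. \<bar>z_bar ! 2 ^ (flow_exp i - 1) - (vector [100000000000000000000000000000000000000000000000000, 84288126297846357641982872592862236582445028135124, 43462149217167539834608483952367109991886160417789] :: real^3) $ i / 10 ^ 50\<bar> \<le> 40 / 10 ^ 50"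
proof -
  define z where "z = z_bar ! 2"
  have z: "z = 0.978860491445977974417005488978870175248391989" by (simp add: z_def z_bar_def)
  have S: "0 < (10 ^ 50 :: real)" and z1: "\<bar>z\<bar> \<le> 1" by (simp_all add: z)
  have p1: "\<bar>z ^ 1 - 97886049144597797441700548897887017524839198900000 / 10 ^ 50\<bar> \<le> (real 1 - 1) / 10 ^ 50" by (simp add: z)
  have p2: "\<bar>z ^ 2 - 95816786171386151922492721704819909915503933559713 / 10 ^ 50\<bar> \<le> (real 2 - 1) / 10 ^ 50"
    by (rule power_step[where r = "-45747815101628327110914562452698006238790000000000", OF p1 p1 _ _ _ S z1]) simp_all
  have p4: "\<bar>z ^ 4 - 91808565122131365136151604750963246018255435836347 / 10 ^ 50\<bar> \<le> (real 4 - 1) / 10 ^ 50"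
    by (rule power_step[where r = "803781192394030802817691377815541395015736642369", OF p2 p2 _ _ _ S z1]) simp_all
  have p5: "\<bar>z ^ 5 - 89867777174399580950973526053443778313177898136765 / 10 ^ 50\<bar> \<le> (real 5 - 1) / 10 ^ 50"
    by (rule power_step[where r = "15110562487250865793088853305726817710982418300000", OF p4 p1 _ _ _ S z1]) simp_all
  have p8: "\<bar>z ^ 8 - 84288126297846357641982872592862236582445028135124 / 10 ^ 50\<bar> \<le> (real 8 - 1) / 10 ^ 50"
    by (rule power_step[where r = "5963645930059260289807124996742298982291366304409", OF p4 p4 _ _ _ S z1]) simp_all
  have p9: "\<bar>z ^ 9 - 82506316730970545717711207346236697536164187994558 / 10 ^ 50\<bar> \<le> (real 9 - 1) / 10 ^ 50"
    by (rule power_step[where r = "-22208413122214893888167327716345165558887836400000", OF p8 p1 _ _ _ S z1]) simp_all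
  have p10: "\<bar>z ^ 10 - 80762173742675343300062873804243190770021672595496 / 10 ^ 50\<bar> \<le> (real 10 - 1) / 10 ^ 50"
    by (rule power_step[where r = "5456825670670564588789916160477701954458644665225", OF p5 p5 _ _ _ S z1]) simp_all
  have p20: "\<bar>z ^ 20 - 65225287076420786684348029959771579523827684285553 / 10 ^ 50\<bar> \<le> (real 20 - 1) / 10 ^ 50"
    by (rule power_step[where r = "48043290064712741266507623941611245235533239486016", OF p10 p10 _ _ _ S z1]) simp_all
  have p30: "\<bar>z ^ 30 - 52677359672817722663233740358058460343911890020254 / 10 ^ 50\<bar> \<le> (real 30 - 1) / 10 ^ 50"
    by (rule power_step[where r = "-44361834963042167237754162090552359062814074330712", OF p20 p10 _ _ _ S z1]) simp_all
  have p39: "\<bar>z ^ 39 - 43462149217167539834608483952367109991886160417789 / 10 ^ 50\<bar> \<le> (real 39 - 1) / 10 ^ 50"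
    by (rule power_step[where r = "17707271965555447215278013173176101220958261777732", OF p30 p9 _ _ _ S z1]) simp_all
  have p40: "\<bar>z ^ 40 - 42543380742015044943448939614760246202567791773065 / 10 ^ 50\<bar> \<le> (real 40 - 1) / 10 ^ 50"
    by (rule power_step[where r = "-1669782688686784271203666243120917731930767900000", OF p39 p1 _ _ _ S z1]) simp_all
  have le: "(real n - 1) / 10 ^ 50 \<le> 40 / 10 ^ 50" if "n \<le> 40" for n
    using that by (intro divide_right_mono) auto
  note p = p1 p8 p9 p39 p40
  show "\<forall>i. \<bar>z_bar ! 2 ^ flow_exp i - (vector [97886049144597797441700548897887017524839198900000, 82506316730970545717711207346236697536164187994558, 42543380742015044943448939614760246202567791773065] :: real^3) $ i / 10 ^ 50\<bar> \<le> 40 / 10 ^ 50"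
    unfolding z_def[symmetric] forall_3 flow_exp_simps vector_3
    by (intro conjI; rule order_trans[OF _ le]; (rule p)?) simp_all
  show "\<forall>i. \<bar>z_bar ! 2 ^ (flow_exp i - 1) - (vector [100000000000000000000000000000000000000000000000000, 84288126297846357641982872592862236582445028135124, 43462149217167539834608483952367109991886160417789] :: real^3) $ i / 10 ^ 50\<bar> \<le> 40 / 10 ^ 50"
    unfolding z_def[symmetric] forall_3 flow_exp_simps vector_3
    using order_trans[OF p8 le] order_trans[OF p39 le] by simp
qed

lemma segment_2:
  "segment_certificate (cycle_policies ! 2) (switch_states ! 2) (Q_grad (switch_states ! 1))
    (approx_point 2) (approx_point 3)
    (vector [0.978860491445977974, 0.825063167309705457, 0.425433807420150449])
    (vector [-171.1174819201381088, -1610.0100899051268561, -2090.1541952398404502])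
    (functional1 2) (functional2 2) (functional1 3) (functional2 3)
    (vector [0.89161688, 0.00000050, -11.39396192]) (vector [0.16907801, 0.35349423, 95.33064767])
    (\<lambda>i. if i = 1 then vector [-0.15191860, -0.00028678, 1.73021280] else if i = 2 then vector [-0.12581618, -0.00320118, -0.74947064]
       else vector [-0.17186574, 0.00194038, -0.98074177])
    (z_bar ! 2) (growth_bound 2)"
proof -
  note vectors = forall_3 sum_3 inner_vec_def flow_exp_simps Q_grad_simps cycle_policies_def switch_states_def
    approx_point_def x_bar_def functional1_def functional2_def growth_bound_def z_bar_def
  show ?thesis
    by (rule segment_certificateI[where J = "vector [2295154717140532013023716939899/15753301776313649791000000000, 2503766611744815878528716939899/15753301776313649791000000000, 2075477022839547068423716939899/15753301776313649791000000000]"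
        and Ja = "vector [14569356632217132081661985083390896849784903633763945, 15893598988304974870174290957962385034644556164060258, 13174869956215736981775473665924848837591179738749831]"
        and Xa = "vector [-2542391559796678795776621329640396237872546696501700, -5330032126393246943318931387593951499606040353929000, 1152028053046404176497869727355554140407188460369000]"
        and Xa' = "vector [-2180657612517331910016885289657912357040385608164400, -1617237321000754645870903920457390515651034790742900, 8059946549339879931679825910847169835087892147267900]"
        and ca = "vector [-16750014244734463991678870373048809206825289241928356, -17510836309305729516045194878419775550295590954803518, -5114923406875857050095647755077679002503287591482255]"
        and ra = "vector [-7331569490822395361698588515584126545991790500000, 11060257439859330048980604541435227837958393542036, -19256657555403351246454209986147839210035798117015]"
        and Ua = "vector [-17111748192013810877439, -21223631114698221813493, -12022841903169332805278]"
        and Pl = "vector [100000000000000000000, 84288126297846357642, 43462149217167539835]"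
        and \<gamma> = "-493.6850918590654630696160565010"
        and h = "vector [0.0006724259690056, -0.0005469177747938, -0.0000102392660633]", OF _ _ _ _ z_bar_powers_2])
       (simp_all add: vectors Q_diff_affine cost_def cost_to_go_101)
qed

lemma z_bar_powers_3:
  "\<forall>i. \<bar>z_bar ! 3 ^ flow_exp i - (vector [95724678294356402143515488654570779490148669500000, 67486241114926958922477385096307219960393331254210, 17416328951970714746413709484016866296633098472835] :: real^3) $ i / 10 ^ 50\<bar> \<le> 40 / 10 ^ 50"
  "\<forall>i. \<bar>z_bar ! 3 ^ (flow_exp i - 1) - (vector [100000000000000000000000000000000000000000000000000, 70500358233019745367511973309114802432363270487127, 18194189066287540201180756991732661146559198240042] :: real^3) $ i / 10 ^ 50\<bar> \<le> 40 / 10 ^ 50"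
proof -
  define z where "z = z_bar ! 3"
  have z: "z = 0.957246782943564021435154886545707794901486695" by (simp add: z_def z_bar_def)
  have S: "0 < (10 ^ 50 :: real)" and z1: "\<bar>z\<bar> \<le> 1" by (simp_all add: z)
  have p1: "\<bar>z ^ 1 - 95724678294356402143515488654570779490148669500000 / 10 ^ 50\<bar> \<le> (real 1 - 1) / 10 ^ 50" by (simp add: z)
  have p2: "\<bar>z ^ 2 - 91632140345580277114987513618178919536662176139032 / 10 ^ 50\<bar> \<le> (real 2 - 1) / 10 ^ 50"
    by (rule power_step[where r = "-10275184661645972733918897200787379769750000000000", OF p1 p1 _ _ _ S z1]) simp_all
  have p4: "\<bar>z ^ 4 - 83964491443121207871043918230973172287095420995246 / 10 ^ 50\<bar> \<le> (real 4 - 1) / 10 ^ 50"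
    by (rule power_step[where r = "14823299906614033512930467082231097407326593897024", OF p2 p2 _ _ _ S z1]) simp_all
  have p5: "\<bar>z ^ 5 - 80374739315420185474338960144248713024522766710102 / 10 ^ 50\<bar> \<le> (real 5 - 1) / 10 ^ 50"
    by (rule power_step[where r = "37636199962520633730824953222136996192725197000000", OF p4 p1 _ _ _ S z1]) simp_all
  have p8: "\<bar>z ^ 8 - 70500358233019745367511973309114802432363270487127 / 10 ^ 50\<bar> \<le> (real 8 - 1) / 10 ^ 50"
    by (rule power_step[where r = "12507774936567325334617974511837061537737154600516", OF p4 p4 _ _ _ S z1]) simp_all
  have p9: "\<bar>z ^ 9 - 67486241114926958922477385096307219960393331254210 / 10 ^ 50\<bar> \<le> (real 9 - 1) / 10 ^ 50"
    by (rule power_step[where r = "-25583357040934344717468299349368133084072473500000", OF p8 p1 _ _ _ S z1]) simp_all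
  have p10: "\<bar>z ^ 10 - 64600987200217512651530636429171756686743965549056 / 10 ^ 50\<bar> \<le> (real 10 - 1) / 10 ^ 50"
    by (rule power_step[where r = "4107169286942155932422704281284570086868508850404", OF p5 p5 _ _ _ S z1]) simp_all
  have p20: "\<bar>z ^ 20 - 41732875472426669040347847204911326087178568763061 / 10 ^ 50\<bar> \<le> (real 20 - 1) / 10 ^ 50"
    by (rule power_step[where r = "721926906561606853465033009542715014195542491136", OF p10 p10 _ _ _ S z1]) simp_all
  have p30: "\<bar>z ^ 30 - 26959849542225066280141529470378561159439095567595 / 10 ^ 50\<bar> \<le> (real 30 - 1) / 10 ^ 50"
    by (rule power_step[where r = "41467502243682454101223862376336607572927636220416", OF p20 p10 _ _ _ S z1]) simp_all
  have p39: "\<bar>z ^ 39 - 18194189066287540201180756991732661146559198240042 / 10 ^ 50\<bar> \<le> (real 39 - 1) / 10 ^ 50"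
    by (rule power_step[where r = "11796980560513023431622631170084435910193183324950", OF p30 p9 _ _ _ S z1]) simp_all
  have p40: "\<bar>z ^ 40 - 17416328951970714746413709484016866296633098472835 / 10 ^ 50\<bar> \<le> (real 40 - 1) / 10 ^ 50"
    by (rule power_step[where r = "-37781668766759860757307223943546938672075881000000", OF p39 p1 _ _ _ S z1]) simp_all
  have le: "(real n - 1) / 10 ^ 50 \<le> 40 / 10 ^ 50" if "n \<le> 40" for n
    using that by (intro divide_right_mono) auto
  note p = p1 p8 p9 p39 p40
  show "\<forall>i. \<bar>z_bar ! 3 ^ flow_exp i - (vector [95724678294356402143515488654570779490148669500000, 67486241114926958922477385096307219960393331254210, 17416328951970714746413709484016866296633098472835] :: real^3) $ i / 10 ^ 50\<bar> \<le> 40 / 10 ^ 50"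
    unfolding z_def[symmetric] forall_3 flow_exp_simps vector_3
    by (intro conjI; rule order_trans[OF _ le]; (rule p)?) simp_all
  show "\<forall>i. \<bar>z_bar ! 3 ^ (flow_exp i - 1) - (vector [100000000000000000000000000000000000000000000000000, 70500358233019745367511973309114802432363270487127, 18194189066287540201180756991732661146559198240042] :: real^3) $ i / 10 ^ 50\<bar> \<le> 40 / 10 ^ 50"
    unfolding z_def[symmetric] forall_3 flow_exp_simps vector_3
    using order_trans[OF p8 le] order_trans[OF p39 le] by simp
qed

lemma segment_3:
  "segment_certificate (cycle_policies ! 3) (switch_states ! 3) (Q_grad (switch_states ! 2))
    (approx_point 3) (approx_point 4)
    (vector [0.957246782943564021, 0.674862411149269589, 0.174163289519707147])
    (vector [-165.5406881547338143, -1102.9261078887398643, -348.1436854480835811])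
    (functional1 3) (functional2 3) (functional1 4) (functional2 4)
    (vector [-0.89469370, 0.00180542, -10.09042553]) (vector [0.11307701, -0.24096465, 48.09060924])
    (\<lambda>i. if i = 1 then vector [-0.17283567, -0.00004932, -1.52592447] else if i = 2 then vector [-0.17336666, -0.00046611, 1.47246241]
       else vector [-0.15821105, 0.01142989, 0.05346215])
    (z_bar ! 3) (growth_bound 3)"
proof -
  note vectors = forall_3 sum_3 inner_vec_def flow_exp_simps Q_grad_simps cycle_policies_def switch_states_def
    approx_point_def x_bar_def functional1_def functional2_def growth_bound_def z_bar_def
  show ?thesis
    by (rule segment_certificateI[where J = "vector [163645112203563106566770354402467/1138526616214164220003000000000, 538475608107598043880506063207401/3415579848642492660009000000000, 438685715099467628739311063207401/3415579848642492660009000000000]"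
        and Ja = "vector [14373411202956049520772530773000575158281602412144436, 15765276526081298608549228655814541406235790558313745, 12843667387071081246800049838835967906698021725592940]"
        and Xa = "vector [-2180657612517331910016885289657912357040385608164400, -1617237321000754645870903920457390515651034790742900, 8059946549339879931679825910847169835087892147267900]"
        and Xa' = "vector [-1472917915282220403151548211207925727560706812207300, 4034471319403938132792980063061058193561576858071700, 12010518829827846016995551328606222468003673151826500]"
        and ca = "vector [-15846329118238269923924078984208500885842309224351740, -11730805206677360475756248592753483212674213700242062, -833148557243235229804498510229745438694348573766378]"
        and ra = "vector [-42960280083292922932051623893352558944493702000000, 40603278199166804358940117430721146128781815274550, -29164058239182254768596869311314405885341240288400]"
        and Ua = "vector [-16554068815473381430789, -17382513847082053254420, -4783720837731201315120]"
        and Pl = "vector [100000000000000000000, 70500358233019745368, 18194189066287540201]"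
        and \<gamma> = "617.9231235827853777139393156140"
        and h = "vector [0.0005000982804074, -0.0008088183523850, 0.0001177447797044]", OF _ _ _ _ z_bar_powers_3])
       (simp_all add: vectors Q_diff_affine cost_def cost_to_go_100)
qed

lemma z_bar_powers_4:
  "\<forall>i. \<bar>z_bar ! 4 ^ flow_exp i - (vector [74800543712818509760527013735869718942942261900000, 7330655190356338772779879209670076987152077615043, 904045289468788006492409196566147343844151531] :: real^3) $ i / 10 ^ 50\<bar> \<le> 40 / 10 ^ 50"
  "\<forall>i. \<bar>z_bar ! 4 ^ (flow_exp i - 1) - (vector [100000000000000000000000000000000000000000000000000, 9800269926514037110791326729605349875012864782321, 1208607911915301336689407729640076562126948589] :: real^3) $ i / 10 ^ 50\<bar> \<le> 40 / 10 ^ 50"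
proof -
  define z where "z = z_bar ! 4"
  have z: "z = 0.748005437128185097605270137358697189429422619" by (simp add: z_def z_bar_def)
  have S: "0 < (10 ^ 50 :: real)" and z1: "\<bar>z\<bar> \<le> 1" by (simp_all add: z)
  have p1: "\<bar>z ^ 1 - 74800543712818509760527013735869718942942261900000 / 10 ^ 50\<bar> \<le> (real 1 - 1) / 10 ^ 50" by (simp add: z)
  have p2: "\<bar>z ^ 2 - 55951213397332726891866690444415726576306187878505 / 10 ^ 50\<bar> \<le> (real 2 - 1) / 10 ^ 50"
    by (rule power_step[where r = "9952446049205706246998410397677088191610000000000", OF p1 p1 _ _ _ S z1]) simp_all
  have p4: "\<bar>z ^ 4 - 31305382806338652262686181886478614376232343023605 / 10 ^ 50\<bar> \<le> (real 4 - 1) / 10 ^ 50"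
    by (rule power_step[where r = "38322614899357046895097665220926314703392641035025", OF p2 p2 _ _ _ S z1]) simp_all
  have p5: "\<bar>z ^ 5 - 23416596550520513506342481982257811393403331049754 / 10 ^ 50\<bar> \<le> (real 5 - 1) / 10 ^ 50"
    by (rule power_step[where r = "-13701612902769341507028973138175995216207850500000", OF p4 p1 _ _ _ S z1]) simp_all
  have p8: "\<bar>z ^ 8 - 9800269926514037110791326729605349875012864782321 / 10 ^ 50\<bar> \<le> (real 8 - 1) / 10 ^ 50"
    by (rule power_step[where r = "20992303196222430428717636635303971577913587196025", OF p4 p4 _ _ _ S z1]) simp_all
  have p9: "\<bar>z ^ 9 - 7330655190356338772779879209670076987152077615043 / 10 ^ 50\<bar> \<le> (real 9 - 1) / 10 ^ 50"
    by (rule power_step[where r = "-49067770212242006464303602801335081385128130100000", OF p8 p1 _ _ _ S z1]) simp_all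
  have p10: "\<bar>z ^ 10 - 5483369940098492120539664677186358000014092495531 / 10 ^ 50\<bar> \<le> (real 10 - 1) / 10 ^ 50"
    by (rule power_step[where r = "-39744430971394243739651806426861969660336376539484", OF p5 p5 _ _ _ S z1]) simp_all
  have p20: "\<bar>z ^ 20 - 300673458999757410661978084349353583072932267656 / 10 ^ 50\<bar> \<le> (real 20 - 1) / 10 ^ 50"
    by (rule power_step[where r = "-48108535395450820293025384461469205569708745028039", OF p10 p10 _ _ _ S z1]) simp_all
  have p30: "\<bar>z ^ 30 - 16487038068647062194830081607114484513542830691 / 10 ^ 50\<bar> \<le> (real 30 - 1) / 10 ^ 50"
    by (rule power_step[where r = "32255835748708423327071505060030983229007875845336", OF p20 p10 _ _ _ S z1]) simp_all
  have p39: "\<bar>z ^ 39 - 1208607911915301336689407729640076562126948589 / 10 ^ 50\<bar> \<le> (real 39 - 1) / 10 ^ 50"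
    by (rule power_step[where r = "30917541095257023401253975449756359742918423684713", OF p30 p9 _ _ _ S z1]) simp_all
  have p40: "\<bar>z ^ 40 - 904045289468788006492409196566147343844151531 / 10 ^ 50\<bar> \<le> (real 40 - 1) / 10 ^ 50"
    by (rule power_step[where r = "40047905051617901825659261769088679456673459100000", OF p39 p1 _ _ _ S z1]) simp_all
  have le: "(real n - 1) / 10 ^ 50 \<le> 40 / 10 ^ 50" if "n \<le> 40" for n
    using that by (intro divide_right_mono) auto
  note p = p1 p8 p9 p39 p40
  show "\<forall>i. \<bar>z_bar ! 4 ^ flow_exp i - (vector [74800543712818509760527013735869718942942261900000, 7330655190356338772779879209670076987152077615043, 904045289468788006492409196566147343844151531] :: real^3) $ i / 10 ^ 50\<bar> \<le> 40 / 10 ^ 50"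
    unfolding z_def[symmetric] forall_3 flow_exp_simps vector_3
    by (intro conjI; rule order_trans[OF _ le]; (rule p)?) simp_all
  show "\<forall>i. \<bar>z_bar ! 4 ^ (flow_exp i - 1) - (vector [100000000000000000000000000000000000000000000000000, 9800269926514037110791326729605349875012864782321, 1208607911915301336689407729640076562126948589] :: real^3) $ i / 10 ^ 50\<bar> \<le> 40 / 10 ^ 50"
    unfolding z_def[symmetric] forall_3 flow_exp_simps vector_3
    using order_trans[OF p8 le] order_trans[OF p39 le] by simp
qed

lemma segment_4:
  "segment_certificate (cycle_policies ! 4) (switch_states ! 4) (Q_grad (switch_states ! 3))
    (approx_point 4) (approx_point 5)
    (vector [0.748005437128185098, 0.073306551903563388, 0.000009040452894688])
    (vector [-24.4439272728313264, 38.0329733671944217, 0.0569171126186851])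
    (functional1 4) (functional2 4) (functional1 5) (functional2 5)
    (vector [-0.89332280, -0.00000009, -1.62168689]) (vector [0.49700690, 0.00006421, 0.91640638])
    (\<lambda>i. if i = 1 then vector [0.17846064, 0.00036643, 0.39026718] else if i = 2 then vector [0.08669252, -0.00581765, -0.89529562]
       else vector [0.01577750, -0.01059649, 0.50502830])
    (z_bar ! 4) (growth_bound 4)"
proof -
  note vectors = forall_3 sum_3 inner_vec_def flow_exp_simps Q_grad_simps cycle_policies_def switch_states_def
    approx_point_def x_bar_def functional1_def functional2_def growth_bound_def z_bar_def
  show ?thesis
    by (rule segment_certificateI[where J = "vector [15241257988584017046063842008001/1568878348702848843095000000000, -13062720181784004624802473975997/4706635046108546529285000000000, 11166012737040012522229526024003/4706635046108546529285000000000]"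
        and Ja = "vector [971474812000912231912330793742258951841503921428516, -277538412343746150543804995621725724167698098574731, 237239824793130920955088802060904348515599881032345]"
        and Xa = "vector [-1472917915282220403151548211207925727560706812207300, 4034471319403938132792980063061058193561576858071700, 12010518829827846016995551328606222468003673151826500]"
        and Xa' = "vector [-856944238483463937839988369361420162903720379651600, 38560152865285907637696003192278268197101542742100, 237346260567391955089675619276974083254236214027300]"
        and ca = "vector [-1828419050484376169752319163103679114745224301080109, 316098565209032058181500998814003992364799641316827, 106435774261034134586817216069734738636332994896]"
        and ra = "vector [-19509946788962203431853015963654902749892210400000, -7360257968535904657077110740831668226552122138467, -41421384969293648064942221053291659038771470898695]"
        and Ua = "vector [-2444392727283132635064, 4312009731747684283337, 11773279005034715096040]"
        and Pl = "vector [100000000000000000000, 9800269926514037111, 1208607911915301]"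
        and \<gamma> = "20.7369275708199513750429496045"
        and h = "vector [-0.0122330298134745, 0.0011568664666991, 0.0000000051800341]", OF _ _ _ _ z_bar_powers_4])
       (simp_all add: vectors Q_diff_affine cost_def cost_to_go_110)
qed

lemma z_bar_powers_5:
  "\<forall>i. \<bar>z_bar ! 5 ^ flow_exp i - (vector [99908989163508063408586084033753455861069194300000, 99183878018000454364588423858304491237655719796648, 96423435159744629948468581892150982533956689477308] :: real^3) $ i / 10 ^ 50\<bar> \<le> 40 / 10 ^ 50"
  "\<forall>i. \<bar>z_bar ! 5 ^ (flow_exp i - 1) - (vector [100000000000000000000000000000000000000000000000000, 99274228323618694779126873715908642398273837568901, 96511270874676671956184018382650668738106495132359] :: real^3) $ i / 10 ^ 50\<bar> \<le> 40 / 10 ^ 50"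
proof -
  define z where "z = z_bar ! 5"
  have z: "z = 0.999089891635080634085860840337534558610691943" by (simp add: z_def z_bar_def)
  have S: "0 < (10 ^ 50 :: real)" and z1: "\<bar>z\<bar> \<le> 1" by (simp_all add: z)
  have p1: "\<bar>z ^ 1 - 99908989163508063408586084033753455861069194300000 / 10 ^ 50\<bar> \<le> (real 1 - 1) / 10 ^ 50" by (simp add: z)
  have p2: "\<bar>z ^ 2 - 99818061156739716437343459501889068058421917639514 / 10 ^ 50\<bar> \<le> (real 2 - 1) / 10 ^ 50"
    by (rule power_step[where r = "8242548797886709388744822770372451152490000000000", OF p1 p1 _ _ _ S z1]) simp_all
  have p4: "\<bar>z ^ 4 - 99636453330906301774982429458800206862139106283999 / 10 ^ 50\<bar> \<le> (real 4 - 1) / 10 ^ 50"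
    by (rule power_step[where r = "-2147500422803644396728997996673417842934345843804", OF p2 p2 _ _ _ S z1]) simp_all
  have p5: "\<bar>z ^ 5 - 99545773361278945931038557512002213632502871943343 / 10 ^ 50\<bar> \<le> (real 5 - 1) / 10 ^ 50"
    by (rule power_step[where r = "6248955217250833525965068628889030085912005700000", OF p4 p1 _ _ _ S z1]) simp_all
  have p8: "\<bar>z ^ 8 - 99274228323618694779126873715908642398273837568901 / 10 ^ 50\<bar> \<le> (real 8 - 1) / 10 ^ 50"
    by (rule power_step[where r = "17936805624419865053577935109991760524010443432001", OF p4 p4 _ _ _ S z1]) simp_all
  have p9: "\<bar>z ^ 9 - 99183878018000454364588423858304491237655719796648 / 10 ^ 50\<bar> \<le> (real 9 - 1) / 10 ^ 50"
    by (rule power_step[where r = "-29780035294045971130369968317670822345193535700000", OF p8 p1 _ _ _ S z1]) simp_all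
  have p10: "\<bar>z ^ 10 - 99093609940951130131833525737167157588660373563005 / 10 ^ 50\<bar> \<le> (real 10 - 1) / 10 ^ 50"
    by (rule power_step[where r = "46433168788775824814679856336252694953565402015649", OF p5 p5 _ _ _ S z1]) simp_all
  have p20: "\<bar>z ^ 20 - 98195435311293686401730890013552682093873061554611 / 10 ^ 50\<bar> \<le> (real 20 - 1) / 10 ^ 50"
    by (rule power_step[where r = "31392455974267900354867767747856906595918704630025", OF p10 p10 _ _ _ S z1]) simp_all
  have p30: "\<bar>z ^ 30 - 97305401647192356744108841681830780196619577493017 / 10 ^ 50\<bar> \<le> (real 30 - 1) / 10 ^ 50"
    by (rule power_step[where r = "-20541297398629812043332516443677422725849543233945", OF p20 p10 _ _ _ S z1]) simp_all
  have p39: "\<bar>z ^ 39 - 96511270874676671956184018382650668738106495132359 / 10 ^ 50\<bar> \<le> (real 39 - 1) / 10 ^ 50"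
    by (rule power_step[where r = "-48362084816336750708264924273319997234215119992984", OF p30 p9 _ _ _ S z1]) simp_all
  have p40: "\<bar>z ^ 40 - 96423435159744629948468581892150982533956689477308 / 10 ^ 50\<bar> \<le> (real 40 - 1) / 10 ^ 50"
    by (rule power_step[where r = "23892060852870969610289491356021562235988353700000", OF p39 p1 _ _ _ S z1]) simp_all
  have le: "(real n - 1) / 10 ^ 50 \<le> 40 / 10 ^ 50" if "n \<le> 40" for n
    using that by (intro divide_right_mono) auto
  note p = p1 p8 p9 p39 p40
  show "\<forall>i. \<bar>z_bar ! 5 ^ flow_exp i - (vector [99908989163508063408586084033753455861069194300000, 99183878018000454364588423858304491237655719796648, 96423435159744629948468581892150982533956689477308] :: real^3) $ i / 10 ^ 50\<bar> \<le> 40 / 10 ^ 50"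
    unfolding z_def[symmetric] forall_3 flow_exp_simps vector_3
    by (intro conjI; rule order_trans[OF _ le]; (rule p)?) simp_all
  show "\<forall>i. \<bar>z_bar ! 5 ^ (flow_exp i - 1) - (vector [100000000000000000000000000000000000000000000000000, 99274228323618694779126873715908642398273837568901, 96511270874676671956184018382650668738106495132359] :: real^3) $ i / 10 ^ 50\<bar> \<le> 40 / 10 ^ 50"
    unfolding z_def[symmetric] forall_3 flow_exp_simps vector_3
    using order_trans[OF p8 le] order_trans[OF p39 le] by simp
qed

lemma segment_5:
  "segment_certificate (cycle_policies ! 5) (switch_states ! 5) (Q_grad (switch_states ! 4))
    (approx_point 5) (approx_point 6)
    (vector [0.999089891635080634, 0.991838780180004544, 0.964234351597446299])
    (vector [26.6046409449084704, 441.6647405015156291, 2028.4277223217763679])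
    (functional1 5) (functional2 5) (functional1 0) (functional2 0)
    (vector [0.89910006, -0.00063812, 17.71982485]) (vector [0.20186473, 0.49004008, -752.22184080])
    (\<lambda>i. if i = 1 then vector [-0.09244910, -0.00001957, -1.52592445] else if i = 2 then vector [-0.09597169, -0.00032723, 1.47246243]
       else vector [0.00457064, 0.00845411, 0.05346212])
    (z_bar ! 5) (growth_bound 5)"
proof -
  note vectors = forall_3 sum_3 inner_vec_def flow_exp_simps Q_grad_simps cycle_policies_def switch_states_def
    approx_point_def x_bar_def functional1_def functional2_def growth_bound_def z_bar_def
  show ?thesis
    by (rule segment_certificateI[where J = "vector [-192481355362500635279531306613557/5472249370596643844587625000000, -268397560115821456252063806613557/5472249370596643844587625000000, -274544619411118232361043806613557/5472249370596643844587625000000]"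
        and Ja = "vector [-3517408332974310981954170106134457798891432813010928, -4904702654048783777764057972303315219525074367636890, -5017034144794180075080714712238461767542473186595168]"
        and Xa = "vector [-856944238483463937839988369361420162903720379651600, 38560152865285907637696003192278268197101542742100, 237346260567391955089675619276974083254236214027300]"
        and Xa' = "vector [-859365549110427684060547352373810356279806687000000, -1782901529947570479958611237140123183129413360000, 49419938415962381038498664432023704303346133600000]"
        and ca = "vector [2658042783863883297893622753760647442611626127412283, 4902919752518836207284099361066175096341944971163748, 5066454083210142456119213376670485471845819390937422]"
        and ra = "vector [11565754795872614623747402806171049003349430400000, -49336687617779127606669984421923415574404588374480, 34534423796678577662450152856187199322880760956144]"
        and Ua = "vector [2660464094490847044114, 4943262806914069685402, 5254380405361572030170]"
        and Pl = "vector [100000000000000000000, 99274228323618694779, 96511270874676671956]"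
        and \<gamma> = "-503.4863921279930276836752030140"
        and h = "vector [-0.0007600589626439, 0.0003268428608369, 0.0004157962527562]", OF _ _ _ _ z_bar_powers_5])
       (simp_all add: vectors Q_diff_affine cost_def cost_to_go_111)
qed

section \<open>The segments joined cyclically\<close>

text \<open>k + 5 stands for k - 1 modulo 6: a segment starts on the plane on which the previous one
  ends.\<close>

definition start_normal :: "nat \<Rightarrow> real^3" where
  "start_normal k = Q_grad (switch_states ! ((k + 5) mod 6))"

text \<open>A seminorm on the whole space, and a norm on the plane with normal
  \<open>start_normal k\<close>, where its unit ball is a parallelogram.\<close>

definition plane_norm :: "nat \<Rightarrow> real^3 \<Rightarrow> real" where
  "plane_norm k e = max \<bar>functional1 (k mod 6) \<bullet> e\<bar> \<bar>functional2 (k mod 6) \<bullet> e\<bar>"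

definition crossing :: "nat \<Rightarrow> real^3 \<Rightarrow> real \<Rightarrow> real^3 \<Rightarrow> bool" where
  "crossing k x z x' \<longleftrightarrow> \<bar>z - z_bar ! k\<bar> \<le> 1 / 10 ^ 30 \<and> x' = flow (cycle_policies ! k) x z
     \<and> Q_diff (switch_states ! k) x' = 0"

lemma less_6_cases:
  fixes k :: nat
  assumes "k < 6" obtains "k = 0" | "k = 1" | "k = 2" | "k = 3" | "k = 4" | "k = 5"
  using assms by linarith

lemma segment:
  assumes "k < 6"
  obtains A B m1 m2 n where "segment_certificate (cycle_policies ! k) (switch_states ! k) (start_normal k)
    (approx_point k) (approx_point (Suc k)) A B (functional1 k) (functional2 k)
    (functional1 (Suc k mod 6)) (functional2 (Suc k mod 6)) m1 m2 n (z_bar ! k) (growth_bound k)"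
proof -
  have "\<exists>A B m1 m2 n. segment_certificate (cycle_policies ! k) (switch_states ! k) (start_normal k)
    (approx_point k) (approx_point (Suc k)) A B (functional1 k) (functional2 k)
    (functional1 (Suc k mod 6)) (functional2 (Suc k mod 6)) m1 m2 n (z_bar ! k) (growth_bound k)"
    using assms
  proof (cases rule: less_6_cases)
    case 1
    have eqs: "(0 + 5) mod 6 = (5 :: nat)" "Suc 0 = 1" "1 mod 6 = (1 :: nat)" by simp_all
    show ?thesis
      unfolding 1 start_normal_def eqs by (intro exI) (rule segment_0)
  next
    case 2
    have eqs: "(1 + 5) mod 6 = (0 :: nat)" "Suc 1 = 2" "2 mod 6 = (2 :: nat)" by simp_all
    show ?thesis
      unfolding 2 start_normal_def eqs by (intro exI) (rule segment_1)
  next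
    case 3
    have eqs: "(2 + 5) mod 6 = (1 :: nat)" "Suc 2 = 3" "3 mod 6 = (3 :: nat)" by simp_all
    show ?thesis
      unfolding 3 start_normal_def eqs by (intro exI) (rule segment_2)
  next
    case 4
    have eqs: "(3 + 5) mod 6 = (2 :: nat)" "Suc 3 = 4" "4 mod 6 = (4 :: nat)" by simp_all
    show ?thesis
      unfolding 4 start_normal_def eqs by (intro exI) (rule segment_3)
  next
    case 5
    have eqs: "(4 + 5) mod 6 = (3 :: nat)" "Suc 4 = 5" "5 mod 6 = (5 :: nat)" by simp_all
    show ?thesis
      unfolding 5 start_normal_def eqs by (intro exI) (rule segment_4)
  next
    case 6
    have eqs: "(5 + 5) mod 6 = (4 :: nat)" "Suc 5 = 6" "6 mod 6 = (0 :: nat)" by simp_all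
    show ?thesis
      unfolding 6 start_normal_def eqs by (intro exI) (rule segment_5)
  qed
  then show thesis using that by blast
qed

lemma plane_norm_bound:
  "\<bar>functional1 (k mod 6) \<bullet> e\<bar> \<le> plane_norm k e" "\<bar>functional2 (k mod 6) \<bullet> e\<bar> \<le> plane_norm k e"
  by (simp_all add: plane_norm_def)

lemma crosses_iff_crossing:
  assumes "segment_certificate (cycle_policies ! k) (switch_states ! k) gp X X' A B c1 c2 d1 d2 m1 m2 n (z_bar ! k) G"
  shows "segment_certificate.crosses (cycle_policies ! k) (switch_states ! k) (z_bar ! k) x z x'
    \<longleftrightarrow> crossing k x z x'"
  unfolding segment_certificate.crosses_def[OF assms] crossing_def ..

lemma crossing_contraction:
  assumes k: "k < 6" and y: "\<And>i. \<bar>y $ i - approx_point k $ i\<bar> \<le> 1 / 10 ^ 20"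
    and c: "crossing k x z x'" "crossing k y w y'" and p: "start_normal k \<bullet> (x - y) = 0"
  shows "plane_norm (Suc k) (x' - y') \<le> 0.95 * plane_norm k (x - y)"
    and "start_normal (Suc k) \<bullet> (x' - y') = 0" and "\<bar>z - w\<bar> \<le> plane_norm k (x - y)"
proof -
  obtain A B m1 m2 n where s: "segment_certificate (cycle_policies ! k) (switch_states ! k) (start_normal k)
    (approx_point k) (approx_point (Suc k)) A B (functional1 k) (functional2 k)
    (functional1 (Suc k mod 6)) (functional2 (Suc k mod 6)) m1 m2 n (z_bar ! k) (growth_bound k)"
    by (rule segment[OF k])
  note con = segment_certificate.crosses_contraction[OF s y, unfolded crosses_iff_crossing[OF s], OF c p
      plane_norm_bound[of k "x - y", unfolded mod_less[OF k]]]
  show "plane_norm (Suc k) (x' - y') \<le> 0.95 * plane_norm k (x - y)"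
    unfolding plane_norm_def[of "Suc k"] by (rule max.boundedI[OF con(1,2)])
  show "\<bar>z - w\<bar> \<le> plane_norm k (x - y)" by (rule con(4))
  have "(Suc k + 5) mod 6 = k" using k by (cases rule: less_6_cases) simp_all
  then show "start_normal (Suc k) \<bullet> (x' - y') = 0"
    using con(3) by (simp add: start_normal_def)
qed

lemma crossing_exists:
  assumes k: "k < 6" and r: "1 / 10 ^ 38 \<le> r" "r \<le> 1 / 10 ^ 30" and x: "\<And>i. \<bar>x $ i - approx_point k $ i\<bar> \<le> r"
  shows "\<exists>z x'. crossing k x z x'"
    and "crossing k x z x' \<Longrightarrow> \<bar>x' $ i - approx_point (Suc k) $ i\<bar> \<le> (growth_bound k + 0.1) * r"
proof -
  obtain A B m1 m2 n where s: "segment_certificate (cycle_policies ! k) (switch_states ! k) (start_normal k)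
    (approx_point k) (approx_point (Suc k)) A B (functional1 k) (functional2 k)
    (functional1 (Suc k mod 6)) (functional2 (Suc k mod 6)) m1 m2 n (z_bar ! k) (growth_bound k)"
    by (rule segment[OF k])
  note ex = segment_certificate.crosses_exists[OF s r x, unfolded crosses_iff_crossing[OF s]]
  show "\<exists>z x'. crossing k x z x'" by (rule ex(1))
  show "\<bar>x' $ i - approx_point (Suc k) $ i\<bar> \<le> (growth_bound k + 0.1) * r" if "crossing k x z x'"
    by (rule ex(2)[OF that])
qed

lemma crossing_near:
  assumes k: "k < 6" and x: "\<And>i. \<bar>x $ i - approx_point k $ i\<bar> \<le> r" "r \<le> 1 / 10 ^ 22" and c: "crossing k x z x'"
  shows "\<bar>x' $ i - approx_point (Suc k) $ i\<bar> \<le> r + 1 / 10 ^ 25"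
proof -
  obtain A B m1 m2 n where s: "segment_certificate (cycle_policies ! k) (switch_states ! k) (start_normal k)
    (approx_point k) (approx_point (Suc k)) A B (functional1 k) (functional2 k)
    (functional1 (Suc k mod 6)) (functional2 (Suc k mod 6)) m1 m2 n (z_bar ! k) (growth_bound k)"
    by (rule segment[OF k])
  show ?thesis
    by (rule segment_certificate.crosses_near[OF s x, unfolded crosses_iff_crossing[OF s], OF c])
qed

lemma plane_component_bound:
  assumes k: "k < 6" and p: "start_normal k \<bullet> e = 0"
  shows "\<bar>e $ i\<bar> \<le> 0.3 * plane_norm k e"
proof -
  obtain A B m1 m2 n where s: "segment_certificate (cycle_policies ! k) (switch_states ! k) (start_normal k)
    (approx_point k) (approx_point (Suc k)) A B (functional1 k) (functional2 k)
    (functional1 (Suc k mod 6)) (functional2 (Suc k mod 6)) m1 m2 n (z_bar ! k) (growth_bound k)"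
    by (rule segment[OF k])
  show ?thesis
    by (rule segment_certificate.component_bound[OF s p plane_norm_bound[of k e, unfolded mod_less[OF k]]])
qed

lemma plane_norm_le:
  assumes "\<And>i. \<bar>e $ i\<bar> \<le> E"
  shows "plane_norm k e \<le> 3000 * E"
proof -
  have "k mod 6 < 6" by simp
  then have "\<bar>functional1 (k mod 6) $ j\<bar> \<le> 1000 \<and> \<bar>functional2 (k mod 6) $ j\<bar> \<le> 1000" for j
    using exhaust_3[of j] by (cases rule: less_6_cases) (auto simp: functional1_def functional2_def)
  then have "\<bar>functional1 (k mod 6) \<bullet> e\<bar> \<le> 3 * 1000 * E" "\<bar>functional2 (k mod 6) \<bullet> e\<bar> \<le> 3 * 1000 * E"
    using assms by (intro abs_inner_le_bound; blast)+
  then show ?thesis by (simp add: plane_norm_def)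
qed

lemma plane_norm_6: "plane_norm 6 = plane_norm 0"
  by (simp add: plane_norm_def fun_eq_iff)

lemma plane_norm_triangle: "plane_norm k (a + b) \<le> plane_norm k a + plane_norm k b"
  unfolding plane_norm_def inner_add_right
  by (intro max.boundedI order.trans[OF abs_triangle_ineq] add_mono max.cobounded1 max.cobounded2)

section \<open>Existence and uniqueness of the solution of the event equations\<close>

text \<open>An arbitrary choice among the crossings; near the approximate cycle the choice is
  immaterial, since \<open>crossing_contraction\<close> applied to equal starting points forces
  equal end points.\<close>

definition next_point :: "nat \<Rightarrow> real^3 \<Rightarrow> real^3" where
  "next_point k x = (SOME x'. \<exists>z. crossing k x z x')"

primrec shoot :: "real^3 \<Rightarrow> nat \<Rightarrow> real^3" where
  "shoot x 0 = x"
| "shoot x (Suc k) = next_point k (shoot x k)"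

definition growth_product :: "nat \<Rightarrow> real" where
  "growth_product k = (\<Prod>i<k. growth_bound i + 0.1)"

lemma growth_product_bounds:
  assumes "k \<le> 6" shows "1 \<le> growth_product k" "growth_product k \<le> 20"
proof -
  from assms consider "k = 0" | "k = 1" | "k = 2" | "k = 3" | "k = 4" | "k = 5" | "k = 6"
    by linarith
  then have "1 \<le> growth_product k \<and> growth_product k \<le> 20"
    by cases (simp_all add: growth_product_def growth_bound_def lessThan_nat_numeral lessThan_Suc)
  then show "1 \<le> growth_product k" "growth_product k \<le> 20" by auto
qed

text \<open>The factor 20 bounds all partial growth products, so the radius stays in the range of
  \<open>crossing_exists\<close> during the whole turn; its lower limit survives because these
  products are at least 1.\<close>

lemma shoot_near:
  assumes r: "1 / 10 ^ 38 \<le> r" "20 * r \<le> 1 / 10 ^ 30" and x: "\<And>i. \<bar>x $ i - x_bar $ i\<bar> \<le> r"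
  shows "k \<le> 6 \<Longrightarrow> \<bar>shoot x k $ i - approx_point k $ i\<bar> \<le> growth_product k * r"
    and "k < 6 \<Longrightarrow> \<exists>z. crossing k (shoot x k) z (shoot x (Suc k))"
proof -
  have r0: "0 \<le> r" using r(1) by (rule order.trans[rotated]) simp
  have *: "(\<exists>z. crossing k (shoot x k) z (shoot x (Suc k))) \<and>
     (\<forall>i. \<bar>shoot x (Suc k) $ i - approx_point (Suc k) $ i\<bar> \<le> growth_product (Suc k) * r)"
    if k: "k < 6" and near: "\<And>i. \<bar>shoot x k $ i - approx_point k $ i\<bar> \<le> growth_product k * r" for k
  proof -
    have "1 / 10 ^ 38 \<le> growth_product k * r"
      using mult_right_mono[OF growth_product_bounds(1)[of k] r0] k r(1) by linarith
    moreover have "growth_product k * r \<le> 1 / 10 ^ 30"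
      using mult_right_mono[OF growth_product_bounds(2)[of k] r0] k r(2) by linarith
    ultimately have ex: "\<exists>z x'. crossing k (shoot x k) z x'"
      "crossing k (shoot x k) z x' \<Longrightarrow> \<bar>x' $ i - approx_point (Suc k) $ i\<bar> \<le> (growth_bound k + 0.1) * (growth_product k * r)"
      for z x' i
      using crossing_exists[OF k _ _ near] by blast+
    have "\<exists>z. crossing k (shoot x k) z (shoot x (Suc k))"
      unfolding shoot.simps next_point_def using ex(1) by (intro someI_ex[of "\<lambda>x'. \<exists>z. crossing k (shoot x k) z x'"]) blast
    moreover have "growth_product (Suc k) = (growth_bound k + 0.1) * growth_product k"
      by (simp add: growth_product_def mult.commute)
    ultimately show ?thesis using ex(2) by (auto simp: mult.assoc)
  qed
  show near: "\<bar>shoot x k $ i - approx_point k $ i\<bar> \<le> growth_product k * r" if "k \<le> 6" for k i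
    using that
  proof (induction k arbitrary: i)
    case 0
    then show ?case using x by (simp add: growth_product_def approx_point_def)
  next
    case (Suc k)
    then show ?case using *[of k] by simp
  qed
  show "\<exists>z. crossing k (shoot x k) z (shoot x (Suc k))" if "k < 6" for k
    using *[OF that near] that by simp
qed

lemma shoot_contraction:
  assumes r: "1 / 10 ^ 38 \<le> r" "20 * r \<le> 1 / 10 ^ 30"
    and x: "\<And>i. \<bar>x $ i - x_bar $ i\<bar> \<le> r" and y: "\<And>i. \<bar>y $ i - x_bar $ i\<bar> \<le> r"
    and p: "start_normal 0 \<bullet> (x - y) = 0" and "k \<le> 6"
  shows "plane_norm k (shoot x k - shoot y k) \<le> 0.95 ^ k * plane_norm 0 (x - y)"
    and "start_normal k \<bullet> (shoot x k - shoot y k) = 0"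
proof -
  have r0: "0 \<le> r" using r(1) by (rule order.trans[rotated]) simp
  have "plane_norm k (shoot x k - shoot y k) \<le> 0.95 ^ k * plane_norm 0 (x - y) \<and>
      start_normal k \<bullet> (shoot x k - shoot y k) = 0"
    using \<open>k \<le> 6\<close>
  proof (induction k)
    case 0
    then show ?case using p by simp
  next
    case (Suc k)
    then have k: "k < 6" and IH: "plane_norm k (shoot x k - shoot y k) \<le> 0.95 ^ k * plane_norm 0 (x - y)"
      "start_normal k \<bullet> (shoot x k - shoot y k) = 0" by auto
    obtain z w where c: "crossing k (shoot x k) z (shoot x (Suc k))" "crossing k (shoot y k) w (shoot y (Suc k))"
      using shoot_near(2)[OF r x k] shoot_near(2)[OF r y k] by blast
    have near: "\<bar>shoot y k $ i - approx_point k $ i\<bar> \<le> 1 / 10 ^ 20" for i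
    proof -
      have "\<bar>shoot y k $ i - approx_point k $ i\<bar> \<le> growth_product k * r"
        using shoot_near(1)[OF r y] k by simp
      also have "\<dots> \<le> 20 * r"
        using growth_product_bounds(2)[of k] k r0 by (intro mult_right_mono) auto
      also have "\<dots> \<le> 1 / 10 ^ 20"
        using r(2) by (rule order.trans) simp
      finally show ?thesis .
    qed
    note con = crossing_contraction[OF k near c IH(2)]
    have "0.95 * plane_norm k (shoot x k - shoot y k) \<le> 0.95 * (0.95 ^ k * plane_norm 0 (x - y))"
      using IH(1) by (intro mult_left_mono) auto
    with con(1,2) show ?case by simp
  qed
  then show "plane_norm k (shoot x k - shoot y k) \<le> 0.95 ^ k * plane_norm 0 (x - y)"
    and "start_normal k \<bullet> (shoot x k - shoot y k) = 0" by auto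
qed

lemma start_normal_6: "start_normal 6 = start_normal 0"
  by (simp add: start_normal_def)

lemma start_normal_0: "start_normal 0 = Q_grad 1"
  by (simp add: start_normal_def switch_states_def)

text \<open>Brouwer on a parallelogram S in the plane \<open>Q_diff 1 x = 0\<close>, centered at the
  orthogonal projection c of \<open>x_bar\<close>. The return map contracts
  \<open>plane_norm\<close>, which is not the metric of the type; the contraction is therefore used
  for self-mapping and continuity, and compactness does the rest.\<close>

lemma fixed_point_exists:
  "\<exists>x. shoot x 6 = x \<and> (\<forall>i. \<bar>x $ i - x_bar $ i\<bar> \<le> 5 / 10 ^ 32) \<and> Q_diff 1 x = 0"
proof -
  define g where "g = Q_grad 1"
  define c where "c = x_bar - (Q_diff 1 x_bar / (g \<bullet> g)) *\<^sub>R g"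
  \<comment> \<open>The largest radius with 20 r \<le> 10^-30. The parallelogram of size R extends
    0.3 R = 3 * 10^-32 in each coordinate, which leaves room for the distance from c to
    \<open>x_bar\<close>.\<close>
  define r :: real where "r = 5 / 10 ^ 32"
  define R :: real where "R = 1 / 10 ^ 31"
  define S where "S = {x. Q_diff 1 x = 0 \<and> \<bar>functional1 0 \<bullet> (x - c)\<bar> \<le> R \<and> \<bar>functional2 0 \<bullet> (x - c)\<bar> \<le> R}"
  have r: "1 / 10 ^ 38 \<le> r" "20 * r \<le> 1 / 10 ^ 30" and r': "1 / 10 ^ 38 \<le> (1 / 10 ^ 38 :: real)" "20 * (1 / 10 ^ 38) \<le> (1 / 10 ^ 30 :: real)"
    by (simp_all add: r_def)
  have gg: "1 / 10 \<le> g \<bullet> g" by (simp add: g_def Q_grad_1 inner_vec_def sum_3)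
  have d0: "\<bar>Q_diff 1 x_bar\<bar> \<le> 1 / 10 ^ 41"
    by (simp add: Q_diff_affine Q_grad_1 inner_vec_def sum_3 x_bar_def cost_def)
  have c_near: "\<bar>c $ i - x_bar $ i\<bar> \<le> 1 / 10 ^ 40" for i
  proof -
    have "\<bar>Q_diff 1 x_bar / (g \<bullet> g) * g $ i\<bar> \<le> (1 / 10 ^ 41) / (1 / 10) * 1"
      unfolding abs_mult abs_divide using d0 gg abs_Q_grad_le[of 1 i]
      by (intro mult_mono frac_le) (auto simp: g_def)
    then show ?thesis by (simp add: c_def)
  qed
  have Qc: "Q_diff 1 c = 0"
  proof -
    have "Q_diff 1 c - Q_diff 1 x_bar = - Q_diff 1 x_bar"
    proof -
      have "g \<bullet> g \<noteq> 0" using gg by linarith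
      then show ?thesis unfolding Q_diff_diff c_def g_def[symmetric] by simp
    qed
    then show ?thesis by simp
  qed
  have S_plane: "start_normal 0 \<bullet> (x - y) = 0" if "x \<in> S" "y \<in> S" for x y
    using that Q_diff_diff[of 1 x y] by (simp add: start_normal_0 S_def)
  have cS: "c \<in> S" by (simp add: S_def Qc R_def)
  have SR: "plane_norm 0 (x - c) \<le> R" if "x \<in> S" for x
    using that by (simp add: S_def plane_norm_def)
  have near_c: "\<bar>(x - c) $ i\<bar> \<le> 0.3 * R" if "x \<in> S" for x i
    using plane_component_bound[OF _ S_plane[OF that cS], of i] SR[OF that] by simp
  have near: "\<bar>x $ i - x_bar $ i\<bar> \<le> r" if "x \<in> S" for x i
    using abs_add_bound[OF near_c[OF that, of i] c_near[of i]] by (simp add: r_def R_def)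
  have c38: "\<bar>c $ i - x_bar $ i\<bar> \<le> 1 / 10 ^ 38" for i
    using c_near[of i] by (rule order.trans) simp
  have con: "plane_norm 6 (shoot x 6 - shoot y 6) \<le> 0.95 ^ 6 * plane_norm 0 (x - y)"
      "start_normal 6 \<bullet> (shoot x 6 - shoot y 6) = 0" if "x \<in> S" "y \<in> S" for x y
    using shoot_contraction[OF r near[OF that(1)] near[OF that(2)] S_plane[OF that]] by auto
  \<comment> \<open>The defect of the return map at c: following the smallest admissible radius
    10^-38 around \<open>x_bar\<close> gives 20 units of 10^-38, and one more unit leads from
    \<open>x_bar\<close> to c.\<close>
  have shoot_c: "plane_norm 0 (shoot c 6 - c) \<le> 3000 * (21 / 10 ^ 38)"
  proof (rule plane_norm_le)
    fix i
    have "\<bar>shoot c 6 $ i - approx_point 6 $ i\<bar> \<le> growth_product 6 * (1 / 10 ^ 38)"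
      using shoot_near(1)[OF r' c38] by simp
    also have "\<dots> \<le> 20 * (1 / 10 ^ 38)"
      using growth_product_bounds(2)[of 6] by (intro mult_right_mono) auto
    finally have "\<bar>shoot c 6 $ i - x_bar $ i\<bar> \<le> 20 * (1 / 10 ^ 38)"
      by (simp add: approx_point_def)
    from abs_add_bound[OF this, of "x_bar $ i - c $ i", OF c38[of i, unfolded abs_minus_commute[of "c $ i"]]]
    show "\<bar>(shoot c 6 - c) $ i\<bar> \<le> 21 / 10 ^ 38" by simp
  qed
  have shoot_plane: "Q_diff 1 (shoot x 6) = 0" if "x \<in> S" for x
    using shoot_near(2)[OF r near[OF that], of 5] by (auto simp: crossing_def switch_states_def numeral_eq_Suc)
  have maps: "shoot x 6 \<in> S" if x: "x \<in> S" for x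
  proof -
    have "plane_norm 0 (shoot x 6 - c) \<le> plane_norm 0 (shoot x 6 - shoot c 6) + plane_norm 0 (shoot c 6 - c)"
      using plane_norm_triangle[of 0 "shoot x 6 - shoot c 6" "shoot c 6 - c"] by simp
    also have "\<dots> \<le> 0.95 ^ 6 * R + 3000 * (21 / 10 ^ 38)"
      using con(1)[OF x cS] SR[OF x] shoot_c unfolding plane_norm_6
      by (intro add_mono) (auto intro: order.trans)
    also have "\<dots> \<le> R" by (simp add: R_def power_divide)
    finally show ?thesis
      using shoot_plane[OF x] by (simp add: S_def plane_norm_def)
  qed
  have lip: "dist (shoot x 6) (shoot y 6) \<le> 3 * (900 * dist x y)" if "x \<in> S" "y \<in> S" for x y
  proof -
    have "\<bar>(x - y) $ i\<bar> \<le> dist x y" for i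
      unfolding dist_norm by (rule component_le_norm_cart)
    then have "plane_norm 0 (x - y) \<le> 3000 * dist x y" by (rule plane_norm_le)
    moreover have "0.95 ^ 6 * plane_norm 0 (x - y) \<le> 1 * plane_norm 0 (x - y)"
      by (intro mult_right_mono) (auto simp: plane_norm_def le_max_iff_disj power_divide)
    ultimately have "plane_norm 0 (shoot x 6 - shoot y 6) \<le> 3000 * dist x y"
      using con(1)[OF that] unfolding plane_norm_6 by linarith
    then have "\<bar>(shoot x 6 - shoot y 6) $ i\<bar> \<le> 900 * dist x y" for i
      using plane_component_bound[of 0 "shoot x 6 - shoot y 6" i] con(2)[OF that] by (simp add: start_normal_6)
    then have "norm (shoot x 6 - shoot y 6) \<le> (\<Sum>i\<in>(UNIV :: 3 set). 900 * dist x y)"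
      by (intro order.trans[OF norm_le_l1_cart] sum_mono)
    then show ?thesis by (simp add: dist_norm)
  qed
  have cont: "continuous_on S (\<lambda>x. shoot x 6)"
    unfolding continuous_on_iff
  proof (intro ballI allI impI)
    fix x e assume x: "x \<in> S" and e: "(0::real) < e"
    show "\<exists>d>0. \<forall>x'\<in>S. dist x' x < d \<longrightarrow> dist (shoot x' 6) (shoot x 6) < e"
    proof (intro exI[of _ "e / 2700"] conjI ballI impI)
      fix x' assume "x' \<in> S" "dist x' x < e / 2700"
      with lip[OF this(1) x] show "dist (shoot x' 6) (shoot x 6) < e" by simp
    qed (use e in simp)
  qed
  have "closed S"
    unfolding S_def Q_diff_affine by (intro closed_Collect_conj closed_Collect_eq closed_Collect_le continuous_intros)
  moreover have "bounded S"
  proof (rule boundedI)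
    fix x assume "x \<in> S"
    have "norm (x - c) \<le> (\<Sum>i\<in>(UNIV :: 3 set). 0.3 * R)"
      using near_c[OF \<open>x \<in> S\<close>] by (intro order.trans[OF norm_le_l1_cart] sum_mono)
    then show "norm x \<le> norm c + R"
      using norm_triangle_ineq[of c "x - c"] by (simp add: R_def)
  qed
  moreover have "convex S"
  proof -
    have "S = {x. Q_grad 1 \<bullet> x = cost 1 0 - cost 1 1} \<inter> {x. functional1 0 \<bullet> x \<le> functional1 0 \<bullet> c + R}
        \<inter> {x. functional1 0 \<bullet> x \<ge> functional1 0 \<bullet> c - R} \<inter> {x. functional2 0 \<bullet> x \<le> functional2 0 \<bullet> c + R}
        \<inter> {x. functional2 0 \<bullet> x \<ge> functional2 0 \<bullet> c - R}"
      by (auto simp: S_def Q_diff_affine inner_diff_right abs_le_iff)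
    then show ?thesis
      by (simp add: convex_Int convex_hyperplane convex_halfspace_le convex_halfspace_ge)
  qed
  ultimately obtain x where "x \<in> S" "shoot x 6 = x"
    using brouwer[of S "\<lambda>x. shoot x 6"] cont maps cS by (auto simp: compact_eq_bounded_closed)
  then show ?thesis using near by (auto simp: r_def S_def)
qed


lemma solution_crossing:
  assumes "(x, zs) \<in> event_box" "event_equations x zs" "k < 6"
  shows "crossing k (cycle_point x zs k) (zs ! k) (cycle_point x zs (Suc k))"
  using assms by (auto simp: event_box_def event_equations_def crossing_def)

lemma solution_near:
  assumes "(x, zs) \<in> event_box" "event_equations x zs" "k \<le> 6"
  shows "\<bar>cycle_point x zs k $ i - approx_point k $ i\<bar> \<le> 1 / 10 ^ 30 + real k / 10 ^ 25"
  using \<open>k \<le> 6\<close>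
proof (induction k arbitrary: i)
  case 0
  then show ?case using assms(1) by (simp add: event_box_def approx_point_def)
next
  case (Suc k)
  then have "1 / 10 ^ 30 + real k / 10 ^ 25 \<le> 1 / 10 ^ 30 + 6 / 10 ^ 25"
    by (intro add_left_mono divide_right_mono) auto
  also have "\<dots> \<le> 1 / 10 ^ 22" by simp
  finally have "\<bar>cycle_point x zs (Suc k) $ i - approx_point (Suc k) $ i\<bar> \<le> 1 / 10 ^ 30 + real k / 10 ^ 25 + 1 / 10 ^ 25"
    using Suc by (intro crossing_near[OF _ _ _ solution_crossing[OF assms(1,2)]]) auto
  then show ?case by (simp add: add_divide_distrib)
qed

lemma solution_near':
  assumes "(x, zs) \<in> event_box" "event_equations x zs" "k \<le> 6"
  shows "\<bar>cycle_point x zs k $ i - approx_point k $ i\<bar> \<le> 1 / 10 ^ 20"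
proof -
  have "1 / 10 ^ 30 + real k / 10 ^ 25 \<le> 1 / 10 ^ 30 + 6 / 10 ^ 25"
    using assms(3) by (intro add_left_mono divide_right_mono) auto
  also have "\<dots> \<le> 1 / 10 ^ 20" by simp
  finally show ?thesis using solution_near[OF assms, of i] by linarith
qed

text \<open>After a full turn both solutions are back at their starting points while their plane
  distance has shrunk by 0.95^6, so it is zero. The parameters then agree because they differ by at
  most the plane distance.\<close>

lemma solution_unique:
  assumes x: "(x, zs) \<in> event_box" "event_equations x zs" and y: "(y, ws) \<in> event_box" "event_equations y ws"
  shows "x = y \<and> zs = ws"
proof -
  let ?x = "cycle_point x zs" and ?y = "cycle_point y ws"
  have cyc: "?x 6 = x" "?y 6 = y"
    using x(2) y(2) by (auto simp: event_equations_def)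
  \<comment> \<open>The sixth event equation together with the closing condition puts both starting
    points on the plane of state 1, where the plane norm separates points.\<close>
  have "Q_diff 1 x = 0" "Q_diff 1 y = 0"
    using x(2) y(2) by (auto simp: event_equations_def switch_states_def numeral_eq_Suc dest!: spec[of _ 5])
  then have "start_normal 0 \<bullet> (?x 0 - ?y 0) = 0"
    using Q_diff_diff[of 1 x y] by (simp add: start_normal_0)
  then have *: "plane_norm k (?x k - ?y k) \<le> 0.95 ^ k * plane_norm 0 (x - y) \<and> start_normal k \<bullet> (?x k - ?y k) = 0"
    if "k \<le> 6" for k
    using that
  proof (induction k)
    case (Suc k)
    then have k: "k < 6" "k \<le> 6" and IH: "plane_norm k (?x k - ?y k) \<le> 0.95 ^ k * plane_norm 0 (x - y)"
      "start_normal k \<bullet> (?x k - ?y k) = 0" by auto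
    note con = crossing_contraction[OF k(1) solution_near'[OF y k(2)] solution_crossing[OF x k(1)] solution_crossing[OF y k(1)] IH(2)]
    have "0.95 * plane_norm k (?x k - ?y k) \<le> 0.95 * (0.95 ^ k * plane_norm 0 (x - y))"
      using IH(1) by (intro mult_left_mono) auto
    with con(1,2) show ?case by (simp del: cycle_point.simps)
  qed simp
  have nn: "0 \<le> plane_norm k e" for k e by (simp add: plane_norm_def le_max_iff_disj)
  have "plane_norm 0 (x - y) \<le> 0.95 ^ 6 * plane_norm 0 (x - y)"
    using *[of 6] by (simp add: cyc plane_norm_6)
  then have N0: "plane_norm 0 (x - y) = 0"
    using nn[of 0 "x - y"] by (simp add: power_divide)
  have "\<bar>(x - y) $ i\<bar> \<le> 0.3 * plane_norm 0 (x - y)" for i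
    using *[of 0] by (intro plane_component_bound) auto
  then have "x = y" by (simp add: N0 vec_eq_iff)
  moreover have "zs ! k = ws ! k" if k: "k < 6" for k
  proof -
    have "plane_norm k (?x k - ?y k) \<le> 0" using *[of k] k by (simp add: N0)
    moreover have "\<bar>zs ! k - ws ! k\<bar> \<le> plane_norm k (?x k - ?y k)"
      using *[of k] k by (intro crossing_contraction(3)[OF k solution_near'[OF y] solution_crossing[OF x k] solution_crossing[OF y k]]) auto
    ultimately show ?thesis by simp
  qed
  then have "zs = ws" using x(1) y(1) by (intro nth_equalityI) (auto simp: event_box_def)
  ultimately show ?thesis ..
qed

lemma solution_exists: "\<exists>x zs. (x, zs) \<in> event_box \<and> event_equations x zs"
proof -
  obtain x where x: "shoot x 6 = x" "\<And>i. \<bar>x $ i - x_bar $ i\<bar> \<le> 5 / 10 ^ 32" "Q_diff 1 x = 0"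
    using fixed_point_exists by blast
  have r: "1 / 10 ^ 38 \<le> (5 / 10 ^ 32 :: real)" "20 * (5 / 10 ^ 32) \<le> (1 / 10 ^ 30 :: real)" by simp_all
  have "\<exists>z. \<forall>k<6. crossing k (shoot x k) (z k) (shoot x (Suc k))"
    using shoot_near(2)[OF r x(2)] by metis
  then obtain z where z: "\<And>k. k < 6 \<Longrightarrow> crossing k (shoot x k) (z k) (shoot x (Suc k))" by blast
  define zs where "zs = map z [0..<6]"
  have zs: "zs ! k = z k" if "k < 6" for k using that by (simp add: zs_def)
  have pt: "cycle_point x zs k = shoot x k" if "k \<le> 6" for k
    using that
  proof (induction k)
    case (Suc k)
    then show ?case using z[of k] by (simp add: crossing_def zs)
  qed simp
  have "(x, zs) \<in> event_box"
  proof -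
    have "\<bar>x $ i - x_bar $ i\<bar> \<le> 1 / 10 ^ 30" for i
      using x(2)[of i] by (rule order.trans) simp
    moreover have "\<bar>zs ! k - z_bar ! k\<bar> \<le> 1 / 10 ^ 30" if "k < 6" for k
      using z[OF that] by (simp add: zs that crossing_def)
    ultimately show ?thesis by (simp add: event_box_def zs_def)
  qed
  moreover have "event_equations x zs"
    unfolding event_equations_def
  proof (intro conjI allI impI)
    fix k :: nat assume k: "k < 6"
    then show "Q_diff (switch_states ! k) (cycle_point x zs (Suc k)) = 0"
      using z[OF k] unfolding crossing_def by (subst pt) auto
  next
    show "cycle_point x zs 6 = x" using x(1) by (subst pt) auto
  qed
  ultimately show ?thesis by blast
qed

definition x_star :: "nat \<Rightarrow> real^3" where
  "x_star k = cycle_point (fst y_star) (snd y_star) k"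

definition z_star :: "nat \<Rightarrow> real" where
  "z_star k = snd y_star ! k"

text \<open>Turns the definite description into usable facts, so that \<open>x_star\<close> and
  \<open>z_star\<close> stand for the exact cycle from here on.\<close>

lemma y_star: "y_star \<in> event_box" "event_equations (fst y_star) (snd y_star)"
proof -
  have "\<exists>!y. y \<in> event_box \<and> event_equations (fst y) (snd y)"
  proof (rule ex_ex1I)
    show "\<exists>y. y \<in> event_box \<and> event_equations (fst y) (snd y)"
      using solution_exists by force
    fix y y' assume "y \<in> event_box \<and> event_equations (fst y) (snd y)" "y' \<in> event_box \<and> event_equations (fst y') (snd y')"
    then show "y = y'"
      using solution_unique[of "fst y" "snd y" "fst y'" "snd y'"] by (simp add: prod_eq_iff)
  qed
  from theI'[OF this] show "y_star \<in> event_box" "event_equations (fst y_star) (snd y_star)"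
    by (simp_all add: y_star_def)
qed

lemma x_star_crossing: "k < 6 \<Longrightarrow> crossing k (x_star k) (z_star k) (x_star (Suc k))"
  using solution_crossing[of "fst y_star" "snd y_star"] y_star by (simp add: x_star_def z_star_def)

lemma x_star_near: "k \<le> 6 \<Longrightarrow> \<bar>x_star k $ i - approx_point k $ i\<bar> \<le> 1 / 10 ^ 20"
  using solution_near'[of "fst y_star" "snd y_star"] y_star by (simp add: x_star_def)

lemma x_star_6: "x_star 6 = x_star 0"
  using y_star(2) by (simp add: event_equations_def x_star_def del: cycle_point.simps) simp

lemma certified_cycle_eq:
  "certified_cycle = (\<Union>k<6. flow (cycle_policies ! k) (x_star k) ` {z_star k..1})"
  by (simp add: certified_cycle_def x_star_def z_star_def split_beta)

section \<open>Hybrid limit cycles\<close>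

definition flow_scale :: "real \<Rightarrow> real^3" where
  "flow_scale z = (\<chi> i. z ^ flow_exp i)"

lemma scale_component [simp]: "flow_scale z $ i = z ^ flow_exp i"
  by (simp add: flow_scale_def)

lemma flow_eq_scale: "flow \<mu> x z = cost_to_go \<mu> + (x - cost_to_go \<mu>) * flow_scale z"
  by (simp add: vec_eq_iff flow_component)

lemma scale_mult: "flow_scale a * flow_scale b = flow_scale (a * b)"
  by (simp add: vec_eq_iff power_mult_distrib)

lemma scale_1 [simp]: "flow_scale 1 = 1"
  by (simp add: vec_eq_iff)

lemma flow_exp_le: "flow_exp i \<le> 40" "1 \<le> flow_exp i"
  by (simp_all add: flow_exp_def)

lemma flow_exp_1 [simp]: "flow_exp 1 = 1"
  by (simp add: flow_exp_def)

lemma update_prob_component: "update_prob $ i = real (flow_exp i) / 50"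
  using exhaust_3[of i] by (auto simp: update_prob_def flow_exp_def)

lemma norm_mult_vec_le:
  fixes a b :: "real^'n"
  assumes "\<And>i. \<bar>a $ i\<bar> \<le> M"
  shows "norm (a * b) \<le> M * norm b"
proof -
  have M: "0 \<le> M" using assms[of undefined] by linarith
  have "norm (a * b) \<le> norm (M *\<^sub>R b)"
    using assms M by (intro norm_le_componentwise_cart) (auto simp: abs_mult intro!: mult_right_mono)
  then show ?thesis using M by simp
qed

text \<open>A uniform bound for all flow factors with exponent at most 40 and parameter at most 4 in
  modulus; the range up to 4 arises from inverting parameters that are at least 1/4.\<close>

definition scale_bound :: real where
  "scale_bound = 4 ^ 40"

lemma power_le_scale_bound: "0 \<le> a \<Longrightarrow> a \<le> 4 \<Longrightarrow> a ^ flow_exp i \<le> scale_bound"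
  using power_mono[of a 4 "flow_exp i"] power_increasing[of "flow_exp i" 40 "4::real"] flow_exp_le[of i]
  unfolding scale_bound_def by linarith

lemma scale_bound_pos: "0 < scale_bound"
  by (simp add: scale_bound_def)

lemma abs_scale_le: "\<bar>flow_scale z $ i\<bar> \<le> scale_bound" if "\<bar>z\<bar> \<le> 4"
  using power_le_scale_bound[of "\<bar>z\<bar>" i] that by (simp add: power_abs)

lemma power_diff_le:
  fixes a b M :: real
  assumes "\<bar>a\<bar> \<le> M" "\<bar>b\<bar> \<le> M" "1 \<le> M"
  shows "\<bar>a ^ p - b ^ p\<bar> \<le> real p * M ^ p * \<bar>a - b\<bar>"
proof (induction p)
  case (Suc p)
  have "\<bar>a ^ Suc p - b ^ Suc p\<bar> = \<bar>a * (a ^ p - b ^ p) + b ^ p * (a - b)\<bar>"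
    by (simp add: algebra_simps)
  also have "\<dots> \<le> M * (real p * M ^ p * \<bar>a - b\<bar>) + M ^ p * \<bar>a - b\<bar>"
    using assms Suc
    by (intro abs_add_bound; unfold abs_mult; intro mult_mono) (auto simp: power_abs power_mono)
  also have "M ^ p * \<bar>a - b\<bar> \<le> M ^ Suc p * \<bar>a - b\<bar>"
    using assms(3) by (intro mult_right_mono power_increasing) auto
  finally show ?case by (simp add: algebra_simps)
qed simp

lemma norm_scale_diff_le:
  assumes "\<bar>a\<bar> \<le> 4" "\<bar>b\<bar> \<le> 4"
  shows "\<bar>(flow_scale a - flow_scale b) $ i\<bar> \<le> 40 * scale_bound * \<bar>a - b\<bar>"
proof -
  have "\<bar>a ^ flow_exp i - b ^ flow_exp i\<bar> \<le> real (flow_exp i) * 4 ^ flow_exp i * \<bar>a - b\<bar>"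
    using power_diff_le[OF assms] by simp
  also have "\<dots> \<le> 40 * scale_bound * \<bar>a - b\<bar>"
    using flow_exp_le[of i] by (intro mult_right_mono mult_mono power_le_scale_bound) auto
  finally show ?thesis by simp
qed

lemma power_taylor:
  fixes s :: real
  assumes "\<bar>s\<bar> \<le> 2"
  shows "\<bar>s ^ p - 1 - p * (s - 1)\<bar> \<le> real p * 2 ^ p * (s - 1)\<^sup>2"
proof (induction p)
  case (Suc p)
  have "\<bar>s ^ Suc p - 1 - Suc p * (s - 1)\<bar> = \<bar>s * (s ^ p - 1 - p * (s - 1)) + p * (s - 1)\<^sup>2\<bar>"
    by (simp add: algebra_simps power2_eq_square)
  also have "\<dots> \<le> 2 * (real p * 2 ^ p * (s - 1)\<^sup>2) + p * (s - 1)\<^sup>2"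
    using assms Suc by (intro abs_add_bound; unfold abs_mult; (intro mult_mono)?) auto
  also have "p * (s - 1)\<^sup>2 \<le> 2 ^ Suc p * (s - 1)\<^sup>2"
  proof (rule mult_right_mono)
    have "real p \<le> 2 ^ p" using of_nat_less_two_power[of p, where 'a = real] by simp
    also have "\<dots> \<le> 2 ^ Suc p" by simp
    finally show "real p \<le> 2 ^ Suc p" .
  qed simp
  finally show ?case by (simp add: algebra_simps)
qed simp

text \<open>50 * \<open>update_prob\<close> is the derivative of \<open>flow_scale\<close> at 1.
  Hence an Euler step of length h agrees to second order with the exact flow for the parameter 1 -
  h/50.\<close>

lemma scale_taylor:
  assumes "\<bar>s\<bar> \<le> 2"
  shows "\<bar>(flow_scale s - 1 - (50 * (s - 1)) *\<^sub>R update_prob) $ i\<bar> \<le> 40 * scale_bound * (s - 1)\<^sup>2"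
proof -
  have "\<bar>s ^ flow_exp i - 1 - flow_exp i * (s - 1)\<bar> \<le> real (flow_exp i) * 2 ^ flow_exp i * (s - 1)\<^sup>2"
    by (rule power_taylor[OF assms])
  also have "\<dots> \<le> 40 * scale_bound * (s - 1)\<^sup>2"
    using flow_exp_le[of i] by (intro mult_right_mono mult_mono power_le_scale_bound) auto
  moreover have "50 * (s - 1) * update_prob $ i = flow_exp i * (s - 1)"
    by (simp add: update_prob_component)
  ultimately show ?thesis by simp
qed

lemma abs_update_prob_le: "\<bar>update_prob $ i\<bar> \<le> 1"
  using flow_exp_le[of i] by (simp add: update_prob_component)

text \<open>Segment \<open>k\<close> of the cycle runs from \<open>x k\<close> to \<open>x (Suc k)\<close> along the flow with center \<open>J k\<close>. The affine
  functions \<open>e k\<close> and \<open>e (Suc k)\<close> change sign from \<open>-\<close> to \<open>+\<close> at its start and at its end, and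
  \<open>t k \<bullet> y + tc k > 0\<close> expresses that the remaining state does not switch. All data have period 6.
  \<open>vel p\<close> is the set of extreme velocities at \<open>p\<close>, and \<open>NV k\<close> measures
  displacements at the start of the segment modulo the flow direction.\<close>

locale hybrid_cycle =
  fixes J x g t :: "nat \<Rightarrow> real^3" and z c tc :: "nat \<Rightarrow> real"
    and NV :: "nat \<Rightarrow> real^3 \<Rightarrow> real" and vel :: "real^3 \<Rightarrow> (real^3) set" and C \<rho> :: real
  fixes f :: "nat \<Rightarrow> real^3 \<Rightarrow> real^3" and e th :: "nat \<Rightarrow> real^3 \<Rightarrow> real" and \<gamma> :: "nat \<Rightarrow> real \<Rightarrow> real^3"
  defines "f k y \<equiv> update_prob * (J k - y)"
    and "e k y \<equiv> g k \<bullet> y + c k" and "th k y \<equiv> t k \<bullet> y + tc k"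
    and "\<gamma> k r \<equiv> J k + (x k - J k) * flow_scale r"
  assumes periodic: "J (k + 6) = J k" "x (k + 6) = x k" "g (k + 6) = g k" "t (k + 6) = t k"
      "z (k + 6) = z k" "c (k + 6) = c k" "tc (k + 6) = tc k" "NV (k + 6) = NV k"
    and z: "1 / 2 < z k" "z k < 1"
    and u1: "(x k - J k) $ 1 \<noteq> 0"
    and x_Suc: "x (Suc k) = \<gamma> k (z k)"
    and e_start: "e k (x k) = 0" "z k \<le> r \<Longrightarrow> r < 1 \<Longrightarrow> 0 < e k (\<gamma> k r)"
    and e_end: "z k < r \<Longrightarrow> r \<le> 1 \<Longrightarrow> e (Suc k) (\<gamma> k r) < 0"
    and th_pos: "z k \<le> r \<Longrightarrow> r \<le> 1 \<Longrightarrow> 0 < th k (\<gamma> k r)"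
    and rate: "0 < g (Suc k) \<bullet> f k (x (Suc k))" "0 < g (Suc k) \<bullet> f (Suc k) (x (Suc k))"
    and C: "1 \<le> C"
    and NV_triangle: "NV k (a + b) \<le> NV k a + NV k b"
    and NV_scaleR: "NV k (s *\<^sub>R a) = \<bar>s\<bar> * NV k a"
    and NV_le: "NV k a \<le> C * norm a"
    and NV_flow: "NV k (f k (x k)) = 0"
    and NV_ge: "a $ 1 = 0 \<Longrightarrow> norm a \<le> C * NV k a"
    and \<rho>: "0 \<le> \<rho>" "\<rho> < 1"
    and contraction: "g (Suc k) \<bullet> (a * flow_scale (z k)) = 0 \<Longrightarrow> NV (Suc k) (a * flow_scale (z k)) \<le> \<rho> * NV k a"
    and vel_inside: "v \<in> vel p \<Longrightarrow> 0 < e k p \<Longrightarrow> e (Suc k) p < 0 \<Longrightarrow> 0 < th k p \<Longrightarrow> v = f k p"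
    and vel_switch: "v \<in> vel p \<Longrightarrow> 0 < e k p \<Longrightarrow> 0 < th k p \<Longrightarrow> 0 < th (Suc k) p \<Longrightarrow> e (Suc (Suc k)) p < 0
      \<Longrightarrow> v = f k p \<or> v = f (Suc k) p"
begin

text \<open>The first coordinate decays with exponent 1, so its ratio to the initial displacement
  recovers the flow parameter without solving an equation. \<open>u1\<close> keeps the denominator
  away from zero.\<close>

definition zc :: "nat \<Rightarrow> real^3 \<Rightarrow> real" where
  "zc k y = (y - J k) $ 1 / (x k - J k) $ 1"

text \<open>Carries y back along the flow to the section where the parameter is 1 and compares it
  with the start of the segment. The result is invariant under the flow of segment k, see
  \<open>flow_xi\<close>.\<close>

definition xi :: "nat \<Rightarrow> real^3 \<Rightarrow> real^3" where
  "xi k y = (y - J k) * flow_scale (1 / zc k y) - (x k - J k)"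

definition V :: "nat \<Rightarrow> real^3 \<Rightarrow> real" where
  "V k y = NV k (xi k y)"

lemma f_periodic: "f (k + 6) = f k"
  by (simp add: f_def periodic fun_eq_iff)

lemma e_periodic: "e (k + 6) = e k"
  by (simp add: e_def periodic fun_eq_iff)

lemma th_periodic: "th (k + 6) = th k"
  by (simp add: th_def periodic fun_eq_iff)

lemma gamma_periodic: "\<gamma> (k + 6) = \<gamma> k"
  by (simp add: \<gamma>_def periodic fun_eq_iff)

lemma zc_periodic: "zc (k + 6) = zc k"
  by (simp add: zc_def periodic fun_eq_iff)

lemma V_periodic: "V (k + 6) = V k"
  by (simp add: V_def xi_def periodic zc_periodic fun_eq_iff)

lemma gamma_1 [simp]: "\<gamma> k 1 = x k"
  by (simp add: \<gamma>_def)

lemma e_end_0: "e (Suc k) (\<gamma> k (z k)) = 0"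
  using e_start(1)[of "Suc k"] x_Suc by simp

text \<open>Periodicity leaves six thresholds to be minimized. Demanding the property for all
  smaller values as well is what makes the minimum admissible for every segment.\<close>

lemma uniform_small:
  fixes P :: "nat \<Rightarrow> real \<Rightarrow> bool"
  assumes ex: "\<And>k. \<exists>\<epsilon>>0. \<forall>\<epsilon>'. 0 < \<epsilon>' \<and> \<epsilon>' \<le> \<epsilon> \<longrightarrow> P k \<epsilon>'" and per: "\<And>k \<epsilon>. P (k + 6) \<epsilon> = P k \<epsilon>"
  shows "\<exists>\<epsilon>>0::real. \<forall>\<epsilon>'. 0 < \<epsilon>' \<and> \<epsilon>' \<le> \<epsilon> \<longrightarrow> (\<forall>k. P k \<epsilon>')"
proof -
  obtain E where E: "\<And>k. 0 < E k" "\<And>k \<epsilon>'. 0 < \<epsilon>' \<Longrightarrow> \<epsilon>' \<le> E k \<Longrightarrow> P k \<epsilon>'"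
    using ex by metis
  define \<epsilon> where "\<epsilon> = Min (E ` {..<6})"
  have "(0::nat) \<in> {..<6}" by simp
  then have "{..<6::nat} \<noteq> {}" by blast
  then have "0 < \<epsilon>" unfolding \<epsilon>_def by (subst Min_gr_iff) (auto simp: E)
  moreover have "P k \<epsilon>'" if "0 < \<epsilon>'" "\<epsilon>' \<le> \<epsilon>" for k \<epsilon>'
  proof (induction k rule: less_induct)
    case (less k)
    show ?case
    proof (cases "k < 6")
      case True
      then have "\<epsilon> \<le> E k" unfolding \<epsilon>_def by (intro Min_le) auto
      then show ?thesis using E(2) that by auto
    next
      case False
      then show ?thesis using per[of "k - 6" \<epsilon>'] less[of "k - 6"] by simp
    qed
  qed
  ultimately show ?thesis by blast
qed

lemma NV_nonneg: "0 \<le> NV k a"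
  using NV_triangle[of k a "- 1 *\<^sub>R a"] NV_scaleR[of k 0 a] NV_scaleR[of k "-1" a] by simp

lemma NV_diff: "\<bar>NV k a - NV k b\<bar> \<le> NV k (a - b)"
proof -
  have "NV k a \<le> NV k (a - b) + NV k b" "NV k b \<le> NV k (b - a) + NV k a"
    using NV_triangle[of k "a - b" b] NV_triangle[of k "b - a" a] by simp_all
  moreover have "NV k (b - a) = NV k (a - b)"
    using NV_scaleR[of k "-1" "a - b"] by simp
  ultimately show ?thesis by simp
qed

lemma V_nonneg: "0 \<le> V k y"
  by (simp add: V_def NV_nonneg)

lemma xi_1: "zc k y \<noteq> 0 \<Longrightarrow> xi k y $ 1 = 0"
  using u1[of k] by (simp add: xi_def zc_def)

lemma point_eq: "zc k y \<noteq> 0 \<Longrightarrow> y = \<gamma> k (zc k y) + xi k y * flow_scale (zc k y)"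
proof -
  assume "zc k y \<noteq> 0"
  then have "flow_scale (1 / zc k y) * flow_scale (zc k y) = 1"
    by (simp add: scale_mult)
  then have "(xi k y + (x k - J k)) * flow_scale (zc k y) = y - J k"
    by (simp add: xi_def mult.assoc)
  then show ?thesis by (simp add: \<gamma>_def algebra_simps)
qed

lemma norm_xi_le: "zc k y \<noteq> 0 \<Longrightarrow> norm (xi k y) \<le> C * V k y"
  unfolding V_def by (intro NV_ge xi_1)

lemma dist_gamma_le:
  assumes "0 < zc k y" "zc k y \<le> 4"
  shows "dist y (\<gamma> k (zc k y)) \<le> scale_bound * (C * V k y)"
proof -
  have "norm (flow_scale (zc k y) * xi k y) \<le> scale_bound * norm (xi k y)"
    using assms by (intro norm_mult_vec_le abs_scale_le) auto
  also have "\<dots> \<le> scale_bound * (C * V k y)"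
    using norm_xi_le[of k y] assms scale_bound_pos by (intro mult_left_mono) auto
  finally have *: "norm (xi k y * flow_scale (zc k y)) \<le> scale_bound * (C * V k y)"
    by (simp add: mult.commute)
  have "y - \<gamma> k (zc k y) = xi k y * flow_scale (zc k y)"
    using point_eq[of k y] assms by (metis add_diff_cancel_left' less_irrefl)
  with * show ?thesis by (simp only: dist_norm)
qed

lemma flow_zc: "zc k (J k + (y - J k) * flow_scale s) = s * zc k y"
  by (simp add: zc_def)

lemma flow_xi:
  assumes "s \<noteq> 0"
  shows "xi k (J k + (y - J k) * flow_scale s) = xi k y"
proof -
  have "flow_scale s * flow_scale (1 / (s * zc k y)) = flow_scale (1 / zc k y)"
    using assms by (simp add: scale_mult)
  then show ?thesis
    by (simp add: xi_def flow_zc mult.assoc)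
qed

lemma flow_V: "s \<noteq> 0 \<Longrightarrow> V k (J k + (y - J k) * flow_scale s) = V k y"
  by (simp add: V_def flow_xi)

lemma zc_gamma [simp]: "zc k (\<gamma> k r) = r"
  using u1[of k] by (simp add: zc_def \<gamma>_def)

lemma V_gamma: "r \<noteq> 0 \<Longrightarrow> V k (\<gamma> k r) = 0"
proof -
  assume "r \<noteq> 0"
  then have "xi k (\<gamma> k r) = 0"
    by (simp only: xi_def zc_gamma) (simp add: \<gamma>_def mult.assoc scale_mult)
  then show ?thesis using NV_scaleR[of k 0 0] by (simp add: V_def)
qed

lemma zc_add: "zc k (y + v) = zc k y + v $ 1 / (x k - J k) $ 1"
  by (simp add: zc_def add_divide_distrib diff_divide_distrib)

definition u_inv :: "nat \<Rightarrow> real" where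
  "u_inv k = 1 / \<bar>(x k - J k) $ 1\<bar>"

lemma u_inv_pos: "0 < u_inv k"
  using u1 by (simp add: u_inv_def)

lemma zc_diff_le: "\<bar>zc k y - zc k y'\<bar> \<le> u_inv k * dist y y'"
proof -
  have "zc k y - zc k y' = (y - y') $ 1 / (x k - J k) $ 1"
    by (simp add: zc_def diff_divide_distrib)
  then have "\<bar>zc k y - zc k y'\<bar> = u_inv k * \<bar>(y - y') $ 1\<bar>"
    by (simp add: u_inv_def abs_divide)
  then show ?thesis
    using component_le_norm_cart[of "y - y'" 1] u_inv_pos[of k] by (simp add: dist_norm mult_left_mono)
qed

lemma e_diff_le: "\<bar>e k y - e k y'\<bar> \<le> norm (g k) * dist y y'"
  using Cauchy_Schwarz_ineq2[of "g k" "y - y'"] by (simp add: e_def inner_diff_right dist_norm)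

lemma th_diff_le: "\<bar>th k y - th k y'\<bar> \<le> norm (t k) * dist y y'"
  using Cauchy_Schwarz_ineq2[of "t k" "y - y'"] by (simp add: th_def inner_diff_right dist_norm)

lemma f_diff_le: "dist (f k y) (f k y') \<le> dist y y'"
  using norm_mult_vec_le[OF abs_update_prob_le, of "y' - y"]
  by (simp add: f_def dist_norm norm_minus_commute flip: right_diff_distrib)

lemma xi_diff_le:
  assumes z: "1 / 4 \<le> zc k y" "1 / 4 \<le> zc k y'"
  shows "norm (xi k y - xi k y') \<le> (640 * scale_bound * u_inv k * norm (y - J k) + scale_bound) * dist y y'"
proof -
  let ?a = "1 / zc k y" and ?b = "1 / zc k y'"
  have ab: "\<bar>?a\<bar> \<le> 4" "\<bar>?b\<bar> \<le> 4" using z by (auto simp: divide_simps)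
  have "\<bar>?a - ?b\<bar> = \<bar>zc k y - zc k y'\<bar> * (\<bar>?a\<bar> * \<bar>?b\<bar>)"
    using z by (simp add: divide_simps abs_mult[symmetric] abs_minus_commute)
  also have "\<dots> \<le> (u_inv k * dist y y') * (4 * 4)"
    using ab zc_diff_le u_inv_pos[of k] by (intro mult_mono) auto
  finally have d: "\<bar>?a - ?b\<bar> \<le> 16 * u_inv k * dist y y'" by simp
  have "norm ((flow_scale ?a - flow_scale ?b) * (y - J k)) \<le> (40 * scale_bound * (16 * u_inv k * dist y y')) * norm (y - J k)"
  proof (rule norm_mult_vec_le)
    fix i
    have "\<bar>(flow_scale ?a - flow_scale ?b) $ i\<bar> \<le> 40 * scale_bound * \<bar>?a - ?b\<bar>"
      by (rule norm_scale_diff_le[OF ab])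
    also have "\<dots> \<le> 40 * scale_bound * (16 * u_inv k * dist y y')"
      using scale_bound_pos by (intro mult_left_mono d) auto
    finally show "\<bar>(flow_scale ?a - flow_scale ?b) $ i\<bar> \<le> 40 * scale_bound * (16 * u_inv k * dist y y')" .
  qed
  moreover have "norm (flow_scale ?b * (y - y')) \<le> scale_bound * norm (y - y')"
    using ab by (intro norm_mult_vec_le abs_scale_le)
  moreover have "xi k y - xi k y' = (flow_scale ?a - flow_scale ?b) * (y - J k) + flow_scale ?b * (y - y')"
    by (simp add: xi_def algebra_simps)
  ultimately have "norm (xi k y - xi k y') \<le> (40 * scale_bound * (16 * u_inv k * dist y y')) * norm (y - J k) + scale_bound * norm (y - y')"
    by (simp only:) (rule order.trans[OF norm_triangle_ineq add_mono])
  then show ?thesis by (simp add: dist_norm algebra_simps)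
qed

lemma V_diff_le:
  assumes "1 / 4 \<le> zc k y" "1 / 4 \<le> zc k y'"
  shows "\<bar>V k y - V k y'\<bar> \<le> C * ((640 * scale_bound * u_inv k * norm (y - J k) + scale_bound) * dist y y')"
proof -
  have "\<bar>V k y - V k y'\<bar> \<le> C * norm (xi k y - xi k y')"
    unfolding V_def by (rule order.trans[OF NV_diff NV_le])
  also have "\<dots> \<le> C * ((640 * scale_bound * u_inv k * norm (y - J k) + scale_bound) * dist y y')"
    using C by (intro mult_left_mono xi_diff_le assms) auto
  finally show ?thesis .
qed

lemma gamma_continuous: "continuous_on UNIV (\<gamma> k)"
proof -
  have "\<gamma> k = (\<lambda>r. \<chi> i. J k $ i + (x k - J k) $ i * r ^ flow_exp i)"
    by (simp add: \<gamma>_def fun_eq_iff vec_eq_iff)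
  then show ?thesis
    by (simp only:) (intro continuous_on_vec_lambda continuous_intros)
qed

end

section \<open>Local geometry of the cycle: tubes and switches\<close>

lemma common_lower_bound:
  fixes a b c d :: real
  assumes "0 < a" "0 < b" "0 < c" "0 < d"
  obtains \<epsilon> where "0 < \<epsilon>" "\<epsilon> \<le> a" "\<epsilon> \<le> b" "\<epsilon> \<le> c" "\<epsilon> \<le> d"
  using assms by (intro that[of "min (min a b) (min c d)"]) auto

context hybrid_cycle
begin

lemma rate_start: "0 < g k \<bullet> f k (x k)"
proof -
  have "k + 6 = Suc (k + 5)" by simp
  then show ?thesis
    using rate(2)[of "k + 5"] periodic(2,3)[of k] f_periodic[of k] by metis
qed

text \<open>The factor -50/r is dt/dr for r = exp(-t/50). Time runs against r, which reverses signs: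
  an event function that rises in time falls in r.\<close>

lemma gamma_derivative:
  assumes "0 < r"
  shows "((\<lambda>r. w \<bullet> \<gamma> k r + b) has_real_derivative - (50 / r) * (w \<bullet> f k (\<gamma> k r))) (at r)"
proof -
  let ?u = "x k - J k"
  have "w $ i * (?u $ i * (real p * r ^ (p - 1))) = - (50 / r) * (w $ i * (real p / 50 * (- (?u $ i * r ^ p))))"
    if "1 \<le> p" for i p
  proof -
    have "r ^ p = r * r ^ (p - 1)" using that by (simp add: power_eq_if)
    then show ?thesis using assms by simp
  qed
  from this[OF flow_exp_le(2)] have *: "(\<Sum>i\<in>UNIV. w $ i * (?u $ i * (real (flow_exp i) * r ^ (flow_exp i - 1))))
      = - (50 / r) * (w \<bullet> f k (\<gamma> k r))"
    by (simp add: inner_vec_def sum_distrib_left f_def \<gamma>_def update_prob_component)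
  have "((\<lambda>r. (\<Sum>i\<in>UNIV. w $ i * (J k $ i + ?u $ i * r ^ flow_exp i)) + b) has_real_derivative
      (\<Sum>i\<in>UNIV. w $ i * (?u $ i * (real (flow_exp i) * r ^ (flow_exp i - 1))))) (at r)"
    by (auto intro!: derivative_eq_intros sum.cong)
  then show ?thesis
    unfolding * by (simp add: \<gamma>_def inner_vec_def)
qed

text \<open>Transversality at both ends: prolonging the segment beyond its end or before its start
  gives the event function the opposite sign. The margins towards 1 and 1/2 keep the prolonged
  parameter range inside the interval on which the later estimates hold.\<close>

lemma extension_signs:
  "\<exists>\<eta>>0. \<forall>\<eta>'. 0 < \<eta>' \<and> \<eta>' \<le> \<eta> \<longrightarrow> (\<forall>r. z k - 2 * \<eta>' \<le> r \<and> r < z k \<longrightarrow> 0 < e (Suc k) (\<gamma> k r)) \<and>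
     (\<forall>r. 1 < r \<and> r \<le> 1 + 2 * \<eta>' \<longrightarrow> e k (\<gamma> k r) < 0) \<and> 16 * \<eta>' \<le> 1 - z k \<and> 8 * \<eta>' \<le> z k - 1 / 2"
proof -
  have zk: "0 < z k" using z[of k] by simp
  have "- (50 / z k) * (g (Suc k) \<bullet> f k (\<gamma> k (z k))) < 0"
    using rate(1)[of k] zk by (simp add: x_Suc)
  from DERIV_neg_dec_left[OF gamma_derivative[OF zk, of "g (Suc k)" k "c (Suc k)"] this]
  obtain d1 where "0 < d1" "\<forall>h>0. h < d1 \<longrightarrow> e (Suc k) (\<gamma> k (z k)) < e (Suc k) (\<gamma> k (z k - h))"
    unfolding e_def by blast
  then have d1: "0 < d1" "\<And>h. 0 < h \<Longrightarrow> h < d1 \<Longrightarrow> 0 < e (Suc k) (\<gamma> k (z k - h))"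
    using e_end_0[of k] by auto
  have "- (50 / 1) * (g k \<bullet> f k (\<gamma> k 1)) < 0"
    using rate_start[of k] by simp
  from DERIV_neg_dec_right[OF gamma_derivative[OF zero_less_one, of "g k" k "c k"] this]
  obtain d2 where "0 < d2" "\<forall>h>0. h < d2 \<longrightarrow> e k (\<gamma> k (1 + h)) < e k (\<gamma> k 1)"
    unfolding e_def by blast
  then have d2: "0 < d2" "\<And>h. 0 < h \<Longrightarrow> h < d2 \<Longrightarrow> e k (\<gamma> k (1 + h)) < 0"
    using e_start(1)[of k] by auto
  obtain \<eta> where \<eta>: "0 < \<eta>" "\<eta> \<le> d1 / 4" "\<eta> \<le> d2 / 4" "\<eta> \<le> (1 - z k) / 16" "\<eta> \<le> (z k - 1 / 2) / 8"
    using d1(1) d2(1) z[of k] by (auto intro: common_lower_bound[of "d1 / 4" "d2 / 4" "(1 - z k) / 16" "(z k - 1 / 2) / 8"])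
  show ?thesis
  proof (intro exI[of _ \<eta>] conjI allI impI; (elim conjE)?)
    fix \<eta>' r assume *: "0 < \<eta>'" "\<eta>' \<le> \<eta>" "z k - 2 * \<eta>' \<le> r" "r < z k"
    then show "0 < e (Suc k) (\<gamma> k r)" using d1(2)[of "z k - r"] \<eta> d1(1) by simp
  next
    fix \<eta>' r assume *: "0 < \<eta>'" "\<eta>' \<le> \<eta>" "1 < r" "r \<le> 1 + 2 * \<eta>'"
    then show "e k (\<gamma> k r) < 0" using d2(2)[of "r - 1"] \<eta> d2(1) by simp
  qed (use \<eta> in auto)
qed

lemma e_continuous: "continuous_on UNIV (e k)" and th_continuous: "continuous_on UNIV (th k)"
  by (simp_all add: e_def th_def continuous_intros)

text \<open>Compactness: points with V tending to 0 accumulate at some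
  \<open>\<gamma> k \<zeta>\<close>, the closed sign conditions force \<zeta> into [z k, 1], and the
  strict signs along the cycle then hold eventually. The implication is inherited by every smaller
  m', as required by \<open>uniform_small\<close>.\<close>

lemma tube_localization:
  assumes \<eta>: "0 < \<eta>" "\<And>r. z k - 2 * \<eta> \<le> r \<Longrightarrow> r < z k \<Longrightarrow> 0 < e (Suc k) (\<gamma> k r)"
    "\<And>r. 1 < r \<Longrightarrow> r \<le> 1 + 2 * \<eta> \<Longrightarrow> e k (\<gamma> k r) < 0" "16 * \<eta> \<le> 1 - z k" "8 * \<eta> \<le> z k - 1 / 2" and \<kappa>: "0 < \<kappa>"
  shows "\<exists>m>0. \<forall>m'. 0 < m' \<and> m' \<le> m \<longrightarrow> (\<forall>y. z k - 2 * \<eta> \<le> zc k y \<and> zc k y \<le> 1 + 2 * \<eta> \<and> V k y \<le> m' \<and> 0 \<le> e k y \<and> e (Suc k) y \<le> 0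
    \<longrightarrow> m' \<le> th k y \<and> z k - \<kappa> \<le> zc k y \<and> zc k y \<le> 1 + \<kappa> \<and> (- m' \<le> e (Suc k) y \<longrightarrow> dist y (x (Suc k)) \<le> \<kappa>)
      \<and> (e k y \<le> m' \<longrightarrow> dist y (x k) \<le> \<kappa>))" (is "\<exists>m>0. \<forall>m'. 0 < m' \<and> m' \<le> m \<longrightarrow> (\<forall>y. ?A m' y \<longrightarrow> ?B m' y)")
proof -
  have mono: "?A m' y \<longrightarrow> ?B m' y" if "?A m y \<longrightarrow> ?B m y" "m' \<le> m" for m m' y
    using that by auto
  have "\<exists>m>0. \<forall>y. ?A m y \<longrightarrow> ?B m y"
  proof (rule ccontr)
    assume "\<not> ?thesis"
    then have "\<forall>n. \<exists>y. ?A (inverse (real (Suc n))) y \<and> \<not> ?B (inverse (real (Suc n))) y"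
      by (metis inverse_positive_iff_positive of_nat_0_less_iff zero_less_Suc)
    then obtain Y where Y: "\<And>n. ?A (inverse (real (Suc n))) (Y n)" "\<And>n. \<not> ?B (inverse (real (Suc n))) (Y n)"
      by metis
    have cmp: "compact {z k - 2 * \<eta>..1 + 2 * \<eta>}" by simp
    have "zc k (Y n) \<in> {z k - 2 * \<eta>..1 + 2 * \<eta>}" for n
      unfolding atLeastAtMost_iff using Y(1)[of n] by blast
    then obtain \<zeta> q where \<zeta>: "\<zeta> \<in> {z k - 2 * \<eta>..1 + 2 * \<eta>}" "strict_mono q" "((\<lambda>n. zc k (Y n)) \<circ> q) \<longlonglongrightarrow> \<zeta>"
      using compact_def[THEN iffD1, OF cmp, rule_format, of "\<lambda>n. zc k (Y n)"] by blast
    define W where "W n = Y (q n)" for n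
    define \<epsilon> where "\<epsilon> n = inverse (real (Suc (q n)))" for n
    have W: "?A (\<epsilon> n) (W n)" for n
      unfolding W_def \<epsilon>_def by (rule Y(1))
    have notB: "\<not> ?B (\<epsilon> n) (W n)" for n
      unfolding W_def \<epsilon>_def by (rule Y(2))
    have Wb: "z k - 2 * \<eta> \<le> zc k (W n)" "zc k (W n) \<le> 1 + 2 * \<eta>" "V k (W n) \<le> \<epsilon> n" "0 \<le> e k (W n)" "e (Suc k) (W n) \<le> 0" for n
      using W[of n] by blast+
    have \<epsilon>: "\<epsilon> \<longlonglongrightarrow> 0"
      unfolding \<epsilon>_def using LIMSEQ_subseq_LIMSEQ[OF LIMSEQ_inverse_real_of_nat \<zeta>(2)] by (simp add: o_def)
    have zW: "(\<lambda>n. zc k (W n)) \<longlonglongrightarrow> \<zeta>"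
      using \<zeta>(3) by (simp add: W_def o_def)
    have bound: "dist (W n) (\<gamma> k (zc k (W n))) \<le> scale_bound * (C * \<epsilon> n)" for n
    proof -
      have "dist (W n) (\<gamma> k (zc k (W n))) \<le> scale_bound * (C * V k (W n))"
        using Wb(1,2)[of n] \<eta>(1,4,5) z[of k] by (intro dist_gamma_le) linarith+
      also have "\<dots> \<le> scale_bound * (C * \<epsilon> n)"
        using Wb(3)[of n] C scale_bound_pos by (intro mult_left_mono) linarith+
      finally show ?thesis .
    qed
    have "(\<lambda>n. scale_bound * (C * \<epsilon> n)) \<longlonglongrightarrow> scale_bound * (C * 0)"
      by (rule tendsto_mult[OF tendsto_const tendsto_mult[OF tendsto_const \<epsilon>]])
    then have bound0: "(\<lambda>n. scale_bound * (C * \<epsilon> n)) \<longlonglongrightarrow> 0" by simp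
    have "(\<lambda>n. dist (W n) (\<gamma> k (zc k (W n)))) \<longlonglongrightarrow> 0"
      by (rule tendsto_sandwich[OF _ _ tendsto_const bound0]) (simp_all add: bound)
    moreover have "(\<lambda>n. \<gamma> k (zc k (W n))) \<longlonglongrightarrow> \<gamma> k \<zeta>"
      by (rule continuous_on_tendsto_compose[OF gamma_continuous zW]) simp_all
    ultimately have Wlim: "W \<longlonglongrightarrow> \<gamma> k \<zeta>"
      unfolding dist_norm by (rule Lim_transform[OF _ tendsto_norm_zero_cancel, rotated])
    have elim: "(\<lambda>n. e j (W n)) \<longlonglongrightarrow> e j (\<gamma> k \<zeta>)" for j
      by (rule continuous_on_tendsto_compose[OF e_continuous Wlim]) simp_all
    have tlim: "(\<lambda>n. th j (W n)) \<longlonglongrightarrow> th j (\<gamma> k \<zeta>)" for j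
      by (rule continuous_on_tendsto_compose[OF th_continuous Wlim]) simp_all
    have "0 \<le> e k (\<gamma> k \<zeta>)" "e (Suc k) (\<gamma> k \<zeta>) \<le> 0"
      by (rule LIMSEQ_le_const[OF elim], use Wb(4) in blast) (rule LIMSEQ_le_const2[OF elim], use Wb(5) in blast)
    then have \<zeta>1: "z k \<le> \<zeta>" "\<zeta> \<le> 1"
      using \<eta>(2)[of \<zeta>] \<eta>(3)[of \<zeta>] \<zeta>(1) by (auto simp: not_le[symmetric])
    have 1: "\<forall>\<^sub>F n in sequentially. \<epsilon> n \<le> th k (W n)"
      using order_tendstoD(1)[OF tendsto_diff[OF tlim[of k] \<epsilon>], of 0] th_pos[OF \<zeta>1] by (auto elim!: eventually_mono)
    have 2: "\<forall>\<^sub>F n in sequentially. z k - \<kappa> \<le> zc k (W n)"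
      using order_tendstoD(1)[OF zW, of "z k - \<kappa>"] \<zeta>1 \<kappa> by (auto elim!: eventually_mono)
    have 3: "\<forall>\<^sub>F n in sequentially. zc k (W n) \<le> 1 + \<kappa>"
      using order_tendstoD(2)[OF zW, of "1 + \<kappa>"] \<zeta>1 \<kappa> by (auto elim!: eventually_mono)
    have near: "\<forall>\<^sub>F n in sequentially. dist (W n) (\<gamma> k \<zeta>) \<le> \<kappa>"
      using tendstoD[OF Wlim \<kappa>] by (auto elim!: eventually_mono)
    have 4: "\<forall>\<^sub>F n in sequentially. - \<epsilon> n \<le> e (Suc k) (W n) \<longrightarrow> dist (W n) (x (Suc k)) \<le> \<kappa>"
    proof (cases "\<zeta> = z k")
      case True
      then show ?thesis using near by (auto simp: x_Suc elim!: eventually_mono)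
    next
      case False
      then have "e (Suc k) (\<gamma> k \<zeta>) + 0 < 0" using \<zeta>1 e_end[of k \<zeta>] by auto
      then show ?thesis
        using order_tendstoD(2)[OF tendsto_add[OF elim[of "Suc k"] \<epsilon>], of 0] by (auto elim!: eventually_mono)
    qed
    have 5: "\<forall>\<^sub>F n in sequentially. e k (W n) \<le> \<epsilon> n \<longrightarrow> dist (W n) (x k) \<le> \<kappa>"
    proof (cases "\<zeta> = 1")
      case True
      then show ?thesis using near by (auto elim!: eventually_mono)
    next
      case False
      then have "0 < e k (\<gamma> k \<zeta>) - 0" using \<zeta>1 e_start(2)[of k \<zeta>] by auto
      then show ?thesis
        using order_tendstoD(1)[OF tendsto_diff[OF elim[of k] \<epsilon>], of 0] by (auto elim!: eventually_mono)
    qed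
    have "\<forall>\<^sub>F n in sequentially. ?B (\<epsilon> n) (W n)"
      using 1 2 3 4 5 by eventually_elim simp
    then have "\<forall>\<^sub>F n in sequentially. False"
      by (rule eventually_mono) (use notB in blast)
    then show False by simp
  qed
  then obtain m where "0 < m" "\<forall>y. ?A m y \<longrightarrow> ?B m y" by blast
  then show ?thesis using mono by (intro exI[of _ m]) blast
qed

text \<open>Every condition is strict at \<open>x (Suc k)\<close> and continuous, hence open. The
  two rate conditions say that both adjacent fields cross the plane in the same direction, which
  excludes sliding along it.\<close>

lemma switch_neighborhood:
  assumes "0 < \<eta>"
  shows "\<exists>\<kappa>>0. \<forall>\<kappa>'. 0 < \<kappa>' \<and> \<kappa>' \<le> \<kappa> \<longrightarrow> (\<forall>y. dist y (x (Suc k)) \<le> \<kappa>' \<longrightarrow>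
     \<kappa>' < g (Suc k) \<bullet> f k y \<and> \<kappa>' < g (Suc k) \<bullet> f (Suc k) y \<and> 0 < e k y \<and> 0 < th k y \<and> 0 < th (Suc k) y
     \<and> e (Suc (Suc k)) y < 0 \<and> z k - \<eta> < zc k y \<and> zc k y < z k + \<eta> \<and> 1 - \<eta> < zc (Suc k) y \<and> zc (Suc k) y < 1 + \<eta>)"
proof -
  define X where "X = x (Suc k)"
  define \<kappa>0 where "\<kappa>0 = min (g (Suc k) \<bullet> f k X) (g (Suc k) \<bullet> f (Suc k) X) / 2"
  have \<kappa>0: "0 < \<kappa>0" "\<kappa>0 < g (Suc k) \<bullet> f k X" "\<kappa>0 < g (Suc k) \<bullet> f (Suc k) X"
    using rate[of k] by (auto simp: \<kappa>0_def X_def min_def)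
  let ?S = "{y. \<kappa>0 < g (Suc k) \<bullet> f k y} \<inter> {y. \<kappa>0 < g (Suc k) \<bullet> f (Suc k) y} \<inter> {y. 0 < e k y} \<inter> {y. 0 < th k y} \<inter> {y. 0 < th (Suc k) y}
     \<inter> {y. e (Suc (Suc k)) y < 0} \<inter> {y. z k - \<eta> < zc k y} \<inter> {y. zc k y < z k + \<eta>} \<inter> {y. 1 - \<eta> < zc (Suc k) y} \<inter> {y. zc (Suc k) y < 1 + \<eta>}"
  have fc: "continuous_on UNIV (\<lambda>y. w \<bullet> f j y)" for w j
    unfolding f_def inner_vec_def by (simp, intro continuous_intros)
  have zcc: "continuous_on UNIV (zc j)" for j
    unfolding zc_def using u1[of j] by (simp, intro continuous_intros) auto
  have "open ?S"
    by (intro open_Int open_Collect_less fc zcc e_continuous th_continuous continuous_on_const)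
  moreover have "X \<in> ?S"
  proof -
    have X1: "X = \<gamma> k (z k)" "X = \<gamma> (Suc k) 1" by (simp_all add: X_def x_Suc)
    have "0 < e k X" "0 < th k X" unfolding X1(1) using z[of k] by (auto intro: e_start th_pos)
    moreover have "0 < th (Suc k) X" "e (Suc (Suc k)) X < 0" unfolding X1(2)
      using z[of "Suc k"] e_end[of "Suc k" 1] th_pos[of "Suc k" 1] by auto
    moreover have "zc k X = z k" "zc (Suc k) X = 1"
      unfolding X1(1) zc_gamma using X1(2) unfolding X1(1) by (metis zc_gamma)+
    ultimately show ?thesis using \<kappa>0 assms by simp
  qed
  ultimately obtain \<epsilon> where \<epsilon>: "0 < \<epsilon>" "ball X \<epsilon> \<subseteq> ?S" by (meson openE)
  define \<kappa> where "\<kappa> = min \<kappa>0 (\<epsilon> / 2)"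
  have "0 < \<kappa>" using \<kappa>0 \<epsilon> by (simp add: \<kappa>_def)
  moreover have "y \<in> ?S \<and> \<kappa>' \<le> \<kappa>0" if "dist y X \<le> \<kappa>'" "\<kappa>' \<le> \<kappa>" for \<kappa>' y
  proof -
    have "dist X y < \<epsilon>" using that \<epsilon>(1) unfolding \<kappa>_def dist_commute[of X] by linarith
    then have "y \<in> ?S" using \<epsilon>(2) by (meson mem_ball subsetD)
    then show ?thesis using that unfolding \<kappa>_def by simp
  qed
  ultimately show ?thesis unfolding X_def[symmetric]
    by (intro exI[of _ \<kappa>] conjI allI impI; (elim conjE)?) (simp, force+)
qed

text \<open>A change of the parameter moves along the flow, to first order in the direction that
  \<open>NV\<close> annihilates, so only the transported v remains. The limit on v keeps the
  parameter of \<open>\<gamma> k r + v\<close> between 3/8 and 9/8.\<close>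

lemma xi_linearization:
  assumes r: "1 / 2 \<le> r" "r \<le> 1"
  shows "\<exists>Q\<ge>0. \<forall>v. norm v \<le> 1 / (8 * u_inv k) \<longrightarrow>
    \<bar>V k (\<gamma> k r + v) - NV k (v * flow_scale (1 / r))\<bar> \<le> Q * (norm v)\<^sup>2"
proof -
  define U where "U = u_inv k"
  have U: "0 < U" by (simp add: U_def u_inv_pos)
  let ?u = "x k - J k"
  let ?Q = "C * (40 * scale_bound * (9 * U\<^sup>2) * norm ?u + 40 * scale_bound * (6 * U))"
  have "\<bar>V k (\<gamma> k r + v) - NV k (v * flow_scale (1 / r))\<bar> \<le> ?Q * (norm v)\<^sup>2"
    if v: "norm v \<le> 1 / (8 * U)" for v
  proof -
    define y where "y = \<gamma> k r + v"
    define a where "a = zc k y"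
    \<comment> \<open>\<theta> compares the parameter of the base point with that of the perturbed
      point; its deviation from 1 is the shift along the flow. R1 and R2 are remainders of second
      order in v.\<close>
    define \<theta> where "\<theta> = r / a"
    define s where "s = 50 * (\<theta> - 1)"
    define R1 where "R1 = (flow_scale \<theta> - 1 - s *\<^sub>R update_prob) * ?u"
    define R2 where "R2 = (flow_scale (1 / a) - flow_scale (1 / r)) * v"
    have "dist y (\<gamma> k r) = norm v" by (simp add: y_def dist_norm)
    then have a_r: "\<bar>a - r\<bar> \<le> U * norm v"
      using zc_diff_le[of k y "\<gamma> k r"] by (simp add: a_def U_def)
    have "U * norm v \<le> 1 / 8" using v U by (simp add: field_simps)
    then have a: "3 / 8 \<le> a" "a \<le> 9 / 8" and Uv: "U * norm v \<le> 1 / 8"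
      using a_r r by linarith+
    have "\<bar>\<theta> - 1\<bar> = \<bar>a - r\<bar> / a" using a by (simp add: \<theta>_def abs_divide[symmetric] divide_simps abs_minus_commute)
    also have "\<dots> \<le> (U * norm v) / (3 / 8)"
      using a a_r by (intro frac_le) auto
    finally have "\<bar>\<theta> - 1\<bar> \<le> (U * norm v) / (3 / 8)" .
    then have \<theta>: "\<bar>\<theta> - 1\<bar> \<le> 3 * U * norm v"
    proof -
      have "0 \<le> U * norm v" using U by simp
      then show ?thesis using \<open>\<bar>\<theta> - 1\<bar> \<le> (U * norm v) / (3 / 8)\<close> by (simp add: mult.assoc)
    qed
    then have \<theta>2: "\<bar>\<theta>\<bar> \<le> 2" using Uv by linarith
    have "(\<theta> - 1)\<^sup>2 \<le> (3 * U * norm v)\<^sup>2"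
      using \<theta> by (intro power2_le_iff_abs_le[THEN iffD2]) (use U in auto)
    then have sq: "(\<theta> - 1)\<^sup>2 \<le> 9 * U\<^sup>2 * (norm v)\<^sup>2" by (simp add: power_mult_distrib)
    have "norm R1 \<le> (40 * scale_bound * (9 * U\<^sup>2 * (norm v)\<^sup>2)) * norm ?u"
      unfolding R1_def
    proof (rule norm_mult_vec_le)
      fix i
      have "\<bar>(flow_scale \<theta> - 1 - s *\<^sub>R update_prob) $ i\<bar> \<le> 40 * scale_bound * (\<theta> - 1)\<^sup>2"
        unfolding s_def by (rule scale_taylor[OF \<theta>2])
      also have "\<dots> \<le> 40 * scale_bound * (9 * U\<^sup>2 * (norm v)\<^sup>2)"
        using scale_bound_pos by (intro mult_left_mono sq) auto
      finally show "\<bar>(flow_scale \<theta> - 1 - s *\<^sub>R update_prob) $ i\<bar> \<le> 40 * scale_bound * (9 * U\<^sup>2 * (norm v)\<^sup>2)" .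
    qed
    moreover have "norm R2 \<le> (40 * scale_bound * (6 * U * norm v)) * norm v"
      unfolding R2_def
    proof (rule norm_mult_vec_le)
      fix i
      have "\<bar>1 / a - 1 / r\<bar> = \<bar>\<theta> - 1\<bar> / r"
        using a r by (simp add: \<theta>_def abs_divide[symmetric] divide_simps)
      also have "\<dots> \<le> (3 * U * norm v) / (1 / 2)" using \<theta> r by (intro frac_le) auto
      finally have 1: "\<bar>1 / a - 1 / r\<bar> \<le> 6 * U * norm v" by simp
      have "\<bar>1 / a\<bar> \<le> 4" "\<bar>1 / r\<bar> \<le> 4" using a r by (auto simp: divide_simps)
      then have "\<bar>(flow_scale (1 / a) - flow_scale (1 / r)) $ i\<bar> \<le> 40 * scale_bound * \<bar>1 / a - 1 / r\<bar>"
        by (rule norm_scale_diff_le)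
      also have "\<dots> \<le> 40 * scale_bound * (6 * U * norm v)"
        using scale_bound_pos by (intro mult_left_mono 1) auto
      finally show "\<bar>(flow_scale (1 / a) - flow_scale (1 / r)) $ i\<bar> \<le> 40 * scale_bound * (6 * U * norm v)" .
    qed
    ultimately have R: "norm (R1 + R2) \<le> (40 * scale_bound * (9 * U\<^sup>2 * (norm v)\<^sup>2)) * norm ?u + (40 * scale_bound * (6 * U * norm v)) * norm v"
      by (rule order.trans[OF norm_triangle_ineq add_mono])
    have "flow_scale r * flow_scale (1 / a) = flow_scale \<theta>"
      by (simp add: scale_mult \<theta>_def)
    moreover have "y - J k = ?u * flow_scale r + v"
      by (simp add: y_def \<gamma>_def)
    ultimately have "xi k y = ?u * flow_scale \<theta> + v * flow_scale (1 / a) - ?u"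
      unfolding xi_def a_def[symmetric] by (simp only: distrib_right mult.assoc)
    moreover have "?u * (s *\<^sub>R update_prob) = (- s) *\<^sub>R f k (x k)"
      by (simp add: f_def vec_eq_iff algebra_simps)
    ultimately have "xi k y - v * flow_scale (1 / r) = (- s) *\<^sub>R f k (x k) + (R1 + R2)"
      by (simp add: R1_def R2_def algebra_simps)
    then have "NV k (xi k y - v * flow_scale (1 / r)) \<le> NV k ((- s) *\<^sub>R f k (x k)) + NV k (R1 + R2)"
      by (simp only: NV_triangle)
    also have "\<dots> \<le> C * norm (R1 + R2)"
      using NV_le[of k "R1 + R2"] by (simp add: NV_scaleR NV_flow del: scaleR_minus_left)
    also have "\<dots> \<le> C * ((40 * scale_bound * (9 * U\<^sup>2 * (norm v)\<^sup>2)) * norm ?u + (40 * scale_bound * (6 * U * norm v)) * norm v)"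
      using C by (intro mult_left_mono R) auto
    also have "\<dots> = ?Q * (norm v)\<^sup>2"
      by (simp add: algebra_simps power2_eq_square)
    finally show ?thesis
      using order.trans[OF NV_diff[of k "xi k y" "v * flow_scale (1 / r)"]] by (simp add: V_def y_def)
  qed
  moreover have "0 \<le> ?Q" using C U scale_bound_pos by (intro mult_nonneg_nonneg add_nonneg_nonneg) auto
  ultimately show ?thesis unfolding U_def by (intro exI[of _ ?Q]) (simp add: U_def)
qed

text \<open>\<open>NV\<close> controls a displacement only modulo the flow direction. Inside the
  switching plane the missing component is recovered from the positive crossing rate
  \<open>\<gamma>0\<close>.\<close>

lemma plane_lower_bound:
  "\<exists>K\<ge>1. \<forall>a. g (Suc k) \<bullet> (a * flow_scale (z k)) = 0 \<longrightarrow> norm (a * flow_scale (z k)) \<le> K * NV k a"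
proof -
  let ?F = "f k (x k)"
  have F1: "?F $ 1 \<noteq> 0"
    using u1[of k] by (simp add: f_def update_prob_component)
  have Fz: "?F * flow_scale (z k) = f k (x (Suc k))"
    by (simp add: f_def x_Suc \<gamma>_def vec_eq_iff algebra_simps)
  define \<gamma>0 where "\<gamma>0 = g (Suc k) \<bullet> f k (x (Suc k))"
  have \<gamma>0: "0 < \<gamma>0" using rate(1) by (simp add: \<gamma>0_def)
  define K where "K = (norm (g (Suc k)) * norm (f k (x (Suc k))) / \<gamma>0 + 1) * scale_bound * C + 1"
  have "norm (a * flow_scale (z k)) \<le> K * NV k a" if a: "g (Suc k) \<bullet> (a * flow_scale (z k)) = 0" for a
  proof -
    define s where "s = a $ 1 / ?F $ 1"
    define w where "w = a - s *\<^sub>R ?F"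
    have "w $ 1 = 0" using F1 by (simp add: w_def s_def)
    then have "norm w \<le> C * NV k w" by (rule NV_ge)
    also have "NV k w \<le> NV k a + NV k ((- s) *\<^sub>R ?F)"
      using NV_triangle[of k a "(- s) *\<^sub>R ?F"] by (simp add: w_def)
    also have "\<dots> = NV k a" by (simp only: NV_scaleR NV_flow)
    finally have w: "norm w \<le> C * NV k a" using C by (simp add: mult_left_mono)
    have "norm (flow_scale (z k) * w) \<le> scale_bound * norm w"
      using z[of k] by (intro norm_mult_vec_le abs_scale_le) auto
    also have "\<dots> \<le> scale_bound * (C * NV k a)"
      using scale_bound_pos by (intro mult_left_mono w) auto
    finally have wz: "norm (w * flow_scale (z k)) \<le> scale_bound * C * NV k a" (is "?n \<le> ?b") by (simp add: mult_ac)
    have eq: "a * flow_scale (z k) = s *\<^sub>R f k (x (Suc k)) + w * flow_scale (z k)"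
      by (simp add: w_def Fz[symmetric] vec_eq_iff algebra_simps)
    then have "s * \<gamma>0 = - (g (Suc k) \<bullet> (w * flow_scale (z k)))"
      using a by (simp add: \<gamma>0_def inner_add_right)
    then have "\<bar>s\<bar> * \<gamma>0 \<le> norm (g (Suc k)) * ?n"
      using Cauchy_Schwarz_ineq2[of "g (Suc k)" "w * flow_scale (z k)"] \<gamma>0
      by (metis abs_minus_cancel abs_mult abs_of_pos)
    then have s: "\<bar>s\<bar> \<le> norm (g (Suc k)) * ?n / \<gamma>0" using \<gamma>0 by (simp add: le_divide_eq)
    have "norm (a * flow_scale (z k)) \<le> \<bar>s\<bar> * norm (f k (x (Suc k))) + ?n"
      unfolding eq using norm_triangle_ineq[of "s *\<^sub>R f k (x (Suc k))" "w * flow_scale (z k)"] by simp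
    also have "\<dots> \<le> (norm (g (Suc k)) * ?n / \<gamma>0) * norm (f k (x (Suc k))) + ?n"
      by (intro add_right_mono mult_right_mono s) auto
    also have "\<dots> = (norm (g (Suc k)) * norm (f k (x (Suc k))) / \<gamma>0 + 1) * ?n"
      by (simp add: algebra_simps)
    also have "\<dots> \<le> (norm (g (Suc k)) * norm (f k (x (Suc k))) / \<gamma>0 + 1) * ?b"
      using \<gamma>0 by (intro mult_left_mono wz) auto
    also have "\<dots> \<le> K * NV k a"
      using NV_nonneg[of k a] by (simp add: K_def algebra_simps)
    finally show ?thesis .
  qed
  moreover have "1 \<le> K"
    using \<gamma>0 C scale_bound_pos by (simp add: K_def)
  ultimately show ?thesis by blast
qed

text \<open>Linearizing the old and the new distance at the switching point turns
  \<open>contraction\<close> into a nonlinear estimate. On the plane the displacement is at most 2 K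
  V, so the quadratic errors are small multiples of V and fit between \<rho> and (1 +
  \<rho>)/2.\<close>

lemma crossing_decrease:
  "\<exists>\<kappa>>0. \<forall>\<kappa>'. 0 < \<kappa>' \<and> \<kappa>' \<le> \<kappa> \<longrightarrow> (\<forall>y. dist y (x (Suc k)) \<le> \<kappa>' \<and> e (Suc k) y = 0 \<longrightarrow> V (Suc k) y \<le> (1 + \<rho>) / 2 * V k y)"
proof -
  have zk: "1 / 2 \<le> z k" "z k \<le> 1" "z k \<noteq> 0" using z[of k] by auto
  obtain Q1 where Q1: "0 \<le> Q1" "\<And>v. norm v \<le> 1 / (8 * u_inv k) \<Longrightarrow>
      \<bar>V k (\<gamma> k (z k) + v) - NV k (v * flow_scale (1 / z k))\<bar> \<le> Q1 * (norm v)\<^sup>2"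
    using xi_linearization[OF zk(1,2)] by blast
  obtain Q2 where Q2: "0 \<le> Q2" "\<And>v. norm v \<le> 1 / (8 * u_inv (Suc k)) \<Longrightarrow>
      \<bar>V (Suc k) (\<gamma> (Suc k) 1 + v) - NV (Suc k) (v * flow_scale (1 / 1))\<bar> \<le> Q2 * (norm v)\<^sup>2"
    using xi_linearization[of 1 "Suc k"] by auto
  obtain K where K: "1 \<le> K" "\<And>a. g (Suc k) \<bullet> (a * flow_scale (z k)) = 0 \<Longrightarrow> norm (a * flow_scale (z k)) \<le> K * NV k a"
    using plane_lower_bound[of k] by blast
  \<comment> \<open>M n is the relative size of the quadratic errors at distance n. The bound 1/(2
    M) on \<kappa> yields n \<le> 2 K V, and (1 - \<rho>)/(2 M) leaves the factor (1 +
    \<rho>)/2.\<close>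
  define M where "M = 2 * K * (Q1 + Q2) + K * Q1 + 1"
  have M: "1 \<le> M" using K Q1 Q2 by (simp add: M_def)
  obtain \<kappa> where \<kappa>: "0 < \<kappa>" "\<kappa> \<le> 1 / (8 * u_inv k)" "\<kappa> \<le> 1 / (8 * u_inv (Suc k))" "\<kappa> \<le> 1 / (2 * M)"
      "\<kappa> \<le> (1 - \<rho>) / (2 * M)"
    using u_inv_pos[of k] u_inv_pos[of "Suc k"] M \<rho>
    by (auto intro: common_lower_bound[of "1 / (8 * u_inv k)" "1 / (8 * u_inv (Suc k))" "1 / (2 * M)" "(1 - \<rho>) / (2 * M)"])
  have "V (Suc k) y \<le> (1 + \<rho>) / 2 * V k y" if y: "dist y (x (Suc k)) \<le> \<kappa>" "e (Suc k) y = 0" for y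
  proof -
    define v where "v = y - x (Suc k)"
    define n where "n = norm v"
    have n: "n \<le> \<kappa>" "0 \<le> n" using y by (simp_all add: n_def v_def dist_norm)
    have yv: "y = \<gamma> k (z k) + v" "y = \<gamma> (Suc k) 1 + v" by (simp_all add: v_def x_Suc)
    define a where "a = v * flow_scale (1 / z k)"
    have av: "a * flow_scale (z k) = v"
      using zk(3) by (simp add: a_def mult.assoc scale_mult)
    have "e (Suc k) y - e (Suc k) (x (Suc k)) = g (Suc k) \<bullet> v"
      by (simp add: e_def v_def inner_diff_right)
    then have g0: "g (Suc k) \<bullet> (a * flow_scale (z k)) = 0"
      using y(2) e_start(1)[of "Suc k"] by (simp add: av)
    have 1: "\<bar>V k y - NV k a\<bar> \<le> Q1 * n\<^sup>2"
      using Q1(2)[of v] n \<kappa> unfolding yv(1) a_def n_def by simp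
    have 2: "\<bar>V (Suc k) y - NV (Suc k) v\<bar> \<le> Q2 * n\<^sup>2"
      using Q2(2)[of v] n \<kappa> unfolding yv(2) n_def by simp
    have 3: "NV (Suc k) v \<le> \<rho> * NV k a" using contraction[OF g0] by (simp add: av)
    have 4: "n \<le> K * NV k a" using K(2)[OF g0] by (simp add: av n_def)
    have Mn: "M * n \<le> 1 / 2" "M * n \<le> (1 - \<rho>) / 2"
    proof -
      have "M * n \<le> M * \<kappa>" using n M by (intro mult_left_mono) auto
      also have "\<dots> \<le> M * (1 / (2 * M))" using \<kappa> M by (intro mult_left_mono) auto
      finally show "M * n \<le> 1 / 2" using M by simp
      have "M * n \<le> M * \<kappa>" using n M by (intro mult_left_mono) auto
      also have "\<dots> \<le> M * ((1 - \<rho>) / (2 * M))" using \<kappa> M by (intro mult_left_mono) auto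
      finally show "M * n \<le> (1 - \<rho>) / 2" using M by simp
    qed
    have "K * Q1 * n \<le> M * n" using K Q1 Q2 n by (intro mult_right_mono) (auto simp: M_def)
    then have "K * (Q1 * n\<^sup>2) \<le> 1 / 2 * n"
      using mult_right_mono[of "K * Q1 * n" "1 / 2" n] Mn(1) n by (simp add: power2_eq_square mult_ac)
    moreover have "K * NV k a \<le> K * (V k y + Q1 * n\<^sup>2)" using 1 K by (intro mult_left_mono) auto
    ultimately have nV: "n \<le> 2 * K * V k y" using 4 by (simp add: distrib_left)
    have "V (Suc k) y \<le> \<rho> * (V k y + Q1 * n\<^sup>2) + Q2 * n\<^sup>2"
      using 1 2 3 mult_left_mono[of "NV k a" "V k y + Q1 * n\<^sup>2" \<rho>] \<rho> by linarith
    also have "\<dots> \<le> \<rho> * V k y + (Q1 + Q2) * n\<^sup>2"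
      using mult_right_mono[of \<rho> 1 "Q1 * n\<^sup>2"] \<rho> Q1 by (simp add: algebra_simps)
    also have "(Q1 + Q2) * n\<^sup>2 \<le> (Q1 + Q2) * n * (2 * K * V k y)"
      using mult_left_mono[OF nV, of "(Q1 + Q2) * n"] Q1 Q2 n by (simp add: power2_eq_square mult_ac)
    also have "\<dots> = (2 * K * (Q1 + Q2) * n) * V k y" by simp
    also have "\<dots> \<le> ((1 - \<rho>) / 2) * V k y"
    proof (rule mult_right_mono[OF _ V_nonneg])
      have "2 * K * (Q1 + Q2) * n \<le> M * n" using K Q1 n by (intro mult_right_mono) (auto simp: M_def)
      then show "2 * K * (Q1 + Q2) * n \<le> (1 - \<rho>) / 2" using Mn(2) by simp
    qed
    also have "\<rho> * V k y + (1 - \<rho>) / 2 * V k y = (1 + \<rho>) / 2 * V k y" by (simp add: field_simps)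
    finally show ?thesis by simp
  qed
  then show ?thesis using \<kappa>(1) by (intro exI[of _ \<kappa>]) auto
qed

end

section \<open>The Lyapunov function and its decrease\<close>

text \<open>A discrete product rule. The gain comes from the parameter \<zeta> alone, which shrinks
  by 1 - h/50 and lowers the weighted value by \<beta> V h \<zeta>/50, at least \<beta> V h/100. The
  five Q are Q for V, 2 Q for its product with the old parameter, and Q each for the two terms with
  the error of \<zeta>.\<close>

lemma weighted_growth:
  fixes V V' \<zeta> \<zeta>' \<beta> Q h :: real
  assumes V: "0 \<le> V'" "V' \<le> V + Q" "0 \<le> V" "V \<le> 1" and Q: "0 \<le> Q" "Q \<le> 1" and \<beta>: "0 \<le> \<beta>" "\<beta> \<le> 1"
    and \<zeta>: "1 / 2 \<le> \<zeta>" "\<zeta> \<le> 2" "\<zeta>' \<le> (1 - h / 50) * \<zeta> + Q" "0 \<le> \<zeta>'" and h: "0 \<le> h" "h \<le> 1"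
  shows "V' * (1 + \<beta> * \<zeta>') \<le> V * (1 + \<beta> * \<zeta>) - \<beta> * V * h / 100 + 5 * Q"
proof -
  have h50: "0 \<le> 1 - h / 50" "1 - h / 50 \<le> 1" using h by auto
  have 1: "V' * (1 + \<beta> * \<zeta>') \<le> (V + Q) * (1 + \<beta> * ((1 - h / 50) * \<zeta> + Q))"
    using V Q \<beta> \<zeta> by (intro mult_mono add_left_mono mult_left_mono) auto
  have 2: "(V + Q) * (1 + \<beta> * ((1 - h / 50) * \<zeta> + Q)) = V * (1 + \<beta> * \<zeta>) - \<beta> * V * h * \<zeta> / 50 + (V * \<beta> * Q + Q + \<beta> * (1 - h / 50) * \<zeta> * Q + \<beta> * Q * Q)"
    by (simp add: algebra_simps)
  have 3: "V * \<beta> * Q \<le> 1 * 1 * Q" using V \<beta> Q by (intro mult_mono) auto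
  have 4: "\<beta> * (1 - h / 50) * \<zeta> * Q \<le> 1 * 1 * 2 * Q" using \<beta> h50 \<zeta> Q by (intro mult_mono) auto
  have 5: "\<beta> * Q * Q \<le> 1 * 1 * Q" using \<beta> Q by (intro mult_mono) auto
  have 6: "\<beta> * V * h * (1 / 2) / 50 \<le> \<beta> * V * h * \<zeta> / 50"
    using \<beta> V h \<zeta> by (intro divide_right_mono mult_left_mono) auto
  show ?thesis using 1 3 4 5 6 unfolding 2 by linarith
qed

context hybrid_cycle
begin

text \<open>\<open>v\<close> lies in the closed convex hull of the velocities at distance at most \<open>\<delta>\<close> from \<open>y\<close>, expressed by
  support functions.\<close>

definition inflated :: "real \<Rightarrow> real^3 \<Rightarrow> real^3 \<Rightarrow> bool" where
  "inflated \<delta> y v \<longleftrightarrow> (\<forall>a b. (\<forall>p u. dist p y \<le> \<delta> \<longrightarrow> u \<in> vel p \<longrightarrow> a \<bullet> u \<le> b) \<longrightarrow> a \<bullet> v \<le> b)"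

lemma inflatedD: "inflated \<delta> y v \<Longrightarrow> (\<And>p u. dist p y \<le> \<delta> \<Longrightarrow> u \<in> vel p \<Longrightarrow> a \<bullet> u \<le> b) \<Longrightarrow> a \<bullet> v \<le> b"
  by (auto simp: inflated_def)

lemma inflated_mono:
  assumes "inflated \<delta> y v" "dist y y' + \<delta> \<le> \<delta>'"
  shows "inflated \<delta>' y' v"
  unfolding inflated_def
proof (intro allI impI)
  fix a b assume *: "\<forall>p u. dist p y' \<le> \<delta>' \<longrightarrow> u \<in> vel p \<longrightarrow> a \<bullet> u \<le> b"
  have "dist p y' \<le> \<delta>'" if "dist p y \<le> \<delta>" for p
    using dist_triangle[of p y' y] that assms(2) by linarith
  with * show "a \<bullet> v \<le> b" by (intro inflatedD[OF assms(1)]) auto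
qed

lemma inflated_norm_le:
  assumes "inflated \<delta> y v" "\<And>p u. dist p y \<le> \<delta> \<Longrightarrow> u \<in> vel p \<Longrightarrow> norm u \<le> B" and B: "0 \<le> B"
  shows "norm v \<le> B"
proof -
  have "v \<bullet> v \<le> norm v * B"
  proof (rule inflatedD[OF assms(1)])
    fix p u assume "dist p y \<le> \<delta>" "u \<in> vel p"
    then have "norm v * norm u \<le> norm v * B" by (intro mult_left_mono assms(2)) auto
    then show "v \<bullet> u \<le> norm v * B" using norm_cauchy_schwarz[of v u] by linarith
  qed
  then have "norm v * norm v \<le> norm v * B" by (simp add: dot_square_norm power2_eq_square)
  then show ?thesis using B by (cases "v = 0") auto
qed

text \<open>Testing the hull in the direction v - f k y itself bounds the length of that vector,
  since all velocities nearby come from one field that is 1-Lipschitz.\<close>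

lemma inflated_single:
  assumes "inflated \<delta> y v" "\<And>p u. dist p y \<le> \<delta> \<Longrightarrow> u \<in> vel p \<Longrightarrow> u = f k p" and \<delta>: "0 \<le> \<delta>"
  shows "norm (v - f k y) \<le> \<delta>"
proof -
  define a where "a = v - f k y"
  have "a \<bullet> v \<le> a \<bullet> f k y + norm a * \<delta>"
  proof (rule inflatedD[OF assms(1)])
    fix p u assume p: "dist p y \<le> \<delta>" "u \<in> vel p"
    have "a \<bullet> (f k p - f k y) \<le> norm a * norm (f k p - f k y)" by (rule norm_cauchy_schwarz)
    also have "norm (f k p - f k y) \<le> \<delta>" using f_diff_le[of k p y] p by (simp add: dist_norm)
    finally show "a \<bullet> u \<le> a \<bullet> f k y + norm a * \<delta>"
      using assms(2)[OF p] by (simp add: inner_diff_right mult_left_mono)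
  qed
  then have "a \<bullet> a \<le> norm a * \<delta>"
    by (simp add: a_def inner_diff_right)
  then have "norm a * norm a \<le> norm a * \<delta>"
    by (simp add: dot_square_norm power2_eq_square)
  then show ?thesis using \<delta> unfolding a_def[symmetric] by (cases "a = 0") auto
qed

end

text \<open>The scales of the argument: \<eta> is the admissible overrun of the parameter, \<kappa>
  a radius around the switching points, m the width of the tubes, and L a common bound for Lipschitz
  constants, speeds and the Euler error. \<kappa> is adapted to \<eta>, and m to both;
  \<open>constants_exist\<close> provides them.\<close>

locale hybrid_cycle_constants = hybrid_cycle +
  fixes \<eta> \<kappa> m L :: real
  assumes \<eta>: "0 < \<eta>" "16 * \<eta> \<le> 1 - z k" "8 * \<eta> \<le> z k - 1 / 2"
    and \<kappa>: "0 < \<kappa>" "\<kappa> \<le> \<eta>" "\<kappa> \<le> 1 / 4" and m: "0 < m" and L: "1 \<le> L"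
    and localization: "z k - 2 * \<eta> \<le> zc k y \<and> zc k y \<le> 1 + 2 * \<eta> \<and> V k y \<le> m \<and> 0 \<le> e k y \<and> e (Suc k) y \<le> 0
      \<longrightarrow> m \<le> th k y \<and> z k - \<kappa> \<le> zc k y \<and> zc k y \<le> 1 + \<kappa> \<and> (- m \<le> e (Suc k) y \<longrightarrow> dist y (x (Suc k)) \<le> \<kappa>)
      \<and> (e k y \<le> m \<longrightarrow> dist y (x k) \<le> \<kappa>)"
    and neighborhood: "dist y (x (Suc k)) \<le> 2 * \<kappa> \<longrightarrow>
     2 * \<kappa> < g (Suc k) \<bullet> f k y \<and> 2 * \<kappa> < g (Suc k) \<bullet> f (Suc k) y \<and> 0 < e k y \<and> 0 < th k y \<and> 0 < th (Suc k) y
     \<and> e (Suc (Suc k)) y < 0 \<and> z k - \<eta> < zc k y \<and> zc k y < z k + \<eta> \<and> 1 - \<eta> < zc (Suc k) y \<and> zc (Suc k) y < 1 + \<eta>"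
    and decrease: "dist y (x (Suc k)) \<le> 2 * \<kappa> \<and> e (Suc k) y = 0 \<longrightarrow> V (Suc k) y \<le> (1 + \<rho>) / 2 * V k y"
    and V_lipschitz: "1 / 4 \<le> zc k y \<and> zc k y \<le> 2 \<and> V k y \<le> 1 \<and> 1 / 4 \<le> zc k y' \<longrightarrow> \<bar>V k y - V k y'\<bar> \<le> L * dist y y'"
    and lipschitz: "\<bar>zc k y - zc k y'\<bar> \<le> L * dist y y'" "\<bar>e k y - e k y'\<bar> \<le> L * dist y y'"
    and f_bound: "1 / 4 \<le> zc k y \<and> zc k y \<le> 2 \<and> V k y \<le> 1 \<longrightarrow> norm (f k y) + 1 \<le> L"
      "dist y (x (Suc k)) \<le> 1 \<longrightarrow> norm (f k y) \<le> L \<and> norm (f (Suc k) y) \<le> L"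
    and euler: "1 / 4 \<le> zc k y \<and> zc k y \<le> 2 \<and> V k y \<le> 1 \<and> 0 \<le> h \<and> h \<le> 1 \<longrightarrow>
      norm (y + h *\<^sub>R f k y - (J k + (y - J k) * flow_scale (1 - h / 50))) \<le> L * h\<^sup>2"
    and th_lipschitz: "\<bar>th k y - th k y'\<bar> \<le> L * dist y y'"
    and extension: "z k - 2 * \<eta> \<le> r \<and> r < z k \<longrightarrow> 0 < e (Suc k) (\<gamma> k r)" "1 < r \<and> r \<le> 1 + 2 * \<eta> \<longrightarrow> e k (\<gamma> k r) < 0"
begin

text \<open>The sign conditions place the point between the two planes; the parameter range,
  slightly longer than the segment, excludes other regions where the same signs may occur.\<close>

definition inside :: "nat \<Rightarrow> real^3 \<Rightarrow> bool" where
  "inside k y \<longleftrightarrow> z k - 2 * \<eta> \<le> zc k y \<and> zc k y \<le> 1 + 2 * \<eta> \<and> 0 \<le> e k y \<and> e (Suc k) y \<le> 0"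

text \<open>Small enough for (1 + \<rho>)/2 * (1 + 2 \<beta>) \<le> 1 - \<beta>: resetting the
  weight at a switch still leaves a gain.\<close>

definition \<beta> :: real where "\<beta> = (1 - \<rho>) / 8"
text \<open>Makes K2 * 2 \<kappa> h equal to \<open>5 * L\<^sup>2 * h + h\<close>: progress through
  a band outweighs the possible growth of the weighted distance and leaves a surplus h.\<close>

definition K2 :: real where "K2 = (5 * L\<^sup>2 + 1) / (2 * \<kappa>)"
text \<open>K3 * \<eta> pays, per unit of \<delta>, for the error of a switch and for the band terms
  that start afresh after it.\<close>

definition K3 :: real where "K3 = (6 * L\<^sup>2 + K2 * (4 * L + 2 * \<kappa>)) / \<eta>"
text \<open>Collects the error terms that remain per unit of h * \<delta>.\<close>

definition K4 :: real where "K4 = 10 * L\<^sup>2 + K3 * L\<^sup>2 + K2 * (4 * L + 2 * \<kappa>) + 2 * K3"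

text \<open>A Lyapunov function along the cycle, up to errors of order \<open>\<delta>\<close>. The terms with \<open>K2\<close> decrease while
  the state passes a switching plane, where the velocity may be that of the wrong segment; the
  term with \<open>K3\<close> drops by a fixed multiple of \<open>\<delta>\<close> at every switch.\<close>

definition \<Psi> :: "real \<Rightarrow> nat \<Rightarrow> real^3 \<Rightarrow> real" where
  "\<Psi> \<delta> k y = V k y * (1 + \<beta> * zc k y)
    + K2 * (min (2 * L * \<delta>) (- e (Suc k) y) + max 0 ((2 * L + 2 * \<kappa>) * \<delta> - e k y)) + K3 * \<delta> * (2 - zc k y)"

lemma constants_pos: "0 < \<beta>" "\<beta> \<le> 1" "0 < K2" "0 < K3" "0 < K4" "1 \<le> L\<^sup>2" "L \<le> L\<^sup>2"
proof -
  show 1: "0 < \<beta>" "\<beta> \<le> 1" using \<rho> by (auto simp: \<beta>_def)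
  show L2: "1 \<le> L\<^sup>2" "L \<le> L\<^sup>2" using L by (auto simp: power2_eq_square mult_ge1_I)
  show K2: "0 < K2" using \<kappa> L2 by (simp add: K2_def)
  show K3: "0 < K3" using \<eta>(1) \<kappa> L L2 K2 unfolding K3_def by (intro divide_pos_pos add_pos_pos mult_pos_pos) auto
  show "0 < K4" using \<kappa> L L2 K2 K3 unfolding K4_def by (intro add_pos_pos mult_pos_pos) auto
qed

lemma inside_zc: "inside k y \<Longrightarrow> 1 / 2 \<le> zc k y" "inside k y \<Longrightarrow> zc k y \<le> 2"
  using \<eta>(1) \<eta>(2,3)[of k] z[of k] by (auto simp: inside_def)

lemma inside_localization:
  assumes "inside k y" "V k y \<le> m"
  shows "m \<le> th k y" "z k - \<kappa> \<le> zc k y" "zc k y \<le> 1 + \<kappa>"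
    "- m \<le> e (Suc k) y \<Longrightarrow> dist y (x (Suc k)) \<le> \<kappa>" "e k y \<le> m \<Longrightarrow> dist y (x k) \<le> \<kappa>"
  using localization[of k y] assms by (auto simp: inside_def)

lemma V_le_Psi:
  assumes "inside k y" "0 \<le> \<delta>"
  shows "V k y + K3 * \<delta> * (2 - zc k y) \<le> \<Psi> \<delta> k y" "V k y \<le> \<Psi> \<delta> k y"
proof -
  have "V k y * 1 \<le> V k y * (1 + \<beta> * zc k y)"
    using V_nonneg constants_pos inside_zc[OF assms(1)] by (intro mult_left_mono) auto
  moreover have "0 \<le> K2 * (min (2 * L * \<delta>) (- e (Suc k) y) + max 0 ((2 * L + 2 * \<kappa>) * \<delta> - e k y))"
    using assms L constants_pos by (intro mult_nonneg_nonneg add_nonneg_nonneg) (auto simp: inside_def)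
  moreover have "0 \<le> K3 * \<delta> * (2 - zc k y)"
    using constants_pos inside_zc[OF assms(1)] assms by (intro mult_nonneg_nonneg) auto
  ultimately show "V k y + K3 * \<delta> * (2 - zc k y) \<le> \<Psi> \<delta> k y" "V k y \<le> \<Psi> \<delta> k y"
    by (auto simp: \<Psi>_def)
qed

lemma band_le:
  assumes "0 \<le> \<delta>" "0 \<le> e k y"
  shows "K2 * (min (2 * L * \<delta>) (- e (Suc k) y) + max 0 ((2 * L + 2 * \<kappa>) * \<delta> - e k y)) \<le> K2 * (4 * L + 2 * \<kappa>) * \<delta>"
proof -
  have "max 0 ((2 * L + 2 * \<kappa>) * \<delta> - e k y) \<le> (2 * L + 2 * \<kappa>) * \<delta>"
    using assms L \<kappa> by auto
  then have "min (2 * L * \<delta>) (- e (Suc k) y) + max 0 ((2 * L + 2 * \<kappa>) * \<delta> - e k y) \<le> 2 * L * \<delta> + (2 * L + 2 * \<kappa>) * \<delta>"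
    by (intro add_mono) auto
  also have "\<dots> = (4 * L + 2 * \<kappa>) * \<delta>" by (simp add: algebra_simps)
  finally show ?thesis
    using constants_pos by (simp add: mult.assoc mult_left_mono)
qed

lemma Psi_le:
  assumes "inside k y" "0 \<le> \<delta>"
  shows "\<Psi> \<delta> k y \<le> 3 * V k y + (K2 * (4 * L + 2 * \<kappa>) + 2 * K3) * \<delta>"
proof -
  have "\<beta> * zc k y \<le> 1 * 2"
    using constants_pos inside_zc[OF assms(1)] by (intro mult_mono) auto
  then have "V k y * (1 + \<beta> * zc k y) \<le> V k y * 3"
    using V_nonneg by (intro mult_left_mono) auto
  moreover have "K3 * \<delta> * (2 - zc k y) \<le> K3 * \<delta> * 2"
    using constants_pos inside_zc[OF assms(1)] assms(2) by (intro mult_left_mono) auto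
  moreover note band_le[OF assms(2), of k y]
  ultimately show ?thesis
    using assms(1) by (simp add: \<Psi>_def inside_def algebra_simps)
qed

text \<open>Within 2 \<kappa> of a switching point only the two adjacent fields occur as extreme
  velocities, and both cross with speed above 2 \<kappa>; half-space and norm bounds pass to the
  hull. The index j + 5 plays the role of j - 1.\<close>

lemma near_velocity:
  assumes "dist y (x j) \<le> \<kappa>" "inflated \<delta> y v" "\<delta> \<le> \<kappa>"
  shows "2 * \<kappa> \<le> g j \<bullet> v" "norm v \<le> L"
proof -
  define k where "k = j + 5"
  have j6: "j + 6 = Suc k" by (simp add: k_def)
  have xj: "x j = x (Suc k)" and gj: "g j = g (Suc k)"
    using periodic(2,3)[of j] unfolding j6 by auto
  have p: "dist p (x (Suc k)) \<le> 2 * \<kappa>" if "dist p y \<le> \<delta>" for p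
    using dist_triangle[of p "x (Suc k)" y] that assms unfolding xj by linarith
  have u: "u = f k p \<or> u = f (Suc k) p" if "dist p y \<le> \<delta>" "u \<in> vel p" for p u
    using neighborhood[of p k] p[OF that(1)] vel_switch[OF that(2), of k] by blast
  have "(- g j) \<bullet> v \<le> - 2 * \<kappa>"
  proof (rule inflatedD[OF assms(2)])
    fix p u assume *: "dist p y \<le> \<delta>" "u \<in> vel p"
    then show "(- g j) \<bullet> u \<le> - 2 * \<kappa>"
      using u[OF *] neighborhood[of p k] p[OF *(1)] unfolding gj by auto
  qed
  then show "2 * \<kappa> \<le> g j \<bullet> v" by simp
  show "norm v \<le> L"
  proof (rule inflated_norm_le[OF assms(2)])
    fix p u assume *: "dist p y \<le> \<delta>" "u \<in> vel p"
    have "dist p (x (Suc k)) \<le> 1" using p[OF *(1)] \<kappa> by linarith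
    then show "norm u \<le> L" using u[OF *] f_bound(2)[of p k] by auto
  qed (use L in auto)
qed

text \<open>An event function varies by at most L \<delta> over the distance \<delta>, so at depth 2
  L \<delta> from both planes no point of the \<delta>-ball uses another policy.\<close>

lemma pure_velocity:
  assumes y: "inside k y" "V k y \<le> m" and v: "inflated \<delta> y v" and \<delta>: "0 < \<delta>" "L * \<delta> < m"
    and e: "2 * L * \<delta> \<le> e k y" "e (Suc k) y \<le> - (2 * L * \<delta>)"
  shows "norm (v - f k y) \<le> \<delta>"
proof (rule inflated_single[OF v])
  fix p u assume p: "dist p y \<le> \<delta>" and u: "u \<in> vel p"
  have Ld: "L * dist p y \<le> L * \<delta>" "0 < L * \<delta>" using p L \<delta> by auto
  show "u = f k p"
    using lipschitz(2)[of k p y] lipschitz(2)[of "Suc k" p y] th_lipschitz[of k p y] e Ld \<delta>(2) inside_localization(1)[OF y]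
    by (intro vel_inside[OF u]) linarith+
qed (use \<delta> in auto)

text \<open>Steps are bounded by the same \<delta> that bounds the inflation, so the quadratic error
  of an Euler step is also of order h * \<delta>.\<close>

context
  fixes \<delta> h :: real
  assumes \<delta>: "0 < \<delta>" "10 * L\<^sup>2 * \<delta> \<le> m" "10 * L\<^sup>2 * \<delta> \<le> \<kappa>" "10 * L\<^sup>2 * \<delta> \<le> 1" and h: "0 < h" "h \<le> \<delta>"
begin

lemma delta_bounds: "10 * \<delta> \<le> \<kappa>" "\<delta> \<le> 1" "10 * (L\<^sup>2 * h) \<le> \<kappa>" "10 * (L\<^sup>2 * h) \<le> m" "10 * (L\<^sup>2 * h) \<le> 1"
  "10 * (L * \<delta>) \<le> m" "L * h \<le> L\<^sup>2 * h" "h \<le> 1" "10 * (L\<^sup>2 * \<delta>) \<le> 1" "10 * (L\<^sup>2 * \<delta>) \<le> \<kappa>"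
proof -
  have "1 * \<delta> \<le> L\<^sup>2 * \<delta>" "L * \<delta> \<le> L\<^sup>2 * \<delta>" "L\<^sup>2 * h \<le> L\<^sup>2 * \<delta>"
    using constants_pos(6,7) \<delta>(1) h by (intro mult_right_mono mult_left_mono; simp)+
  then show "10 * \<delta> \<le> \<kappa>" "\<delta> \<le> 1" "10 * (L\<^sup>2 * h) \<le> \<kappa>" "10 * (L\<^sup>2 * h) \<le> m" "10 * (L\<^sup>2 * h) \<le> 1"
    "10 * (L * \<delta>) \<le> m" "10 * (L\<^sup>2 * \<delta>) \<le> 1" "10 * (L\<^sup>2 * \<delta>) \<le> \<kappa>"
    using \<delta>(2-4) unfolding mult.assoc by linarith+
  then show "h \<le> 1" using h by simp
  show "L * h \<le> L\<^sup>2 * h" using constants_pos(7) h by (intro mult_right_mono) auto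
qed

lemma step_norm:
  assumes y: "inside k y" "V k y \<le> m" "V k y \<le> 1" and v: "inflated \<delta> y v"
  shows "norm v \<le> L" "dist (y + h *\<^sub>R v) y \<le> L * h"
proof -
  show n: "norm v \<le> L"
  proof (cases "2 * L * \<delta> \<le> e k y \<and> e (Suc k) y \<le> - (2 * L * \<delta>)")
    case True
    have "norm (v - f k y) \<le> \<delta>"
      using True \<delta> delta_bounds m by (intro pure_velocity y v) auto
    moreover have "norm (f k y) + 1 \<le> L" using f_bound(1)[of k y] inside_zc[OF y(1)] y(3) by simp
    ultimately show ?thesis using norm_triangle_ineq2[of v "f k y"] delta_bounds by linarith
  next
    case False
    then have "dist y (x k) \<le> \<kappa> \<or> dist y (x (Suc k)) \<le> \<kappa>"
      using inside_localization(4,5)[OF y(1,2)] delta_bounds(6) m by (auto simp: mult.assoc not_le)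
    then show ?thesis
      using near_velocity(2)[OF _ v] delta_bounds \<delta> by (metis (no_types) \<kappa>(1) linorder_le_cases mult_le_cancel_right1 order_trans one_le_numeral less_imp_le)
  qed
  then show "dist (y + h *\<^sub>R v) y \<le> L * h"
    using h by (simp add: dist_norm mult.commute mult_left_mono)
qed


text \<open>Far from the end plane the minimum in \<Psi> is saturated and cannot grow. The loss
  \<beta> V h/100 becomes a rate for \<Psi> through \<Psi> \<le> 3 V + O(\<delta>), whence the
  constant \<beta>/300.\<close>

lemma Psi_step_drift:
  assumes y: "inside k y" "\<Psi> \<delta> k y \<le> 1" and y': "0 \<le> e k y'"
    and V': "V k y' \<le> V k y + 2 * L\<^sup>2 * h * \<delta>" and zc': "zc k y' \<le> (1 - h / 50) * zc k y + 2 * L\<^sup>2 * h * \<delta>"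
      "zc k y - L\<^sup>2 * h \<le> zc k y'" "0 \<le> zc k y'"
    and band: "2 * L * \<delta> \<le> - e (Suc k) y"
      "max 0 ((2 * L + 2 * \<kappa>) * \<delta> - e k y') \<le> max 0 ((2 * L + 2 * \<kappa>) * \<delta> - e k y)"
  shows "\<Psi> \<delta> k y' \<le> (1 - \<beta> / 300 * h) * \<Psi> \<delta> k y + K4 * h * \<delta>"
proof -
  have V1: "V k y \<le> 1" using V_le_Psi(2)[OF y(1), of \<delta>] y(2) \<delta> by simp
  have Q: "0 \<le> 2 * L\<^sup>2 * h * \<delta>" "2 * L\<^sup>2 * h * \<delta> \<le> 1"
  proof -
    show "0 \<le> 2 * L\<^sup>2 * h * \<delta>" using h \<delta> by simp
    have "L\<^sup>2 * h * \<delta> \<le> 1 / 10 * 1" using delta_bounds(2,5) h \<delta> by (intro mult_mono) auto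
    then show "2 * L\<^sup>2 * h * \<delta> \<le> 1" by simp
  qed
  have 1: "V k y' * (1 + \<beta> * zc k y') \<le> V k y * (1 + \<beta> * zc k y) - \<beta> * V k y * h / 100 + 5 * (2 * L\<^sup>2 * h * \<delta>)"
    using Q V1 V' zc' V_nonneg constants_pos inside_zc[OF y(1)] h delta_bounds(8) by (intro weighted_growth) auto
  have "min (2 * L * \<delta>) (- e (Suc k) y') + max 0 ((2 * L + 2 * \<kappa>) * \<delta> - e k y')
      \<le> min (2 * L * \<delta>) (- e (Suc k) y) + max 0 ((2 * L + 2 * \<kappa>) * \<delta> - e k y)"
    using band by (intro add_mono) auto
  then have 2: "K2 * (min (2 * L * \<delta>) (- e (Suc k) y') + max 0 ((2 * L + 2 * \<kappa>) * \<delta> - e k y'))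
      \<le> K2 * (min (2 * L * \<delta>) (- e (Suc k) y) + max 0 ((2 * L + 2 * \<kappa>) * \<delta> - e k y))"
    using constants_pos(3) by (intro mult_left_mono) auto
  have 3: "K3 * \<delta> * (2 - zc k y') \<le> K3 * \<delta> * (2 - zc k y) + K3 * L\<^sup>2 * h * \<delta>"
    using mult_left_mono[of "2 - zc k y'" "2 - zc k y + L\<^sup>2 * h" "K3 * \<delta>"] zc' constants_pos \<delta>
    by (simp add: algebra_simps)
  have "\<Psi> \<delta> k y' \<le> \<Psi> \<delta> k y - \<beta> * V k y * h / 100 + (10 * L\<^sup>2 + K3 * L\<^sup>2) * h * \<delta>"
    using 1 2 3 by (simp add: \<Psi>_def algebra_simps)
  moreover have "\<beta> * h / 300 * \<Psi> \<delta> k y \<le> \<beta> * h / 300 * (3 * V k y + (K2 * (4 * L + 2 * \<kappa>) + 2 * K3) * \<delta>)"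
    using Psi_le[OF y(1), of \<delta>] constants_pos h \<delta> by (intro mult_left_mono) auto
  moreover have "\<beta> * h / 300 * ((K2 * (4 * L + 2 * \<kappa>) + 2 * K3) * \<delta>) \<le> h * ((K2 * (4 * L + 2 * \<kappa>) + 2 * K3) * \<delta>)"
  proof (rule mult_right_mono)
    have "\<beta> * h \<le> 1 * h" using constants_pos h by (intro mult_right_mono) auto
    then show "\<beta> * h / 300 \<le> h" using h by simp
    show "0 \<le> (K2 * (4 * L + 2 * \<kappa>) + 2 * K3) * \<delta>"
      using constants_pos L \<kappa> \<delta> by (intro mult_nonneg_nonneg add_nonneg_nonneg) auto
  qed
  ultimately show ?thesis by (simp add: K4_def algebra_simps)
qed

text \<open>In a band the velocity may be that of the wrong segment, and V may grow at speed
  \<open>L\<^sup>2\<close>. K2 converts the progress 2 \<kappa> h through the band into more than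
  that growth; the surplus h covers the rate because \<Psi> \<le> 1.\<close>

lemma Psi_step_band:
  assumes y: "inside k y" "\<Psi> \<delta> k y \<le> 1"
    and V': "V k y' \<le> V k y + L\<^sup>2 * h" and zc': "\<bar>zc k y' - zc k y\<bar> \<le> L\<^sup>2 * h"
    and band: "min (2 * L * \<delta>) (- e (Suc k) y') + max 0 ((2 * L + 2 * \<kappa>) * \<delta> - e k y')
      \<le> min (2 * L * \<delta>) (- e (Suc k) y) + max 0 ((2 * L + 2 * \<kappa>) * \<delta> - e k y) - 2 * \<kappa> * h"
  shows "\<Psi> \<delta> k y' \<le> (1 - \<beta> / 300 * h) * \<Psi> \<delta> k y + K4 * h * \<delta>"
proof -
  have V1: "V k y \<le> 1" using V_le_Psi(2)[OF y(1), of \<delta>] y(2) \<delta> by simp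
  have z1: "1 / 2 \<le> zc k y" "zc k y \<le> 2" using inside_zc[OF y(1)] by auto
  have "V k y' * (1 + \<beta> * zc k y') \<le> V k y * (1 + \<beta> * (zc k y)) - \<beta> * V k y * 0 / 100 + 5 * (L\<^sup>2 * h)"
    using V1 V' zc' V_nonneg constants_pos z1 h delta_bounds(5) by (intro weighted_growth) auto
  then have 1: "V k y' * (1 + \<beta> * zc k y') \<le> V k y * (1 + \<beta> * zc k y) + 5 * (L\<^sup>2 * h)" by simp
  have 2: "K2 * (min (2 * L * \<delta>) (- e (Suc k) y') + max 0 ((2 * L + 2 * \<kappa>) * \<delta> - e k y'))
      \<le> K2 * (min (2 * L * \<delta>) (- e (Suc k) y) + max 0 ((2 * L + 2 * \<kappa>) * \<delta> - e k y) - 2 * \<kappa> * h)"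
    using constants_pos(3) by (intro mult_left_mono band) auto
  have K: "K2 * (2 * \<kappa> * h) = 5 * (L\<^sup>2 * h) + h"
    using \<kappa> by (simp add: K2_def field_simps)
  have 3: "K3 * \<delta> * (2 - zc k y') \<le> K3 * \<delta> * (2 - zc k y) + K3 * L\<^sup>2 * h * \<delta>"
    using mult_left_mono[of "2 - zc k y'" "2 - zc k y + L\<^sup>2 * h" "K3 * \<delta>"] zc' constants_pos \<delta>
    by (simp add: algebra_simps)
  have 4: "\<Psi> \<delta> k y' \<le> \<Psi> \<delta> k y - h + K3 * L\<^sup>2 * h * \<delta>"
    using 1 2 3 K by (simp add: \<Psi>_def algebra_simps)
  have 5: "\<beta> / 300 * h * \<Psi> \<delta> k y \<le> h"
  proof -
    have "0 \<le> \<Psi> \<delta> k y" using V_le_Psi(2)[OF y(1), of \<delta>] V_nonneg[of k y] \<delta> by linarith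
    then have "\<beta> / 300 * h * \<Psi> \<delta> k y \<le> (1 * h) * 1"
      using y(2) constants_pos h by (intro mult_mono) auto
    then show ?thesis by simp
  qed
  have 6: "K3 * L\<^sup>2 * h * \<delta> \<le> K4 * h * \<delta>"
    using constants_pos L \<kappa> h \<delta> by (intro mult_right_mono) (auto simp: K4_def)
  show ?thesis using 4 5 6 by (simp add: algebra_simps)
qed

text \<open>The step is cut at its intersection p with the plane: the old distance is compared up to
  p, \<open>decrease\<close> applies at p, and the new distance is compared from p on. Errors of
  order \<delta>, including the new band terms, are paid by the term with K3, because the parameter
  jumps from near z k to near 1.\<close>

lemma Psi_switch:
  assumes y: "inside k y" "\<Psi> \<delta> k y \<le> 1 / 2" "\<Psi> \<delta> k y \<le> m" and v: "inflated \<delta> y v"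
    and cross: "0 < e (Suc k) (y + h *\<^sub>R v)"
  shows "inside (Suc k) (y + h *\<^sub>R v)" "\<Psi> \<delta> (Suc k) (y + h *\<^sub>R v) \<le> (1 - \<beta> / 300 * h) * \<Psi> \<delta> k y"
proof -
  define y' where "y' = y + h *\<^sub>R v"
  have \<delta>0: "0 \<le> \<delta>" using \<delta> by simp
  note VPsi = V_le_Psi[OF y(1) \<delta>0]
  have Vm: "V k y \<le> m" and V2: "V k y \<le> 1 / 2" using VPsi(2) y by auto
  have V1: "V k y \<le> 1" using V2 by simp
  have step: "norm v \<le> L" "dist y' y \<le> L * h"
    using step_norm[OF y(1) Vm V1 v] by (auto simp: y'_def)
  have Lh: "L * (L * h) = L\<^sup>2 * h" by (simp add: power2_eq_square)
  have e_y: "e (Suc k) y \<le> 0" using y(1) by (simp add: inside_def)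
  have "\<bar>e (Suc k) y' - e (Suc k) y\<bar> \<le> L * (L * h)"
    using lipschitz(2)[of "Suc k" y' y] mult_left_mono[OF step(2), of L] L by linarith
  then have "- m \<le> e (Suc k) y" using cross delta_bounds(4) m unfolding Lh y'_def by linarith
  then have near: "dist y (x (Suc k)) \<le> \<kappa>" by (rule inside_localization(4)[OF y(1) Vm])
  define s where "s = - e (Suc k) y / (g (Suc k) \<bullet> v)"
  define p where "p = y + s *\<^sub>R v"
  have gv: "0 < g (Suc k) \<bullet> v"
    using near_velocity(1)[OF near v] delta_bounds(1) \<kappa> \<delta> by linarith
  have e_line: "e (Suc k) (y + r *\<^sub>R v) = e (Suc k) y + r * (g (Suc k) \<bullet> v)" for r
    by (simp add: e_def inner_add_right)
  have s: "0 \<le> s" "s \<le> h"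
  proof -
    have "- e (Suc k) y \<le> h * (g (Suc k) \<bullet> v)" using cross unfolding e_line by linarith
    then show "s \<le> h" unfolding s_def using gv by (rule pos_divide_le_eq[THEN iffD2, rotated])
    show "0 \<le> s" unfolding s_def using e_y gv by (intro divide_nonneg_pos) auto
  qed
  have ep: "e (Suc k) p = 0" unfolding p_def e_line using gv by (simp add: s_def)
  have py: "dist p y \<le> L * h" and py': "dist y' p \<le> L * h"
  proof -
    have "dist p y = s * norm v" using s by (simp add: p_def dist_norm)
    also have "\<dots> \<le> h * L" using s step L by (intro mult_mono) auto
    finally show "dist p y \<le> L * h" by (simp add: mult.commute)
    have "y' - p = (h - s) *\<^sub>R v" by (simp add: y'_def p_def algebra_simps)
    then have "dist y' p = (h - s) * norm v" using s by (simp add: dist_norm)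
    also have "\<dots> \<le> h * L" using s step L by (intro mult_mono) auto
    finally show "dist y' p \<le> L * h" by (simp add: mult.commute)
  qed
  have Lhk: "L * h \<le> \<kappa> / 10" using delta_bounds(3,7) by linarith
  have near_p: "dist p (x (Suc k)) \<le> 2 * \<kappa>" and near_y': "dist y' (x (Suc k)) \<le> 2 * \<kappa>"
    using dist_triangle[of p "x (Suc k)" y] dist_triangle[of y' "x (Suc k)" y] py step(2) near Lhk \<kappa> by linarith+
  have near_y: "dist y (x (Suc k)) \<le> 2 * \<kappa>" using near \<kappa> by simp
  note np = neighborhood[of p k, THEN mp, OF near_p] and ny = neighborhood[of y k, THEN mp, OF near_y]
    and ny' = neighborhood[of y' k, THEN mp, OF near_y']
  have zk: "1 / 2 < z k" "z k < 1" "16 * \<eta> \<le> 1 - z k" "8 * \<eta> \<le> z k - 1 / 2" using z[of k] \<eta>(2,3)[of k] by auto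
  have zs: "1 / 2 < z (Suc k)" "z (Suc k) < 1" "16 * \<eta> \<le> 1 - z (Suc k)" using z[of "Suc k"] \<eta>(2)[of "Suc k"] by auto
  have "\<bar>V k y - V k p\<bar> \<le> L * dist y p"
    using V_lipschitz[of k y p] inside_zc[OF y(1)] V1 np zk \<eta>(1) by simp
  then have Vp: "V k p \<le> V k y + L\<^sup>2 * h"
    using py mult_left_mono[OF py, of L] L unfolding dist_commute[of y p] Lh by linarith
  have \<rho>2: "0 \<le> (1 + \<rho>) / 2" "(1 + \<rho>) / 2 \<le> 1" using \<rho> by auto
  have Vp1: "V (Suc k) p \<le> (1 + \<rho>) / 2 * (V k y + L\<^sup>2 * h)"
    using decrease[of p k] near_p ep mult_left_mono[OF Vp \<rho>2(1)] by simp
  also have le: "\<dots> \<le> (1 + \<rho>) / 2 * V k y + L\<^sup>2 * h"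
    using mult_right_mono[OF \<rho>2(2), of "L\<^sup>2 * h"] h by (simp add: distrib_left)
  finally have Vp2: "V (Suc k) p \<le> (1 + \<rho>) / 2 * V k y + L\<^sup>2 * h" .
  have "(1 + \<rho>) / 2 * V k y \<le> 1 * (1 / 2)" using \<rho>2 V2 V_nonneg by (intro mult_mono) auto
  then have Vp3: "V (Suc k) p \<le> 1" using Vp2 delta_bounds(5) by linarith
  have "\<bar>V (Suc k) p - V (Suc k) y'\<bar> \<le> L * dist p y'"
    using V_lipschitz[of "Suc k" p y'] Vp3 np ny' zk \<eta>(1) by simp
  then have Vy': "V (Suc k) y' \<le> (1 + \<rho>) / 2 * V k y + 2 * (L\<^sup>2 * h)"
    using Vp2 mult_left_mono[OF py', of L] L unfolding dist_commute[of p y'] Lh by linarith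
  have ins: "inside (Suc k) y'"
    unfolding inside_def using ny' cross zs \<eta>(1) by (auto simp: y'_def)
  then show "inside (Suc k) (y + h *\<^sub>R v)" by (simp add: y'_def)
  have zc'2: "zc (Suc k) y' \<le> 2" using inside_zc(2)[OF ins] .
  have \<beta>z: "1 + \<beta> * zc (Suc k) y' \<le> 1 + 2 * \<beta>" "0 \<le> 1 + \<beta> * zc (Suc k) y'"
    using mult_left_mono[OF zc'2, of \<beta>] constants_pos inside_zc(1)[OF ins] by auto
  have "V (Suc k) y' * (1 + \<beta> * zc (Suc k) y') \<le> ((1 + \<rho>) / 2 * V k y + 2 * (L\<^sup>2 * h)) * (1 + 2 * \<beta>)"
    using Vy' \<beta>z V_nonneg \<rho>2 h by (intro mult_mono) auto
  also have "\<dots> = ((1 + \<rho>) / 2 * (1 + 2 * \<beta>)) * V k y + 2 * (1 + 2 * \<beta>) * (L\<^sup>2 * h)"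
  proof -
    have "(p * a + 2 * q) * r = (p * r) * a + 2 * r * q" for p a q r :: real by (simp add: algebra_simps)
    then show ?thesis .
  qed
  also have "((1 + \<rho>) / 2 * (1 + 2 * \<beta>)) * V k y \<le> (1 - \<beta>) * V k y"
  proof (rule mult_right_mono[OF _ V_nonneg])
    have "(1 + \<rho>) / 2 * (2 * \<beta>) \<le> 1 * (2 * \<beta>)" using \<rho>2 constants_pos by (intro mult_right_mono) auto
    then have "(1 + \<rho>) / 2 * (1 + 2 * \<beta>) \<le> (1 + \<rho>) / 2 + 2 * \<beta>" by (simp add: distrib_left)
    also have "\<dots> \<le> 1 - \<beta>" using \<rho> by (simp add: \<beta>_def field_simps)
    finally show "(1 + \<rho>) / 2 * (1 + 2 * \<beta>) \<le> 1 - \<beta>" .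
  qed
  also have "2 * (1 + 2 * \<beta>) * (L\<^sup>2 * h) \<le> 6 * (L\<^sup>2 * \<delta>)"
    using constants_pos h by (intro mult_mono) auto
  finally have 1: "V (Suc k) y' * (1 + \<beta> * zc (Suc k) y') \<le> (1 - \<beta>) * V k y + 6 * (L\<^sup>2 * \<delta>)" by simp
  have 2: "K2 * (min (2 * L * \<delta>) (- e (Suc (Suc k)) y') + max 0 ((2 * L + 2 * \<kappa>) * \<delta> - e (Suc k) y')) \<le> K2 * (4 * L + 2 * \<kappa>) * \<delta>"
    using cross by (intro band_le[OF \<delta>0]) (simp add: y'_def)
  have 3: "K3 * \<delta> * (2 - zc (Suc k) y') \<le> K3 * \<delta> * (1 + \<eta>)"
    using ny' constants_pos \<delta>0 by (intro mult_left_mono) auto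
  define \<mu> where "\<mu> = \<beta> / 300 * h"
  have "\<beta> * h \<le> 1 * (\<kappa> / 10)" using constants_pos h \<delta> delta_bounds(1) by (intro mult_mono) auto
  moreover have "\<beta> * h \<le> \<beta> * 1" "0 \<le> \<beta> * h"
    using constants_pos h delta_bounds(8) by (auto intro!: mult_left_mono mult_nonneg_nonneg)
  ultimately have \<mu>: "0 \<le> \<mu>" "\<mu> \<le> \<beta>" "2 * \<mu> \<le> \<eta>" "\<mu> \<le> 1"
    using constants_pos(1,2) \<kappa>(1,2) unfolding \<mu>_def by linarith+
  have "(1 - \<mu>) * (V k y + K3 * \<delta> * (2 - zc k y)) \<le> (1 - \<mu>) * \<Psi> \<delta> k y"
    using VPsi(1) \<mu> by (intro mult_left_mono) auto
  moreover have "(1 - \<beta>) * V k y \<le> (1 - \<mu>) * V k y" using \<mu> V_nonneg by (intro mult_right_mono) auto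
  moreover have "K3 * \<delta> * (1 + 2 * \<eta>) \<le> (1 - \<mu>) * (K3 * \<delta> * (2 - zc k y))"
  proof -
    \<comment> \<open>The old parameter lies below z k + \<eta> \<le> 1 - 15 \<eta>, the new one
      above 1 - \<eta>, so 2 - zc drops by at least 2 \<eta>: one \<eta> pays the errors, the other
      covers the multiplier 1 - \<mu>.\<close>
    have "1 + 2 * \<eta> + \<eta> \<le> 2 - zc k y" using ny zk \<eta>(1) by linarith
    moreover have "\<mu> * (2 - zc k y) \<le> \<mu> * 2" using inside_zc(1)[OF y(1)] \<mu> by (intro mult_left_mono) auto
    ultimately have "1 + 2 * \<eta> \<le> (1 - \<mu>) * (2 - zc k y)" using \<mu>(3) by (simp add: algebra_simps)
    then have "K3 * \<delta> * (1 + 2 * \<eta>) \<le> K3 * \<delta> * ((1 - \<mu>) * (2 - zc k y))"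
      using constants_pos \<delta>0 by (intro mult_left_mono) auto
    then show ?thesis by (simp add: mult_ac)
  qed
  moreover have "K3 * \<delta> * \<eta> = 6 * (L\<^sup>2 * \<delta>) + K2 * (4 * L + 2 * \<kappa>) * \<delta>"
    using \<eta>(1) by (simp add: K3_def field_simps)
  moreover have "\<Psi> \<delta> (Suc k) y' \<le> (1 - \<beta>) * V k y + 6 * (L\<^sup>2 * \<delta>) + K2 * (4 * L + 2 * \<kappa>) * \<delta> + K3 * \<delta> * (1 + \<eta>)"
    unfolding \<Psi>_def using 1 2 3 by linarith
  ultimately have "\<Psi> \<delta> (Suc k) y' \<le> (1 - \<mu>) * \<Psi> \<delta> k y"
    by (simp add: algebra_simps)
  then show "\<Psi> \<delta> (Suc k) (y + h *\<^sub>R v) \<le> (1 - \<beta> / 300 * h) * \<Psi> \<delta> k y"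
    by (simp add: y'_def \<mu>_def)
qed

text \<open>Three cases: the step crosses the end plane, it starts in one of the two bands, or it
  starts where the velocity is within \<delta> of \<open>f k y\<close>. The start plane cannot be
  crossed backwards, since all velocities near it point into the segment.\<close>

lemma potential_step:
  assumes y: "inside k y" "\<Psi> \<delta> k y \<le> 1 / 2" "\<Psi> \<delta> k y \<le> m" and v: "inflated \<delta> y v"
  shows "\<exists>j. inside j (y + h *\<^sub>R v) \<and> \<Psi> \<delta> j (y + h *\<^sub>R v) \<le> (1 - \<beta> / 300 * h) * \<Psi> \<delta> k y + K4 * h * \<delta>"
proof (cases "0 < e (Suc k) (y + h *\<^sub>R v)")
  case True
  have "0 \<le> K4 * h * \<delta>" using constants_pos h \<delta> by simp
  then show ?thesis using Psi_switch[OF y v True] by (intro exI[of _ "Suc k"]) auto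
next
  case False
  define y' where "y' = y + h *\<^sub>R v"
  have \<delta>0: "0 \<le> \<delta>" and \<delta>\<kappa>: "\<delta> \<le> \<kappa>" using \<delta> delta_bounds(1) by auto
  note VPsi = V_le_Psi[OF y(1) \<delta>0]
  have Vm: "V k y \<le> m" and V1: "V k y \<le> 1" using VPsi(2) y by auto
  have P1: "\<Psi> \<delta> k y \<le> 1" using y by simp
  have step: "norm v \<le> L" "dist y' y \<le> L * h"
    using step_norm[OF y(1) Vm V1 v] by (auto simp: y'_def)
  have Lh: "L * (L * h) = L\<^sup>2 * h" by (simp add: power2_eq_square)
  have Ldist: "L * dist y' y \<le> L\<^sup>2 * h"
    using mult_left_mono[OF step(2), of L] L Lh by simp
  have zc': "\<bar>zc k y' - zc k y\<bar> \<le> L\<^sup>2 * h" and e': "\<bar>e j y' - e j y\<bar> \<le> L\<^sup>2 * h" for j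
    using lipschitz(1)[of k y' y] lipschitz(2)[of j y' y] Ldist by linarith+
  note loc = inside_localization[OF y(1) Vm]
  have rising: "e j y + 2 * \<kappa> * h \<le> e j y'" if "dist y (x j) \<le> \<kappa>" for j
    using mult_left_mono[OF near_velocity(1)[OF that v \<delta>\<kappa>], of h] h
    by (simp add: e_def y'_def inner_add_right mult_ac)
  have \<kappa>h: "0 \<le> 2 * \<kappa> * h" using \<kappa> h by simp
  have zk: "1 / 2 < z k" "16 * \<eta> \<le> 1 - z k" "8 * \<eta> \<le> z k - 1 / 2" using z[of k] \<eta>(2,3)[of k] by auto
  have ek': "0 \<le> e k y'"
  proof (cases "e k y \<le> m")
    case True
    then show ?thesis using rising[OF loc(5)] y(1) \<kappa>h by (auto simp: inside_def)
  next
    case False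
    then show ?thesis using e'[of k] delta_bounds(4) m by linarith
  qed
  have ins: "inside k y'"
    unfolding inside_def using ek' False zc' loc(2,3) delta_bounds(3) \<kappa> \<eta>(1) by (auto simp: y'_def) 
  have \<kappa>\<delta>: "2 * \<kappa> * \<delta> \<le> L * \<delta>" using \<kappa> L \<delta>0 by (intro mult_right_mono) auto
  have start: "max 0 ((2 * L + 2 * \<kappa>) * \<delta> - e k y') \<le> max 0 ((2 * L + 2 * \<kappa>) * \<delta> - e k y)"
  proof (cases "e k y \<le> m")
    case True
    then show ?thesis using rising[OF loc(5)] \<kappa>h by auto
  next
    case False
    then have "(2 * L + 2 * \<kappa>) * \<delta> \<le> e k y'"
      using e'[of k] delta_bounds(4,6) \<kappa>\<delta> m by (simp add: distrib_right)
    then show ?thesis by simp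
  qed
  have final: "min (2 * L * \<delta>) (- e (Suc k) y') \<le> min (2 * L * \<delta>) (- e (Suc k) y)"
  proof (cases "- m \<le> e (Suc k) y")
    case True
    then show ?thesis using rising[OF loc(4)] \<kappa>h by auto
  next
    case False
    then have "2 * L * \<delta> \<le> - e (Suc k) y" using delta_bounds(6) m by linarith
    then show ?thesis by simp
  qed
  have "\<Psi> \<delta> k y' \<le> (1 - \<beta> / 300 * h) * \<Psi> \<delta> k y + K4 * h * \<delta>"
  proof (cases "e k y < 2 * L * \<delta> \<or> - (2 * L * \<delta>) < e (Suc k) y")
    case False
    then have pure: "norm (v - f k y) \<le> \<delta>"
      using \<delta> delta_bounds(6) m by (intro pure_velocity[OF y(1) Vm v]) auto
    \<comment> \<open>The exact flow image for the parameter 1 - h/50: it preserves V and multiplies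
      the parameter by exactly this factor, and y' differs from it by O(h * \<delta>).\<close>
    define w where "w = J k + (y - J k) * flow_scale (1 - h / 50)"
    have "norm (y + h *\<^sub>R f k y - w) \<le> L * h\<^sup>2"
      unfolding w_def using euler[of k y h] inside_zc[OF y(1)] V1 h delta_bounds(8) by simp
    moreover have "y' - w = h *\<^sub>R (v - f k y) + (y + h *\<^sub>R f k y - w)"
      by (simp add: y'_def algebra_simps)
    then have "norm (y' - w) \<le> norm (h *\<^sub>R (v - f k y)) + norm (y + h *\<^sub>R f k y - w)"
      by (simp only: norm_triangle_ineq)
    then have "norm (y' - w) \<le> h * norm (v - f k y) + norm (y + h *\<^sub>R f k y - w)"
      using h by simp
    moreover have "h * norm (v - f k y) \<le> h * \<delta>" using pure h by (intro mult_left_mono) auto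
    moreover have "h * \<delta> \<le> L * (h * \<delta>)" using L h \<delta>0 mult_right_mono[of 1 L "h * \<delta>"] by simp
    moreover have "L * h\<^sup>2 \<le> L * (h * \<delta>)"
      unfolding power2_eq_square using L h by (intro mult_left_mono) auto
    ultimately have yw: "dist y' w \<le> 2 * L * h * \<delta>" by (simp add: dist_norm)
    have yw2: "L * dist y' w \<le> 2 * L\<^sup>2 * h * \<delta>"
      using mult_left_mono[OF yw, of L] L by (simp add: power2_eq_square mult_ac)
    have h50: "0 \<le> 1 - h / 50" "49 / 50 \<le> 1 - h / 50" "1 - h / 50 \<le> 1" "1 - h / 50 \<noteq> 0" using h delta_bounds(8) by auto
    have zw: "zc k w = (1 - h / 50) * zc k y" and Vw: "V k w = V k y"
      unfolding w_def by (rule flow_zc) (rule flow_V[OF h50(4)])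
    have zy: "1 / 2 \<le> zc k y" "zc k y \<le> 2" "1 / 2 \<le> zc k y'" using inside_zc[OF y(1)] inside_zc[OF ins] by auto
    have "49 / 50 * (1 / 2) \<le> zc k w" "zc k w \<le> 1 * 2"
      unfolding zw using zy h50 by (intro mult_mono; simp)+
    then have "\<bar>V k w - V k y'\<bar> \<le> L * dist w y'"
      using V_lipschitz[of k w y'] Vw V1 zy by simp
    then have V': "V k y' \<le> V k y + 2 * L\<^sup>2 * h * \<delta>"
      using yw2 unfolding Vw dist_commute[of w] by linarith
    have zc'': "zc k y' \<le> (1 - h / 50) * zc k y + 2 * L\<^sup>2 * h * \<delta>"
      using lipschitz(1)[of k y' w] yw2 unfolding zw by linarith
    show ?thesis
      using zc' zy False by (intro Psi_step_drift[OF y(1) P1 ek' V' zc'' _ _ _ start]) auto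
  next
    case True
    have "\<bar>V k y - V k y'\<bar> \<le> L * dist y y'"
      using V_lipschitz[of k y y'] inside_zc[OF y(1)] inside_zc[OF ins] V1 by simp
    then have V': "V k y' \<le> V k y + L\<^sup>2 * h" using Ldist unfolding dist_commute[of y] by linarith
    have "min (2 * L * \<delta>) (- e (Suc k) y') + max 0 ((2 * L + 2 * \<kappa>) * \<delta> - e k y')
      \<le> min (2 * L * \<delta>) (- e (Suc k) y) + max 0 ((2 * L + 2 * \<kappa>) * \<delta> - e k y) - 2 * \<kappa> * h"
    proof (cases "e k y < 2 * L * \<delta>")
      case True
      then have "e k y + 2 * \<kappa> * h \<le> e k y'" using delta_bounds(6) m by (intro rising loc(5)) linarith
      moreover have "2 * \<kappa> * h \<le> 2 * \<kappa> * \<delta>" using h \<kappa> by (intro mult_left_mono) auto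
      ultimately have "max 0 ((2 * L + 2 * \<kappa>) * \<delta> - e k y') \<le> max 0 ((2 * L + 2 * \<kappa>) * \<delta> - e k y) - 2 * \<kappa> * h"
        using True by (auto simp: distrib_right)
      then show ?thesis using final by linarith
    next
      case False
      then have b: "- (2 * L * \<delta>) < e (Suc k) y" using \<open>e k y < 2 * L * \<delta> \<or> - (2 * L * \<delta>) < e (Suc k) y\<close> by simp
      then have "e (Suc k) y + 2 * \<kappa> * h \<le> e (Suc k) y'" using delta_bounds(6) m by (intro rising loc(4)) linarith
      then have "min (2 * L * \<delta>) (- e (Suc k) y') \<le> min (2 * L * \<delta>) (- e (Suc k) y) - 2 * \<kappa> * h"
        using b by auto
      then show ?thesis using start by linarith
    qed
    then show ?thesis by (rule Psi_step_band[OF y(1) P1 V' zc'])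
  qed
  then show ?thesis using ins by (auto simp: y'_def)
qed

end

text \<open>One half-space has to work for all admissible velocities. Away from the planes the
  parameter falls at the rate zc/50 \<ge> 1/100, of which 1/200 survives the perturbation; near a
  plane the event function rises.\<close>

lemma drift_direction:
  assumes y: "inside k y" "V k y \<le> m" and \<delta>: "0 < \<delta>" "\<delta> \<le> \<kappa>" "L * \<delta> < m / 2" "1000 * L * \<delta> \<le> 1"
  shows "\<exists>a c. 0 < c \<and> (\<forall>v. inflated \<delta> y v \<longrightarrow> c \<le> a \<bullet> v)"
proof (cases "2 * L * \<delta> \<le> e k y \<and> e (Suc k) y \<le> - (2 * L * \<delta>)")
  case True
  define a :: "real^3" where "a = (- (1 / (x k - J k) $ 1)) *\<^sub>R axis 1 1"
  have u: "u_inv k \<le> L"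
    using lipschitz(1)[of k "y + axis 1 1" y] by (simp add: zc_add dist_norm u_inv_def abs_divide norm_axis_1)
  have "1 / 200 \<le> a \<bullet> v" if v: "inflated \<delta> y v" for v
  proof -
    have "norm (v - f k y) \<le> \<delta>"
      using True \<delta> m by (intro pure_velocity[OF y v]) auto
    then have "\<bar>(v - f k y) $ 1\<bar> \<le> \<delta>" using component_le_norm_cart order.trans by blast
    then have "u_inv k * \<bar>(v - f k y) $ 1\<bar> \<le> L * \<delta>"
      using u u_inv_pos[of k] by (intro mult_mono) auto
    moreover have "\<bar>a \<bullet> (v - f k y)\<bar> = u_inv k * \<bar>(v - f k y) $ 1\<bar>"
      by (simp add: a_def inner_axis' u_inv_def abs_mult abs_divide)
    moreover have "a \<bullet> f k y = zc k y / 50"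
    proof -
      have "f k y $ 1 = - ((y - J k) $ 1 / 50)"
        by (simp add: f_def update_prob_component minus_divide_left)
      then show ?thesis by (simp only: a_def inner_scaleR_left inner_axis' zc_def) simp
    qed
    moreover have "1 / 2 \<le> zc k y" by (rule inside_zc[OF y(1)])
    ultimately show ?thesis using \<delta>(4) unfolding inner_diff_right by linarith
  qed
  then show ?thesis by (intro exI[of _ a] exI[of _ "1 / 200"]) auto
next
  case False
  then have "dist y (x k) \<le> \<kappa> \<or> dist y (x (Suc k)) \<le> \<kappa>"
    using inside_localization(4,5)[OF y] \<delta>(3) by (auto simp: not_le)
  then obtain j where "dist y (x j) \<le> \<kappa>" by blast
  then have "\<forall>v. inflated \<delta> y v \<longrightarrow> 2 * \<kappa> \<le> g j \<bullet> v" using near_velocity(1) \<delta>(2) by blast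
  then show ?thesis using \<kappa> by (intro exI[of _ "g j"] exI[of _ "2 * \<kappa>"]) auto
qed

text \<open>Discrete Gronwall: the excess of \<Psi> over the level 300 K4 \<delta>/\<beta> is
  multiplied by at most 1 - c h in each step, so steps with divergent sum drive any positive excess
  to zero.\<close>

lemma trapping:
  fixes Y v :: "nat \<Rightarrow> real^3" and h :: "nat \<Rightarrow> real"
  assumes \<delta>: "0 < \<delta>" "10 * L\<^sup>2 * \<delta> \<le> m" "10 * L\<^sup>2 * \<delta> \<le> \<kappa>" "10 * L\<^sup>2 * \<delta> \<le> 1"
    and \<epsilon>: "\<epsilon> \<le> 1 / 2" "\<epsilon> \<le> m" "300 * K4 / \<beta> * \<delta> \<le> \<epsilon>"
    and start: "inside k0 (Y 0)" "\<Psi> \<delta> k0 (Y 0) \<le> \<epsilon>"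
    and Y: "\<And>n. Y (Suc n) = Y n + h n *\<^sub>R v n" and h: "\<And>n. 0 < h n" "\<And>n. h n \<le> \<delta>"
    and v: "\<And>n. inflated \<delta> (Y n) (v n)"
  shows "\<exists>k. inside k (Y n) \<and> V k (Y n) \<le> \<epsilon>"
    and "0 < \<epsilon>' \<Longrightarrow> \<not> summable h \<Longrightarrow> eventually (\<lambda>n. \<exists>k. inside k (Y n) \<and> V k (Y n) \<le> 300 * K4 / \<beta> * \<delta> + \<epsilon>') sequentially"
proof -
  define c where "c = \<beta> / 300"
  have c: "0 < c" "c \<le> 1" using constants_pos by (auto simp: c_def)
  have \<delta>0: "0 \<le> \<delta>" using \<delta> by simp
  have "\<delta> \<le> L\<^sup>2 * \<delta>" using constants_pos(6) \<delta>0 mult_right_mono[of 1 "L\<^sup>2" \<delta>] by simp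
  then have h1: "h n \<le> 1" for n using h(2)[of n] \<delta>(4) unfolding mult.assoc by linarith
  have K: "K4 * \<delta> \<le> c * \<epsilon>"
    using mult_left_mono[OF \<epsilon>(3), of c] c constants_pos by (simp add: c_def)
  \<comment> \<open>The active segment belongs to the state of the process; dependent choice selects
    its index along the sequence, with the bound \<epsilon> as invariant.\<close>
  have "\<exists>kk. \<forall>n. (inside (kk n) (Y n) \<and> \<Psi> \<delta> (kk n) (Y n) \<le> \<epsilon> \<and> (n = 0 \<longrightarrow> kk n = k0)) \<and>
      \<Psi> \<delta> (kk (Suc n)) (Y (Suc n)) \<le> (1 - c * h n) * \<Psi> \<delta> (kk n) (Y n) + K4 * h n * \<delta>"
  proof (rule dependent_nat_choice)
    show "\<exists>k. inside k (Y 0) \<and> \<Psi> \<delta> k (Y 0) \<le> \<epsilon> \<and> (0 = 0 \<longrightarrow> k = k0)" using start by blast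
    fix k n assume k: "inside k (Y n) \<and> \<Psi> \<delta> k (Y n) \<le> \<epsilon> \<and> (n = 0 \<longrightarrow> k = k0)"
    obtain j where j: "inside j (Y (Suc n))"
      "\<Psi> \<delta> j (Y (Suc n)) \<le> (1 - c * h n) * \<Psi> \<delta> k (Y n) + K4 * h n * \<delta>"
      using potential_step[OF \<delta> h(1)[of n] h(2)[of n] _ _ _ v[of n], of k] k \<epsilon> unfolding Y c_def by auto
    have ch: "0 \<le> 1 - c * h n" using mult_mono[of c 1 "h n" 1] c h(1)[of n] h1[of n] by simp
    have "(1 - c * h n) * \<Psi> \<delta> k (Y n) \<le> (1 - c * h n) * \<epsilon>"
      using k ch by (intro mult_left_mono) auto
    moreover have "h n * (K4 * \<delta>) \<le> h n * (c * \<epsilon>)" using K h(1)[of n] by (intro mult_left_mono) auto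
    ultimately have "\<Psi> \<delta> j (Y (Suc n)) \<le> \<epsilon>" using j(2) by (simp add: algebra_simps)
    then show "\<exists>j. (inside j (Y (Suc n)) \<and> \<Psi> \<delta> j (Y (Suc n)) \<le> \<epsilon> \<and> (Suc n = 0 \<longrightarrow> j = k0)) \<and>
      \<Psi> \<delta> j (Y (Suc n)) \<le> (1 - c * h n) * \<Psi> \<delta> k (Y n) + K4 * h n * \<delta>"
      using j by auto
  qed
  then obtain kk where kk: "\<And>n. inside (kk n) (Y n)" "\<And>n. \<Psi> \<delta> (kk n) (Y n) \<le> \<epsilon>"
    "\<And>n. \<Psi> \<delta> (kk (Suc n)) (Y (Suc n)) \<le> (1 - c * h n) * \<Psi> \<delta> (kk n) (Y n) + K4 * h n * \<delta>"
    by blast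
  show "\<exists>k. inside k (Y n) \<and> V k (Y n) \<le> \<epsilon>" for n
    using kk(1,2)[of n] V_le_Psi(2)[OF kk(1)[of n] \<delta>0] by (intro exI[of _ "kk n"]) auto
  assume \<epsilon>': "0 < \<epsilon>'" and sum: "\<not> summable h"
  define b where "b n = \<Psi> \<delta> (kk n) (Y n) - K4 * \<delta> / c" for n
  have b_Suc: "b (Suc n) \<le> (1 - c * h n) * b n" for n
  proof -
    have "(1 - c * h n) * (K4 * \<delta> / c) = K4 * \<delta> / c - K4 * h n * \<delta>"
      using c(1) by (simp add: field_simps)
    then show ?thesis using kk(3)[of n] unfolding b_def right_diff_distrib by linarith
  qed
  have b: "b n \<le> exp (- c * (\<Sum>i<n. h i)) * \<bar>b 0\<bar>" for n
  proof (induction n)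
    case (Suc n)
    have ch: "0 \<le> 1 - c * h n" using mult_mono[of c 1 "h n" 1] c h(1)[of n] h1[of n] by simp
    have "b (Suc n) \<le> (1 - c * h n) * (exp (- c * (\<Sum>i<n. h i)) * \<bar>b 0\<bar>)"
      using b_Suc[of n] mult_left_mono[OF Suc ch] by linarith
    also have "\<dots> \<le> exp (- c * h n) * (exp (- c * (\<Sum>i<n. h i)) * \<bar>b 0\<bar>)"
      using exp_ge_add_one_self[of "- c * h n"] by (intro mult_right_mono) auto
    also have "\<dots> = exp (- c * (\<Sum>i<Suc n. h i)) * \<bar>b 0\<bar>"
      by (simp add: exp_add[symmetric] algebra_simps)
    finally show ?case .
  qed simp
  have unbounded: "\<exists>n. M < (\<Sum>i<n. h i)" for M
  proof (rule ccontr)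
    assume "\<not> ?thesis"
    then have "(\<Sum>i<n. h i) \<le> M" for n by (auto simp: not_less)
    then have "summable h" using h(1) by (intro summableI_nonneg_bounded[of h M]) (auto intro: less_imp_le)
    with sum show False ..
  qed
  obtain M where M: "exp (- c * M) * \<bar>b 0\<bar> < \<epsilon>'"
  proof (cases "b 0 = 0")
    case False
    have "exp (- c * (- ln (\<epsilon>' / (2 * \<bar>b 0\<bar>)) / c)) * \<bar>b 0\<bar> < \<epsilon>'"
      using c \<epsilon>' False by simp
    then show ?thesis by (rule that)
  qed (use \<epsilon>' that in auto)
  obtain n0 where n0: "M < (\<Sum>i<n0. h i)" using unbounded by blast
  have "V (kk n) (Y n) \<le> 300 * K4 / \<beta> * \<delta> + \<epsilon>'" if "n0 \<le> n" for n
  proof -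
    have "(\<Sum>i<n0. h i) \<le> (\<Sum>i<n. h i)"
      using h(1) that by (intro sum_mono2) (auto intro: less_imp_le)
    then have "exp (- c * (\<Sum>i<n. h i)) * \<bar>b 0\<bar> \<le> exp (- c * M) * \<bar>b 0\<bar>"
      using n0 c by (intro mult_right_mono) auto
    then have "b n \<le> \<epsilon>'" using b[of n] M by linarith
    moreover have "K4 * \<delta> / c = 300 * K4 / \<beta> * \<delta>" by (simp add: c_def)
    ultimately show ?thesis using V_le_Psi(2)[OF kk(1)[of n] \<delta>0] by (simp add: b_def)
  qed
  then show "eventually (\<lambda>n. \<exists>k. inside k (Y n) \<and> V k (Y n) \<le> 300 * K4 / \<beta> * \<delta> + \<epsilon>') sequentially"
    using kk(1) by (auto simp: eventually_sequentially)
qed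

end

section \<open>Choice of the constants, neighbourhoods of the orbit, and nonconvergence\<close>

context hybrid_cycle
begin

lemma norm_tube_le:
  assumes "1 / 4 \<le> zc k y" "zc k y \<le> 2" "V k y \<le> 1"
  shows "norm (y - J k) \<le> scale_bound * (C + norm (x k - J k))"
proof -
  have z0: "zc k y \<noteq> 0" using assms by auto
  have "y - J k = flow_scale (zc k y) * (xi k y + (x k - J k))"
    using point_eq[OF z0] by (simp add: \<gamma>_def algebra_simps)
  then have "norm (y - J k) \<le> scale_bound * norm (xi k y + (x k - J k))"
    using assms by (simp only:) (intro norm_mult_vec_le abs_scale_le, auto)
  also have "norm (xi k y + (x k - J k)) \<le> C + norm (x k - J k)"
  proof -
    have "C * V k y \<le> C * 1" using C assms by (intro mult_left_mono) auto
    then show ?thesis using norm_triangle_ineq[of "xi k y" "x k - J k"] norm_xi_le[OF z0] by linarith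
  qed
  finally show ?thesis using scale_bound_pos by (simp add: mult_left_mono)
qed

definition tube_radius :: "nat \<Rightarrow> real" where
  "tube_radius k = scale_bound * (C + norm (x k - J k))"

lemma tube_radius_nonneg: "0 \<le> tube_radius k"
  using C scale_bound_pos by (auto simp: tube_radius_def intro!: mult_nonneg_nonneg)

lemma euler_flow_le:
  assumes "norm (y - J k) \<le> R" "0 \<le> h" "h \<le> 1"
  shows "norm (y + h *\<^sub>R f k y - (J k + (y - J k) * flow_scale (1 - h / 50))) \<le> 40 * scale_bound * R * h\<^sup>2"
proof -
  let ?s = "1 - h / 50"
  let ?w = "flow_scale ?s - 1 - (50 * (?s - 1)) *\<^sub>R update_prob"
  have "h *\<^sub>R f k y = ((50 * (?s - 1)) *\<^sub>R update_prob) * (y - J k)"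
    by (simp add: f_def vec_eq_iff algebra_simps)
  then have eq: "y + h *\<^sub>R f k y - (J k + (y - J k) * flow_scale ?s) = - (?w * (y - J k))"
    by (simp add: algebra_simps)
  have "norm (?w * (y - J k)) \<le> (40 * scale_bound * (?s - 1)\<^sup>2) * norm (y - J k)"
    using assms by (intro norm_mult_vec_le scale_taylor) auto
  also have "\<dots> \<le> (40 * scale_bound * h\<^sup>2) * R"
  proof (intro mult_mono)
    show "(?s - 1)\<^sup>2 \<le> h\<^sup>2" using assms(2) by (simp add: power_divide)
  qed (use assms scale_bound_pos in auto)
  finally show ?thesis unfolding eq norm_minus_cancel by (simp add: mult_ac)
qed

text \<open>A sum rather than a maximum: each required constant is dominated by one or two of the
  nonnegative summands, so linear arithmetic yields all comparisons.\<close>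

definition lipschitz_bound :: "nat \<Rightarrow> real" where
  "lipschitz_bound k = C * (640 * scale_bound * u_inv k * tube_radius k + scale_bound) + u_inv k + norm (g k) + norm (t k)
     + tube_radius k + 1 + norm (J k - x (Suc k)) + norm (J (Suc k) - x (Suc k)) + 1 + 40 * scale_bound * tube_radius k"

lemma lipschitz_bound_ge:
  "C * (640 * scale_bound * u_inv k * tube_radius k + scale_bound) \<le> lipschitz_bound k"
  "u_inv k \<le> lipschitz_bound k" "norm (g k) \<le> lipschitz_bound k" "norm (t k) \<le> lipschitz_bound k"
  "tube_radius k + 1 \<le> lipschitz_bound k" "norm (J k - x (Suc k)) + 1 \<le> lipschitz_bound k"
  "norm (J (Suc k) - x (Suc k)) + 1 \<le> lipschitz_bound k" "40 * scale_bound * tube_radius k \<le> lipschitz_bound k"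
  "1 \<le> lipschitz_bound k"
proof -
  have nn: "0 \<le> C * (640 * scale_bound * u_inv k * tube_radius k + scale_bound)" "0 \<le> u_inv k" "0 \<le> norm (g k)"
    "0 \<le> norm (t k)" "0 \<le> tube_radius k" "0 \<le> norm (J k - x (Suc k))" "0 \<le> norm (J (Suc k) - x (Suc k))"
    "0 \<le> 40 * scale_bound * tube_radius k"
    using C scale_bound_pos u_inv_pos[of k] tube_radius_nonneg[of k]
    by (auto intro!: mult_nonneg_nonneg add_nonneg_nonneg)
  show "C * (640 * scale_bound * u_inv k * tube_radius k + scale_bound) \<le> lipschitz_bound k"
  "u_inv k \<le> lipschitz_bound k" "norm (g k) \<le> lipschitz_bound k" "norm (t k) \<le> lipschitz_bound k"
  "tube_radius k + 1 \<le> lipschitz_bound k" "norm (J k - x (Suc k)) + 1 \<le> lipschitz_bound k"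
  "norm (J (Suc k) - x (Suc k)) + 1 \<le> lipschitz_bound k" "40 * scale_bound * tube_radius k \<le> lipschitz_bound k"
  "1 \<le> lipschitz_bound k"
    unfolding lipschitz_bound_def using nn by linarith+
qed

lemma lipschitz_bound_periodic: "lipschitz_bound (k + 6) = lipschitz_bound k"
  using periodic(1,2)[of k] periodic(1,2)[of "Suc k"] periodic(3,4)[of k]
  by (simp add: lipschitz_bound_def tube_radius_def u_inv_def)

text \<open>Order of choice: \<eta> from transversality, \<kappa> from the switching neighbourhoods
  for this \<eta>, m from the localization for both, and L from the geometry alone. \<kappa> is at
  most half of its thresholds because balls of radius 2 \<kappa> are used.\<close>

lemma constants_exist:
  "\<exists>\<eta> \<kappa> m L. hybrid_cycle_constants J x g t z c tc NV vel C \<rho> \<eta> \<kappa> m L"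
proof -
  have "\<exists>\<eta>>0. \<forall>\<eta>'. 0 < \<eta>' \<and> \<eta>' \<le> \<eta> \<longrightarrow> (\<forall>k. (\<forall>r. z k - 2 * \<eta>' \<le> r \<and> r < z k \<longrightarrow> 0 < e (Suc k) (\<gamma> k r)) \<and>
     (\<forall>r. 1 < r \<and> r \<le> 1 + 2 * \<eta>' \<longrightarrow> e k (\<gamma> k r) < 0) \<and> 16 * \<eta>' \<le> 1 - z k \<and> 8 * \<eta>' \<le> z k - 1 / 2)"
    using extension_signs e_periodic[of "Suc _"] 
    by (intro uniform_small) (simp_all add: e_periodic gamma_periodic periodic(5))
  then obtain \<eta> where \<eta>0: "0 < \<eta>" and \<eta>: "\<And>k r. z k - 2 * \<eta> \<le> r \<Longrightarrow> r < z k \<Longrightarrow> 0 < e (Suc k) (\<gamma> k r)"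
     "\<And>k r. 1 < r \<Longrightarrow> r \<le> 1 + 2 * \<eta> \<Longrightarrow> e k (\<gamma> k r) < 0" "\<And>k. 16 * \<eta> \<le> 1 - z k" "\<And>k. 8 * \<eta> \<le> z k - 1 / 2"
    by blast
  have pS: "x (Suc (k + 6)) = x (Suc k)" "g (Suc (k + 6)) = g (Suc k)" "f (Suc (k + 6)) = f (Suc k)"
    "th (Suc (k + 6)) = th (Suc k)" "e (Suc (k + 6)) = e (Suc k)" "e (Suc (Suc (k + 6))) = e (Suc (Suc k))"
    "zc (Suc (k + 6)) = zc (Suc k)" "V (Suc (k + 6)) = V (Suc k)" for k
    using periodic(2,3)[of "Suc k"] f_periodic[of "Suc k"] th_periodic[of "Suc k"] e_periodic[of "Suc k"]
      e_periodic[of "Suc (Suc k)"] zc_periodic[of "Suc k"] V_periodic[of "Suc k"] by simp_all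
  have "\<exists>\<kappa>>0. \<forall>\<kappa>'. 0 < \<kappa>' \<and> \<kappa>' \<le> \<kappa> \<longrightarrow> (\<forall>k y. dist y (x (Suc k)) \<le> \<kappa>' \<longrightarrow>
     \<kappa>' < g (Suc k) \<bullet> f k y \<and> \<kappa>' < g (Suc k) \<bullet> f (Suc k) y \<and> 0 < e k y \<and> 0 < th k y \<and> 0 < th (Suc k) y
     \<and> e (Suc (Suc k)) y < 0 \<and> z k - \<eta> < zc k y \<and> zc k y < z k + \<eta> \<and> 1 - \<eta> < zc (Suc k) y \<and> zc (Suc k) y < 1 + \<eta>)"
    using switch_neighborhood[OF \<eta>0]
    by (intro uniform_small) (simp_all only: pS f_periodic e_periodic th_periodic zc_periodic periodic(5))
  then obtain \<kappa>1 where \<kappa>1: "0 < \<kappa>1" "\<And>\<kappa>' k y. 0 < \<kappa>' \<Longrightarrow> \<kappa>' \<le> \<kappa>1 \<Longrightarrow> dist y (x (Suc k)) \<le> \<kappa>' \<longrightarrow>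
     \<kappa>' < g (Suc k) \<bullet> f k y \<and> \<kappa>' < g (Suc k) \<bullet> f (Suc k) y \<and> 0 < e k y \<and> 0 < th k y \<and> 0 < th (Suc k) y
     \<and> e (Suc (Suc k)) y < 0 \<and> z k - \<eta> < zc k y \<and> zc k y < z k + \<eta> \<and> 1 - \<eta> < zc (Suc k) y \<and> zc (Suc k) y < 1 + \<eta>"
    by meson
  have "\<exists>\<kappa>>0. \<forall>\<kappa>'. 0 < \<kappa>' \<and> \<kappa>' \<le> \<kappa> \<longrightarrow> (\<forall>k y. dist y (x (Suc k)) \<le> \<kappa>' \<and> e (Suc k) y = 0 \<longrightarrow> V (Suc k) y \<le> (1 + \<rho>) / 2 * V k y)"
    using crossing_decrease by (intro uniform_small) (simp_all only: pS V_periodic)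
  then obtain \<kappa>2 where \<kappa>2: "0 < \<kappa>2" "\<And>\<kappa>' k y. 0 < \<kappa>' \<Longrightarrow> \<kappa>' \<le> \<kappa>2 \<Longrightarrow> dist y (x (Suc k)) \<le> \<kappa>' \<and> e (Suc k) y = 0 \<longrightarrow>
      V (Suc k) y \<le> (1 + \<rho>) / 2 * V k y"
    by meson
  obtain \<kappa> where \<kappa>: "0 < \<kappa>" "\<kappa> \<le> \<kappa>1 / 2" "\<kappa> \<le> \<kappa>2 / 2" "\<kappa> \<le> \<eta>" "\<kappa> \<le> 1 / 4"
    using common_lower_bound[of "\<kappa>1 / 2" "\<kappa>2 / 2" \<eta> "1 / 4"] \<kappa>1(1) \<kappa>2(1) \<eta>0 by auto
  have "\<exists>m>0. \<forall>m'. 0 < m' \<and> m' \<le> m \<longrightarrow> (\<forall>k y. z k - 2 * \<eta> \<le> zc k y \<and> zc k y \<le> 1 + 2 * \<eta> \<and> V k y \<le> m' \<and> 0 \<le> e k y \<and> e (Suc k) y \<le> 0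
    \<longrightarrow> m' \<le> th k y \<and> z k - \<kappa> \<le> zc k y \<and> zc k y \<le> 1 + \<kappa> \<and> (- m' \<le> e (Suc k) y \<longrightarrow> dist y (x (Suc k)) \<le> \<kappa>)
      \<and> (e k y \<le> m' \<longrightarrow> dist y (x k) \<le> \<kappa>))"
    using tube_localization[OF \<eta>0 \<eta> \<kappa>(1)]
    by (intro uniform_small) (simp_all only: pS e_periodic th_periodic zc_periodic V_periodic periodic(2,5))
  then obtain m where m: "0 < m" and m_all: "\<forall>m'. 0 < m' \<and> m' \<le> m \<longrightarrow> (\<forall>k y. z k - 2 * \<eta> \<le> zc k y \<and> zc k y \<le> 1 + 2 * \<eta> \<and> V k y \<le> m' \<and> 0 \<le> e k y \<and> e (Suc k) y \<le> 0
    \<longrightarrow> m' \<le> th k y \<and> z k - \<kappa> \<le> zc k y \<and> zc k y \<le> 1 + \<kappa> \<and> (- m' \<le> e (Suc k) y \<longrightarrow> dist y (x (Suc k)) \<le> \<kappa>)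
      \<and> (e k y \<le> m' \<longrightarrow> dist y (x k) \<le> \<kappa>))"
    by (elim exE conjE) (rule that)
  have m_loc: "z k - 2 * \<eta> \<le> zc k y \<and> zc k y \<le> 1 + 2 * \<eta> \<and> V k y \<le> m \<and> 0 \<le> e k y \<and> e (Suc k) y \<le> 0
    \<longrightarrow> m \<le> th k y \<and> z k - \<kappa> \<le> zc k y \<and> zc k y \<le> 1 + \<kappa> \<and> (- m \<le> e (Suc k) y \<longrightarrow> dist y (x (Suc k)) \<le> \<kappa>)
      \<and> (e k y \<le> m \<longrightarrow> dist y (x k) \<le> \<kappa>)" for k y
    by (rule m_all[THEN spec, of m, THEN mp, OF conjI[OF m order_refl], THEN spec, THEN spec])
  have "\<exists>\<epsilon>>0. \<forall>\<epsilon>'. 0 < \<epsilon>' \<and> \<epsilon>' \<le> \<epsilon> \<longrightarrow> (\<forall>k. lipschitz_bound k \<le> 1 / \<epsilon>')"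
  proof (rule uniform_small)
    fix k
    show "\<exists>\<epsilon>>0. \<forall>\<epsilon>'. 0 < \<epsilon>' \<and> \<epsilon>' \<le> \<epsilon> \<longrightarrow> lipschitz_bound k \<le> 1 / \<epsilon>'"
      using lipschitz_bound_ge(9)[of k]
      by (intro exI[of _ "1 / lipschitz_bound k"]) (auto simp: field_simps)
  qed (simp add: lipschitz_bound_periodic)
  then obtain L where L: "\<And>k. lipschitz_bound k \<le> L" by (metis order_refl)
  have scaled: "a \<le> L * d" if "a \<le> b * d" "b \<le> lipschitz_bound k" "0 \<le> d" for a b d k
    using that mult_right_mono[of b L d] L[of k] by linarith
  have V_lip: "\<bar>V k y - V k y'\<bar> \<le> L * dist y y'"
    if "1 / 4 \<le> zc k y \<and> zc k y \<le> 2 \<and> V k y \<le> 1 \<and> 1 / 4 \<le> zc k y'" for k y y'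
  proof -
    have "norm (y - J k) \<le> tube_radius k" using norm_tube_le[of k y] that by (simp add: tube_radius_def)
    then have "640 * scale_bound * u_inv k * norm (y - J k) + scale_bound \<le> 640 * scale_bound * u_inv k * tube_radius k + scale_bound"
      using u_inv_pos[of k] scale_bound_pos by (intro add_right_mono mult_left_mono) auto
    then have "C * ((640 * scale_bound * u_inv k * norm (y - J k) + scale_bound) * dist y y') \<le> C * (640 * scale_bound * u_inv k * tube_radius k + scale_bound) * dist y y'"
      unfolding mult.assoc[of C] using C by (intro mult_left_mono mult_right_mono) auto
    with V_diff_le[of k y y'] that show ?thesis
      by (intro scaled[OF _ lipschitz_bound_ge(1)[of k]]) auto
  qed
  have radius: "norm (y - J k) \<le> tube_radius k" if "1 / 4 \<le> zc k y \<and> zc k y \<le> 2 \<and> V k y \<le> 1" for k y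
    using norm_tube_le[of k y] that by (simp add: tube_radius_def)
  have f_norm: "norm (f k y) \<le> norm (y - J k)" for k y
    using norm_mult_vec_le[OF abs_update_prob_le, of "J k - y"] by (simp add: f_def norm_minus_commute)
  have f1: "norm (f k y) + 1 \<le> L" if "1 / 4 \<le> zc k y \<and> zc k y \<le> 2 \<and> V k y \<le> 1" for k y
    using f_norm[of k y] radius[OF that] lipschitz_bound_ge(5)[of k] L[of k] by linarith
  have f2: "norm (f k y) \<le> L \<and> norm (f (Suc k) y) \<le> L" if "dist y (x (Suc k)) \<le> 1" for k y
  proof -
    have "norm (y - J j) \<le> norm (J j - x (Suc k)) + 1" for j
      using norm_triangle_ineq4[of "y - x (Suc k)" "J j - x (Suc k)"] that by (simp add: dist_norm)
    then show ?thesis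
      using f_norm[of k y] f_norm[of "Suc k" y] lipschitz_bound_ge(6,7)[of k] L[of k] by (meson order_trans)
  qed
  have eul: "norm (y + h *\<^sub>R f k y - (J k + (y - J k) * flow_scale (1 - h / 50))) \<le> L * h\<^sup>2"
    if "1 / 4 \<le> zc k y \<and> zc k y \<le> 2 \<and> V k y \<le> 1 \<and> 0 \<le> h \<and> h \<le> 1" for k y h
    using euler_flow_le[OF radius, of k y h] that by (intro scaled[OF _ lipschitz_bound_ge(8)[of k]]) auto
  have lip: "\<bar>zc k y - zc k y'\<bar> \<le> L * dist y y'" "\<bar>e k y - e k y'\<bar> \<le> L * dist y y'" "\<bar>th k y - th k y'\<bar> \<le> L * dist y y'" for k y y'
    by (rule scaled[OF zc_diff_le lipschitz_bound_ge(2)] scaled[OF e_diff_le lipschitz_bound_ge(3)] scaled[OF th_diff_le lipschitz_bound_ge(4)]; simp)+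
  have near: "dist y (x (Suc k)) \<le> 2 * \<kappa> \<longrightarrow>
     2 * \<kappa> < g (Suc k) \<bullet> f k y \<and> 2 * \<kappa> < g (Suc k) \<bullet> f (Suc k) y \<and> 0 < e k y \<and> 0 < th k y \<and> 0 < th (Suc k) y
     \<and> e (Suc (Suc k)) y < 0 \<and> z k - \<eta> < zc k y \<and> zc k y < z k + \<eta> \<and> 1 - \<eta> < zc (Suc k) y \<and> zc (Suc k) y < 1 + \<eta>" for k y
    using \<kappa> by (intro \<kappa>1(2)) auto
  have dec: "dist y (x (Suc k)) \<le> 2 * \<kappa> \<and> e (Suc k) y = 0 \<longrightarrow> V (Suc k) y \<le> (1 + \<rho>) / 2 * V k y" for k y
    using \<kappa> by (intro \<kappa>2(2)) auto
  have ext: "z k - 2 * \<eta> \<le> r \<and> r < z k \<longrightarrow> 0 < e (Suc k) (\<gamma> k r)" "1 < r \<and> r \<le> 1 + 2 * \<eta> \<longrightarrow> e k (\<gamma> k r) < 0" for k r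
    using \<eta>(1,2) by blast+
  have L1: "1 \<le> L" using L[of 0] lipschitz_bound_ge(9)[of 0] by linarith
  have "hybrid_cycle_constants_axioms J x g t z c tc NV \<rho> \<eta> \<kappa> m L"
    unfolding hybrid_cycle_constants_axioms_def
    apply (intro conjI allI; ((rule \<eta>0 \<eta>(3) \<eta>(4) \<kappa>(1) \<kappa>(4) \<kappa>(5) m L1 m_loc[unfolded e_def th_def] near[unfolded e_def th_def f_def] dec[unfolded e_def]
      lip[unfolded e_def th_def] impI[OF V_lip] impI[OF f1[unfolded f_def]] impI[OF f2[unfolded f_def]] impI[OF eul[unfolded f_def]] ext[unfolded e_def \<gamma>_def]); assumption?)?)
    done
  then show ?thesis
    by (intro exI) (rule hybrid_cycle_constants.intro[OF hybrid_cycle_axioms])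
qed

definition orbit :: "(real^3) set" where
  "orbit = (\<Union>k. \<gamma> k ` {z k..1})"

lemma orbit_eq: "orbit = (\<Union>k<6. \<gamma> k ` {z k..1})"
proof -
  have j: "\<exists>j<6. \<gamma> k = \<gamma> j \<and> z k = z j" for k
  proof (induction k rule: less_induct)
    case (less k)
    show ?case
    proof (cases "k < 6")
      case False
      then show ?thesis
        using less[of "k - 6"] gamma_periodic[of "k - 6"] periodic(5)[of "k - 6"] by simp
    qed auto
  qed
  have "\<gamma> k ` {z k..1} \<subseteq> (\<Union>j<6. \<gamma> j ` {z j..1})" for k
  proof -
    obtain i where "i < 6" "\<gamma> k ` {z k..1} = \<gamma> i ` {z i..1}" using j[of k] by metis
    then show ?thesis by blast
  qed
  then show ?thesis unfolding orbit_def by blast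
qed

end

context hybrid_cycle_constants
begin

lemma inside_periodic: "inside (k + 6) = inside k"
  using e_periodic[of "Suc k"] by (simp add: fun_eq_iff inside_def zc_periodic e_periodic periodic(5))

text \<open>\<open>localization\<close> holds for the fixed \<kappa> only. The compactness lemma is
  applied anew with a tolerance depending on \<epsilon>, so that clamping the parameter to [z k, 1]
  moves the point of the curve by less than \<epsilon>/2.\<close>

lemma inside_near_orbit:
  assumes \<epsilon>: "0 < \<epsilon>"
  shows "\<exists>d>0. \<forall>k y. inside k y \<and> V k y \<le> d \<longrightarrow> infdist y orbit \<le> \<epsilon>"
proof -
  have "\<exists>d>0. \<forall>d'. 0 < d' \<and> d' \<le> d \<longrightarrow> (\<forall>k y. inside k y \<and> V k y \<le> d' \<longrightarrow> infdist y orbit \<le> \<epsilon>)"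
  proof (rule uniform_small)
    fix k
    have "uniformly_continuous_on {0..3} (\<gamma> k)"
      by (intro compact_uniformly_continuous continuous_on_subset[OF gamma_continuous]) auto
    then obtain q where q: "0 < q" "\<And>r r'. r \<in> {0..3} \<Longrightarrow> r' \<in> {0..3} \<Longrightarrow> dist r' r < q \<Longrightarrow> dist (\<gamma> k r') (\<gamma> k r) < \<epsilon> / 2"
      unfolding uniformly_continuous_on_def using \<epsilon> by (metis half_gt_zero)
    have q2: "0 < q / 2" using q(1) by simp
    have "\<exists>m1>0. \<forall>m'. 0 < m' \<and> m' \<le> m1 \<longrightarrow> (\<forall>y. z k - 2 * \<eta> \<le> zc k y \<and> zc k y \<le> 1 + 2 * \<eta> \<and> V k y \<le> m' \<and> 0 \<le> e k y \<and> e (Suc k) y \<le> 0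
      \<longrightarrow> m' \<le> th k y \<and> z k - q / 2 \<le> zc k y \<and> zc k y \<le> 1 + q / 2 \<and> (- m' \<le> e (Suc k) y \<longrightarrow> dist y (x (Suc k)) \<le> q / 2)
      \<and> (e k y \<le> m' \<longrightarrow> dist y (x k) \<le> q / 2))"
      by (rule tube_localization[OF \<eta>(1) _ _ \<eta>(2,3) q2]) (use extension in blast)+
    then obtain m1 where m1: "0 < m1" and m1_loc: "\<forall>m'. 0 < m' \<and> m' \<le> m1 \<longrightarrow> (\<forall>y. z k - 2 * \<eta> \<le> zc k y \<and> zc k y \<le> 1 + 2 * \<eta> \<and> V k y \<le> m' \<and> 0 \<le> e k y \<and> e (Suc k) y \<le> 0
      \<longrightarrow> m' \<le> th k y \<and> z k - q / 2 \<le> zc k y \<and> zc k y \<le> 1 + q / 2 \<and> (- m' \<le> e (Suc k) y \<longrightarrow> dist y (x (Suc k)) \<le> q / 2)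
      \<and> (e k y \<le> m' \<longrightarrow> dist y (x k) \<le> q / 2))"
      by (elim exE conjE) (rule that)
    define d where "d = min m1 (\<epsilon> / (2 * (scale_bound * C)))"
    have sC: "0 < scale_bound * C" using scale_bound_pos C by simp
    have "infdist y orbit \<le> \<epsilon>" if y: "inside k y" "V k y \<le> d" for y
    proof -
      define r where "r = max (z k) (min 1 (zc k y))"
      have zcy: "z k - q / 2 \<le> zc k y" "zc k y \<le> 1 + q / 2" "1 / 2 \<le> zc k y" "zc k y \<le> 2"
        using m1_loc[rule_format, OF conjI[OF m1 order_refl], of y] y inside_zc[OF y(1)] by (auto simp: inside_def d_def)
      have r: "z k \<le> r" "r \<le> 1" "dist (zc k y) r < q"
        using zcy z[of k] q(1) by (auto simp: r_def dist_real_def max_def min_def)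
      have "dist (\<gamma> k (zc k y)) (\<gamma> k r) < \<epsilon> / 2"
        using r zcy z[of k] by (intro q(2)) auto
      moreover have "dist y (\<gamma> k (zc k y)) \<le> \<epsilon> / 2"
      proof -
        have "dist y (\<gamma> k (zc k y)) \<le> scale_bound * (C * V k y)"
          using zcy by (intro dist_gamma_le) auto
        also have "\<dots> \<le> (scale_bound * C) * (\<epsilon> / (2 * (scale_bound * C)))"
          unfolding mult.assoc[symmetric] using y(2) sC by (intro mult_left_mono) (auto simp: d_def)
        also have "\<dots> = \<epsilon> / 2" using scale_bound_pos C by simp
        finally show ?thesis .
      qed
      moreover have "\<gamma> k r \<in> orbit" unfolding orbit_def using r by (intro UN_I[of k] imageI) auto
      then have "infdist y orbit \<le> dist y (\<gamma> k r)" by (rule infdist_le)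
      ultimately show ?thesis using dist_triangle[of y "\<gamma> k r" "\<gamma> k (zc k y)"] by linarith
    qed
    moreover have "0 < d" using m1 \<epsilon> sC by (simp add: d_def)
    ultimately show "\<exists>d>0. \<forall>d'. 0 < d' \<and> d' \<le> d \<longrightarrow> (\<forall>y. inside k y \<and> V k y \<le> d' \<longrightarrow> infdist y orbit \<le> \<epsilon>)"
      by (intro exI[of _ d]) auto
  qed (simp add: inside_periodic V_periodic)
  then show ?thesis by blast
qed

text \<open>Around a switching point a single tube covers only one side of the plane; the sign of
  the event function tells which of the two adjacent tubes contains the point.\<close>

lemma orbit_neighborhood:
  assumes q: "q \<in> orbit" and d: "0 < d"
  shows "\<exists>r>0. \<forall>y. dist y q < r \<longrightarrow> (\<exists>k. inside k y \<and> V k y \<le> d)"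
proof -
  have V_near: "V k y \<le> d" if "dist y (\<gamma> k r) \<le> d / L" "1 / 2 \<le> r" "r \<le> 1" "1 / 4 \<le> zc k y" for k y r
  proof -
    have "V k (\<gamma> k r) = 0" using that by (intro V_gamma) auto
    then have "\<bar>V k (\<gamma> k r) - V k y\<bar> \<le> L * dist (\<gamma> k r) y"
      using that by (intro V_lipschitz[rule_format]) auto
    also have "\<dots> \<le> L * (d / L)"
      using that L by (intro mult_left_mono) (auto simp: dist_commute)
    also have "\<dots> = d" using L by simp
    finally show ?thesis using \<open>V k (\<gamma> k r) = 0\<close> by linarith
  qed
  have dL: "0 < d / L" using d L by simp
  have switch: "\<exists>r>0. \<forall>y. dist y (x (Suc k)) < r \<longrightarrow> (\<exists>k. inside k y \<and> V k y \<le> d)" for k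
  proof (intro exI[of _ "min (2 * \<kappa>) (d / L)"] conjI allI impI)
    fix y assume y: "dist y (x (Suc k)) < min (2 * \<kappa>) (d / L)"
    then have n: "0 < e k y" "e (Suc (Suc k)) y < 0" "z k - \<eta> < zc k y" "zc k y < z k + \<eta>" "1 - \<eta> < zc (Suc k) y" "zc (Suc k) y < 1 + \<eta>"
      using neighborhood[of y k] by auto
    have zz: "16 * \<eta> \<le> 1 - z k" "8 * \<eta> \<le> z k - 1 / 2" "16 * \<eta> \<le> 1 - z (Suc k)" "1 / 2 < z k" "z k < 1" "1 / 2 < z (Suc k)" "0 < \<eta>"
      using \<eta>(2,3)[of k] \<eta>(2)[of "Suc k"] z[of k] z[of "Suc k"] \<eta>(1) by auto
    show "\<exists>k. inside k y \<and> V k y \<le> d"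
    proof (cases "e (Suc k) y \<le> 0")
      case True
      have "V k y \<le> d" using y n zz by (intro V_near[of y k "z k"]) (auto simp: x_Suc)
      then show ?thesis using True n zz by (intro exI[of _ k]) (auto simp: inside_def)
    next
      case False
      have "V (Suc k) y \<le> d" using y n zz by (intro V_near[of y "Suc k" 1]) auto
      then show ?thesis using False n zz by (intro exI[of _ "Suc k"]) (auto simp: inside_def)
    qed
  qed (use \<kappa> dL in auto)
  obtain k r where r: "q = \<gamma> k r" "z k \<le> r" "r \<le> 1" using q by (auto simp: orbit_def)
  consider "r = z k" | "r = 1" | "z k < r" "r < 1" using r by linarith
  then show ?thesis
  proof cases
    case 1
    then show ?thesis using switch[of k] by (simp add: r x_Suc)
  next
    case 2
    have "k + 6 = Suc (k + 5)" by simp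
    then have "x k = x (Suc (k + 5))" using periodic(2)[of k] by metis
    then show ?thesis using switch[of "k + 5"] 2 by (simp add: r)
  next
    case 3
    have e: "0 < e k q" "e (Suc k) q < 0" using 3 r e_start(2)[of k r] e_end[of k r] by auto
    obtain s where s: "0 < s" "s \<le> e k q / L" "s \<le> - e (Suc k) q / L" "s \<le> \<eta> / L" "s \<le> d / L"
    proof -
      have "0 < e k q / L" "0 < - e (Suc k) q / L" "0 < \<eta> / L"
        using e \<eta>(1) L by (intro divide_pos_pos; simp)+
      from common_lower_bound[OF this dL] show ?thesis using that by blast
    qed
    have Ls: "L * s \<le> e k q" "L * s \<le> - e (Suc k) q" "L * s \<le> \<eta>"
      using s L mult_left_mono[of s _ L] by (auto simp: field_simps)
    have zz: "8 * \<eta> \<le> z k - 1 / 2" "1 / 2 < z k" "0 < \<eta>" using \<eta>(3)[of k] \<eta>(1) z[of k] by auto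
    show ?thesis
    proof (intro exI[of _ s] conjI allI impI)
      fix y assume y: "dist y q < s"
      have Ly: "L * dist y q \<le> L * s" using y L by (intro mult_left_mono) auto
      have zq: "zc k q = r" by (simp add: r)
      have zcy: "\<bar>zc k y - r\<bar> \<le> \<eta>" "0 \<le> e k y" "e (Suc k) y \<le> 0"
        using lipschitz(1)[of k y q] lipschitz(2)[of k y q] lipschitz(2)[of "Suc k" y q] Ly Ls unfolding zq by linarith+
      then have ins: "inside k y" using r zz unfolding inside_def by auto
      have "V k y \<le> d"
        using y s zcy r zz by (intro V_near[of y k r]) auto
      with ins show "\<exists>k. inside k y \<and> V k y \<le> d" by blast
    qed (rule s)
  qed
qed

text \<open>If X converged, Y would remain within 4 \<delta> of one of its points, and all its later
  velocities would lie in the inflated hull of radius 5 \<delta> there. A direction of uniformly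
  positive drift then makes the step sizes summable.\<close>

lemma no_limit:
  fixes Y v X :: "nat \<Rightarrow> real^3"
  assumes \<delta>: "0 < \<delta>" "5 * \<delta> \<le> \<kappa>" "L * (5 * \<delta>) < m / 2" "1000 * L * (5 * \<delta>) \<le> 1"
    and Y: "\<And>n. Y (Suc n) = Y n + h n *\<^sub>R v n" and h: "\<And>n. 0 < h n" "\<not> summable h"
    and v: "\<And>n. inflated \<delta> (Y n) (v n)" and inside: "\<And>n. \<exists>k. inside k (Y n) \<and> V k (Y n) \<le> m"
    and XY: "\<And>n. dist (X n) (Y n) \<le> \<delta>"
  shows "\<not> convergent X"
proof
  assume "convergent X"
  then obtain \<Lambda> where "X \<longlonglongrightarrow> \<Lambda>" by (auto simp: convergent_def)
  then obtain n1 where n1: "\<And>n. n1 \<le> n \<Longrightarrow> dist (X n) \<Lambda> < \<delta>"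
    using \<delta>(1) by (auto simp: tendsto_iff eventually_sequentially)
  have Yn: "dist (Y n) (Y n1) \<le> 4 * \<delta>" if "n1 \<le> n" for n
    using dist_triangle[of "Y n" "Y n1" "X n"] dist_triangle[of "X n" "Y n1" \<Lambda>] dist_triangle[of \<Lambda> "Y n1" "X n1"]
      n1[OF that] n1[of n1] XY[of n] XY[of n1] by (simp add: dist_commute)
  obtain k where k: "inside k (Y n1)" "V k (Y n1) \<le> m" using inside by blast
  have "0 < 5 * \<delta>" using \<delta> by simp
  then obtain a c where a: "0 < c" "\<And>v. inflated (5 * \<delta>) (Y n1) v \<Longrightarrow> c \<le> a \<bullet> v"
    using drift_direction[OF k _ \<delta>(2-4)] by blast
  have av: "c \<le> a \<bullet> v n" if "n1 \<le> n" for n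
    using Yn[OF that] by (intro a(2) inflated_mono[OF v]) simp
  have grow: "a \<bullet> Y n1 + c * (\<Sum>i<j. h (n1 + i)) \<le> a \<bullet> Y (n1 + j)" for j
  proof (induction j)
    case (Suc j)
    have "h (n1 + j) * c \<le> h (n1 + j) * (a \<bullet> v (n1 + j))"
      using av[of "n1 + j"] h(1)[of "n1 + j"] by (intro mult_left_mono) auto
    then show ?case using Suc Y[of "n1 + j"] by (simp add: inner_add_right algebra_simps)
  qed simp
  have "(\<Sum>i<j. h (n1 + i)) \<le> norm a * (4 * \<delta>) / c" for j
  proof -
    have "a \<bullet> (Y (n1 + j) - Y n1) \<le> norm a * norm (Y (n1 + j) - Y n1)" by (rule norm_cauchy_schwarz)
    also have "\<dots> \<le> norm a * (4 * \<delta>)" using Yn[of "n1 + j"] by (intro mult_left_mono) (auto simp: dist_norm)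
    finally show ?thesis using grow[of j] a(1) by (simp add: inner_diff_right le_divide_eq mult.commute)
  qed
  then have "summable (\<lambda>i. h (n1 + i))"
    using h(1) by (intro summableI_nonneg_bounded) (auto intro: less_imp_le)
  then have "summable h" using summable_iff_shift[of h n1] by (simp add: add.commute)
  with h(2) show False ..
qed

definition K\<Psi> :: real where "K\<Psi> = K2 * (4 * L + 2 * \<kappa>) + 2 * K3"

text \<open>Exports two consequences with constants independent of the sequence: the asymptotic
  distance of order \<delta> serves the solutions of the inclusion, the nonconvergence serves the
  recursion.\<close>

theorem trapped:
  obtains d \<delta>1 K where "0 < d" "0 < \<delta>1" "0 < K"
    and "\<And>\<delta> k0 Y v h \<epsilon>. 0 < \<delta> \<Longrightarrow> \<delta> \<le> \<delta>1 \<Longrightarrow> inside k0 (Y 0) \<Longrightarrow> V k0 (Y 0) \<le> d \<Longrightarrow>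
      (\<And>n. Y (Suc n) = Y n + h n *\<^sub>R v n) \<Longrightarrow> (\<And>n. 0 < h n) \<Longrightarrow> (\<And>n. h n \<le> \<delta>) \<Longrightarrow> \<not> summable h \<Longrightarrow>
      (\<And>n. inflated \<delta> (Y n) (v n)) \<Longrightarrow> 0 < \<epsilon> \<Longrightarrow>
      eventually (\<lambda>n. \<exists>k. inside k (Y n) \<and> V k (Y n) \<le> K * \<delta> + \<epsilon>) sequentially"
    and "\<And>\<delta> k0 Y v h X. 0 < \<delta> \<Longrightarrow> \<delta> \<le> \<delta>1 \<Longrightarrow> inside k0 (Y 0) \<Longrightarrow> V k0 (Y 0) \<le> d \<Longrightarrow>
      (\<And>n. Y (Suc n) = Y n + h n *\<^sub>R v n) \<Longrightarrow> (\<And>n. 0 < h n) \<Longrightarrow> (\<And>n. h n \<le> \<delta>) \<Longrightarrow> \<not> summable h \<Longrightarrow>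
      (\<And>n. inflated \<delta> (Y n) (v n)) \<Longrightarrow> (\<And>n. dist (X n) (Y n) \<le> \<delta>) \<Longrightarrow> \<not> convergent X"
proof -
  define \<epsilon> where "\<epsilon> = min (1 / 2) m"
  have \<epsilon>: "0 < \<epsilon>" "\<epsilon> \<le> 1 / 2" "\<epsilon> \<le> m" using m by (auto simp: \<epsilon>_def)
  \<comment> \<open>A dominates every coefficient of \<delta> in the smallness conditions, so that
    bounding A \<delta> settles all of them.\<close>
  define A where "A = 300 * K4 / \<beta> + 2 * K\<Psi> + 10 * L\<^sup>2 + 5000 * L + 11 * L"
  have K\<Psi>: "0 \<le> K\<Psi>" using constants_pos L \<kappa> by (auto simp: K\<Psi>_def intro!: add_nonneg_nonneg mult_nonneg_nonneg)
  have K4b: "0 < 300 * K4 / \<beta>" using constants_pos by simp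
  have A: "300 * K4 / \<beta> \<le> A" "2 * K\<Psi> \<le> A" "10 * L\<^sup>2 \<le> A" "5000 * L \<le> A" "11 * L \<le> A" "5 \<le> A" "0 < A"
    unfolding A_def using K\<Psi> K4b L zero_le_power2[of L] by linarith+
  obtain \<delta>1 where \<delta>1: "0 < \<delta>1" "\<delta>1 \<le> \<epsilon> / A" "\<delta>1 \<le> \<kappa> / A" "\<delta>1 \<le> 1 / A" "\<delta>1 \<le> 1"
    using common_lower_bound[of "\<epsilon> / A" "\<kappa> / A" "1 / A" 1] \<epsilon> \<kappa>(1) A(7) by auto
  have *: "0 < \<epsilon>' \<Longrightarrow> eventually (\<lambda>n. \<exists>k. inside k (Y n) \<and> V k (Y n) \<le> 300 * K4 / \<beta> * \<delta> + \<epsilon>') sequentially"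
      "(\<And>n. dist (X n) (Y n) \<le> \<delta>) \<Longrightarrow> \<not> convergent X"
    if \<delta>: "0 < \<delta>" "\<delta> \<le> \<delta>1" and start: "inside k0 (Y 0)" "V k0 (Y 0) \<le> \<epsilon> / 6"
      and Y: "\<And>n. Y (Suc n) = Y n + h n *\<^sub>R v n" and h: "\<And>n. 0 < h n" "\<And>n. h n \<le> \<delta>" "\<not> summable h"
      and v: "\<And>n. inflated \<delta> (Y n) (v n)"
    for \<delta> k0 and Y v X :: "nat \<Rightarrow> real^3" and h :: "nat \<Rightarrow> real" and \<epsilon>'
  proof -
    have A\<delta>: "A * \<delta> \<le> \<epsilon>" "A * \<delta> \<le> \<kappa>" "A * \<delta> \<le> 1"
    proof -
      have "A * \<delta> \<le> A * \<delta>1" using \<delta>(2) A(7) by simp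
      moreover have "A * \<delta>1 \<le> \<epsilon>" "A * \<delta>1 \<le> \<kappa>" "A * \<delta>1 \<le> 1" using \<delta>1(2-4) A(7) by (simp_all add: pos_le_divide_eq mult.commute)
      ultimately show "A * \<delta> \<le> \<epsilon>" "A * \<delta> \<le> \<kappa>" "A * \<delta> \<le> 1" by linarith+
    qed
    have small: "B * \<delta> \<le> \<epsilon>" "B * \<delta> \<le> \<kappa>" "B * \<delta> \<le> 1" if "B \<le> A" for B
      using mult_right_mono[OF that, of \<delta>] A\<delta> \<delta>(1) by linarith+
    \<comment> \<open>Half of \<epsilon> is reserved for the part of \<Psi> proportional to
      \<delta>; since the distance enters with factor 3, the start is required to satisfy V \<le>
      \<epsilon>/6.\<close>
    have "\<Psi> \<delta> k0 (Y 0) \<le> 3 * (\<epsilon> / 6) + K\<Psi> * \<delta>"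
      using Psi_le[OF start(1), of \<delta>] start(2) \<delta>(1) by (simp add: K\<Psi>_def)
    then have \<Psi>0: "\<Psi> \<delta> k0 (Y 0) \<le> \<epsilon>" using small(1)[OF A(2)] by simp
    have c: "10 * L\<^sup>2 * \<delta> \<le> m" "10 * L\<^sup>2 * \<delta> \<le> \<kappa>" "10 * L\<^sup>2 * \<delta> \<le> 1" "300 * K4 / \<beta> * \<delta> \<le> \<epsilon>"
      using small[OF A(3)] small(1)[OF A(1)] \<epsilon> by linarith+
    note trap = trapping[OF \<delta>(1) c(1-3) \<epsilon>(2,3) c(4) start(1) \<Psi>0 Y h(1,2) v]
    show "eventually (\<lambda>n. \<exists>k. inside k (Y n) \<and> V k (Y n) \<le> 300 * K4 / \<beta> * \<delta> + \<epsilon>') sequentially" if "0 < \<epsilon>'"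
      by (rule trap(2)[OF that h(3)])
    show "\<not> convergent X" if X: "\<And>n. dist (X n) (Y n) \<le> \<delta>"
    proof -
      have d5: "5 * \<delta> \<le> \<kappa>" "L * (5 * \<delta>) < m / 2" "1000 * L * (5 * \<delta>) \<le> 1"
        using small(2)[OF A(6)] small(1)[OF A(5)] small(3)[OF A(4)] \<epsilon> L \<delta>(1) by (auto simp: mult_ac)
      have "\<exists>k. inside k (Y n) \<and> V k (Y n) \<le> m" for n
        using trap(1)[of n] \<epsilon>(3) by (auto intro: order_trans)
      then show ?thesis
        by (intro no_limit[OF \<delta>(1) d5 Y h(1,3) v _ X])
    qed
  qed
  show thesis
  proof (rule that[of "\<epsilon> / 6" \<delta>1 "300 * K4 / \<beta>"])
    show "0 < \<epsilon> / 6" "0 < \<delta>1" "0 < 300 * K4 / \<beta>" using \<epsilon> \<delta>1 K4b by auto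
  qed (rule *(1) *(2); assumption)+
qed

end

section \<open>Solutions of the differential inclusion\<close>

definition velocities :: "real^3 \<Rightarrow> (real^3) set" where
  "velocities p = {update_prob * (cost_to_go \<mu> - p) | \<mu>. \<mu> \<in> greedy_policies p}"

text \<open>A closed half-space containing the generating velocities contains their convex hull.
  This is the form in which convexification enters, matching the support functions in
  \<open>inflated\<close>.\<close>

lemma mean_field_inner_le:
  assumes v: "v \<in> mean_field p" and le: "\<And>u. u \<in> velocities p \<Longrightarrow> a \<bullet> u \<le> b"
  shows "a \<bullet> v \<le> b"
proof -
  obtain w where w: "v = update_prob * w" "w \<in> convex hull {cost_to_go \<mu> - p | \<mu>. \<mu> \<in> greedy_policies p}"
    using v by (auto simp: mean_field_def)
  have adj: "a \<bullet> (update_prob * u) = (update_prob * a) \<bullet> u" for u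
    by (simp add: inner_vec_def mult_ac)
  have "convex hull {cost_to_go \<mu> - p | \<mu>. \<mu> \<in> greedy_policies p} \<subseteq> {u. (update_prob * a) \<bullet> u \<le> b}"
    using le by (intro hull_minimal convex_halfspace_le) (auto simp: velocities_def simp flip: adj)
  then show ?thesis using w by (auto simp: adj)
qed

lemma cost_to_go_bounded: "\<exists>B>0. \<forall>\<mu> i. \<bar>cost_to_go \<mu> $ i\<bar> \<le> B"
proof -
  have "bounded (range cost_to_go)" by (intro finite_imp_bounded) simp
  then obtain B where "0 < B" "\<And>\<mu>. norm (cost_to_go \<mu>) \<le> B"
    by (auto simp: bounded_pos)
  then show ?thesis using component_le_norm_cart order.trans by blast
qed

locale inclusion_path =
  fixes x v :: "real \<Rightarrow> real^3" and N :: "real set"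
  assumes v: "0 \<le> t \<Longrightarrow> v absolutely_integrable_on {0..t}" and x: "0 \<le> t \<Longrightarrow> x t = x 0 + integral {0..t} v"
    and N: "negligible N" and field: "0 \<le> t \<Longrightarrow> t \<notin> N \<Longrightarrow> v t \<in> mean_field (x t)"
begin

text \<open>The exceptional null set and the left endpoint are removed by changing the integrand
  there. Excluding the endpoint matters for the barrier argument that follows.\<close>

lemma increment_le:
  assumes st: "0 \<le> s" "s \<le> t" and le: "\<And>r. s < r \<Longrightarrow> r \<le> t \<Longrightarrow> r \<notin> N \<Longrightarrow> a \<bullet> v r \<le> b"
  shows "a \<bullet> (x t - x s) \<le> b * (t - s)"
proof -
  have int: "v integrable_on {0..t}"
    using v[of t] st by (simp add: absolutely_integrable_on_def)
  have ist: "v integrable_on {s..t}"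
    by (rule integrable_subinterval_real[OF int]) (use st in auto)
  have xx: "x t - x s = integral {s..t} v"
    using x[of t] x[of s] st Henstock_Kurzweil_Integration.integral_combine[OF st int] by (simp add: algebra_simps)
  have ai: "(\<lambda>r. a \<bullet> v r) integrable_on {s..t}"
    using integrable_linear[OF ist bounded_linear_inner_right[of a]] by (simp add: o_def)
  have NN: "negligible (insert s N)" using N by simp
  let ?w = "\<lambda>r. if r \<in> insert s N then b else a \<bullet> v r"
  have "a \<bullet> integral {s..t} v = integral {s..t} (\<lambda>r. a \<bullet> v r)"
    using integral_linear[OF ist bounded_linear_inner_right[of a]] by (simp add: o_def)
  also have "\<dots> = integral {s..t} ?w"
    by (rule integral_spike[OF NN]) auto
  also have "\<dots> \<le> integral {s..t} (\<lambda>_. b)"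
  proof (rule integral_le)
    show "?w integrable_on {s..t}" by (rule integrable_spike[OF ai NN]) auto
    show "?w r \<le> b" if "r \<in> {s..t}" for r using le[of r] that by (auto simp: less_le)
  qed auto
  also have "\<dots> = b * (t - s)" using st by simp
  finally show ?thesis by (simp add: xx)
qed

lemma continuous: "0 \<le> t \<Longrightarrow> continuous_on {0..t} x"
proof -
  assume t: "0 \<le> t"
  have "v integrable_on {0..t}" using v[OF t] by (simp add: absolutely_integrable_on_def)
  then have "continuous_on {0..t} (\<lambda>s. x 0 + integral {0..s} v)"
    by (intro continuous_intros indefinite_integral_continuous_1)
  then show ?thesis by (rule continuous_on_eq) (rule x[symmetric], simp)
qed

text \<open>Barrier argument: s is the last time up to t at which the bound holds, and from s to t
  the increment would be nonpositive.\<close>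

lemma inner_le:
  assumes B: "a \<bullet> x 0 \<le> B" and le: "\<And>r. 0 \<le> r \<Longrightarrow> r \<notin> N \<Longrightarrow> B < a \<bullet> x r \<Longrightarrow> a \<bullet> v r \<le> 0" and t: "0 \<le> t"
  shows "a \<bullet> x t \<le> B"
proof (rule ccontr)
  assume gt: "\<not> a \<bullet> x t \<le> B"
  define S where "S = {s \<in> {0..t}. a \<bullet> x s \<le> B}"
  have cont: "continuous_on {0..t} (\<lambda>s. a \<bullet> x s)"
    by (intro continuous_intros continuous t)
  have "closed S" unfolding S_def
    by (rule continuous_on_closed_Collect_le[OF cont]) auto
  moreover have "bounded S" by (rule bounded_subset[of "{0..t}"]) (auto simp: S_def)
  ultimately have "compact S" by (simp add: compact_eq_bounded_closed)
  moreover have "0 \<in> S" using B t by (simp add: S_def)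
  ultimately obtain s where s: "s \<in> S" "\<And>r. r \<in> S \<Longrightarrow> r \<le> s"
    using compact_attains_sup[of S] by blast
  have "a \<bullet> (x t - x s) \<le> 0 * (t - s)"
  proof (rule increment_le)
    fix r assume r: "s < r" "r \<le> t" "r \<notin> N"
    have "r \<notin> S" using s(2)[of r] r by auto
    then show "a \<bullet> v r \<le> 0" using r s(1) by (intro le) (auto simp: S_def)
  qed (use s(1) in \<open>auto simp: S_def\<close>)
  then show False using gt s(1) by (simp add: S_def inner_diff_right)
qed

text \<open>Outside a box containing all costs-to-go every admissible velocity points back, one
  coordinate at a time; enlarging the box by the norm of the initial point makes it contain the
  whole path.\<close>

lemma bounded_path: "\<exists>B>0. \<forall>t\<ge>0. \<forall>i. \<bar>x t $ i\<bar> \<le> B"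
proof -
  obtain B0 where B0: "0 < B0" "\<And>\<mu> i. \<bar>cost_to_go \<mu> $ i\<bar> \<le> B0" using cost_to_go_bounded by blast
  define B where "B = B0 + norm (x 0)"
  have x0: "\<bar>x 0 $ i\<bar> \<le> B" for i using component_le_norm_cart[of "x 0" i] B0(1) by (simp add: B_def)
  have BB: "B0 \<le> B" by (simp add: B_def)
  have q: "0 \<le> update_prob $ i" for i using exhaust_3[of i] by (auto simp: update_prob_def)
  have "\<bar>x t $ i\<bar> \<le> B" if "0 \<le> t" for t i
  proof -
    have "axis i 1 \<bullet> x t \<le> B"
    proof (rule inner_le[OF _ _ that])
      fix r assume r: "0 \<le> r" "r \<notin> N" "B < axis i 1 \<bullet> x r"
      show "axis i 1 \<bullet> v r \<le> 0"
      proof (rule mean_field_inner_le[OF field[OF r(1,2)]])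
        fix u assume "u \<in> velocities (x r)"
        then obtain \<mu> where "u = update_prob * (cost_to_go \<mu> - x r)" by (auto simp: velocities_def)
        then show "axis i 1 \<bullet> u \<le> 0"
          using r(3) B0(2)[of \<mu> i] BB q[of i] by (auto simp: inner_axis' intro!: mult_nonneg_nonpos)
      qed
    qed (use x0[of i] in \<open>simp add: inner_axis'\<close>)
    moreover have "axis i (-1) \<bullet> x t \<le> B"
    proof (rule inner_le[OF _ _ that])
      fix r assume r: "0 \<le> r" "r \<notin> N" "B < axis i (-1) \<bullet> x r"
      show "axis i (-1) \<bullet> v r \<le> 0"
      proof (rule mean_field_inner_le[OF field[OF r(1,2)]])
        fix u assume "u \<in> velocities (x r)"
        then obtain \<mu> where "u = update_prob * (cost_to_go \<mu> - x r)" by (auto simp: velocities_def)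
        then show "axis i (-1) \<bullet> u \<le> 0"
          using r(3) B0(2)[of \<mu> i] BB q[of i] by (auto simp: inner_axis' intro!: mult_nonneg_nonneg)
      qed
    qed (use x0[of i] in \<open>simp add: inner_axis'\<close>)
    ultimately show ?thesis by (simp add: inner_axis' abs_le_iff)
  qed
  moreover have "0 < B" using B0(1) by (simp add: B_def add_pos_nonneg)
  ultimately show ?thesis by blast
qed

lemma lipschitz_path: "\<exists>B>0. \<forall>s t. 0 \<le> s \<longrightarrow> s \<le> t \<longrightarrow> dist (x t) (x s) \<le> B * (t - s)"
proof -
  obtain B0 where B0: "0 < B0" "\<And>\<mu> i. \<bar>cost_to_go \<mu> $ i\<bar> \<le> B0" using cost_to_go_bounded by blast
  obtain B where B: "0 < B" "\<And>t i. 0 \<le> t \<Longrightarrow> \<bar>x t $ i\<bar> \<le> B" using bounded_path by blast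
  define D where "D = 3 * (B0 + B)"
  have "dist (x t) (x s) \<le> D * (t - s)" if st: "0 \<le> s" "s \<le> t" for s t
  proof -
    let ?a = "x t - x s"
    have "?a \<bullet> (x t - x s) \<le> norm ?a * D * (t - s)"
    proof (rule increment_le[OF st])
      fix r assume r: "s < r" "r \<le> t" "r \<notin> N"
      have r0: "0 \<le> r" using r st by simp
      show "?a \<bullet> v r \<le> norm ?a * D"
      proof (rule mean_field_inner_le[OF field[OF r0 r(3)]])
        fix u assume "u \<in> velocities (x r)"
        then obtain \<mu> where u: "u = update_prob * (cost_to_go \<mu> - x r)" by (auto simp: velocities_def)
        have "norm u \<le> 1 * norm (cost_to_go \<mu> - x r)"
          unfolding u by (intro norm_mult_vec_le abs_update_prob_le)
        also have "\<dots> \<le> (\<Sum>i\<in>UNIV. \<bar>(cost_to_go \<mu> - x r) $ i\<bar>)"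
          unfolding mult_1 by (rule norm_le_l1_cart)
        also have "\<dots> \<le> (\<Sum>i\<in>(UNIV::3 set). B0 + B)"
        proof (rule sum_mono)
          fix i show "\<bar>(cost_to_go \<mu> - x r) $ i\<bar> \<le> B0 + B"
            using B0(2)[of \<mu> i] B(2)[OF r0, of i] by simp
        qed
        finally have "norm u \<le> D" by (simp add: D_def)
        then have "norm ?a * norm u \<le> norm ?a * D" by (intro mult_left_mono) auto
        then show "?a \<bullet> u \<le> norm ?a * D" using norm_cauchy_schwarz[of ?a u] by linarith
      qed
    qed
    then have "norm ?a * norm ?a \<le> norm ?a * (D * (t - s))"
      by (simp add: dot_square_norm power2_eq_square mult.assoc)
    then show ?thesis
      using st B(1) B0(1) by (cases "?a = 0") (auto simp: dist_norm D_def)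
  qed
  moreover have "0 < D" using B(1) B0(1) by (simp add: D_def)
  ultimately show ?thesis by blast
qed

end

lemma inclusion_pathE:
  assumes "inclusion_solution x"
  obtains v N where "inclusion_path x v N"
proof -
  from assms obtain v where v: "\<forall>t\<ge>0. v absolutely_integrable_on {0..t} \<and> x t = x 0 + integral {0..t} v"
    "AE t in lebesgue. 0 \<le> t \<longrightarrow> v t \<in> mean_field (x t)"
    unfolding inclusion_solution_def by blast
  then obtain N where N: "negligible N" "{t. \<not> (0 \<le> t \<longrightarrow> v t \<in> mean_field (x t))} \<subseteq> N"
    unfolding eventually_ae_filter_negligible by blast
  have "inclusion_path x v N"
  proof
    show "x t = x 0 + integral {0..t} v" if "0 \<le> t" for t
      using v(1) that by blast
    show "v absolutely_integrable_on {0..t}" if "0 \<le> t" for t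
      using v(1) that by blast
    show "v t \<in> mean_field (x t)" if "0 \<le> t" "t \<notin> N" for t
      using N(2) that by blast
  qed (rule N(1))
  then show ?thesis by (rule that)
qed

context hybrid_cycle_constants
begin

text \<open>Sampling so finely that the solution moves at most \<delta> per step puts the averaged
  velocities into the inflated hulls, by \<open>increment_le\<close>. Since \<delta> may be chosen
  after the target accuracy while the initial distance d stays fixed, the asymptotic error of order
  \<delta> improves to convergence.\<close>

lemma solution_converges:
  assumes vel: "\<And>p. vel p = velocities p"
  shows "\<exists>d>0. \<forall>X. inclusion_solution X \<longrightarrow> (\<exists>k. inside k (X 0) \<and> V k (X 0) \<le> d) \<longrightarrow>
    ((\<lambda>t. infdist (X t) orbit) \<longlongrightarrow> 0) at_top"
proof (rule trapped)
  fix d \<delta>1 K assume d: "0 < d" "0 < \<delta>1" "0 < K" and trap: "\<And>\<delta> k0 Y v h \<epsilon>. 0 < \<delta> \<Longrightarrow> \<delta> \<le> \<delta>1 \<Longrightarrow>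
      inside k0 (Y 0) \<Longrightarrow> V k0 (Y 0) \<le> d \<Longrightarrow> (\<And>n. Y (Suc n) = Y n + h n *\<^sub>R v n) \<Longrightarrow> (\<And>n. 0 < h n) \<Longrightarrow> (\<And>n. h n \<le> \<delta>) \<Longrightarrow>
      \<not> summable h \<Longrightarrow> (\<And>n. inflated \<delta> (Y n) (v n)) \<Longrightarrow> 0 < \<epsilon> \<Longrightarrow>
      eventually (\<lambda>n. \<exists>k. inside k (Y n) \<and> V k (Y n) \<le> K * \<delta> + \<epsilon>) sequentially"
    and "\<And>\<delta> k0 Y v h X. 0 < \<delta> \<Longrightarrow> \<delta> \<le> \<delta>1 \<Longrightarrow> inside k0 (Y 0) \<Longrightarrow> V k0 (Y 0) \<le> d \<Longrightarrow>
      (\<And>n. Y (Suc n) = Y n + h n *\<^sub>R v n) \<Longrightarrow> (\<And>n. 0 < h n) \<Longrightarrow> (\<And>n. h n \<le> \<delta>) \<Longrightarrow> \<not> summable h \<Longrightarrow>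
      (\<And>n. inflated \<delta> (Y n) (v n)) \<Longrightarrow> (\<And>n. dist (X n) (Y n) \<le> \<delta>) \<Longrightarrow> \<not> convergent X"
  have "((\<lambda>t. infdist (X t) orbit) \<longlongrightarrow> 0) at_top" if sol: "inclusion_solution X" and start: "inside k0 (X 0)" "V k0 (X 0) \<le> d" for X k0
  proof (rule tendstoI)
    fix \<epsilon> :: real assume \<epsilon>: "0 < \<epsilon>"
    obtain v N where "inclusion_path X v N" by (rule inclusion_pathE[OF sol])
    then interpret inclusion_path X v N .
    obtain D where D: "0 < D" "\<And>s t. 0 \<le> s \<Longrightarrow> s \<le> t \<Longrightarrow> dist (X t) (X s) \<le> D * (t - s)"
      using lipschitz_path by blast
    have "0 < \<epsilon> / 2" using \<epsilon> by simp
    from inside_near_orbit[OF this] obtain d' where d': "0 < d'" "\<And>k y. inside k y \<Longrightarrow> V k y \<le> d' \<Longrightarrow> infdist y orbit \<le> \<epsilon> / 2"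
      by blast
    have "0 < d' / (2 * K)" "0 < \<epsilon> / 4" using d' d \<epsilon> by simp_all
    from common_lower_bound[OF d(2) this zero_less_one] obtain \<delta> where \<delta>: "0 < \<delta>" "\<delta> \<le> \<delta>1" "\<delta> \<le> d' / (2 * K)" "\<delta> \<le> \<epsilon> / 4"
      by blast
    define h where "h = min \<delta> (\<delta> / D)"
    have h: "0 < h" "h \<le> \<delta>" "D * h \<le> \<delta>"
    proof -
      show "0 < h" "h \<le> \<delta>" using \<delta> D by (auto simp: h_def)
      have "D * h \<le> D * (\<delta> / D)" using D(1) by (intro mult_left_mono) (auto simp: h_def)
      then show "D * h \<le> \<delta>" using D(1) by simp
    qed
    define Y where "Y n = X (real n * h)" for n
    define w where "w n = (1 / h) *\<^sub>R (Y (Suc n) - Y n)" for n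
    have near: "dist (X r) (Y n) \<le> \<delta>" if "real n * h \<le> r" "r \<le> real (Suc n) * h" for r n
    proof -
      have "dist (X r) (Y n) \<le> D * (r - real n * h)" unfolding Y_def using that h by (intro D) auto
      also have "\<dots> \<le> D * h" using that D(1) by (intro mult_left_mono) (auto simp: algebra_simps)
      finally show ?thesis using h(3) by simp
    qed
    have "eventually (\<lambda>n. \<exists>k. inside k (Y n) \<and> V k (Y n) \<le> K * \<delta> + d' / 2) sequentially"
    proof (rule trap[of \<delta> k0 Y "\<lambda>_. h" w "d' / 2"])
      show "Y (Suc n) = Y n + h *\<^sub>R w n" for n using h(1) by (simp add: w_def)
      show "\<not> summable (\<lambda>n. h)" using h(1) by (simp add: summable_const_iff)
      show "inflated \<delta> (Y n) (w n)" for n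
        unfolding inflated_def
      proof (intro allI impI)
        fix a b assume ab: "\<forall>p u. dist p (Y n) \<le> \<delta> \<longrightarrow> u \<in> vel p \<longrightarrow> a \<bullet> u \<le> b"
        have "a \<bullet> (X (real (Suc n) * h) - X (real n * h)) \<le> b * (real (Suc n) * h - real n * h)"
        proof (rule increment_le)
          fix r assume r: "real n * h < r" "r \<le> real (Suc n) * h" "r \<notin> N"
          have r0: "0 \<le> r" using r h(1) by (auto intro: order.trans[of _ "real n * h"])
          show "a \<bullet> v r \<le> b"
            using ab near[of n r] r by (intro mean_field_inner_le[OF field[OF r0 r(3)]]) (auto simp: vel)
        qed (use h(1) in auto)
        also have "real (Suc n) * h - real n * h = h" by (simp add: algebra_simps)
        finally have "a \<bullet> (Y (Suc n) - Y n) \<le> b * h" unfolding Y_def .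
        then show "a \<bullet> w n \<le> b" using h(1) by (simp add: w_def divide_le_eq)
      qed
      show "V k0 (Y 0) \<le> d" "inside k0 (Y 0)" using start by (simp_all add: Y_def)
      show "0 < \<delta>" "\<delta> \<le> \<delta>1" "0 < d' / 2" using \<delta> d' by simp_all
      show "0 < h" "h \<le> \<delta>" by (rule h)+
    qed
    then obtain n0 where n0: "\<And>n. n0 \<le> n \<Longrightarrow> \<exists>k. inside k (Y n) \<and> V k (Y n) \<le> K * \<delta> + d' / 2"
      unfolding eventually_sequentially by blast
    have Kd: "K * \<delta> + d' / 2 \<le> d'" using \<delta>(3) d(3) by (simp add: field_simps)
    have "dist (infdist (X t) orbit) 0 < \<epsilon>" if t: "real n0 * h \<le> t" for t
    proof -
      define n where "n = nat \<lfloor>t / h\<rfloor>"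
      have t0: "0 \<le> t" using t h(1) by (auto intro: order.trans[of _ "real n0 * h"])
      have n: "real n \<le> t / h" "t / h < real n + 1"
        using t0 h(1) by (simp_all add: n_def of_nat_nat)
      have "real n0 \<le> t / h" using t h(1) by (simp add: pos_le_divide_eq)
      then have "n0 \<le> n" using n by linarith
      from n0[OF this] obtain k where "inside k (Y n)" "V k (Y n) \<le> K * \<delta> + d' / 2" by blast
      then have "infdist (Y n) orbit \<le> \<epsilon> / 2" using Kd by (intro d'(2)[of k]) auto
      moreover have "dist (X t) (Y n) \<le> \<delta>"
        using n h(1) by (intro near) (auto simp: field_simps)
      ultimately show ?thesis
        using infdist_triangle[of "X t" orbit "Y n"] infdist_nonneg[of "X t" orbit] \<delta>(4) \<epsilon> by simp
    qed
    then show "eventually (\<lambda>t. dist (infdist (X t) orbit) 0 < \<epsilon>) at_top"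
      unfolding eventually_at_top_linorder by blast
  qed
  then show ?thesis using d(1) by blast
qed

end

section \<open>The noise of the Monte Carlo recursion\<close>

lemma integral_bind_pmf_bounded:
  fixes h :: "'b \<Rightarrow> real"
  assumes "\<And>y. \<bar>h y\<bar> \<le> B"
  shows "measure_pmf.expectation (bind_pmf p k) h = measure_pmf.expectation p (\<lambda>x. measure_pmf.expectation (k x) h)"
  unfolding measure_pmf_bind
proof (rule integral_bind[where K = "count_space UNIV" and B = B and B' = 1])
  show "(\<lambda>x. measure_pmf (k x)) \<in> measure_pmf p \<rightarrow>\<^sub>M subprob_algebra (count_space UNIV)"
    by (simp add: measure_pmf_in_subprob_algebra)
qed (use assms in \<open>auto simp: measure_pmf.emeasure_space_1\<close>)

lemma integrable_pmf_bounded: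
  fixes h :: "'a \<Rightarrow> real"
  assumes "\<And>x. \<bar>h x\<bar> \<le> B"
  shows "integrable (measure_pmf p) h"
  using assms by (intro measure_pmf.integrable_const_bound[where B = B]) auto

lemma abs_expectation_le:
  fixes h :: "'a \<Rightarrow> real"
  assumes "\<And>x. \<bar>h x\<bar> \<le> B"
  shows "\<bar>measure_pmf.expectation p h\<bar> \<le> B"
proof (rule abs_leI)
  show "measure_pmf.expectation p h \<le> B"
    using assms by (intro measure_pmf.integral_le_const integrable_pmf_bounded[of _ B]) (auto simp: abs_le_iff)
  have "- B \<le> measure_pmf.expectation p h"
    using assms by (intro measure_pmf.integral_ge_const integrable_pmf_bounded[of _ B]) (auto simp: abs_le_iff minus_le_iff)
  then show "- measure_pmf.expectation p h \<le> B" by simp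
qed

lemma expectation_affine:
  fixes h :: "'a \<Rightarrow> real"
  assumes "\<And>x. \<bar>h x\<bar> \<le> B"
  shows "measure_pmf.expectation p (\<lambda>x. a * (h x / c - b)) = a * (measure_pmf.expectation p h / c - b)"
  using integrable_pmf_bounded[of h B p, OF assms] by simp

definition final_cost :: "policy \<Rightarrow> state list \<Rightarrow> real" where
  "final_cost \<mu> p = cost (last p) (\<mu> (last p))"

lemma abs_cost_le: "\<bar>cost i a\<bar> \<le> 9"
  using exhaust_3[of i] by (auto simp: cost_def)

lemma abs_final_cost_le: "\<bar>final_cost \<mu> p\<bar> \<le> 9"
  by (simp add: final_cost_def abs_cost_le)

lemma trajectory_nonempty: "p \<in> set_pmf (trajectory_pmf \<mu> m i) \<Longrightarrow> p \<noteq> []"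
  by (cases m) auto

lemma expectation_step:
  fixes h :: "state \<Rightarrow> real"
  shows "measure_pmf.expectation (step_pmf \<mu> i) h = (\<Sum>j\<in>UNIV. trans_prob i (\<mu> i) j * h j)"
  by (subst integral_measure_pmf_real[of UNIV]) (auto simp: pmf_step_pmf mult.commute)

lemma expectation_update:
  fixes h :: "state \<Rightarrow> real"
  shows "measure_pmf.expectation update_pmf h = (\<Sum>j\<in>UNIV. update_prob $ j * h j)"
  by (subst integral_measure_pmf_real[of UNIV]) (auto simp: pmf_update_pmf mult.commute)

definition mean_cost :: "policy \<Rightarrow> nat \<Rightarrow> state \<Rightarrow> real" where
  "mean_cost \<mu> m i = measure_pmf.expectation (trajectory_pmf \<mu> m i) (final_cost \<mu>)"

lemma abs_mean_cost_le: "\<bar>mean_cost \<mu> m i\<bar> \<le> 9"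
  unfolding mean_cost_def by (intro abs_expectation_le abs_final_cost_le)

lemma mean_cost_0: "mean_cost \<mu> 0 i = cost i (\<mu> i)"
  by (simp add: mean_cost_def final_cost_def)

text \<open>Conditioning on the first transition: prepending the initial state leaves the last state
  unchanged, because trajectories are nonempty.\<close>

lemma mean_cost_Suc: "mean_cost \<mu> (Suc m) i = (\<Sum>j\<in>UNIV. trans_prob i (\<mu> i) j * mean_cost \<mu> m j)"
proof -
  have "measure_pmf.expectation (trajectory_pmf \<mu> m j) (\<lambda>p. final_cost \<mu> (i # p)) = mean_cost \<mu> m j" for j
    unfolding mean_cost_def
    by (intro integral_cong_AE) (auto simp: AE_measure_pmf_iff final_cost_def trajectory_nonempty)
  then show ?thesis
    by (simp add: mean_cost_def[of \<mu> "Suc m"] integral_bind_pmf_bounded[OF abs_final_cost_le] expectation_step)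
qed

text \<open>Memorylessness: with probability 1 - \<open>discount\<close> the horizon is 0, otherwise
  it is one more than a fresh copy.\<close>

lemma expectation_geometric:
  fixes h :: "nat \<Rightarrow> real"
  assumes "\<And>m. \<bar>h m\<bar> \<le> B"
  shows "measure_pmf.expectation (geometric_pmf (1 - discount)) h
    = (1 - discount) * h 0 + discount * measure_pmf.expectation (geometric_pmf (1 - discount)) (\<lambda>m. h (Suc m))"
proof -
  have d: "1 - discount \<in> {0<..1}" by (simp add: discount_def)
  have "measure_pmf.expectation (geometric_pmf (1 - discount)) h = measure_pmf.expectation
      (bind_pmf (bernoulli_pmf (1 - discount)) (\<lambda>b. if b then return_pmf 0 else map_pmf Suc (geometric_pmf (1 - discount)))) h"
    using geometric_bind_pmf_unfold[OF d] by simp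
  also have "\<dots> = (1 - discount) * h 0 + discount * measure_pmf.expectation (geometric_pmf (1 - discount)) (\<lambda>m. h (Suc m))"
    using d by (simp add: integral_bind_pmf_bounded[OF assms] mult.commute)
  finally show ?thesis .
qed

text \<open>Unbiasedness of the estimator. Splitting off the first step of the horizon shows that
  the expected return solves the policy evaluation equation, whose solution is unique.\<close>

lemma expected_return:
  "measure_pmf.expectation (geometric_pmf (1 - discount)) (\<lambda>m. mean_cost \<mu> m i) / (1 - discount) = cost_to_go \<mu> $ i"
proof -
  let ?E = "measure_pmf.expectation (geometric_pmf (1 - discount))"
  define G :: "real^3" where "G = (\<chi> i. ?E (\<lambda>m. mean_cost \<mu> m i) / (1 - discount))"
  have d: "1 - discount \<noteq> 0" by (simp add: discount_def)
  have "G $ i = cost i (\<mu> i) + discount * (\<Sum>j\<in>UNIV. trans_prob i (\<mu> i) j * G $ j)" for i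
  proof -
    have "?E (\<lambda>m. mean_cost \<mu> m i) = (1 - discount) * cost i (\<mu> i) + discount * ?E (\<lambda>m. \<Sum>j\<in>UNIV. trans_prob i (\<mu> i) j * mean_cost \<mu> m j)"
      by (subst expectation_geometric[OF abs_mean_cost_le]) (simp only: mean_cost_0 mean_cost_Suc)
    also have "?E (\<lambda>m. \<Sum>j\<in>UNIV. trans_prob i (\<mu> i) j * mean_cost \<mu> m j) = (\<Sum>j\<in>UNIV. trans_prob i (\<mu> i) j * ?E (\<lambda>m. mean_cost \<mu> m j))"
    proof -
      have "integrable (measure_pmf (geometric_pmf (1 - discount))) (\<lambda>m. mean_cost \<mu> m j)" for j
        by (rule integrable_pmf_bounded[OF abs_mean_cost_le])
      then show ?thesis by (subst Bochner_Integration.integral_sum) auto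
    qed
    finally show ?thesis using d by (simp add: G_def field_simps sum_divide_distrib[symmetric])
  qed
  then have "cost_to_go \<mu> = G" by (intro cost_to_go_eqI) blast
  then show ?thesis by (simp add: G_def)
qed

text \<open>Costs are at most 9 in modulus, and 9 / (1 - 0.95) = 180; the same constant bounds the
  sampled returns.\<close>

lemma abs_cost_to_go_le: "\<bar>cost_to_go \<mu> $ i\<bar> \<le> 180"
proof -
  have "\<bar>measure_pmf.expectation (geometric_pmf (1 - discount)) (\<lambda>m. mean_cost \<mu> m i)\<bar> \<le> 9"
    by (intro abs_expectation_le abs_mean_cost_le)
  then show ?thesis by (simp add: expected_return[symmetric] discount_def)
qed

lemma abs_mc_return_le: "\<bar>mc_return \<mu> s\<bar> \<le> 180"
  using abs_cost_le[of "last (snd s)" "\<mu> (last (snd s))"] by (simp add: mc_return_def Let_def discount_def)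

lemma mc_return_eq: "mc_return \<mu> (i, p) = final_cost \<mu> p / (1 - discount)"
  by (simp add: mc_return_def final_cost_def Let_def)

lemma expectation_sample:
  fixes h :: "sample \<Rightarrow> real"
  assumes "\<And>s. \<bar>h s\<bar> \<le> B"
  shows "measure_pmf.expectation (sample_pmf \<mu>) h = (\<Sum>i\<in>UNIV. update_prob $ i *
    measure_pmf.expectation (geometric_pmf (1 - discount)) (\<lambda>m. measure_pmf.expectation (trajectory_pmf \<mu> m i) (\<lambda>p. h (i, p))))"
  by (simp add: sample_pmf_def integral_bind_pmf_bounded[OF assms] expectation_update)

text \<open>The sampled update direction minus its conditional mean, hence a martingale difference
  along the recursion.\<close>

definition noise :: "policy \<Rightarrow> real^3 \<Rightarrow> sample \<Rightarrow> real^3" where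
  "noise \<mu> y s = (mc_return \<mu> s - y $ fst s) *\<^sub>R axis (fst s) 1 - update_prob * (cost_to_go \<mu> - y)"

lemma noise_mean:
  "measure_pmf.expectation (sample_pmf \<mu>) (\<lambda>s. w \<bullet> noise \<mu> y s) = 0"
  and abs_inner_noise_le: "\<exists>B. \<forall>s. \<bar>w \<bullet> noise \<mu> y s\<bar> \<le> B"
proof -
  define F where "F s = w $ fst s * (mc_return \<mu> s - y $ fst s)" for s :: sample
  have noise_eq: "w \<bullet> noise \<mu> y s = F s - w \<bullet> (update_prob * (cost_to_go \<mu> - y))" for s
    by (simp add: noise_def F_def inner_diff_right inner_axis)
  have F: "\<bar>F s\<bar> \<le> norm w * (180 + norm y)" for s
    unfolding F_def abs_mult
    using component_le_norm_cart[of w "fst s"] component_le_norm_cart[of y "fst s"] abs_mc_return_le[of \<mu> s]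
    by (intro mult_mono) auto
  then have "\<bar>w \<bullet> noise \<mu> y s\<bar> \<le> norm w * (180 + norm y) + \<bar>w \<bullet> (update_prob * (cost_to_go \<mu> - y))\<bar>" for s
    unfolding noise_eq using F[of s] by linarith
  then show "\<exists>B. \<forall>s. \<bar>w \<bullet> noise \<mu> y s\<bar> \<le> B" by blast
  have affine: "measure_pmf.expectation p (\<lambda>m. a * (mean_cost \<mu> m i / c - b)) = a * (measure_pmf.expectation p (\<lambda>m. mean_cost \<mu> m i) / c - b)"
    for p a b c i
    by (rule expectation_affine[OF abs_mean_cost_le])
  have "measure_pmf.expectation (sample_pmf \<mu>) F = (\<Sum>i\<in>UNIV. update_prob $ i * (w $ i * (cost_to_go \<mu> $ i - y $ i)))"
    unfolding expectation_sample[OF F]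
    by (simp only: F_def mc_return_eq fst_conv expectation_affine[OF abs_final_cost_le] mean_cost_def[symmetric] affine expected_return)
  also have "\<dots> = w \<bullet> (update_prob * (cost_to_go \<mu> - y))"
    by (simp add: inner_vec_def mult_ac)
  finally show "measure_pmf.expectation (sample_pmf \<mu>) (\<lambda>s. w \<bullet> noise \<mu> y s) = 0"
    unfolding noise_eq using integrable_pmf_bounded[of F _ "sample_pmf \<mu>", OF F] by simp
qed

lemma norm_le_3: "(\<And>i. \<bar>(y::real^3) $ i\<bar> \<le> B) \<Longrightarrow> norm y \<le> 3 * B"
  using norm_le_l1_cart[of y] sum_mono[of UNIV "\<lambda>i. \<bar>y $ i\<bar>" "\<lambda>_. B"] by simp

lemma norm_noise_le:
  assumes "\<And>i. \<bar>y $ i\<bar> \<le> B" "180 \<le> B"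
  shows "norm (noise \<mu> y s) \<le> 12 * B"
proof -
  have "\<bar>noise \<mu> y s $ i\<bar> \<le> 4 * B" for i
  proof -
    have "\<bar>update_prob $ i\<bar> \<le> 1" using exhaust_3[of i] by (auto simp: update_prob_def)
    then have "\<bar>update_prob $ i * (cost_to_go \<mu> $ i - y $ i)\<bar> \<le> 1 * (2 * B)"
      unfolding abs_mult using abs_cost_to_go_le[of \<mu> i] assms(1)[of i] assms(2) by (intro mult_mono) auto
    moreover have "\<bar>(mc_return \<mu> s - y $ fst s) * axis (fst s) 1 $ i\<bar> \<le> 2 * B"
      using abs_mc_return_le[of \<mu> s] assms(1)[of "fst s"] assms(2) by (auto simp: axis_def)
    ultimately show ?thesis by (simp add: noise_def)
  qed
  from norm_le_3[OF this] show ?thesis by simp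
qed

section \<open>Stopped noise and the law of sample paths\<close>

context
  fixes \<tau> :: "real^3 \<Rightarrow> policy" and \<gamma> :: "nat \<Rightarrow> real" and J0 :: "real^3" and \<delta> B :: real
  assumes \<gamma>: "\<And>n. 0 \<le> \<gamma> n" "\<And>n. \<gamma> n \<le> 1" and B: "180 \<le> B" "\<And>i. \<bar>J0 $ i\<bar> \<le> B" and \<delta>: "0 < \<delta>"
begin

text \<open>The recursion as a deterministic function of the sample sequence, so that pathwise
  estimates are independent of the underlying probability space.\<close>

primrec path_value :: "(nat \<Rightarrow> sample) \<Rightarrow> nat \<Rightarrow> real^3" where
  "path_value f 0 = J0"
| "path_value f (Suc n) = mc_update \<tau> (\<gamma> n) (path_value f n) (f n)"

definition path_noise :: "(nat \<Rightarrow> sample) \<Rightarrow> nat \<Rightarrow> real^3" where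
  "path_noise f n = noise (\<tau> (path_value f n)) (path_value f n) (f n)"

text \<open>Coincides with the accumulated noise as long as the latter stays within \<delta>. The
  first exceeding term is included and the value then frozen, so the event of having exceeded
  \<delta> increases with n.\<close>

primrec stopped_noise :: "(nat \<Rightarrow> sample) \<Rightarrow> nat \<Rightarrow> real^3" where
  "stopped_noise f 0 = 0"
| "stopped_noise f (Suc n) = stopped_noise f n + (if norm (stopped_noise f n) \<le> \<delta> then \<gamma> n *\<^sub>R path_noise f n else 0)"

lemma path_value_cong: "(\<And>i. i < n \<Longrightarrow> f i = g i) \<Longrightarrow> path_value f n = path_value g n"
  by (induction n) auto

lemma stopped_noise_cong: "(\<And>i. i < n \<Longrightarrow> f i = g i) \<Longrightarrow> stopped_noise f n = stopped_noise g n"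
proof (induction n)
  case (Suc n)
  then show ?case using path_value_cong[of n f g] by (simp add: path_noise_def)
qed simp

text \<open>An update replaces one coordinate by a convex combination of itself and a return of
  modulus at most 180. The iterates, and with them the noise, are thus bounded on every
  path.\<close>

lemma abs_path_value_le: "\<bar>path_value f n $ i\<bar> \<le> B"
proof (induction n)
  case (Suc n)
  let ?y = "path_value f n" and ?R = "mc_return (\<tau> (path_value f n)) (f n)"
  show ?case
  proof (cases "i = fst (f n)")
    case True
    have "path_value f (Suc n) $ i = (1 - \<gamma> n) * ?y $ i + \<gamma> n * ?R"
      using True by (simp add: mc_update_def algebra_simps)
    also have "\<bar>\<dots>\<bar> \<le> (1 - \<gamma> n) * B + \<gamma> n * B"
    proof -
      have "\<bar>(1 - \<gamma> n) * ?y $ i\<bar> \<le> (1 - \<gamma> n) * B" "\<bar>\<gamma> n * ?R\<bar> \<le> \<gamma> n * B"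
        unfolding abs_mult using Suc \<gamma>[of n] abs_mc_return_le[of "\<tau> ?y" "f n"] B(1) by (auto intro!: mult_mono)
      then show ?thesis by linarith
    qed
    finally show ?thesis by (simp add: algebra_simps)
  next
    case False
    then show ?thesis using Suc by (simp add: mc_update_def axis_def)
  qed
qed (simp add: B)

lemma norm_path_noise_le: "norm (path_noise f n) \<le> 12 * B"
  unfolding path_noise_def by (intro norm_noise_le abs_path_value_le B)

lemma norm_stopped_noise_le: "norm (stopped_noise f n) \<le> n * (12 * B)"
proof (induction n)
  case (Suc n)
  have "norm (\<gamma> n *\<^sub>R path_noise f n) \<le> 1 * (12 * B)"
    using \<gamma>[of n] norm_path_noise_le[of f n] by (simp only: norm_scaleR, intro mult_mono) auto
  then have "norm (if norm (stopped_noise f n) \<le> \<delta> then \<gamma> n *\<^sub>R path_noise f n else 0) \<le> 12 * B"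
    using B(1) by simp
  with Suc show ?case
    using norm_triangle_ineq[of "stopped_noise f n" "if norm (stopped_noise f n) \<le> \<delta> then \<gamma> n *\<^sub>R path_noise f n else 0"]
    by (simp only: stopped_noise.simps of_nat_Suc distrib_right)
qed simp

text \<open>The law of the first n samples as a discrete distribution on lists, where moments can be
  computed by conditioning on the prefix.\<close>

primrec path_pmf :: "nat \<Rightarrow> sample list pmf" where
  "path_pmf 0 = return_pmf []"
| "path_pmf (Suc n) = bind_pmf (path_pmf n) (\<lambda>l. map_pmf (\<lambda>s. l @ [s]) (sample_pmf (\<tau> (path_value ((!) l) n))))"

lemma length_path: "l \<in> set_pmf (path_pmf n) \<Longrightarrow> length l = n"
  by (induction n arbitrary: l) auto

text \<open>Expanding the square, the cross term has mean zero by \<open>noise_mean\<close>; only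
  the squared new increment is added.\<close>

lemma stopped_noise_step:
  "measure_pmf.expectation (sample_pmf (\<tau> y)) (\<lambda>s. (norm (a + (if norm a \<le> \<delta> then c *\<^sub>R noise (\<tau> y) y s else 0)))\<^sup>2)
     \<le> (norm a)\<^sup>2 + (12 * B * c)\<^sup>2"
  if "\<And>i. \<bar>y $ i\<bar> \<le> B"
proof (cases "norm a \<le> \<delta>")
  case True
  obtain D where D: "\<And>s. \<bar>a \<bullet> noise (\<tau> y) y s\<bar> \<le> D" using abs_inner_noise_le[of a "\<tau> y" y] by blast
  let ?N = "noise (\<tau> y) y"
  have pt: "(norm (a + c *\<^sub>R ?N s))\<^sup>2 \<le> ((norm a)\<^sup>2 + (12 * B * c)\<^sup>2) + 2 * c * (a \<bullet> ?N s)" for s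
  proof -
    have "(norm (c *\<^sub>R ?N s))\<^sup>2 \<le> (12 * B * c)\<^sup>2"
      using power_mono[OF norm_noise_le[OF that B(1), of "\<tau> y" s], of 2]
      by (simp add: power_mult_distrib mult_left_mono mult.commute[of _ "c\<^sup>2"])
    moreover have "(norm (a + c *\<^sub>R ?N s))\<^sup>2 = (norm a)\<^sup>2 + 2 * c * (a \<bullet> ?N s) + (norm (c *\<^sub>R ?N s))\<^sup>2"
      unfolding power2_norm_eq_inner by (simp add: inner_add_left inner_add_right inner_commute algebra_simps)
    ultimately show ?thesis by linarith
  qed
  have bnd: "\<bar>(norm (a + c *\<^sub>R ?N s))\<^sup>2\<bar> \<le> ((norm a)\<^sup>2 + (12 * B * c)\<^sup>2) + 2 * \<bar>c\<bar> * D" for s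
  proof -
    have "2 * c * (a \<bullet> ?N s) \<le> \<bar>2 * c * (a \<bullet> ?N s)\<bar>" by simp
    also have "\<dots> \<le> 2 * \<bar>c\<bar> * D" using D[of s] by (simp add: abs_mult mult_left_mono)
    finally show ?thesis using pt[of s] by simp
  qed
  have int: "integrable (measure_pmf (sample_pmf (\<tau> y))) (\<lambda>s. a \<bullet> ?N s)"
    by (rule integrable_pmf_bounded[OF D])
  have "measure_pmf.expectation (sample_pmf (\<tau> y)) (\<lambda>s. (norm (a + c *\<^sub>R ?N s))\<^sup>2)
    \<le> measure_pmf.expectation (sample_pmf (\<tau> y)) (\<lambda>s. ((norm a)\<^sup>2 + (12 * B * c)\<^sup>2) + 2 * c * (a \<bullet> ?N s))"
    using int pt by (intro integral_mono integrable_pmf_bounded[OF bnd]) auto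
  also have "\<dots> = (norm a)\<^sup>2 + (12 * B * c)\<^sup>2"
    using int by (simp add: noise_mean)
  finally show ?thesis using True by simp
qed simp

lemma second_moment:
  "measure_pmf.expectation (path_pmf n) (\<lambda>l. (norm (stopped_noise ((!) l) n))\<^sup>2) \<le> (12 * B)\<^sup>2 * (\<Sum>i<n. (\<gamma> i)\<^sup>2)"
proof (induction n)
  case (Suc n)
  have bnd: "\<bar>(norm (stopped_noise f m))\<^sup>2\<bar> \<le> (m * (12 * B))\<^sup>2" for f m
    using power_mono[OF norm_stopped_noise_le[of f m], of 2] by simp
  have int: "integrable (measure_pmf (path_pmf n)) (\<lambda>l. (norm (stopped_noise ((!) l) n))\<^sup>2)"
    by (rule integrable_pmf_bounded[OF bnd])
  let ?h = "\<lambda>l. measure_pmf.expectation (sample_pmf (\<tau> (path_value ((!) l) n))) (\<lambda>s. (norm (stopped_noise ((!) (l @ [s])) (Suc n)))\<^sup>2)"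
  have step: "?h l \<le> (norm (stopped_noise ((!) l) n))\<^sup>2 + (12 * B * \<gamma> n)\<^sup>2" if "length l = n" for l
  proof -
    have "(\<lambda>s. (norm (stopped_noise ((!) (l @ [s])) (Suc n)))\<^sup>2) = (\<lambda>s. (norm (stopped_noise ((!) l) n +
      (if norm (stopped_noise ((!) l) n) \<le> \<delta> then \<gamma> n *\<^sub>R noise (\<tau> (path_value ((!) l) n)) (path_value ((!) l) n) s else 0)))\<^sup>2)"
      using that stopped_noise_cong[of n "(!) (l @ [_])" "(!) l"] path_value_cong[of n "(!) (l @ [_])" "(!) l"]
      by (simp add: fun_eq_iff path_noise_def nth_append)
    then show ?thesis using stopped_noise_step[OF abs_path_value_le] by simp
  qed
  have "measure_pmf.expectation (path_pmf (Suc n)) (\<lambda>l. (norm (stopped_noise ((!) l) (Suc n)))\<^sup>2) = measure_pmf.expectation (path_pmf n) ?h"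
    unfolding path_pmf.simps integral_bind_pmf_bounded[OF bnd] integral_map_pmf ..
  also have "\<dots> \<le> measure_pmf.expectation (path_pmf n) (\<lambda>l. (norm (stopped_noise ((!) l) n))\<^sup>2 + (12 * B * \<gamma> n)\<^sup>2)"
  proof (rule integral_mono_AE)
    show "integrable (measure_pmf (path_pmf n)) ?h"
      by (rule integrable_pmf_bounded, rule abs_expectation_le, rule bnd)
    show "integrable (measure_pmf (path_pmf n)) (\<lambda>l. (norm (stopped_noise ((!) l) n))\<^sup>2 + (12 * B * \<gamma> n)\<^sup>2)"
      using int by auto
    show "AE l in path_pmf n. ?h l \<le> (norm (stopped_noise ((!) l) n))\<^sup>2 + (12 * B * \<gamma> n)\<^sup>2"
      using step length_path by (auto simp: AE_measure_pmf_iff)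
  qed
  also have "\<dots> = measure_pmf.expectation (path_pmf n) (\<lambda>l. (norm (stopped_noise ((!) l) n))\<^sup>2) + (12 * B * \<gamma> n)\<^sup>2"
    using int by simp
  also have "\<dots> \<le> (12 * B)\<^sup>2 * (\<Sum>i<n. (\<gamma> i)\<^sup>2) + (12 * B * \<gamma> n)\<^sup>2"
    using Suc by simp
  finally show ?case by (simp add: power_mult_distrib algebra_simps)
qed simp

lemma pmf_path_Suc: "pmf (path_pmf (Suc n)) (l @ [x]) = pmf (path_pmf n) l * pmf (sample_pmf (\<tau> (path_value ((!) l) n))) x"
proof -
  let ?S = "\<lambda>l. sample_pmf (\<tau> (path_value ((!) l) n))"
  have "pmf (map_pmf (\<lambda>s. k @ [s]) (?S k)) (l @ [x]) = (if k = l then pmf (?S l) x else 0)" for k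
  proof (cases "k = l")
    case True
    then show ?thesis using pmf_map_inj'[of "\<lambda>s. l @ [s]" "?S l" x] by (simp add: inj_def)
  qed (auto simp: pmf_eq_0_set_pmf)
  then have "pmf (path_pmf (Suc n)) (l @ [x]) = measure_pmf.expectation (path_pmf n) (\<lambda>k. if k = l then pmf (?S l) x else 0)"
    unfolding path_pmf.simps pmf_bind by simp
  also have "\<dots> = (\<Sum>k\<in>{l}. (if k = l then pmf (?S l) x else 0) * pmf (path_pmf n) k)"
    by (rule integral_measure_pmf_real) (auto split: if_splits)
  finally show ?thesis by simp
qed

context
  fixes M :: "'w measure" and X :: "nat \<Rightarrow> 'w \<Rightarrow> sample" and J :: "nat \<Rightarrow> 'w \<Rightarrow> real^3"
  assumes rec: "mc_recursion \<tau> \<gamma> J0 M X J"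
begin

definition path :: "nat \<Rightarrow> 'w \<Rightarrow> sample list" where
  "path n \<omega> = map (\<lambda>s. X s \<omega>) [0..<n]"

interpretation prob_space M
  using rec by (simp add: mc_recursion_def)

lemma X_measurable [measurable]: "X t \<in> M \<rightarrow>\<^sub>M count_space UNIV"
  using rec by (simp add: mc_recursion_def)

lemma J_eq: "\<omega> \<in> space M \<Longrightarrow> J t \<omega> = path_value (\<lambda>s. X s \<omega>) t"
  using rec by (induction t) (auto simp: mc_recursion_def)

lemma path_nth: "i < n \<Longrightarrow> path n \<omega> ! i = X i \<omega>"
  by (simp add: path_def)

lemma path_eq_set: "length l = n \<Longrightarrow> {\<omega> \<in> space M. path n \<omega> = l} = {\<omega> \<in> space M. \<forall>i\<in>{..<n}. X i \<omega> = l ! i}"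
  by (auto simp: path_def list_eq_iff_nth_eq)

lemma path_sets_history: "length l = n \<Longrightarrow> {\<omega> \<in> space M. path n \<omega> = l} \<in> sets (history M X n)"
proof -
  assume l: "length l = n"
  have sp: "space (history M X n) = space M" by (simp add: history_def space_measure_of_conv)
  have "{\<omega> \<in> space (history M X n). X i \<omega> = l ! i} \<in> sets (history M X n)" if "i < n" for i
  proof -
    have "{\<omega> \<in> space (history M X n). X i \<omega> = l ! i} = X i -` {l ! i} \<inter> space M"
      unfolding sp by auto
    also have "\<dots> \<in> sets (history M X n)"
      unfolding history_def using that by (subst sets_measure_of) auto
    finally show ?thesis .
  qed
  then have "{\<omega> \<in> space (history M X n). \<forall>i\<in>{..<n}. X i \<omega> = l ! i} \<in> sets (history M X n)"
    by (intro sets.sets_Collect_finite_All) auto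
  then show ?thesis unfolding path_eq_set[OF l] sp .
qed

lemma history_subalgebra: "subalgebra M (history M X n)"
proof -
  have "{X s -` A \<inter> space M | s A. s < n} \<subseteq> sets M"
    using measurable_sets[OF X_measurable] by auto
  then have "sets (history M X n) \<subseteq> sets M"
    unfolding history_def by (subst sets_measure_of) (auto dest: sets.sets_into_space intro: sets.sigma_sets_subset[THEN subsetD])
  then show ?thesis by (simp add: subalgebra_def history_def space_measure_of_conv)
qed

lemma path_measurable [measurable]: "path n \<in> M \<rightarrow>\<^sub>M count_space UNIV"
proof -
  have "path n -` {l} \<inter> space M \<in> sets M" for l
  proof (cases "length l = n")
    case True
    have "path n -` {l} \<inter> space M = {\<omega> \<in> space M. path n \<omega> = l}" by auto
    then show ?thesis
      using path_sets_history[OF True] history_subalgebra[of n] by (auto simp: subalgebra_def)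
  next
    case False
    then have "path n -` {l} \<inter> space M = {}" by (auto simp: path_def)
    then show ?thesis by simp
  qed
  then show ?thesis by (subst measurable_count_space_eq2_countable) auto
qed

text \<open>On the event of a given history the policy is constant, so integrating the conditional
  point mass over this event, which belongs to the history, multiplies the probability by one
  transition factor. Hence every realization has the path law \<open>path_pmf\<close>.\<close>

lemma prob_path: "prob {\<omega> \<in> space M. path n \<omega> = l} = pmf (path_pmf n) l"
proof (induction n arbitrary: l)
  case 0
  then show ?case using prob_space by (cases "l = []") (auto simp: path_def)
next
  case (Suc n)
  consider "length l \<noteq> Suc n" | k x where "l = k @ [x]" "length k = n"
    by (metis length_Suc_conv_rev)
  then show ?case
  proof cases
    case 1
    then have "{\<omega> \<in> space M. path (Suc n) \<omega> = l} = {}" by (auto simp: path_def)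
    moreover have "pmf (path_pmf (Suc n)) l = 0"
      using 1 length_path by (intro pmf_eq_0_set_pmf[THEN iffD2]) blast
    ultimately show ?thesis by (simp only: measure_empty)
  next
    case (2 k x)
    let ?A = "{\<omega> \<in> space M. path n \<omega> = k}" and ?I = "\<lambda>\<omega>. indicator {x} (X n \<omega>) :: real"
    let ?p = "pmf (sample_pmf (\<tau> (path_value ((!) k) n))) x"
    interpret finite_measure_subalgebra M "history M X n"
      by unfold_locales (rule history_subalgebra)
    have A: "?A \<in> sets (history M X n)" by (rule path_sets_history) (rule 2)
    have [measurable]: "?A \<in> sets M" by measurable
    have "prob {\<omega> \<in> space M. path (Suc n) \<omega> = l} = (LINT \<omega>:?A|M. ?I \<omega>)"
    proof -
      have "{\<omega> \<in> space M. path (Suc n) \<omega> = l} = {\<omega> \<in> space M. path n \<omega> = k \<and> X n \<omega> = x}"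
        using 2 by (auto simp: path_def)
      moreover have "(\<lambda>\<omega>. indicator ?A \<omega> *\<^sub>R ?I \<omega>) = indicator {\<omega> \<in> space M. path n \<omega> = k \<and> X n \<omega> = x}"
        by (auto simp: fun_eq_iff indicator_def)
      ultimately show ?thesis unfolding set_lebesgue_integral_def by simp
    qed
    also have "\<dots> = (LINT \<omega>:?A|M. real_cond_exp M (history M X n) ?I \<omega>)"
      by (rule real_cond_exp_intA[OF _ A]) (intro integrable_const_bound[where B = 1], auto simp: indicator_def)
    also have "\<dots> = (LINT \<omega>:?A|M. ?p)"
    proof (rule set_lebesgue_integral_cong_AE)
      have "AE \<omega> in M. real_cond_exp M (history M X n) ?I \<omega> = pmf (sample_pmf (\<tau> (J n \<omega>))) x"
        using rec unfolding mc_recursion_def by blast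
      then show "AE \<omega>\<in>?A in M. real_cond_exp M (history M X n) ?I \<omega> = ?p"
      proof (eventually_elim, intro impI)
        fix \<omega> assume e: "real_cond_exp M (history M X n) ?I \<omega> = pmf (sample_pmf (\<tau> (J n \<omega>))) x" and \<omega>: "\<omega> \<in> ?A"
        have "J n \<omega> = path_value ((!) k) n"
          using \<omega> path_nth[of _ n \<omega>] by (simp add: J_eq) (intro path_value_cong, auto)
        then show "real_cond_exp M (history M X n) ?I \<omega> = ?p" using e by simp
      qed
    qed (auto intro: borel_measurable_cond_exp2)
    also have "\<dots> = prob ?A * ?p"
      by (simp add: set_lebesgue_integral_def)
    also have "\<dots> = pmf (path_pmf (Suc n)) l"
      unfolding Suc 2(1) pmf_path_Suc ..
    finally show ?thesis .
  qed
qed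

lemma distr_path: "distr M (count_space UNIV) (path n) = measure_pmf (path_pmf n)"
proof (rule measure_eqI_countable[of _ UNIV])
  fix l
  have "path n -` {l} \<inter> space M = {\<omega> \<in> space M. path n \<omega> = l}" by auto
  then show "emeasure (distr M (count_space UNIV) (path n)) {l} = emeasure (measure_pmf (path_pmf n)) {l}"
    using prob_path[of n l] by (simp add: emeasure_distr emeasure_eq_measure emeasure_pmf_single)
qed auto

lemma stopped_noise_path: "stopped_noise ((!) (path n \<omega>)) n = stopped_noise (\<lambda>s. X s \<omega>) n"
  by (rule stopped_noise_cong) (simp add: path_nth)

lemma J_measurable: "J t \<in> borel_measurable M"
proof -
  have "(\<lambda>\<omega>. path_value ((!) (path t \<omega>)) t) \<in> borel_measurable M"
    using measurable_compose[OF path_measurable, of "\<lambda>l. path_value ((!) l) t" borel t] by simp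
  moreover have "path_value ((!) (path t \<omega>)) t = J t \<omega>" if "\<omega> \<in> space M" for \<omega>
    unfolding J_eq[OF that] by (rule path_value_cong) (simp add: path_nth)
  ultimately show ?thesis by (rule measurable_cong[THEN iffD1, rotated]) auto
qed

lemma prob_large_noise:
  assumes "(12 * B)\<^sup>2 * (\<Sum>i<n. (\<gamma> i)\<^sup>2) \<le> \<delta>\<^sup>2 / 2"
  shows "prob {\<omega> \<in> space M. \<delta> < norm (stopped_noise (\<lambda>s. X s \<omega>) n)} \<le> 1 / 2"
    and "{\<omega> \<in> space M. \<delta> < norm (stopped_noise (\<lambda>s. X s \<omega>) n)} \<in> sets M"
proof -
  let ?S = "{l. \<delta> < norm (stopped_noise ((!) l) n)}"
  have eq: "{\<omega> \<in> space M. \<delta> < norm (stopped_noise (\<lambda>s. X s \<omega>) n)} = path n -` ?S \<inter> space M"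
    by (auto simp: stopped_noise_path)
  show "{\<omega> \<in> space M. \<delta> < norm (stopped_noise (\<lambda>s. X s \<omega>) n)} \<in> sets M"
    unfolding eq by (rule measurable_sets[OF path_measurable]) simp
  have bnd: "\<bar>(norm (stopped_noise f m))\<^sup>2\<bar> \<le> (m * (12 * B))\<^sup>2" for f m
    using power_mono[OF norm_stopped_noise_le[of f m], of 2] by simp
  have "prob (path n -` ?S \<inter> space M) = measure (distr M (count_space UNIV) (path n)) ?S"
    by (subst measure_distr) auto
  also have "\<dots> = measure (measure_pmf (path_pmf n)) ?S" by (simp only: distr_path)
  also have "\<dots> \<le> measure (measure_pmf (path_pmf n)) {l \<in> space (measure_pmf (path_pmf n)). (norm (stopped_noise ((!) l) n))\<^sup>2 \<ge> \<delta>\<^sup>2}"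
    using \<delta> by (intro measure_pmf.finite_measure_mono) (auto intro!: power_mono)
  also have "\<dots> \<le> measure_pmf.expectation (path_pmf n) (\<lambda>l. (norm (stopped_noise ((!) l) n))\<^sup>2) / \<delta>\<^sup>2"
    using \<delta> integrable_pmf_bounded[OF bnd]
    by (intro integral_Markov_inequality_measure[where A = UNIV]) auto
  also have "\<dots> \<le> (\<delta>\<^sup>2 / 2) / \<delta>\<^sup>2"
    using order.trans[OF second_moment assms] by (intro divide_right_mono) auto
  also have "\<dots> = 1 / 2" using \<delta> by simp
  finally show "prob {\<omega> \<in> space M. \<delta> < norm (stopped_noise (\<lambda>s. X s \<omega>) n)} \<le> 1 / 2" unfolding eq .
qed

text \<open>The exceedance events increase, so their union still has probability at most 1/2. Off
  the union the stopped noise is the whole noise; subtracting it leaves an Euler scheme whose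
  velocities are taken at the original iterates, at distance at most \<delta>.\<close>

lemma divergence_probability:
  assumes small: "\<And>n. (12 * B)\<^sup>2 * (\<Sum>i<n. (\<gamma> i)\<^sup>2) \<le> \<delta>\<^sup>2 / 2"
    and div: "\<And>(Y :: nat \<Rightarrow> real^3) x. Y 0 = J0 \<Longrightarrow> (\<And>n. Y (Suc n) = Y n + \<gamma> n *\<^sub>R (update_prob * (cost_to_go (\<tau> (x n)) - x n)))
      \<Longrightarrow> (\<And>n. dist (x n) (Y n) \<le> \<delta>) \<Longrightarrow> \<not> convergent x"
  shows "0 < prob {\<omega> \<in> space M. \<not> convergent (\<lambda>t. J t \<omega>)}"
proof -
  define A where "A n = {\<omega> \<in> space M. \<delta> < norm (stopped_noise (\<lambda>s. X s \<omega>) n)}" for n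
  have A: "A n \<in> sets M" "prob (A n) \<le> 1 / 2" for n
    unfolding A_def using prob_large_noise[OF small] by auto
  have "incseq A" by (rule incseq_SucI) (auto simp: A_def)
  then have "(\<lambda>n. prob (A n)) \<longlonglongrightarrow> prob (\<Union>n. A n)"
    using A(1) by (intro finite_Lim_measure_incseq) auto
  then have U: "prob (\<Union>n. A n) \<le> 1 / 2"
    using A(2) by (intro LIMSEQ_le_const2) auto
  have nc: "\<not> convergent (\<lambda>t. J t \<omega>)" if \<omega>: "\<omega> \<in> space M" "\<omega> \<notin> (\<Union>n. A n)" for \<omega>
  proof -
    let ?f = "\<lambda>s. X s \<omega>"
    have le: "norm (stopped_noise ?f n) \<le> \<delta>" for n
      using \<omega> by (auto simp: A_def not_less)
    show ?thesis
    proof (rule div[of "\<lambda>n. J n \<omega> - stopped_noise ?f n"])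
      show "J 0 \<omega> - stopped_noise ?f 0 = J0" by (simp add: J_eq[OF \<omega>(1)])
      show "J (Suc n) \<omega> - stopped_noise ?f (Suc n) = (J n \<omega> - stopped_noise ?f n) + \<gamma> n *\<^sub>R (update_prob * (cost_to_go (\<tau> (J n \<omega>)) - J n \<omega>))" for n
        using le[of n] by (simp add: J_eq[OF \<omega>(1)] mc_update_def path_noise_def noise_def algebra_simps)
      show "dist (J n \<omega>) (J n \<omega> - stopped_noise ?f n) \<le> \<delta>" for n
        using le[of n] by (simp add: dist_norm)
    qed
  qed
  \<comment> \<open>Measurability is essential here: a nonmeasurable set would have measure 0 by
    default.\<close>
  have "{\<omega> \<in> space M. Cauchy (\<lambda>t. J t \<omega>)} \<in> sets M"
    using J_measurable by (intro sets_Collect_Cauchy)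
  then have m: "{\<omega> \<in> space M. \<not> convergent (\<lambda>t. J t \<omega>)} \<in> sets M"
    by (subst sets.sets_Collect_neg) (auto simp: Cauchy_convergent_iff)
  have "1 / 2 \<le> prob (space M - (\<Union>n. A n))"
    using A(1) U by (subst prob_compl) auto
  also have "\<dots> \<le> prob {\<omega> \<in> space M. \<not> convergent (\<lambda>t. J t \<omega>)}"
    using nc m by (intro finite_measure_mono) auto
  finally show ?thesis by simp
qed

end

end

text \<open>Telescoping against 1/((n + N - 1) (n + N)). At n = 0 the right side is 2/N - 1/(N - 1),
  which is nonnegative because N \<ge> 2.\<close>

lemma sum_inverse_squares:
  assumes "2 \<le> N"
  shows "(\<Sum>i<n. (1 / (real i + real N))\<^sup>2) \<le> 2 / real N - 1 / (real n + real N - 1)"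
proof (induction n)
  case 0
  then show ?case using assms by (simp add: field_simps)
next
  case (Suc n)
  have "(1 / (real n + real N))\<^sup>2 \<le> 1 / ((real n + real N - 1) * (real n + real N))"
    using assms by (auto simp: power2_eq_square divide_simps)
  also have "\<dots> = 1 / (real n + real N - 1) - 1 / (real (Suc n) + real N - 1)"
    using assms by (auto simp: divide_simps)
  finally show ?case using Suc by simp
qed

section \<open>Signs along the cycle\<close>

text \<open>Along a segment every action gap is a combination of 1, r, r^9 and r^40. The
  coefficients depend on the exact cycle, which is known only through decimal approximations; hence
  the tolerance.\<close>

definition near_profile :: "(real \<Rightarrow> real) \<Rightarrow> real \<Rightarrow> real \<Rightarrow> real \<Rightarrow> real \<Rightarrow> bool" where
  "near_profile F a0 a1 a2 a3 \<longleftrightarrow> (\<exists>c0 c1 c2 c3. (\<forall>r. F r = c0 + c1 * r + c2 * r ^ 9 + c3 * r ^ 40) \<and>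
     \<bar>c0 - a0\<bar> \<le> 1 / 10 ^ 6 \<and> \<bar>c1 - a1\<bar> \<le> 1 / 10 ^ 6 \<and> \<bar>c2 - a2\<bar> \<le> 1 / 10 ^ 6 \<and> \<bar>c3 - a3\<bar> \<le> 1 / 10 ^ 6)"

lemma coefficient_approx:
  fixes g c x C X a :: real
  assumes "\<bar>c - C\<bar> \<le> 1 / 10 ^ 9" "\<bar>x - X\<bar> \<le> 1 / 10 ^ 9" "\<bar>g\<bar> \<le> 1" "\<bar>g * (X - C) - a\<bar> \<le> 1 / 10 ^ 7"
  shows "\<bar>g * (x - c) - a\<bar> \<le> 1 / 10 ^ 6"
proof -
  have "\<bar>(x - X) - (c - C)\<bar> \<le> 2 / 10 ^ 9" using assms(1,2) by linarith
  then have "\<bar>g * ((x - X) - (c - C))\<bar> \<le> 1 * (2 / 10 ^ 9)"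
    unfolding abs_mult by (rule mult_mono[OF assms(3)]) auto
  moreover have "g * (x - c) - a = g * ((x - X) - (c - C)) + (g * (X - C) - a)" by (simp add: algebra_simps)
  ultimately have "\<bar>g * (x - c) - a\<bar> \<le> 2 / 10 ^ 9 + 1 / 10 ^ 7" using assms(4) by linarith
  then show ?thesis by simp
qed

lemma near_profileI:
  fixes s :: real
  assumes c: "\<bar>cost_to_go \<mu> $ 1 - C1\<bar> \<le> 1 / 10 ^ 9" "\<bar>cost_to_go \<mu> $ 2 - C2\<bar> \<le> 1 / 10 ^ 9" "\<bar>cost_to_go \<mu> $ 3 - C3\<bar> \<le> 1 / 10 ^ 9"
    and x: "\<bar>x $ 1 - X1\<bar> \<le> 1 / 10 ^ 9" "\<bar>x $ 2 - X2\<bar> \<le> 1 / 10 ^ 9" "\<bar>x $ 3 - X3\<bar> \<le> 1 / 10 ^ 9"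
    and s: "\<bar>s\<bar> = 1"
    and a0: "\<bar>s * (cost i 1 - cost i 0 + Q_grad i $ 1 * C1 + Q_grad i $ 2 * C2 + Q_grad i $ 3 * C3) - a0\<bar> \<le> 1 / 10 ^ 7"
    and a: "\<bar>(s * Q_grad i $ 1) * (X1 - C1) - a1\<bar> \<le> 1 / 10 ^ 7" "\<bar>(s * Q_grad i $ 2) * (X2 - C2) - a2\<bar> \<le> 1 / 10 ^ 7"
      "\<bar>(s * Q_grad i $ 3) * (X3 - C3) - a3\<bar> \<le> 1 / 10 ^ 7"
  shows "near_profile (\<lambda>r. s * Q_diff i (flow \<mu> x r)) a0 a1 a2 a3"
  unfolding near_profile_def
proof (rule exI, rule exI, rule exI, rule exI, intro conjI)
  let ?c0 = "s * (cost i 1 - cost i 0 + Q_grad i $ 1 * cost_to_go \<mu> $ 1 + Q_grad i $ 2 * cost_to_go \<mu> $ 2 + Q_grad i $ 3 * cost_to_go \<mu> $ 3)"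
  have g: "\<bar>s * Q_grad i $ j\<bar> \<le> 1" for j using s abs_Q_grad_le[of i j] by (simp add: abs_mult)
  show "\<forall>r. s * Q_diff i (flow \<mu> x r) = ?c0 + (s * Q_grad i $ 1) * (x $ 1 - cost_to_go \<mu> $ 1) * r
    + (s * Q_grad i $ 2) * (x $ 2 - cost_to_go \<mu> $ 2) * r ^ 9 + (s * Q_grad i $ 3) * (x $ 3 - cost_to_go \<mu> $ 3) * r ^ 40"
    by (simp add: Q_diff_affine flow_component flow_exp_simps inner_vec_def sum_3 algebra_simps)
  show "\<bar>?c0 - a0\<bar> \<le> 1 / 10 ^ 6"
  proof -
    let ?d = "\<lambda>j C. (s * Q_grad i $ j) * (cost_to_go \<mu> $ j - C)"
    have "\<bar>?d 1 C1\<bar> \<le> 1 * (1 / 10 ^ 9)" "\<bar>?d 2 C2\<bar> \<le> 1 * (1 / 10 ^ 9)" "\<bar>?d 3 C3\<bar> \<le> 1 * (1 / 10 ^ 9)"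
      unfolding abs_mult[of "s * _"] using g c by (intro mult_mono; simp)+
    moreover have "?c0 - a0 = ?d 1 C1 + ?d 2 C2 + ?d 3 C3 + (s * (cost i 1 - cost i 0 + Q_grad i $ 1 * C1 + Q_grad i $ 2 * C2 + Q_grad i $ 3 * C3) - a0)"
      by (simp add: algebra_simps)
    ultimately have "\<bar>?c0 - a0\<bar> \<le> 3 * (1 / 10 ^ 9) + 1 / 10 ^ 7" using a0 by linarith
    then show ?thesis by simp
  qed
  show "\<bar>(s * Q_grad i $ 1) * (x $ 1 - cost_to_go \<mu> $ 1) - a1\<bar> \<le> 1 / 10 ^ 6"
    "\<bar>(s * Q_grad i $ 2) * (x $ 2 - cost_to_go \<mu> $ 2) - a2\<bar> \<le> 1 / 10 ^ 6"
    "\<bar>(s * Q_grad i $ 3) * (x $ 3 - cost_to_go \<mu> $ 3) - a3\<bar> \<le> 1 / 10 ^ 6"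
    using c x a g by (blast intro: coefficient_approx)+
qed

lemma monomial_bounds:
  fixes a c r l u t :: real
  assumes "0 \<le> l" "l \<le> r" "r \<le> u" "u \<le> 1" "\<bar>c - a\<bar> \<le> t"
  shows "min (a * l ^ p) (a * u ^ p) - t \<le> c * r ^ p" "c * r ^ p \<le> max (a * l ^ p) (a * u ^ p) + t"
proof -
  have r: "0 \<le> r ^ p" "r ^ p \<le> 1" "l ^ p \<le> r ^ p" "r ^ p \<le> u ^ p"
    using assms by (auto intro!: power_mono power_le_one)
  have t: "0 \<le> t" using assms(5) by linarith
  have "\<bar>(c - a) * r ^ p\<bar> \<le> t * 1"
    unfolding abs_mult using r assms(5) t by (intro mult_mono) auto
  then have ca: "a * r ^ p - t \<le> c * r ^ p" "c * r ^ p \<le> a * r ^ p + t"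
    unfolding left_diff_distrib by linarith+
  have "min (a * l ^ p) (a * u ^ p) \<le> a * r ^ p \<and> a * r ^ p \<le> max (a * l ^ p) (a * u ^ p)"
  proof (cases "0 \<le> a")
    case True
    then have "a * l ^ p \<le> a * r ^ p" "a * r ^ p \<le> a * u ^ p" using r by (auto intro: mult_left_mono)
    then show ?thesis by (simp add: min_def max_def)
  next
    case False
    then have "a * r ^ p \<le> a * l ^ p" "a * u ^ p \<le> a * r ^ p" using r by (auto intro: mult_left_mono_neg)
    then show ?thesis by (simp add: min_def max_def)
  qed
  with ca show "min (a * l ^ p) (a * u ^ p) - t \<le> c * r ^ p" "c * r ^ p \<le> max (a * l ^ p) (a * u ^ p) + t"
    by linarith+
qed

text \<open>Interval arithmetic: each monomial is bounded below by its endpoint values, and the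
  margin 1/1000 dominates the four coefficient errors.\<close>

lemma profile_pos:
  assumes F: "near_profile F a0 a1 a2 a3" and r: "l \<le> r" "r \<le> u" and l: "0 \<le> l" and u: "u \<le> 1"
    and m: "m1 \<le> a1 * l" "m1 \<le> a1 * u" "m2 \<le> a2 * l ^ 9" "m2 \<le> a2 * u ^ 9" "m3 \<le> a3 * l ^ 40" "m3 \<le> a3 * u ^ 40"
    and a: "1 / 1000 \<le> a0 + m1 + m2 + m3"
  shows "0 < F r"
proof -
  obtain c0 c1 c2 c3 where c: "F r = c0 + c1 * r + c2 * r ^ 9 + c3 * r ^ 40"
    "\<bar>c0 - a0\<bar> \<le> 1 / 10 ^ 6" "\<bar>c1 - a1\<bar> \<le> 1 / 10 ^ 6" "\<bar>c2 - a2\<bar> \<le> 1 / 10 ^ 6" "\<bar>c3 - a3\<bar> \<le> 1 / 10 ^ 6"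
    using F by (auto simp: near_profile_def)
  have "min (a1 * l) (a1 * u) - 1 / 10 ^ 6 \<le> c1 * r" using monomial_bounds(1)[OF l r u c(3), of 1] by simp
  moreover note monomial_bounds(1)[OF l r u c(4), of 9] monomial_bounds(1)[OF l r u c(5), of 40]
  moreover have "a0 - 1 / 10 ^ 6 \<le> c0" using c(2) by linarith
  moreover note min.boundedI[OF m(1,2)] min.boundedI[OF m(3,4)] min.boundedI[OF m(5,6)]
  moreover have "4 * (1 / 10 ^ 6) < (1 / 1000 :: real)" by simp
  ultimately show ?thesis using a unfolding c(1) by linarith
qed

lemma profile_neg:
  assumes F: "near_profile F a0 a1 a2 a3" and r: "l \<le> r" "r \<le> u" and l: "0 \<le> l" and u: "u \<le> 1"
    and m: "a1 * l \<le> m1" "a1 * u \<le> m1" "a2 * l ^ 9 \<le> m2" "a2 * u ^ 9 \<le> m2" "a3 * l ^ 40 \<le> m3" "a3 * u ^ 40 \<le> m3"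
    and a: "a0 + m1 + m2 + m3 \<le> - (1 / 1000)"
  shows "F r < 0"
proof -
  obtain c0 c1 c2 c3 where c: "F r = c0 + c1 * r + c2 * r ^ 9 + c3 * r ^ 40"
    "\<bar>c0 - a0\<bar> \<le> 1 / 10 ^ 6" "\<bar>c1 - a1\<bar> \<le> 1 / 10 ^ 6" "\<bar>c2 - a2\<bar> \<le> 1 / 10 ^ 6" "\<bar>c3 - a3\<bar> \<le> 1 / 10 ^ 6"
    using F by (auto simp: near_profile_def)
  have "c1 * r \<le> max (a1 * l) (a1 * u) + 1 / 10 ^ 6" using monomial_bounds(2)[OF l r u c(3), of 1] by simp
  moreover note monomial_bounds(2)[OF l r u c(4), of 9] monomial_bounds(2)[OF l r u c(5), of 40]
  moreover have "c0 \<le> a0 + 1 / 10 ^ 6" using c(2) by linarith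
  moreover note max.boundedI[OF m(1,2)] max.boundedI[OF m(3,4)] max.boundedI[OF m(5,6)]
  moreover have "4 * (1 / 10 ^ 6) < (1 / 1000 :: real)" by simp
  ultimately show ?thesis using a unfolding c(1) by linarith
qed

lemma power_diff_mean_value:
  fixes r s :: real
  assumes "r < s"
  obtains m where "r \<le> m" "m \<le> s" "s ^ p - r ^ p = (s - r) * (real p * m ^ (p - 1))"
proof -
  have "\<exists>m>r. m < s \<and> s ^ p - r ^ p = (s - r) * (real p * m ^ (p - 1))"
    by (rule MVT2[OF assms]) (auto intro!: derivative_eq_intros)
  then obtain m where "r < m" "m < s" "s ^ p - r ^ p = (s - r) * (real p * m ^ (p - 1))" by blast
  then show ?thesis by (intro that[of m] less_imp_le)
qed

text \<open>At an end of the segment the gap vanishes, so interval bounds cannot decide its sign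
  nearby; monotonicity towards the zero does. The mean value theorem is applied to each power
  separately, each with its own intermediate point.\<close>

lemma profile_decreasing:
  assumes F: "near_profile F a0 a1 a2 a3" and rs: "l \<le> r" "r < s" "s \<le> u" and l: "0 \<le> l" and u: "u \<le> 1"
    and M: "a2 * l ^ 8 \<le> m2" "a2 * u ^ 8 \<le> m2" "a3 * l ^ 39 \<le> m3" "a3 * u ^ 39 \<le> m3"
    and a: "a1 + 9 * m2 + 40 * m3 \<le> - (1 / 1000)"
  shows "F s < F r"
proof -
  obtain c0 c1 c2 c3 where c: "\<And>r. F r = c0 + c1 * r + c2 * r ^ 9 + c3 * r ^ 40"
    "\<bar>c1 - a1\<bar> \<le> 1 / 10 ^ 6" "\<bar>c2 - a2\<bar> \<le> 1 / 10 ^ 6" "\<bar>c3 - a3\<bar> \<le> 1 / 10 ^ 6"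
    using F by (auto simp: near_profile_def)
  obtain m where m: "r \<le> m" "m \<le> s" "s ^ 9 - r ^ 9 = (s - r) * (real 9 * m ^ (9 - 1))"
    by (rule power_diff_mean_value[OF rs(2)])
  obtain n where n: "r \<le> n" "n \<le> s" "s ^ 40 - r ^ 40 = (s - r) * (real 40 * n ^ (40 - 1))"
    by (rule power_diff_mean_value[OF rs(2)])
  have "c2 * m ^ 8 \<le> max (a2 * l ^ 8) (a2 * u ^ 8) + 1 / 10 ^ 6" "c3 * n ^ 39 \<le> max (a3 * l ^ 39) (a3 * u ^ 39) + 1 / 10 ^ 6"
    using m n rs by (intro monomial_bounds(2)[OF l _ _ u] c; simp)+
  moreover have "c1 \<le> a1 + 1 / 10 ^ 6" using c(2) by linarith
  moreover note max.boundedI[OF M(1,2)] max.boundedI[OF M(3,4)]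
  moreover have "50 * (1 / 10 ^ 6) < (1 / 1000 :: real)" by simp
  ultimately have "c1 + 9 * (c2 * m ^ 8) + 40 * (c3 * n ^ 39) < 0" using a by linarith
  then have "(s - r) * (c1 + 9 * (c2 * m ^ 8) + 40 * (c3 * n ^ 39)) < 0"
    using rs(2) by (simp add: mult_pos_neg)
  moreover have "F s - F r = c1 * (s - r) + c2 * (s ^ 9 - r ^ 9) + c3 * (s ^ 40 - r ^ 40)"
    by (simp add: c(1) algebra_simps)
  then have "F s - F r = (s - r) * (c1 + 9 * (c2 * m ^ 8) + 40 * (c3 * n ^ 39))"
    unfolding m(3) n(3) by (simp add: algebra_simps)
  ultimately show ?thesis by linarith
qed

lemma x_star_approxI:
  assumes "k \<le> 6" "\<bar>approx_point k $ i - a\<bar> \<le> 9 / 10 ^ 10"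
  shows "\<bar>x_star k $ i - a\<bar> \<le> 1 / 10 ^ 9"
proof -
  have "\<bar>x_star k $ i - a\<bar> \<le> 1 / 10 ^ 20 + 9 / 10 ^ 10"
    using x_star_near[OF assms(1), of i] assms(2) by linarith
  then show ?thesis by simp
qed

lemma flow_1: "flow \<mu> x 1 = x"
  by (simp add: vec_eq_iff flow_component)

lemma x_star_end: "k < 6 \<Longrightarrow> Q_diff (switch_states ! k) (flow (cycle_policies ! k) (x_star k) (z_star k)) = 0"
  by (metis crossing_def x_star_crossing)

lemma x_star_switch: "k < 6 \<Longrightarrow> m = Suc k \<Longrightarrow> Q_diff (switch_states ! k) (x_star m) = 0"
  by (metis crossing_def x_star_crossing)

lemma z_star_boundsI:
  assumes "k < 6" "a + 1 / 10 ^ 30 \<le> z_bar ! k" "z_bar ! k + 1 / 10 ^ 30 < 1"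
  shows "a \<le> z_star k" "z_star k < 1"
proof -
  have "\<bar>z_star k - z_bar ! k\<bar> \<le> 1 / 10 ^ 30"
    using x_star_crossing[OF assms(1)] by (simp only: crossing_def)
  then show "a \<le> z_star k" "z_star k < 1" using assms(2,3) by linarith+
qed

lemma x_star_endI: "k < 6 \<Longrightarrow> switch_states ! k = i \<Longrightarrow> Q_diff i (flow (cycle_policies ! k) (x_star k) (z_star k)) = 0"
  using x_star_end by blast

lemma x_star_switchI: "k < 6 \<Longrightarrow> switch_states ! k = i \<Longrightarrow> x_star (Suc k) = x \<Longrightarrow> Q_diff i x = 0"
  using x_star_switch by blast

lemma sum_3_pos:
  fixes p1 p2 p3 :: real
  assumes "\<bar>p1 - a1\<bar> \<le> 1 / 10 ^ 6" "\<bar>p2 - a2\<bar> \<le> 1 / 10 ^ 6" "\<bar>p3 - a3\<bar> \<le> 1 / 10 ^ 6" "1 / 1000 \<le> a1 + a2 + a3"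
  shows "0 < p1 + p2 + p3"
proof -
  have "a1 + a2 + a3 - 3 * (1 / 10 ^ 6) \<le> p1 + p2 + p3" using assms(1-3) by linarith
  moreover have "3 * (1 / 10 ^ 6) < (1 / 1000 :: real)" by simp
  ultimately show ?thesis using assms(4) by linarith
qed

lemma rate_posI:
  fixes s :: real
  assumes c: "\<bar>c $ 1 - C1\<bar> \<le> 1 / 10 ^ 9" "\<bar>c $ 2 - C2\<bar> \<le> 1 / 10 ^ 9" "\<bar>c $ 3 - C3\<bar> \<le> 1 / 10 ^ 9"
    and x: "\<bar>x $ 1 - X1\<bar> \<le> 1 / 10 ^ 9" "\<bar>x $ 2 - X2\<bar> \<le> 1 / 10 ^ 9" "\<bar>x $ 3 - X3\<bar> \<le> 1 / 10 ^ 9"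
    and s: "\<bar>s\<bar> = 1"
    and a: "1 / 1000 \<le> s * Q_grad i $ 1 * 0.02 * (C1 - X1) + s * Q_grad i $ 2 * 0.18 * (C2 - X2) + s * Q_grad i $ 3 * 0.80 * (C3 - X3)"
  shows "0 < s * (Q_grad i \<bullet> (update_prob * (c - x)))"
proof -
  have q: "\<bar>update_prob $ j\<bar> \<le> 1" for j using exhaust_3[of j] by (auto simp: update_prob_def)
  have g: "\<bar>s * Q_grad i $ j * update_prob $ j\<bar> \<le> 1" for j
    using mult_mono[of "\<bar>Q_grad i $ j\<bar>" 1 "\<bar>update_prob $ j\<bar>" 1, OF abs_Q_grad_le q] s by (simp add: abs_mult)
  have near: "\<bar>(s * Q_grad i $ j * update_prob $ j) * (c $ j - x $ j) - (s * Q_grad i $ j * update_prob $ j) * (C - X)\<bar> \<le> 1 / 10 ^ 6"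
    if "\<bar>x $ j - X\<bar> \<le> 1 / 10 ^ 9" "\<bar>c $ j - C\<bar> \<le> 1 / 10 ^ 9" for j C X
    by (rule coefficient_approx[OF that g]) simp
  have "1 / 1000 \<le> s * Q_grad i $ 1 * update_prob $ 1 * (C1 - X1) + s * Q_grad i $ 2 * update_prob $ 2 * (C2 - X2)
      + s * Q_grad i $ 3 * update_prob $ 3 * (C3 - X3)"
    using a by (simp only: update_prob_def vector_3)
  from sum_3_pos[OF near[OF x(1) c(1)] near[OF x(2) c(2)] near[OF x(3) c(3)] this]
  show ?thesis by (simp add: inner_vec_def sum_3 algebra_simps)
qed

section \<open>Sign verification for the six segments\<close>

lemma center_approx_0:
  "\<bar>cost_to_go (cycle_policies ! 0) $ 1 - (-85.826954875)\<bar> \<le> 1 / 10 ^ 9"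
  "\<bar>cost_to_go (cycle_policies ! 0) $ 2 - (-92.977295130)\<bar> \<le> 1 / 10 ^ 9"
  "\<bar>cost_to_go (cycle_policies ! 0) $ 3 - (-93.906426259)\<bar> \<le> 1 / 10 ^ 9"
  by (simp_all add: cycle_policies_def cost_to_go_simps)

lemma x_star_approx_0:
  "\<bar>x_star 0 $ 1 - (-8.593655491)\<bar> \<le> 1 / 10 ^ 9"
  "\<bar>x_star 0 $ 2 - (-0.017829015)\<bar> \<le> 1 / 10 ^ 9"
  "\<bar>x_star 0 $ 3 - 0.494199384\<bar> \<le> 1 / 10 ^ 9"
  by (rule x_star_approxI, simp, simp add: approx_point_def x_bar_def)+

lemma z_star_ge_0: "0.7475 \<le> z_star 0" "z_star 0 < 1"
  by (rule z_star_boundsI[where a = "0.7475"]; simp add: z_bar_def)+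

lemma center_approx_1:
  "\<bar>cost_to_go (cycle_policies ! 1) $ 1 - 137.987345040\<bar> \<le> 1 / 10 ^ 9"
  "\<bar>cost_to_go (cycle_policies ! 1) $ 2 - 156.242444586\<bar> \<le> 1 / 10 ^ 9"
  "\<bar>cost_to_go (cycle_policies ! 1) $ 3 - 127.104521456\<bar> \<le> 1 / 10 ^ 9"
  by (simp_all add: cycle_policies_def cost_to_go_simps)

lemma x_star_approx_1:
  "\<bar>x_star 1 $ 1 - (-28.093604266)\<bar> \<le> 1 / 10 ^ 9"
  "\<bar>x_star 1 $ 2 - (-86.202546379)\<bar> \<le> 1 / 10 ^ 9"
  "\<bar>x_star 1 $ 3 - (-93.905594760)\<bar> \<le> 1 / 10 ^ 9"
  by (rule x_star_approxI, simp, simp add: approx_point_def x_bar_def)+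

lemma z_star_ge_1: "0.9839 \<le> z_star 1" "z_star 1 < 1"
  by (rule z_star_boundsI[where a = "0.9839"]; simp add: z_bar_def)+

lemma center_approx_2:
  "\<bar>cost_to_go (cycle_policies ! 2) $ 1 - 145.693566322\<bar> \<le> 1 / 10 ^ 9"
  "\<bar>cost_to_go (cycle_policies ! 2) $ 2 - 158.935989883\<bar> \<le> 1 / 10 ^ 9"
  "\<bar>cost_to_go (cycle_policies ! 2) $ 3 - 131.748699562\<bar> \<le> 1 / 10 ^ 9"
  by (simp_all add: cycle_policies_def cost_to_go_simps)

lemma x_star_approx_2:
  "\<bar>x_star 2 $ 1 - (-25.423915598)\<bar> \<le> 1 / 10 ^ 9"
  "\<bar>x_star 2 $ 2 - (-53.300321264)\<bar> \<le> 1 / 10 ^ 9"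
  "\<bar>x_star 2 $ 3 - 11.520280530\<bar> \<le> 1 / 10 ^ 9"
  by (rule x_star_approxI, simp, simp add: approx_point_def x_bar_def)+

lemma z_star_ge_2: "0.9788 \<le> z_star 2" "z_star 2 < 1"
  by (rule z_star_boundsI[where a = "0.9788"]; simp add: z_bar_def)+

lemma center_approx_3:
  "\<bar>cost_to_go (cycle_policies ! 3) $ 1 - 143.734112030\<bar> \<le> 1 / 10 ^ 9"
  "\<bar>cost_to_go (cycle_policies ! 3) $ 2 - 157.652765261\<bar> \<le> 1 / 10 ^ 9"
  "\<bar>cost_to_go (cycle_policies ! 3) $ 3 - 128.436673871\<bar> \<le> 1 / 10 ^ 9"
  by (simp_all add: cycle_policies_def cost_to_go_simps)

lemma x_star_approx_3:
  "\<bar>x_star 3 $ 1 - (-21.806576125)\<bar> \<le> 1 / 10 ^ 9"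
  "\<bar>x_star 3 $ 2 - (-16.172373210)\<bar> \<le> 1 / 10 ^ 9"
  "\<bar>x_star 3 $ 3 - 80.599465493\<bar> \<le> 1 / 10 ^ 9"
  by (rule x_star_approxI, simp, simp add: approx_point_def x_bar_def)+

lemma z_star_ge_3: "0.9572 \<le> z_star 3" "z_star 3 < 1"
  by (rule z_star_boundsI[where a = "0.9572"]; simp add: z_bar_def)+

lemma center_approx_4:
  "\<bar>cost_to_go (cycle_policies ! 4) $ 1 - 9.714748120\<bar> \<le> 1 / 10 ^ 9"
  "\<bar>cost_to_go (cycle_policies ! 4) $ 2 - (-2.775384123)\<bar> \<le> 1 / 10 ^ 9"
  "\<bar>cost_to_go (cycle_policies ! 4) $ 3 - 2.372398248\<bar> \<le> 1 / 10 ^ 9"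
  by (simp_all add: cycle_policies_def cost_to_go_simps)

lemma x_star_approx_4:
  "\<bar>x_star 4 $ 1 - (-14.729179153)\<bar> \<le> 1 / 10 ^ 9"
  "\<bar>x_star 4 $ 2 - 40.344713194\<bar> \<le> 1 / 10 ^ 9"
  "\<bar>x_star 4 $ 3 - 120.105188298\<bar> \<le> 1 / 10 ^ 9"
  by (rule x_star_approxI, simp, simp add: approx_point_def x_bar_def)+

lemma z_star_ge_4: "0.748 \<le> z_star 4" "z_star 4 < 1"
  by (rule z_star_boundsI[where a = "0.748"]; simp add: z_bar_def)+

lemma center_approx_5:
  "\<bar>cost_to_go (cycle_policies ! 5) $ 1 - (-35.174083330)\<bar> \<le> 1 / 10 ^ 9"
  "\<bar>cost_to_go (cycle_policies ! 5) $ 2 - (-49.047026540)\<bar> \<le> 1 / 10 ^ 9"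
  "\<bar>cost_to_go (cycle_policies ! 5) $ 3 - (-50.170341448)\<bar> \<le> 1 / 10 ^ 9"
  by (simp_all add: cycle_policies_def cost_to_go_simps)

lemma x_star_approx_5:
  "\<bar>x_star 5 $ 1 - (-8.569442385)\<bar> \<le> 1 / 10 ^ 9"
  "\<bar>x_star 5 $ 2 - 0.385601529\<bar> \<le> 1 / 10 ^ 9"
  "\<bar>x_star 5 $ 3 - 2.373462606\<bar> \<le> 1 / 10 ^ 9"
  by (rule x_star_approxI, simp, simp add: approx_point_def x_bar_def)+

lemma z_star_ge_5: "0.999 \<le> z_star 5" "z_star 5 < 1"
  by (rule z_star_boundsI[where a = "0.999"]; simp add: z_bar_def)+

text \<open>Each segment has three profiles: for the state that has just switched, for the state
  that switches next, and for the remaining one. The factor 1 or -1 orients them so that they are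
  positive, negative and positive along the segment.\<close>

lemma start_profile_0: "near_profile (\<lambda>r. 1 * Q_diff 1 (flow (cycle_policies ! 0) (x_star 0) r)) (6.3364557) (29.5825117) (-15.4233700) (-20.4955974)"
  by (rule near_profileI[OF center_approx_0 x_star_approx_0]) (simp_all add: Q_grad_simps cost_def)

lemma start_zero_0: "Q_diff 1 (x_star 0) = 0"
  by (rule x_star_switchI[of 5]) (simp_all add: switch_states_def x_star_6)

lemma end_zero_0: "Q_diff 2 (flow (cycle_policies ! 0) (x_star 0) (z_star 0)) = 0"
  by (rule x_star_endI) (simp_all add: switch_states_def)

lemma start_sign_0: "z_star 0 \<le> r \<Longrightarrow> r < 1 \<Longrightarrow> 0 < 1 * Q_diff 1 (flow (cycle_policies ! 0) (x_star 0) r)"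
proof -
  assume r: "z_star 0 \<le> r" "r < 1"
  have h: "0.7475 \<le> r" "r \<le> 1" using r z_star_ge_0(1) by linarith+
  \<comment> \<open>The cut separates the range decided by interval bounds from the range next to
    the zero at r = 1, where monotonicity decides.\<close>
  show ?thesis
  proof (cases "r \<le> 0.8295")
    case True
    show ?thesis by (rule profile_pos[where ?m1.0 = "22.112927" and ?m2.0 = "-2.867655" and ?m3.0 = "-0.011597", OF start_profile_0 h(1) True]) (simp_all add: power_divide)
  next
    case False
    then have g0: "0.8295 \<le> r" by linarith
    have "1 * Q_diff 1 (flow (cycle_policies ! 0) (x_star 0) 1) < 1 * Q_diff 1 (flow (cycle_policies ! 0) (x_star 0) r)"
      by (rule profile_decreasing[where ?m2.0 = "-3.457087" and ?m3.0 = "-0.013979", OF start_profile_0 g0 r(2) order_refl]) (simp_all add: power_divide)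
    then show ?thesis unfolding flow_1 start_zero_0 by linarith
  qed
qed

lemma end_profile_0: "near_profile (\<lambda>r. 1 * Q_diff 2 (flow (cycle_policies ! 0) (x_star 0) r)) (-13.6208390) (24.9327672) (-68.8436402) (39.4361366)"
  by (rule near_profileI[OF center_approx_0 x_star_approx_0]) (simp_all add: Q_grad_simps cost_def)

lemma end_sign_0: "z_star 0 < r \<Longrightarrow> r \<le> 1 \<Longrightarrow> 1 * Q_diff 2 (flow (cycle_policies ! 0) (x_star 0) r) < 0"
proof -
  assume r: "z_star 0 < r" "r \<le> 1"
  have h: "0.7475 \<le> r" "r \<le> 1" using r z_star_ge_0(1) by linarith+
  \<comment> \<open>Here the zero is at the lower end. The large coefficient of r^40 destroys
    monotonicity near 1, so the rest is covered by two intervals on which crude bounds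
    suffice.\<close>
  show ?thesis
  proof (cases "r \<le> 0.8795")
    case True
    have "1 * Q_diff 2 (flow (cycle_policies ! 0) (x_star 0) r) < 1 * Q_diff 2 (flow (cycle_policies ! 0) (x_star 0) (z_star 0))"
      by (rule profile_decreasing[where ?m2.0 = "-6.710477" and ?m3.0 = "0.263690", OF end_profile_0 z_star_ge_0(1) r(1) True]) (simp_all add: power_divide)
    then show ?thesis unfolding end_zero_0 by linarith
  next
    case False
    then have g0: "0.8795 \<le> r" by linarith
    show ?thesis
    proof (cases "r \<le> 0.9688")
      case True
      show ?thesis by (rule profile_neg[where ?m1.0 = "24.154865" and ?m2.0 = "-21.676363" and ?m3.0 = "11.098380", OF end_profile_0 g0 True]) (simp_all add: power_divide)
    next
      case False
      then have g1: "0.9688 \<le> r" by linarith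
      show ?thesis by (rule profile_neg[where ?m1.0 = "24.932768" and ?m2.0 = "-51.757226" and ?m3.0 = "39.436137", OF end_profile_0 g1 h(2)]) (simp_all add: power_divide)
    qed
  qed
qed

lemma third_profile_0: "near_profile (\<lambda>r. - 1 * Q_diff 3 (flow (cycle_policies ! 0) (x_star 0) r)) (5.4965725) (26.1925800) (-30.4213493) (-1.1216612)"
  by (rule near_profileI[OF center_approx_0 x_star_approx_0]) (simp_all add: Q_grad_simps cost_def)

lemma third_sign_0: "z_star 0 \<le> r \<Longrightarrow> r \<le> 1 \<Longrightarrow> 0 < - 1 * Q_diff 3 (flow (cycle_policies ! 0) (x_star 0) r)"
proof -
  assume r: "z_star 0 \<le> r" "r \<le> 1"
  have h: "0.7475 \<le> r" "r \<le> 1" using r z_star_ge_0(1) by linarith+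
  show ?thesis
  proof (cases "r \<le> 0.9768")
    case True
    show ?thesis by (rule profile_pos[where ?m1.0 = "19.578953" and ?m2.0 = "-24.628011" and ?m3.0 = "-0.438620", OF third_profile_0 h(1) True]) (simp_all add: power_divide)
  next
    case False
    then have g0: "0.9768 \<le> r" by linarith
    show ?thesis
    proof (cases "r \<le> 0.9985")
      case True
      show ?thesis by (rule profile_pos[where ?m1.0 = "25.584912" and ?m2.0 = "-30.013117" and ?m3.0 = "-1.056294", OF third_profile_0 g0 True]) (simp_all add: power_divide)
    next
      case False
      then have g1: "0.9985 \<le> r" by linarith
      show ?thesis by (rule profile_pos[where ?m1.0 = "26.153291" and ?m2.0 = "-30.421350" and ?m3.0 = "-1.121662", OF third_profile_0 g1 h(2)]) (simp_all add: power_divide)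
    qed
  qed
qed

lemma start_profile_1: "near_profile (\<lambda>r. 1 * Q_diff 2 (flow (cycle_policies ! 1) (x_star 1) r)) (-33.6066313) (-53.6149261) (179.5491779) (-92.3276205)"
  by (rule near_profileI[OF center_approx_1 x_star_approx_1]) (simp_all add: Q_grad_simps cost_def)

lemma start_zero_1: "Q_diff 2 (x_star 1) = 0"
  by (rule x_star_switchI[of 0]) (simp_all add: switch_states_def)

lemma end_zero_1: "Q_diff 1 (flow (cycle_policies ! 1) (x_star 1) (z_star 1)) = 0"
  by (rule x_star_endI) (simp_all add: switch_states_def)

lemma start_sign_1: "z_star 1 \<le> r \<Longrightarrow> r < 1 \<Longrightarrow> 0 < 1 * Q_diff 2 (flow (cycle_policies ! 1) (x_star 1) r)"
proof -
  assume r: "z_star 1 \<le> r" "r < 1"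
  have h: "0.9839 \<le> r" "r \<le> 1" using r z_star_ge_1(1) by linarith+
  have "1 * Q_diff 2 (flow (cycle_policies ! 1) (x_star 1) 1) < 1 * Q_diff 2 (flow (cycle_policies ! 1) (x_star 1) r)"
    by (rule profile_decreasing[where ?m2.0 = "179.549178" and ?m3.0 = "-49.025169", OF start_profile_1 h(1) r(2) order_refl]) (simp_all add: power_divide)
  then show ?thesis unfolding flow_1 start_zero_1 by linarith
qed

lemma end_profile_1: "near_profile (\<lambda>r. - 1 * Q_diff 1 (flow (cycle_policies ! 1) (x_star 1) r)) (-2.7299561) (63.6136442) (-40.2252611) (-47.9841562)"
  by (rule near_profileI[OF center_approx_1 x_star_approx_1]) (simp_all add: Q_grad_simps cost_def)

lemma end_sign_1: "z_star 1 < r \<Longrightarrow> r \<le> 1 \<Longrightarrow> - 1 * Q_diff 1 (flow (cycle_policies ! 1) (x_star 1) r) < 0"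
proof -
  assume r: "z_star 1 < r" "r \<le> 1"
  have h: "0.9839 \<le> r" "r \<le> 1" using r z_star_ge_1(1) by linarith+
  have "- 1 * Q_diff 1 (flow (cycle_policies ! 1) (x_star 1) r) < - 1 * Q_diff 1 (flow (cycle_policies ! 1) (x_star 1) (z_star 1))"
    by (rule profile_decreasing[where ?m2.0 = "-35.326983" and ?m3.0 = "-25.479172", OF end_profile_1 z_star_ge_1(1) r(1) h(2)]) (simp_all add: power_divide)
  then show ?thesis unfolding end_zero_1 by linarith
qed

lemma third_profile_1: "near_profile (\<lambda>r. - 1 * Q_diff 3 (flow (cycle_policies ! 1) (x_star 1) r)) (-2.7841479) (-56.3240025) (79.3410725) (2.6260258)"
  by (rule near_profileI[OF center_approx_1 x_star_approx_1]) (simp_all add: Q_grad_simps cost_def)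

lemma third_sign_1: "z_star 1 \<le> r \<Longrightarrow> r \<le> 1 \<Longrightarrow> 0 < - 1 * Q_diff 3 (flow (cycle_policies ! 1) (x_star 1) r)"
proof -
  assume r: "z_star 1 \<le> r" "r \<le> 1"
  have h: "0.9839 \<le> r" "r \<le> 1" using r z_star_ge_1(1) by linarith+
  show ?thesis by (rule profile_pos[where ?m1.0 = "-56.324003" and ?m2.0 = "68.557774" and ?m3.0 = "1.371947", OF third_profile_1 h(1) h(2)]) (simp_all add: power_divide)
qed

lemma start_profile_2: "near_profile (\<lambda>r. - 1 * Q_diff 1 (flow (cycle_policies ! 2) (x_star 2) r)) (-4.2264435) (65.5427769) (-35.2131879) (-26.1031456)"
  by (rule near_profileI[OF center_approx_2 x_star_approx_2]) (simp_all add: Q_grad_simps cost_def)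

lemma start_zero_2: "Q_diff 1 (x_star 2) = 0"
  by (rule x_star_switchI[of 1]) (simp_all add: switch_states_def numeral_2_eq_2)

lemma end_zero_2: "Q_diff 3 (flow (cycle_policies ! 2) (x_star 2) (z_star 2)) = 0"
  by (rule x_star_endI) (simp_all add: switch_states_def)

lemma start_sign_2: "z_star 2 \<le> r \<Longrightarrow> r < 1 \<Longrightarrow> 0 < - 1 * Q_diff 1 (flow (cycle_policies ! 2) (x_star 2) r)"
proof -
  assume r: "z_star 2 \<le> r" "r < 1"
  have h: "0.9788 \<le> r" "r \<le> 1" using r z_star_ge_2(1) by linarith+
  have "- 1 * Q_diff 1 (flow (cycle_policies ! 2) (x_star 2) 1) < - 1 * Q_diff 1 (flow (cycle_policies ! 2) (x_star 2) r)"
    by (rule profile_decreasing[where ?m2.0 = "-29.665865" and ?m3.0 = "-11.317677", OF start_profile_2 h(1) r(2) order_refl]) (simp_all add: power_divide)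
  then show ?thesis unfolding flow_1 start_zero_2 by linarith
qed

lemma end_profile_2: "near_profile (\<lambda>r. 1 * Q_diff 3 (flow (cycle_policies ! 2) (x_star 2) r)) (1.1073471) (58.0320712) (-69.4551638) (-1.4285452)"
  by (rule near_profileI[OF center_approx_2 x_star_approx_2]) (simp_all add: Q_grad_simps cost_def)

lemma end_sign_2: "z_star 2 < r \<Longrightarrow> r \<le> 1 \<Longrightarrow> 1 * Q_diff 3 (flow (cycle_policies ! 2) (x_star 2) r) < 0"
proof -
  assume r: "z_star 2 < r" "r \<le> 1"
  have h: "0.9788 \<le> r" "r \<le> 1" using r z_star_ge_2(1) by linarith+
  have "1 * Q_diff 3 (flow (cycle_policies ! 2) (x_star 2) r) < 1 * Q_diff 3 (flow (cycle_policies ! 2) (x_star 2) (z_star 2))"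
    by (rule profile_decreasing[where ?m2.0 = "-58.513520" and ?m3.0 = "-0.619381", OF end_profile_2 z_star_ge_2(1) r(1) h(2)]) (simp_all add: power_divide)
  then show ?thesis unfolding end_zero_2 by linarith
qed

lemma third_profile_2: "near_profile (\<lambda>r. 1 * Q_diff 2 (flow (cycle_policies ! 2) (x_star 2) r)) (-31.1735363) (-55.2408400) (157.1773252) (-50.2257726)"
  by (rule near_profileI[OF center_approx_2 x_star_approx_2]) (simp_all add: Q_grad_simps cost_def)

lemma third_sign_2: "z_star 2 \<le> r \<Longrightarrow> r \<le> 1 \<Longrightarrow> 0 < 1 * Q_diff 2 (flow (cycle_policies ! 2) (x_star 2) r)"
proof -
  assume r: "z_star 2 \<le> r" "r \<le> 1"
  have h: "0.9788 \<le> r" "r \<le> 1" using r z_star_ge_2(1) by linarith+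
  show ?thesis
  proof (cases "r \<le> 0.9963")
    case True
    show ?thesis by (rule profile_pos[where ?m1.0 = "-55.036449" and ?m2.0 = "129.609113" and ?m3.0 = "-43.304382", OF third_profile_2 h(1) True]) (simp_all add: power_divide)
  next
    case False
    then have g0: "0.9963 \<le> r" by linarith
    show ?thesis by (rule profile_pos[where ?m1.0 = "-55.240840" and ?m2.0 = "152.020118" and ?m3.0 = "-50.225773", OF third_profile_2 g0 h(2)]) (simp_all add: power_divide)
  qed
qed

lemma start_profile_3: "near_profile (\<lambda>r. 1 * Q_diff 3 (flow (cycle_policies ! 3) (x_star 3) r)) (1.3125748) (56.1407805) (-56.8849571) (-0.5683982)"
  by (rule near_profileI[OF center_approx_3 x_star_approx_3]) (simp_all add: Q_grad_simps cost_def)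

lemma start_zero_3: "Q_diff 3 (x_star 3) = 0"
  by (rule x_star_switchI[of 2]) (simp_all add: switch_states_def)

lemma end_zero_3: "Q_diff 2 (flow (cycle_policies ! 3) (x_star 3) (z_star 3)) = 0"
  by (rule x_star_endI) (simp_all add: switch_states_def)

lemma start_sign_3: "z_star 3 \<le> r \<Longrightarrow> r < 1 \<Longrightarrow> 0 < 1 * Q_diff 3 (flow (cycle_policies ! 3) (x_star 3) r)"
proof -
  assume r: "z_star 3 \<le> r" "r < 1"
  have h: "0.9572 \<le> r" "r \<le> 1" using r z_star_ge_3(1) by linarith+
  have "1 * Q_diff 3 (flow (cycle_policies ! 3) (x_star 3) 1) < 1 * Q_diff 3 (flow (cycle_policies ! 3) (x_star 3) r)"
    by (rule profile_decreasing[where ?m2.0 = "-40.088421" and ?m3.0 = "-0.103218", OF start_profile_3 h(1) r(2) order_refl]) (simp_all add: power_divide)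
  then show ?thesis unfolding flow_1 start_zero_3 by linarith
qed

lemma end_profile_3: "near_profile (\<lambda>r. - 1 * Q_diff 2 (flow (cycle_policies ! 3) (x_star 3) r)) (32.2393771) (53.4405168) (-128.7308952) (19.9841333)"
  by (rule near_profileI[OF center_approx_3 x_star_approx_3]) (simp_all add: Q_grad_simps cost_def)

lemma end_sign_3: "z_star 3 < r \<Longrightarrow> r \<le> 1 \<Longrightarrow> - 1 * Q_diff 2 (flow (cycle_policies ! 3) (x_star 3) r) < 0"
proof -
  assume r: "z_star 3 < r" "r \<le> 1"
  have h: "0.9572 \<le> r" "r \<le> 1" using r z_star_ge_3(1) by linarith+
  show ?thesis
  proof (cases "r \<le> 0.9988")
    case True
    have "- 1 * Q_diff 2 (flow (cycle_policies ! 3) (x_star 3) r) < - 1 * Q_diff 2 (flow (cycle_policies ! 3) (x_star 3) (z_star 3))"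
      by (rule profile_decreasing[where ?m2.0 = "-90.720264" and ?m3.0 = "19.069888", OF end_profile_3 z_star_ge_3(1) r(1) True]) (simp_all add: power_divide)
    then show ?thesis unfolding end_zero_3 by linarith
  next
    case False
    then have g0: "0.9988 \<le> r" by linarith
    show ?thesis by (rule profile_neg[where ?m1.0 = "53.440517" and ?m2.0 = "-127.347256" and ?m3.0 = "19.984134", OF end_profile_3 g0 h(2)]) (simp_all add: power_divide)
  qed
qed

lemma third_profile_3: "near_profile (\<lambda>r. - 1 * Q_diff 1 (flow (cycle_policies ! 3) (x_star 3) r)) (-4.4079076) (63.4067091) (-28.8401981) (-10.3860770)"
  by (rule near_profileI[OF center_approx_3 x_star_approx_3]) (simp_all add: Q_grad_simps cost_def)

lemma third_sign_3: "z_star 3 \<le> r \<Longrightarrow> r \<le> 1 \<Longrightarrow> 0 < - 1 * Q_diff 1 (flow (cycle_policies ! 3) (x_star 3) r)"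
proof -
  assume r: "z_star 3 \<le> r" "r \<le> 1"
  have h: "0.9572 \<le> r" "r \<le> 1" using r z_star_ge_3(1) by linarith+
  show ?thesis by (rule profile_pos[where ?m1.0 = "60.692901" and ?m2.0 = "-28.840199" and ?m3.0 = "-10.386077", OF third_profile_3 h(1) h(2)]) (simp_all add: power_divide)
qed

lemma start_profile_4: "near_profile (\<lambda>r. - 1 * Q_diff 2 (flow (cycle_policies ! 4) (x_star 4) r)) (9.3583773) (7.8910878) (31.9337512) (-49.1832164)"
  by (rule near_profileI[OF center_approx_4 x_star_approx_4]) (simp_all add: Q_grad_simps cost_def)

lemma start_zero_4: "Q_diff 2 (x_star 4) = 0"
  by (rule x_star_switchI[of 3]) (simp_all add: switch_states_def)

lemma end_zero_4: "Q_diff 3 (flow (cycle_policies ! 4) (x_star 4) (z_star 4)) = 0"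
  by (rule x_star_endI) (simp_all add: switch_states_def)

lemma start_sign_4: "z_star 4 \<le> r \<Longrightarrow> r < 1 \<Longrightarrow> 0 < - 1 * Q_diff 2 (flow (cycle_policies ! 4) (x_star 4) r)"
proof -
  assume r: "z_star 4 \<le> r" "r < 1"
  have h: "0.748 \<le> r" "r \<le> 1" using r z_star_ge_4(1) by linarith+
  show ?thesis
  proof (cases "r \<le> 0.955")
    case True
    show ?thesis by (rule profile_pos[where ?m1.0 = "5.902533" and ?m2.0 = "2.340800" and ?m3.0 = "-7.797436", OF start_profile_4 h(1) True]) (simp_all add: power_divide)
  next
    case False
    then have g0: "0.955 \<le> r" by linarith
    have "- 1 * Q_diff 2 (flow (cycle_policies ! 4) (x_star 4) 1) < - 1 * Q_diff 2 (flow (cycle_policies ! 4) (x_star 4) r)"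
      by (rule profile_decreasing[where ?m2.0 = "31.933752" and ?m3.0 = "-8.164853", OF start_profile_4 g0 r(2) order_refl]) (simp_all add: power_divide)
    then show ?thesis unfolding flow_1 start_zero_4 by linarith
  qed
qed

lemma end_profile_4: "near_profile (\<lambda>r. - 1 * Q_diff 3 (flow (cycle_policies ! 4) (x_star 4) r)) (7.2352819) (-8.2898118) (-14.1112207) (-1.3988923)"
  by (rule near_profileI[OF center_approx_4 x_star_approx_4]) (simp_all add: Q_grad_simps cost_def)

lemma end_sign_4: "z_star 4 < r \<Longrightarrow> r \<le> 1 \<Longrightarrow> - 1 * Q_diff 3 (flow (cycle_policies ! 4) (x_star 4) r) < 0"
proof -
  assume r: "z_star 4 < r" "r \<le> 1"
  have h: "0.748 \<le> r" "r \<le> 1" using r z_star_ge_4(1) by linarith+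
  have "- 1 * Q_diff 3 (flow (cycle_policies ! 4) (x_star 4) r) < - 1 * Q_diff 3 (flow (cycle_policies ! 4) (x_star 4) (z_star 4))"
    by (rule profile_decreasing[where ?m2.0 = "-1.382857" and ?m3.0 = "-0.000016", OF end_profile_4 z_star_ge_4(1) r(1) h(2)]) (simp_all add: power_divide)
  then show ?thesis unfolding end_zero_4 by linarith
qed

lemma third_profile_4: "near_profile (\<lambda>r. - 1 * Q_diff 1 (flow (cycle_policies ! 4) (x_star 4) r)) (-7.0623686) (9.3627072) (7.1542710) (25.5613122)"
  by (rule near_profileI[OF center_approx_4 x_star_approx_4]) (simp_all add: Q_grad_simps cost_def)

lemma third_sign_4: "z_star 4 \<le> r \<Longrightarrow> r \<le> 1 \<Longrightarrow> 0 < - 1 * Q_diff 1 (flow (cycle_policies ! 4) (x_star 4) r)"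
proof -
  assume r: "z_star 4 \<le> r" "r \<le> 1"
  have h: "0.748 \<le> r" "r \<le> 1" using r z_star_ge_4(1) by linarith+
  show ?thesis by (rule profile_pos[where ?m1.0 = "7.003304" and ?m2.0 = "0.524420" and ?m3.0 = "0.000231", OF third_profile_4 h(1) h(2)]) (simp_all add: power_divide)
qed

lemma start_profile_5: "near_profile (\<lambda>r. - 1 * Q_diff 3 (flow (cycle_policies ! 5) (x_star 5) r)) (7.7787554) (9.0225873) (-16.1770211) (-0.6243216)"
  by (rule near_profileI[OF center_approx_5 x_star_approx_5]) (simp_all add: Q_grad_simps cost_def)

lemma start_zero_5: "Q_diff 3 (x_star 5) = 0"
  by (rule x_star_switchI[of 4]) (simp_all add: switch_states_def)

lemma end_zero_5: "Q_diff 1 (flow (cycle_policies ! 5) (x_star 5) (z_star 5)) = 0"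
  by (rule x_star_endI) (simp_all add: switch_states_def)

lemma start_sign_5: "z_star 5 \<le> r \<Longrightarrow> r < 1 \<Longrightarrow> 0 < - 1 * Q_diff 3 (flow (cycle_policies ! 5) (x_star 5) r)"
proof -
  assume r: "z_star 5 \<le> r" "r < 1"
  have h: "0.999 \<le> r" "r \<le> 1" using r z_star_ge_5(1) by linarith+
  have "- 1 * Q_diff 3 (flow (cycle_policies ! 5) (x_star 5) 1) < - 1 * Q_diff 3 (flow (cycle_policies ! 5) (x_star 5) r)"
    by (rule profile_decreasing[where ?m2.0 = "-16.048056" and ?m3.0 = "-0.600430", OF start_profile_5 h(1) r(2) order_refl]) (simp_all add: power_divide)
  then show ?thesis unfolding flow_1 start_zero_5 by linarith
qed

lemma end_profile_5: "near_profile (\<lambda>r. 1 * Q_diff 1 (flow (cycle_policies ! 5) (x_star 5) r)) (8.9535602) (10.1903209) (-8.2016146) (-11.4079398)"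
  by (rule near_profileI[OF center_approx_5 x_star_approx_5]) (simp_all add: Q_grad_simps cost_def)

lemma end_sign_5: "z_star 5 < r \<Longrightarrow> r \<le> 1 \<Longrightarrow> 1 * Q_diff 1 (flow (cycle_policies ! 5) (x_star 5) r) < 0"
proof -
  assume r: "z_star 5 < r" "r \<le> 1"
  have h: "0.999 \<le> r" "r \<le> 1" using r z_star_ge_5(1) by linarith+
  have "1 * Q_diff 1 (flow (cycle_policies ! 5) (x_star 5) r) < 1 * Q_diff 1 (flow (cycle_policies ! 5) (x_star 5) (z_star 5))"
    by (rule profile_decreasing[where ?m2.0 = "-8.136230" and ?m3.0 = "-10.971380", OF end_profile_5 z_star_ge_5(1) r(1) h(2)]) (simp_all add: power_divide)
  then show ?thesis unfolding end_zero_5 by linarith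
qed

lemma third_profile_5: "near_profile (\<lambda>r. - 1 * Q_diff 2 (flow (cycle_policies ! 5) (x_star 5) r)) (11.5317419) (-8.5886182) (36.6086661) (-21.9503274)"
  by (rule near_profileI[OF center_approx_5 x_star_approx_5]) (simp_all add: Q_grad_simps cost_def)

lemma third_sign_5: "z_star 5 \<le> r \<Longrightarrow> r \<le> 1 \<Longrightarrow> 0 < - 1 * Q_diff 2 (flow (cycle_policies ! 5) (x_star 5) r)"
proof -
  assume r: "z_star 5 \<le> r" "r \<le> 1"
  have h: "0.999 \<le> r" "r \<le> 1" using r z_star_ge_5(1) by linarith+
  show ?thesis by (rule profile_pos[where ?m1.0 = "-8.588619" and ?m2.0 = "36.280502" and ?m3.0 = "-21.950328", OF third_profile_5 h(1) h(2)]) (simp_all add: power_divide)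
qed

lemma switch_state_0: "switch_states ! 0 = 2"
  by (simp add: switch_states_def)

lemma crossing_rate_0:
  "0 < 1 * (Q_grad (switch_states ! 0) \<bullet> (update_prob * (cost_to_go (cycle_policies ! 0) - x_star 1)))"
  "0 < 1 * (Q_grad (switch_states ! 0) \<bullet> (update_prob * (cost_to_go (cycle_policies ! 1) - x_star 1)))"
  unfolding switch_state_0
  by (rule rate_posI[OF center_approx_0 x_star_approx_1], simp, simp add: Q_grad_simps,
      rule rate_posI[OF center_approx_1 x_star_approx_1], simp, simp add: Q_grad_simps)

lemma switch_state_1: "switch_states ! 1 = 1"
  by (simp add: switch_states_def)

lemma crossing_rate_1:
  "0 < - 1 * (Q_grad (switch_states ! 1) \<bullet> (update_prob * (cost_to_go (cycle_policies ! 1) - x_star 2)))"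
  "0 < - 1 * (Q_grad (switch_states ! 1) \<bullet> (update_prob * (cost_to_go (cycle_policies ! 2) - x_star 2)))"
  unfolding switch_state_1
  by (rule rate_posI[OF center_approx_1 x_star_approx_2], simp, simp add: Q_grad_simps,
      rule rate_posI[OF center_approx_2 x_star_approx_2], simp, simp add: Q_grad_simps)

lemma switch_state_2: "switch_states ! 2 = 3"
  by (simp add: switch_states_def)

lemma crossing_rate_2:
  "0 < 1 * (Q_grad (switch_states ! 2) \<bullet> (update_prob * (cost_to_go (cycle_policies ! 2) - x_star 3)))"
  "0 < 1 * (Q_grad (switch_states ! 2) \<bullet> (update_prob * (cost_to_go (cycle_policies ! 3) - x_star 3)))"
  unfolding switch_state_2
  by (rule rate_posI[OF center_approx_2 x_star_approx_3], simp, simp add: Q_grad_simps,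
      rule rate_posI[OF center_approx_3 x_star_approx_3], simp, simp add: Q_grad_simps)

lemma switch_state_3: "switch_states ! 3 = 2"
  by (simp add: switch_states_def)

lemma crossing_rate_3:
  "0 < - 1 * (Q_grad (switch_states ! 3) \<bullet> (update_prob * (cost_to_go (cycle_policies ! 3) - x_star 4)))"
  "0 < - 1 * (Q_grad (switch_states ! 3) \<bullet> (update_prob * (cost_to_go (cycle_policies ! 4) - x_star 4)))"
  unfolding switch_state_3
  by (rule rate_posI[OF center_approx_3 x_star_approx_4], simp, simp add: Q_grad_simps,
      rule rate_posI[OF center_approx_4 x_star_approx_4], simp, simp add: Q_grad_simps)

lemma switch_state_4: "switch_states ! 4 = 3"
  by (simp add: switch_states_def)

lemma crossing_rate_4:
  "0 < - 1 * (Q_grad (switch_states ! 4) \<bullet> (update_prob * (cost_to_go (cycle_policies ! 4) - x_star 5)))"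
  "0 < - 1 * (Q_grad (switch_states ! 4) \<bullet> (update_prob * (cost_to_go (cycle_policies ! 5) - x_star 5)))"
  unfolding switch_state_4
  by (rule rate_posI[OF center_approx_4 x_star_approx_5], simp, simp add: Q_grad_simps,
      rule rate_posI[OF center_approx_5 x_star_approx_5], simp, simp add: Q_grad_simps)

lemma switch_state_5: "switch_states ! 5 = 1"
  by (simp add: switch_states_def)

lemma crossing_rate_5:
  "0 < 1 * (Q_grad (switch_states ! 5) \<bullet> (update_prob * (cost_to_go (cycle_policies ! 5) - x_star 0)))"
  "0 < 1 * (Q_grad (switch_states ! 5) \<bullet> (update_prob * (cost_to_go (cycle_policies ! 0) - x_star 0)))"
  unfolding switch_state_5
  by (rule rate_posI[OF center_approx_5 x_star_approx_0], simp, simp add: Q_grad_simps,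
      rule rate_posI[OF center_approx_0 x_star_approx_0], simp, simp add: Q_grad_simps)

section \<open>The certified cycle as a hybrid cycle\<close>

definition plane_state :: "nat \<Rightarrow> state" where
  "plane_state k = switch_states ! ((k + 5) mod 6)"

text \<open>The sign of the derivative of \<^term>\<open>Q_diff (plane_state k)\<close> when the cycle enters segment \<open>k\<close>.\<close>

definition orient :: "nat \<Rightarrow> real" where
  "orient k = (if k mod 6 \<in> {0, 1, 3} then 1 else - 1)"

text \<open>The state that switches at neither end of the segment. Together with the states of the
  two bounding planes it exhausts all three states, so the three signs determine the greedy
  policy.\<close>

definition third_state :: "nat \<Rightarrow> state" where
  "third_state k = [3, 3, 2, 1, 1, 2] ! (k mod 6)"

definition third_orient :: "nat \<Rightarrow> real" where
  "third_orient k = (if k mod 6 = 2 then 1 else - 1)"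

lemma cycle_signs:
  assumes "k < 6"
  shows "(z_star k \<le> r \<longrightarrow> r < 1 \<longrightarrow> 0 < orient k * Q_diff (plane_state k) (flow (cycle_policies ! k) (x_star k) r)) \<and>
    (z_star k < r \<longrightarrow> r \<le> 1 \<longrightarrow> orient (Suc k) * Q_diff (switch_states ! k) (flow (cycle_policies ! k) (x_star k) r) < 0) \<and>
    (z_star k \<le> r \<longrightarrow> r \<le> 1 \<longrightarrow> 0 < third_orient k * Q_diff (third_state k) (flow (cycle_policies ! k) (x_star k) r))"
  using assms
proof (cases rule: less_6_cases)
  case 1
  then show ?thesis
    using start_sign_0[of r] end_sign_0[of r] third_sign_0[of r]
    by (simp add: orient_def plane_state_def third_state_def third_orient_def switch_states_def numeral_2_eq_2)
next
  case 2
  then show ?thesis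
    using start_sign_1[of r] end_sign_1[of r] third_sign_1[of r]
    by (simp add: orient_def plane_state_def third_state_def third_orient_def switch_states_def numeral_2_eq_2)
next
  case 3
  then show ?thesis
    using start_sign_2[of r] end_sign_2[of r] third_sign_2[of r]
    by (simp add: orient_def plane_state_def third_state_def third_orient_def switch_states_def numeral_2_eq_2)
next
  case 4
  then show ?thesis
    using start_sign_3[of r] end_sign_3[of r] third_sign_3[of r]
    by (simp add: orient_def plane_state_def third_state_def third_orient_def switch_states_def numeral_2_eq_2)
next
  case 5
  then show ?thesis
    using start_sign_4[of r] end_sign_4[of r] third_sign_4[of r]
    by (simp add: orient_def plane_state_def third_state_def third_orient_def switch_states_def numeral_2_eq_2)
next
  case 6
  then show ?thesis
    using start_sign_5[of r] end_sign_5[of r] third_sign_5[of r]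
    by (simp add: orient_def plane_state_def third_state_def third_orient_def switch_states_def numeral_2_eq_2)
qed

lemma cycle_rates:
  assumes "k < 6"
  shows "0 < orient (Suc k) * (Q_grad (switch_states ! k) \<bullet> (update_prob * (cost_to_go (cycle_policies ! k) - x_star (Suc k)))) \<and>
    0 < orient (Suc k) * (Q_grad (switch_states ! k) \<bullet> (update_prob * (cost_to_go (cycle_policies ! (Suc k mod 6)) - x_star (Suc k))))"
  using assms
proof (cases rule: less_6_cases)
  case 1
  then show ?thesis
    using crossing_rate_0 by (simp add: orient_def)
next
  case 2
  then show ?thesis
    using crossing_rate_1 by (simp add: orient_def numeral_2_eq_2)
next
  case 3
  then show ?thesis
    using crossing_rate_2 by (simp add: orient_def)
next
  case 4
  then show ?thesis
    using crossing_rate_3 by (simp add: orient_def)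
next
  case 5
  then show ?thesis
    using crossing_rate_4 by (simp add: orient_def)
next
  case 6
  then show ?thesis
    using crossing_rate_5 by (simp add: orient_def x_star_6)
qed

lemma approx_separated:
  fixes x c X C :: real
  assumes "\<bar>c - C\<bar> \<le> 1 / 10 ^ 9" "\<bar>x - X\<bar> \<le> 1 / 10 ^ 9" "1 \<le> \<bar>X - C\<bar>"
  shows "x \<noteq> c"
proof
  assume "x = c"
  then have "\<bar>X - C\<bar> \<le> 2 / 10 ^ 9" using assms(1,2) by linarith
  then show False using assms(3) by simp
qed

lemma cycle_nondegenerate:
  assumes "k < 6"
  shows "x_star k $ 1 \<noteq> cost_to_go (cycle_policies ! k) $ 1 \<and> 1 / 2 < z_star k \<and> z_star k < 1"
  using assms
proof (cases rule: less_6_cases)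
  case 1
  have "x_star 0 $ 1 \<noteq> cost_to_go (cycle_policies ! 0) $ 1"
    by (rule approx_separated[OF center_approx_0(1) x_star_approx_0(1)]) simp
  with 1 show ?thesis using z_star_ge_0 by simp
next
  case 2
  have "x_star 1 $ 1 \<noteq> cost_to_go (cycle_policies ! 1) $ 1"
    by (rule approx_separated[OF center_approx_1(1) x_star_approx_1(1)]) simp
  with 2 show ?thesis using z_star_ge_1 by simp
next
  case 3
  have "x_star 2 $ 1 \<noteq> cost_to_go (cycle_policies ! 2) $ 1"
    by (rule approx_separated[OF center_approx_2(1) x_star_approx_2(1)]) simp
  with 3 show ?thesis using z_star_ge_2 by simp
next
  case 4
  have "x_star 3 $ 1 \<noteq> cost_to_go (cycle_policies ! 3) $ 1"
    by (rule approx_separated[OF center_approx_3(1) x_star_approx_3(1)]) simp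
  with 4 show ?thesis using z_star_ge_3 by simp
next
  case 5
  have "x_star 4 $ 1 \<noteq> cost_to_go (cycle_policies ! 4) $ 1"
    by (rule approx_separated[OF center_approx_4(1) x_star_approx_4(1)]) simp
  with 5 show ?thesis using z_star_ge_4 by simp
next
  case 6
  have "x_star 5 $ 1 \<noteq> cost_to_go (cycle_policies ! 5) $ 1"
    by (rule approx_separated[OF center_approx_5(1) x_star_approx_5(1)]) simp
  with 6 show ?thesis using z_star_ge_5 by simp
qed

lemma greedy_action:
  assumes "\<mu> \<in> greedy_policies p"
  shows "0 < Q_diff i p \<Longrightarrow> \<mu> i = 0" "Q_diff i p < 0 \<Longrightarrow> \<mu> i = 1"
proof -
  have "Q_value i (\<mu> i) p \<le> Q_value i 0 p" "Q_value i (\<mu> i) p \<le> Q_value i 1 p"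
    using assms by (auto simp: greedy_policies_def)
  moreover have "\<mu> i = 1 \<or> \<mu> i = 0" using exhaust_2[of "\<mu> i"] by auto
  ultimately show "0 < Q_diff i p \<Longrightarrow> \<mu> i = 0" "Q_diff i p < 0 \<Longrightarrow> \<mu> i = 1"
    by (auto simp: Q_diff_def)
qed

lemma eq_mk_policy: "\<mu> = mk_policy a b c \<longleftrightarrow> \<mu> 1 = a \<and> \<mu> 2 = b \<and> \<mu> 3 = c"
  by (auto simp: fun_eq_iff mk_policy_def forall_3)

text \<open>Two strict gaps fix two actions, which leaves exactly the policies of the current and of
  the next segment; they differ in the state that switches. Ties at that state fall under the first
  alternative, so the statement holds on the switching plane itself.\<close>

lemma greedy_on_cycle:
  assumes "k < 6" and \<mu>: "\<mu> \<in> greedy_policies p"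
    and "0 < orient k * Q_diff (plane_state k) p" "0 < third_orient k * Q_diff (third_state k) p"
  shows "\<mu> = cycle_policies ! k \<or> \<mu> = cycle_policies ! (Suc k mod 6)"
    and "orient (Suc k) * Q_diff (switch_states ! k) p < 0 \<Longrightarrow> \<mu> = cycle_policies ! k"
proof -
  have two: "\<mu> i = 1 \<or> \<mu> i = 0" for i using exhaust_2[of "\<mu> i"] by auto
  note g = greedy_action[OF \<mu>]
  have "(\<mu> = cycle_policies ! k \<or> \<mu> = cycle_policies ! (Suc k mod 6)) \<and>
    (orient (Suc k) * Q_diff (switch_states ! k) p < 0 \<longrightarrow> \<mu> = cycle_policies ! k)"
    using \<open>k < 6\<close> assms(3,4) two[of 1] two[of 2] two[of 3] g[of 1] g[of 2] g[of 3]
    by (cases rule: less_6_cases)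
      (auto simp: orient_def plane_state_def third_orient_def third_state_def switch_states_def cycle_policies_def eq_mk_policy)
  then show "\<mu> = cycle_policies ! k \<or> \<mu> = cycle_policies ! (Suc k mod 6)"
    "orient (Suc k) * Q_diff (switch_states ! k) p < 0 \<Longrightarrow> \<mu> = cycle_policies ! k" by auto
qed

definition center :: "nat \<Rightarrow> real^3" where
  "center k = cost_to_go (cycle_policies ! (k mod 6))"

definition start :: "nat \<Rightarrow> real^3" where
  "start k = x_star (k mod 6)"

definition drift :: "nat \<Rightarrow> real^3 \<Rightarrow> real^3" where
  "drift k y = update_prob * (center k - y)"

text \<open>Oblique projection onto the switching plane along the velocity at the start of the
  segment; killing that direction is what \<open>NV_flow\<close> demands.\<close>

definition flow_slice :: "nat \<Rightarrow> real^3 \<Rightarrow> real^3" where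
  "flow_slice k w = w - ((start_normal k \<bullet> w) / (start_normal k \<bullet> drift k (start k))) *\<^sub>R drift k (start k)"

text \<open>Displacements are measured on the switching plane after projection along the flow.\<close>

definition cycle_norm :: "nat \<Rightarrow> real^3 \<Rightarrow> real" where
  "cycle_norm k w = plane_norm k (flow_slice k w)"

lemma start_normal_eq: "start_normal k = Q_grad (plane_state k)"
  by (simp add: start_normal_def plane_state_def)

lemma x_star_Suc_mod: "x_star (Suc (k mod 6)) = start (Suc k)"
proof (cases "k mod 6 = 5")
  case True
  then have "Suc k mod 6 = 0" by (simp add: mod_Suc)
  then show ?thesis using True by (simp add: start_def x_star_6)
next
  case False
  moreover have "k mod 6 < 6" by simp
  ultimately have "Suc k mod 6 = Suc (k mod 6)" by (simp add: mod_Suc)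
  then show ?thesis by (simp add: start_def)
qed

lemma mod_6_lemmas: "orient (Suc (k mod 6)) = orient (Suc k)" "orient (k mod 6) = orient k"
  "plane_state (k mod 6) = plane_state k" "plane_state (Suc k) = switch_states ! (k mod 6)"
  "third_state (k mod 6) = third_state k" "third_orient (k mod 6) = third_orient k" "Suc (k mod 6) mod 6 = Suc k mod 6"
  by (simp_all add: orient_def plane_state_def third_state_def third_orient_def mod_simps)

lemma rates:
  "0 < (orient (Suc k) *\<^sub>R start_normal (Suc k)) \<bullet> drift k (start (Suc k))"
  "0 < (orient (Suc k) *\<^sub>R start_normal (Suc k)) \<bullet> drift (Suc k) (start (Suc k))"
  using cycle_rates[of "k mod 6"]
  by (simp_all add: drift_def center_def start_normal_eq mod_6_lemmas x_star_Suc_mod)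

lemma periodic_data: "center (k + 6) = center k" "start (k + 6) = start k" "orient (k + 6) = orient k"
  "start_normal (k + 6) = start_normal k" "third_orient (k + 6) = third_orient k" "third_state (k + 6) = third_state k"
  "plane_state (k + 6) = plane_state k" "drift (k + 6) = drift k"
proof -
  have "(k + 6 + 5) mod 6 = (k + 5) mod 6" by presburger
  then show "start_normal (k + 6) = start_normal k" "plane_state (k + 6) = plane_state k"
    by (simp_all only: start_normal_def plane_state_def)
qed (simp_all add: center_def start_def orient_def third_orient_def third_state_def drift_def fun_eq_iff)

lemma transversal: "start_normal k \<bullet> drift k (start k) \<noteq> 0"
  using rates(2)[of "k + 5"] periodic_data[of k] by (auto simp: add.commute)

lemma start_normal_slice: "start_normal k \<bullet> flow_slice k w = 0"
  using transversal[of k] by (simp add: flow_slice_def inner_diff_right)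

lemma plane_norm_scaleR: "plane_norm k (s *\<^sub>R a) = \<bar>s\<bar> * plane_norm k a"
  by (simp add: plane_norm_def abs_mult max_mult_distrib_left)

lemma plane_norm_mod: "plane_norm (k mod 6) = plane_norm k"
  by (simp add: plane_norm_def fun_eq_iff)

lemma plane_norm_le_norm: "plane_norm k e \<le> 3000 * norm e"
  by (rule plane_norm_le) (rule component_le_norm_cart)

lemma flow_slice_linear: "flow_slice k (a + b) = flow_slice k a + flow_slice k b" "flow_slice k (s *\<^sub>R a) = s *\<^sub>R flow_slice k a"
  by (simp_all add: flow_slice_def inner_add_right algebra_simps add_divide_distrib)

lemma slice_component: "\<bar>flow_slice k w $ i\<bar> \<le> 0.3 * cycle_norm k w"
proof -
  have "start_normal (k mod 6) \<bullet> flow_slice k w = 0"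
    using start_normal_slice[of k w] by (simp add: start_normal_def mod_simps)
  from plane_component_bound[OF _ this, of i] show ?thesis
    by (simp add: cycle_norm_def plane_norm_mod)
qed

text \<open>The lower bound concerns vectors with vanishing first coordinate. On them the projection
  is injective, because the removed direction has a nonzero first coordinate.\<close>

lemma cycle_norm_bounds:
  assumes u: "drift k (start k) $ 1 \<noteq> 0"
  shows "\<exists>C. (\<forall>a. cycle_norm k a \<le> C * norm a) \<and> (\<forall>a. a $ 1 = 0 \<longrightarrow> norm a \<le> C * cycle_norm k a)"
proof -
  let ?f = "drift k (start k)"
  let ?s = "\<lambda>a. (start_normal k \<bullet> a) / (start_normal k \<bullet> ?f)"
  define C1 where "C1 = 3000 * (1 + norm (start_normal k) / \<bar>start_normal k \<bullet> ?f\<bar> * norm ?f)"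
  define C2 where "C2 = 0.9 + 0.3 / \<bar>?f $ 1\<bar> * norm ?f"
  have nn: "0 \<le> cycle_norm k a" for a by (simp add: cycle_norm_def plane_norm_def)
  have 1: "cycle_norm k a \<le> C1 * norm a" for a
  proof -
    have "\<bar>?s a\<bar> \<le> norm (start_normal k) * norm a / \<bar>start_normal k \<bullet> ?f\<bar>"
      unfolding abs_divide by (intro divide_right_mono Cauchy_Schwarz_ineq2) simp
    then have "\<bar>?s a\<bar> * norm ?f \<le> norm (start_normal k) * norm a / \<bar>start_normal k \<bullet> ?f\<bar> * norm ?f"
      by (intro mult_right_mono) auto
    moreover have "norm (flow_slice k a) \<le> norm a + \<bar>?s a\<bar> * norm ?f"
      using norm_triangle_ineq4[of a "?s a *\<^sub>R ?f"] by (simp add: flow_slice_def)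
    ultimately have "norm (flow_slice k a) \<le> norm a + norm (start_normal k) * norm a / \<bar>start_normal k \<bullet> ?f\<bar> * norm ?f" by linarith
    then have "plane_norm k (flow_slice k a) \<le> 3000 * (norm a + norm (start_normal k) * norm a / \<bar>start_normal k \<bullet> ?f\<bar> * norm ?f)"
      by (intro order.trans[OF plane_norm_le_norm] mult_left_mono) simp_all
    also have "\<dots> = C1 * norm a" by (simp add: C1_def algebra_simps)
    finally show ?thesis by (simp only: cycle_norm_def)
  qed
  have 2: "norm a \<le> C2 * cycle_norm k a" if "a $ 1 = 0" for a
  proof -
    have "\<bar>?s a\<bar> * \<bar>?f $ 1\<bar> \<le> 0.3 * cycle_norm k a"
      using slice_component[of k a 1] that by (simp add: flow_slice_def abs_mult)
    then have "\<bar>?s a\<bar> \<le> 0.3 * cycle_norm k a / \<bar>?f $ 1\<bar>"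
      by (rule pos_le_divide_eq[THEN iffD2, rotated]) (use u in simp)
    then have "\<bar>?s a\<bar> * norm ?f \<le> 0.3 * cycle_norm k a / \<bar>?f $ 1\<bar> * norm ?f" by (intro mult_right_mono) auto
    moreover have "norm (flow_slice k a) \<le> 3 * (0.3 * cycle_norm k a)"
      by (intro norm_le_3 slice_component)
    moreover have "norm a \<le> norm (flow_slice k a) + \<bar>?s a\<bar> * norm ?f"
      using norm_triangle_ineq[of "flow_slice k a" "?s a *\<^sub>R ?f"] by (simp add: flow_slice_def)
    ultimately show ?thesis by (simp add: C2_def algebra_simps)
  qed
  have "cycle_norm k a \<le> max C1 C2 * norm a" for a
    using 1[of a] mult_right_mono[of C1 "max C1 C2" "norm a"] by simp
  moreover have "norm a \<le> max C1 C2 * cycle_norm k a" if "a $ 1 = 0" for a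
    using 2[OF that] mult_right_mono[of C2 "max C1 C2", OF _ nn[of a]] by simp
  ultimately show ?thesis by blast
qed

text \<open>The flow carries the component of a along the drift to a multiple of its derivative in
  z, so that component only alters the free coefficient d of \<open>derivative_contraction\<close>;
  the projected component carries the norm.\<close>

lemma slice_contraction:
  assumes k: "k < 6" and b: "b = a * flow_scale (z_star k)" and p: "Q_grad (switch_states ! k) \<bullet> b = 0"
  shows "plane_norm (Suc k) b \<le> 0.95 * cycle_norm k a"
proof -
  obtain A B m1 m2 n where s: "segment_certificate (cycle_policies ! k) (switch_states ! k) (start_normal k)
    (approx_point k) (approx_point (Suc k)) A B (functional1 k) (functional2 k)
    (functional1 (Suc k mod 6)) (functional2 (Suc k mod 6)) m1 m2 n (z_bar ! k) (growth_bound k)"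
    by (rule segment[OF k])
  have km: "k mod 6 = k" using k by simp
  define e where "e = flow_slice k a"
  define s' where "s' = (start_normal k \<bullet> a) / (start_normal k \<bullet> drift k (start k))"
  have a: "a = e + s' *\<^sub>R drift k (start k)" by (simp add: e_def s'_def flow_slice_def)
  have x: "\<bar>x_star k $ i - approx_point k $ i\<bar> \<le> 1 / 10 ^ 20" for i using x_star_near[of k i] k by simp
  have "\<bar>z_star k - z_bar ! k\<bar> \<le> 1 / 10 ^ 30" using x_star_crossing[OF k] by (simp only: crossing_def)
  also have "\<dots> \<le> 1 / 10 ^ 20" by simp
  finally have z: "\<bar>z_star k - z_bar ! k\<bar> \<le> 1 / 10 ^ 20" .
  have t: "\<bar>functional1 k \<bullet> e\<bar> \<le> cycle_norm k a" "\<bar>functional2 k \<bullet> e\<bar> \<le> cycle_norm k a"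
    using plane_norm_bound[of k e] by (simp_all add: cycle_norm_def e_def km)
  have e: "start_normal k \<bullet> e = 0" unfolding e_def by (rule start_normal_slice)
  have b': "b $ i = z_star k ^ flow_exp i * e $ i
    + (- (s' * z_star k / 50)) * ((x_star k $ i - cost_to_go (cycle_policies ! k) $ i) * (flow_exp i * z_star k ^ (flow_exp i - 1)))" for i
  proof -
    have "z_star k ^ flow_exp i = z_star k * z_star k ^ (flow_exp i - 1)"
      using flow_exp_le(2)[of i] by (simp add: power_eq_if)
    then show ?thesis
      by (simp add: b a drift_def center_def start_def km update_prob_component algebra_simps)
  qed
  have "\<bar>functional1 (Suc k mod 6) \<bullet> b\<bar> \<le> 0.95 * cycle_norm k a" "\<bar>functional2 (Suc k mod 6) \<bullet> b\<bar> \<le> 0.95 * cycle_norm k a"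
    by (rule segment_certificate.derivative_contraction[OF s x z e t p b'])+
  then show ?thesis by (simp add: plane_norm_def)
qed

lemma cycle_norm_contraction:
  assumes "(orient (Suc k) *\<^sub>R start_normal (Suc k)) \<bullet> (a * flow_scale (z_star (k mod 6))) = 0"
  shows "cycle_norm (Suc k) (a * flow_scale (z_star (k mod 6))) \<le> 0.95 * cycle_norm k a"
proof -
  let ?b = "a * flow_scale (z_star (k mod 6))"
  have "orient (Suc k) \<noteq> 0" by (simp add: orient_def)
  then have p: "start_normal (Suc k) \<bullet> ?b = 0" using assms by simp
  have mods: "cycle_norm (k mod 6) a = cycle_norm k a" "plane_norm (Suc (k mod 6)) = plane_norm (Suc k)"
    by (simp_all add: cycle_norm_def flow_slice_def drift_def center_def start_def start_normal_def plane_norm_def fun_eq_iff mod_simps)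
  have "plane_norm (Suc (k mod 6)) ?b \<le> 0.95 * cycle_norm (k mod 6) a"
    using p by (intro slice_contraction) (simp_all add: start_normal_eq mod_6_lemmas)
  \<comment> \<open>The image already lies in the next switching plane, where the projection is the
    identity.\<close>
  then show ?thesis using p unfolding mods by (simp add: cycle_norm_def[of "Suc k"] flow_slice_def[of "Suc k"])
qed

lemma cycle_hybrid:
  "\<exists>C. hybrid_cycle center start (\<lambda>k. orient k *\<^sub>R start_normal k) (\<lambda>k. third_orient k *\<^sub>R Q_grad (third_state k))
    (\<lambda>k. z_star (k mod 6)) (\<lambda>k. orient k * (cost (plane_state k) 1 - cost (plane_state k) 0))
    (\<lambda>k. third_orient k * (cost (third_state k) 1 - cost (third_state k) 0)) cycle_norm velocities C 0.95"
proof -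
  have e_eq: "(orient k *\<^sub>R start_normal k) \<bullet> y + orient k * (cost (plane_state k) 1 - cost (plane_state k) 0) = orient k * Q_diff (plane_state k) y" for k y
    by (simp add: Q_diff_affine start_normal_eq algebra_simps)
  have t_eq: "(third_orient k *\<^sub>R Q_grad (third_state k)) \<bullet> y + third_orient k * (cost (third_state k) 1 - cost (third_state k) 0) = third_orient k * Q_diff (third_state k) y" for k y
    by (simp add: Q_diff_affine algebra_simps)
  have gamma_eq: "center k + (start k - center k) * flow_scale r = flow (cycle_policies ! (k mod 6)) (x_star (k mod 6)) r" for k r
    by (simp add: flow_eq_scale center_def start_def)
  have km: "k mod 6 < 6" for k :: nat by simp
  have u: "start k $ 1 \<noteq> center k $ 1" for k using cycle_nondegenerate[OF km[of k]] by (simp add: start_def center_def)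
  have "drift k (start k) $ 1 \<noteq> 0" for k
    using u[of k] by (simp add: drift_def update_prob_component)
  from cycle_norm_bounds[OF this] obtain C0 where C0: "\<And>k a. cycle_norm k a \<le> C0 k * norm a" "\<And>k a. a $ 1 = 0 \<Longrightarrow> norm a \<le> C0 k * cycle_norm k a"
    by metis
  \<comment> \<open>One constant for all segments, at least 1 as the locale demands.\<close>
  define C where "C = 1 + (\<Sum>k<6. \<bar>C0 k\<bar>)"
  have C: "1 \<le> C" by (simp add: C_def sum_nonneg)
  have C0_le: "C0 (k mod 6) \<le> C" for k
  proof -
    have "\<bar>C0 (k mod 6)\<bar> \<le> (\<Sum>k<6. \<bar>C0 k\<bar>)" by (rule member_le_sum) auto
    then show ?thesis by (simp add: C_def)
  qed
  have nn: "0 \<le> cycle_norm k a" for k a by (simp add: cycle_norm_def plane_norm_def)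
  have mods: "cycle_norm (k mod 6) a = cycle_norm k a" for k a
    by (simp add: cycle_norm_def flow_slice_def drift_def center_def start_def start_normal_def plane_norm_def mod_simps)
  have bounds: "cycle_norm k a \<le> C * norm a" "a $ 1 = 0 \<Longrightarrow> norm a \<le> C * cycle_norm k a" for k a
    using C0(1)[of "k mod 6" a] C0(2)[of a "k mod 6"] mult_right_mono[OF C0_le[of k], of "norm a"] mult_right_mono[OF C0_le[of k] nn[of k a]] unfolding mods by auto
  have per: "cycle_norm (k + 6) = cycle_norm k" for k
    by (simp add: cycle_norm_def flow_slice_def periodic_data fun_eq_iff plane_norm_def)
  have z: "1 / 2 < z_star (k mod 6)" "z_star (k mod 6) < 1" for k using cycle_nondegenerate[OF km[of k]] by auto
  have x_Suc: "start (Suc k) = flow (cycle_policies ! (k mod 6)) (x_star (k mod 6)) (z_star (k mod 6))" for k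
    using x_star_crossing[OF km[of k]] by (simp only: crossing_def flip: x_star_Suc_mod)
  have e0: "orient (Suc k) * Q_diff (plane_state (Suc k)) (start (Suc k)) = 0" for k
    using x_star_switch[OF km[of k] refl] by (simp add: mod_6_lemmas x_star_Suc_mod)
  have e_start0: "orient k * Q_diff (plane_state k) (start k) = 0" for k
    using e0[of "k + 5"] periodic_data[of k] by (simp add: add.commute)
  have signs: "z_star (k mod 6) \<le> r \<Longrightarrow> r < 1 \<Longrightarrow> 0 < orient k * Q_diff (plane_state k) (flow (cycle_policies ! (k mod 6)) (x_star (k mod 6)) r)"
    "z_star (k mod 6) < r \<Longrightarrow> r \<le> 1 \<Longrightarrow> orient (Suc k) * Q_diff (plane_state (Suc k)) (flow (cycle_policies ! (k mod 6)) (x_star (k mod 6)) r) < 0"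
    "z_star (k mod 6) \<le> r \<Longrightarrow> r \<le> 1 \<Longrightarrow> 0 < third_orient k * Q_diff (third_state k) (flow (cycle_policies ! (k mod 6)) (x_star (k mod 6)) r)" for k r
    using cycle_signs[OF km[of k], of r] unfolding mod_6_lemmas by blast+
  have norm_props: "cycle_norm k (a + b) \<le> cycle_norm k a + cycle_norm k b" "cycle_norm k (s *\<^sub>R a) = \<bar>s\<bar> * cycle_norm k a"
    "cycle_norm k (drift k (start k)) = 0" for k a b s
  proof -
    show "cycle_norm k (drift k (start k)) = 0"
      using transversal[of k] by (simp add: cycle_norm_def flow_slice_def plane_norm_def)
  qed (simp_all only: cycle_norm_def flow_slice_linear plane_norm_triangle plane_norm_scaleR)
  have vel1: "v = drift k p" if "v \<in> velocities p" "0 < orient k * Q_diff (plane_state k) p"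
    "orient (Suc k) * Q_diff (plane_state (Suc k)) p < 0" "0 < third_orient k * Q_diff (third_state k) p" for v k p
    using that greedy_on_cycle(2)[OF km[of k], of _ p] by (auto simp: velocities_def mod_6_lemmas drift_def center_def)
  have vel2: "v = drift k p \<or> v = drift (Suc k) p" if vp: "v \<in> velocities p" "0 < orient k * Q_diff (plane_state k) p"
    "0 < third_orient k * Q_diff (third_state k) p" for v k p
  proof -
    obtain \<mu> where \<mu>: "\<mu> \<in> greedy_policies p" "v = update_prob * (cost_to_go \<mu> - p)"
      using vp(1) by (auto simp: velocities_def)
    have "\<mu> = cycle_policies ! (k mod 6) \<or> \<mu> = cycle_policies ! (Suc k mod 6)"
      using greedy_on_cycle(1)[OF km[of k] \<mu>(1)] vp(2,3) by (simp add: mod_6_lemmas)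
    then show ?thesis by (auto simp: \<mu>(2) drift_def center_def)
  qed
  have uu: "(start k - center k) $ 1 \<noteq> 0" for k using u[of k] by simp
  have "hybrid_cycle center start (\<lambda>k. orient k *\<^sub>R start_normal k) (\<lambda>k. third_orient k *\<^sub>R Q_grad (third_state k))
    (\<lambda>k. z_star (k mod 6)) (\<lambda>k. orient k * (cost (plane_state k) 1 - cost (plane_state k) 0))
    (\<lambda>k. third_orient k * (cost (third_state k) 1 - cost (third_state k) 0)) cycle_norm velocities C 0.95"
    unfolding hybrid_cycle_def e_eq t_eq gamma_eq drift_def[symmetric]
    apply (intro conjI allI impI; ((rule periodic_data per z uu x_Suc e_start0 signs rates C norm_props bounds cycle_norm_contraction vel1 vel2; assumption)?))
    apply (simp_all add: periodic_data)
    done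
  then show ?thesis by blast
qed

context hybrid_cycle_constants
begin

text \<open>The starting point is taken on the cycle itself, where V vanishes, so it lies in the
  tubes of every width. The same constant \<delta>1 limits the step sizes, the noise, and thereby
  the distance between the iterates and the noise-free scheme.\<close>

lemma recursion_diverges:
  assumes vel: "\<And>p. vel p = velocities p" and orb: "orbit = certified_cycle" and \<tau>: "\<And>J. \<tau> J \<in> greedy_policies J"
  shows "\<exists>(N::nat) J0. N \<ge> 1 \<and> (\<exists>U. is_local_basin U \<and> J0 \<in> U) \<and>
    (\<forall>(M :: 'w measure) X J. mc_recursion \<tau> (\<lambda>t. 1 / (real t + real N)) J0 M X J \<longrightarrow>
      measure M {\<omega> \<in> space M. \<not> convergent (\<lambda>t. J t \<omega>)} > 0)"
proof (rule trapped)
  fix d \<delta>1 K assume d: "0 < d" "0 < \<delta>1" "0 < K"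
    and "\<And>\<delta> k0 Y v h \<epsilon>. 0 < \<delta> \<Longrightarrow> \<delta> \<le> \<delta>1 \<Longrightarrow>
      inside k0 (Y 0) \<Longrightarrow> V k0 (Y 0) \<le> d \<Longrightarrow> (\<And>n. Y (Suc n) = Y n + h n *\<^sub>R v n) \<Longrightarrow> (\<And>n. 0 < h n) \<Longrightarrow> (\<And>n. h n \<le> \<delta>) \<Longrightarrow>
      \<not> summable h \<Longrightarrow> (\<And>n. inflated \<delta> (Y n) (v n)) \<Longrightarrow> 0 < \<epsilon> \<Longrightarrow>
      eventually (\<lambda>n. \<exists>k. inside k (Y n) \<and> V k (Y n) \<le> K * \<delta> + \<epsilon>) sequentially"
    and trap: "\<And>\<delta> k0 Y v h X. 0 < \<delta> \<Longrightarrow> \<delta> \<le> \<delta>1 \<Longrightarrow> inside k0 (Y 0) \<Longrightarrow> V k0 (Y 0) \<le> d \<Longrightarrow>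
      (\<And>n. Y (Suc n) = Y n + h n *\<^sub>R v n) \<Longrightarrow> (\<And>n. 0 < h n) \<Longrightarrow> (\<And>n. h n \<le> \<delta>) \<Longrightarrow> \<not> summable h \<Longrightarrow>
      (\<And>n. inflated \<delta> (Y n) (v n)) \<Longrightarrow> (\<And>n. dist (X n) (Y n) \<le> \<delta>) \<Longrightarrow> \<not> convergent X"
  define q where "q = x 0"
  have "\<gamma> 0 1 \<in> \<gamma> 0 ` {z 0..1}" using z(2)[of 0] by (intro imageI) auto
  then have q: "q \<in> orbit" unfolding orbit_def q_def by (intro UN_I[of 0]) simp_all
  obtain k0 where k0: "inside k0 q" "V k0 q \<le> d"
    using orbit_neighborhood[OF q d(1)] by (metis dist_self)
  \<comment> \<open>Covers both the returns and the starting point, so the iterates never leave the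
    box of this size.\<close>
  define B where "B = 180 + norm q"
  have B: "180 \<le> B" "\<And>i. \<bar>q $ i\<bar> \<le> B"
    using component_le_norm_cart[of q] by (auto simp: B_def intro: order.trans add_increasing)
  \<comment> \<open>The three summands yield N \<ge> 2 for the telescoping sum, 1/N \<le> \<delta>1
    for the step sizes, and at most \<open>\<delta>1\<^sup>2 / 2\<close> for the second moment of
    the noise.\<close>
  obtain N :: nat where N: "2 + 1 / \<delta>1 + 4 * (12 * B)\<^sup>2 / \<delta>1\<^sup>2 < real N" using reals_Archimedean2 by blast
  have pos: "0 < 1 / \<delta>1" "0 \<le> 4 * (12 * B)\<^sup>2 / \<delta>1\<^sup>2" using d(2) by simp_all
  have N2: "2 \<le> real N" "1 / \<delta>1 \<le> real N" "4 * (12 * B)\<^sup>2 / \<delta>1\<^sup>2 \<le> real N" using N pos by linarith+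
  have N\<delta>: "1 / real N \<le> \<delta>1" "(12 * B)\<^sup>2 * (2 / real N) \<le> \<delta>1\<^sup>2 / 2"
    using N2 d(2) by (simp_all add: divide_simps mult.commute)
  have small: "(12 * B)\<^sup>2 * (\<Sum>i<n. (1 / (real i + real N))\<^sup>2) \<le> \<delta>1\<^sup>2 / 2" for n
  proof -
    have "(\<Sum>i<n. (1 / (real i + real N))\<^sup>2) \<le> 2 / real N - 1 / (real n + real N - 1)"
      using N2 by (intro sum_inverse_squares) simp
    also have "\<dots> \<le> 2 / real N" using N2 by simp
    finally have "(12 * B)\<^sup>2 * (\<Sum>i<n. (1 / (real i + real N))\<^sup>2) \<le> (12 * B)\<^sup>2 * (2 / real N)"
      by (intro mult_left_mono) auto
    then show ?thesis using N\<delta>(2) by linarith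
  qed
  have ns: "\<not> summable (\<lambda>n. 1 / (real n + real N))"
  proof -
    have "(\<lambda>n. 1 / (real n + real N)) = (\<lambda>n. inverse (real (n + N)))" by (simp add: inverse_eq_divide)
    then show ?thesis
      using not_summable_harmonic[where 'a = real] summable_iff_shift[of "\<lambda>n. inverse (real n)" N] by simp
  qed
  have conv: "0 < measure M {\<omega> \<in> space M. \<not> convergent (\<lambda>t. J t \<omega>)}"
    if rec: "mc_recursion \<tau> (\<lambda>t. 1 / (real t + real N)) q M X J" for M :: "'w measure" and X J
  proof (rule divergence_probability[OF _ _ B d(2) rec small])
    fix Y X :: "nat \<Rightarrow> real^3"
    assume Y: "Y 0 = q" "\<And>n. Y (Suc n) = Y n + (1 / (real n + real N)) *\<^sub>R (update_prob * (cost_to_go (\<tau> (X n)) - X n))"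
      and near: "\<And>n. dist (X n) (Y n) \<le> \<delta>1"
    show "\<not> convergent X"
    proof (rule trap[of \<delta>1 k0 Y "\<lambda>n. 1 / (real n + real N)" "\<lambda>n. update_prob * (cost_to_go (\<tau> (X n)) - X n)"])
      show "1 / (real n + real N) \<le> \<delta>1" for n
      proof -
        have "1 / (real n + real N) \<le> 1 / real N" using N2 by (intro divide_left_mono) auto
        then show ?thesis using N\<delta>(1) by simp
      qed
      show "inflated \<delta>1 (Y n) (update_prob * (cost_to_go (\<tau> (X n)) - X n))" for n
        using near[of n] \<tau>[of "X n"] by (auto simp: inflated_def vel velocities_def)
      show "0 < 1 / (real n + real N)" for n using N2 by simp
    qed (use d k0 Y near ns in simp_all)
  qed (use N2 in \<open>auto simp: divide_simps\<close>)
  have "\<exists>U. is_local_basin U \<and> q \<in> U"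
  proof -
    obtain d' where d': "0 < d'" "\<And>X. inclusion_solution X \<Longrightarrow> \<exists>k. inside k (X 0) \<and> V k (X 0) \<le> d' \<Longrightarrow>
        ((\<lambda>t. infdist (X t) orbit) \<longlongrightarrow> 0) at_top"
      using solution_converges[OF vel] by blast
    \<comment> \<open>The union of the tubes of width d' witnesses the local basin: it is a
      neighbourhood of the orbit by \<open>orbit_neighborhood\<close>, and d' comes from
      \<open>solution_converges\<close>.\<close>
    let ?U = "{y. \<exists>k. inside k y \<and> V k y \<le> d'}"
    have "orbit \<subseteq> interior ?U"
    proof
      fix p assume "p \<in> orbit"
      from orbit_neighborhood[OF this d'(1)] obtain r where "0 < r" "\<And>y. dist y p < r \<Longrightarrow> \<exists>k. inside k y \<and> V k y \<le> d'"
        by blast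
      then show "p \<in> interior ?U" unfolding mem_interior by (intro exI[of _ r]) (auto simp: dist_commute)
    qed
    then have "is_local_basin ?U" unfolding is_local_basin_def orb[symmetric] using d'(2) by blast
    moreover have "q \<in> ?U" using \<open>orbit \<subseteq> interior ?U\<close> q interior_subset by blast
    ultimately show ?thesis by blast
  qed
  moreover have "1 \<le> N" using N2 by simp
  ultimately show ?thesis using conv by blast
qed

end

theorem theorem1:
  fixes \<tau> :: "real^3 \<Rightarrow> policy"
  assumes "\<tau> \<in> borel \<rightarrow>\<^sub>M count_space UNIV"
    and "\<And>J. \<tau> J \<in> greedy_policies J"
  shows "\<exists>(N::nat) J0. N \<ge> 1 \<and> (\<exists>U. is_local_basin U \<and> J0 \<in> U) \<and>
           (\<forall>(M :: 'w measure) X J.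
              mc_recursion \<tau> (\<lambda>t. 1 / (real t + real N)) J0 M X J \<longrightarrow>
              measure M {\<omega> \<in> space M. \<not> convergent (\<lambda>t. J t \<omega>)} > 0)"
proof -
  from cycle_hybrid obtain C where C: "hybrid_cycle center start (\<lambda>k. orient k *\<^sub>R start_normal k) (\<lambda>k. third_orient k *\<^sub>R Q_grad (third_state k))
    (\<lambda>k. z_star (k mod 6)) (\<lambda>k. orient k * (cost (plane_state k) 1 - cost (plane_state k) 0))
    (\<lambda>k. third_orient k * (cost (third_state k) 1 - cost (third_state k) 0)) cycle_norm velocities C 0.95" ..
  from hybrid_cycle.constants_exist[OF C] obtain \<eta> \<kappa> m L where
    c: "hybrid_cycle_constants center start (\<lambda>k. orient k *\<^sub>R start_normal k) (\<lambda>k. third_orient k *\<^sub>R Q_grad (third_state k))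
    (\<lambda>k. z_star (k mod 6)) (\<lambda>k. orient k * (cost (plane_state k) 1 - cost (plane_state k) 0))
    (\<lambda>k. third_orient k * (cost (third_state k) 1 - cost (third_state k) 0)) cycle_norm velocities C 0.95 \<eta> \<kappa> m L" by blast
  \<comment> \<open>The abstract orbit is a union over all indices; by periodicity six of them
    suffice, and these are the arcs of the certified cycle.\<close>
  have "hybrid_cycle.orbit center start (\<lambda>k. z_star (k mod 6)) = certified_cycle"
    unfolding hybrid_cycle.orbit_eq[OF C] certified_cycle_eq
    by (intro SUP_cong refl image_cong) (auto simp: flow_eq_scale center_def start_def)
  from hybrid_cycle_constants.recursion_diverges[OF c refl this assms(2)] show ?thesis .
qed

end
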